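(* There is a randomized algorithm \textsf{Test-linear-junta} with the following guarantee. Given oracle access to $f:\mathbb{R}^n\to\{-1,1\}$, a rank parameter $k$, a surface area parameter $s$ and an error parameter $\epsilon>0$, it makes $\mathrm{poly}(s,\epsilon^{-1},k)$ queries (the number of queries does not depend on $n$), and: (1) if $f$ is a linear $k$-junta with $\mathsf{surf}(f)\le s$, the algorithm outputs \textsf{yes} with probability at least $0.9$; (2) there is an absolute constant $C>0$ such that if $f$ is $C\epsilon$-far from every linear $k$-junta $g:\mathbb{R}^n\to\{-1,1\}$ with $\mathsf{surf}(g)\le(1+\epsilon)s$, the algorithm outputs \textsf{no} with probability at least $0.9$.
   Context: $\gamma_n$ is the standard Gaussian measure on $\mathbb{R}^n$. Oracle access to $f$ means the algorithm may submit any point $x\in\mathbb{R}^n$ and receive $f(x)$. Two functions $f,g$ are $\epsilon$-close if $\Pr_{x\sim\gamma_n}[f(x)\neq g(x)]\le\epsilon$, and $\epsilon$-far otherwise (far from a class means far from every member). A function $f:\mathbb{R}^n\to\mathbb{R}$ is a linear $k$-junta if there are at most $k$ orthonormal vectors $u_1,\dots,u_k\in\mathbb{R}^n$ and a function $g:\mathbb{R}^k\to\mathbb{R}$ with $f(x)=g(\langle u_1,x\rangle,\dots,\langle u_k,x\rangle)$. For a Borel set $A\subseteq\mathbb{R}^n$, its Gaussian surface area is $\Gamma(A)=\liminf_{\delta\to0}\gamma_n(A_\delta\setminus A)/\delta$, where $A_\delta=\{x:d(x,A)\le\delta\}$ with $d$ the Euclidean distance; for $f:\mathbb{R}^n\to\{-1,1\}$,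 $\mathsf{surf}(f)=\Gamma(\{x:f(x)=1\})$. *)

theory Defs
  imports "HOL-Probability.Probability"
begin

text \<open>Points of R^n are represented as extensional functions on the index set {..<n}
  (i.e. elements of PiE {..<n} UNIV); the dimension n is an explicit natural number so that
  constants can be quantified before n.\<close>

definition gauss1 :: "real measure" where
  "gauss1 = density lborel (\<lambda>x. ennreal (std_normal_density x))"

definition gauss :: "nat \<Rightarrow> (nat \<Rightarrow> real) measure" where
  "gauss n = PiM {..<n} (\<lambda>_. gauss1)"

definition inner_n :: "nat \<Rightarrow> (nat \<Rightarrow> real) \<Rightarrow> (nat \<Rightarrow> real) \<Rightarrow> real" where
  "inner_n n x y = (\<Sum>i<n. x i * y i)"

definition dist_n :: "nat \<Rightarrow> (nat \<Rightarrow> real) \<Rightarrow> (nat \<Rightarrow> real) \<Rightarrow> real" where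
  "dist_n n x y = sqrt (\<Sum>i<n. (x i - y i)\<^sup>2)"

text \<open>Euclidean distance from a point to a set (infinity for the empty set).\<close>
definition setdist_n :: "nat \<Rightarrow> (nat \<Rightarrow> real) \<Rightarrow> (nat \<Rightarrow> real) set \<Rightarrow> ereal" where
  "setdist_n n x A = (INF a\<in>A. ereal (dist_n n x a))"

definition enlarge :: "nat \<Rightarrow> (nat \<Rightarrow> real) set \<Rightarrow> real \<Rightarrow> (nat \<Rightarrow> real) set" where
  "enlarge n A \<delta> = {x \<in> space (gauss n). setdist_n n x A \<le> ereal \<delta>}"

definition gsa :: "nat \<Rightarrow> (nat \<Rightarrow> real) set \<Rightarrow> ereal" where
  "gsa n A = Liminf (at_right 0)
      (\<lambda>\<delta>. ereal (measure (gauss n) (enlarge n A \<delta> - A) / \<delta>))"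

definition surf :: "nat \<Rightarrow> ((nat \<Rightarrow> real) \<Rightarrow> real) \<Rightarrow> ereal" where
  "surf n f = gsa n {x \<in> space (gauss n). f x = 1}"

definition is_pm1 :: "nat \<Rightarrow> ((nat \<Rightarrow> real) \<Rightarrow> real) \<Rightarrow> bool" where
  "is_pm1 n f \<longleftrightarrow> (\<forall>x\<in>space (gauss n). f x = -1 \<or> f x = 1)"

definition linear_junta :: "nat \<Rightarrow> nat \<Rightarrow> ((nat \<Rightarrow> real) \<Rightarrow> real) \<Rightarrow> bool" where
  "linear_junta n k f \<longleftrightarrow>
     (\<exists>m u g. m \<le> k \<and>
        (\<forall>i<m. u i \<in> space (gauss n)) \<and>
        (\<forall>i<m. \<forall>j<m. inner_n n (u i) (u j) = (if i = j then 1 else 0)) \<and>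
        (\<forall>x\<in>space (gauss n). f x = g (\<lambda>j. if j < m then inner_n n (u j) x else 0)))"

definition gdist :: "nat \<Rightarrow> ((nat \<Rightarrow> real) \<Rightarrow> real) \<Rightarrow> ((nat \<Rightarrow> real) \<Rightarrow> real) \<Rightarrow> real" where
  "gdist n f g = measure (gauss n) {x \<in> space (gauss n). f x \<noteq> g x}"

text \<open>Adaptive randomized query algorithm: random seed \<omega>; the i-th query point Q \<omega> as
  depends on the previous answers as; after q queries the output is D \<omega> (answers).\<close>
fun answers :: "((nat \<Rightarrow> real) \<Rightarrow> real) \<Rightarrow> (real \<Rightarrow> real list \<Rightarrow> (nat \<Rightarrow> real))
                 \<Rightarrow> real \<Rightarrow> nat \<Rightarrow> real list" where
  "answers f Q \<omega> 0 = []"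
| "answers f Q \<omega> (Suc i) = (let as = answers f Q \<omega> i in as @ [f (Q \<omega> as)])"

definition accepts :: "((nat \<Rightarrow> real) \<Rightarrow> real) \<Rightarrow> nat \<Rightarrow> (real \<Rightarrow> real list \<Rightarrow> (nat \<Rightarrow> real))
                 \<Rightarrow> (real \<Rightarrow> real list \<Rightarrow> bool) \<Rightarrow> real \<Rightarrow> bool" where
  "accepts f q Q D \<omega> = D \<omega> (answers f Q \<omega> q)"

end

theory Submission
  imports Defs
begin

text \<open>
Rotating a pair of independent Gaussian vectors by an angle \<open>\<phi>\<close> sends \<open>X\<close> to
\<open>cos \<phi> X + sin \<phi> Z\<close>; let \<open>D h \<phi>\<close> be the expected change of \<open>h\<close> under this move. It is subadditive in
\<open>\<phi>\<close>, and for a smoothed function it is \<open>sin \<phi> sqrt (2/\<pi>) E |grad h|\<close> up to \<open>O(\<phi>\<^sup>2)\<close>. Hence \<open>D h \<phi>\<close> is at most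
\<open>\<phi> sqrt (2/\<pi>)\<close> times the mean gradient, and, applied to Lipschitz cutoffs, at most \<open>2 \<phi> sqrt (2/\<pi>) s\<close> for a sign
function of surface area \<open>s\<close>. This is an easily estimated lower bound for the surface area.

Conversely, let \<open>D f \<theta>\<close> be small for one tiny angle and let the gradients of a smoothing of \<open>f\<close> lie, in mean square,
close to a space of dimension \<open>k\<close>. Averaging \<open>f\<close> over the orthogonal complement and smoothing within the space gives a
function \<open>H\<close> of \<open>k\<close> linear forms that is close to \<open>f\<close> and whose mean gradient is controlled by \<open>D f \<theta>\<close>; by the
coarea inequality some level set of \<open>H\<close> is a junta of small surface area close to \<open>f\<close>.

The dimension condition is tested at random points \<open>x\<^sub>1, \<dots>, x\<^sub>m\<close> without ever writing down a vector of length \<open>n\<close>: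
symmetric differences of the smoothing at \<open>x\<^sub>i\<close> in a common random direction \<open>g\<close> have as covariances over \<open>g\<close> a
rescaled Gram matrix of the gradients up to higher order, and one checks that this \<open>m \<times> m\<close> matrix is nearly of rank at
most \<open>k\<close>.
\<close>

section \<open>Finite products of probability spaces\<close>

lemma distr_eqI_nn_integral:
  assumes T [measurable]: "T \<in> measurable M N"
    and eq: "\<And>F. F \<in> borel_measurable N \<Longrightarrow> (\<integral>\<^sup>+x. F (T x) \<partial>M) = (\<integral>\<^sup>+x. F x \<partial>N)"
  shows "distr M N T = N"
proof (rule measure_eqI)
  fix A assume "A \<in> sets (distr M N T)"
  then have [measurable]: "A \<in> sets N" by simp
  have "emeasure (distr M N T) A = (\<integral>\<^sup>+x. indicator A (T x) \<partial>M)"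
    using nn_integral_distr[OF T, of "indicator A"] by simp
  also have "\<dots> = emeasure N A" by (subst eq) auto
  finally show "emeasure (distr M N T) A = emeasure N A" .
qed simp

lemma product_sigma_finite_prob_space: "(\<And>i. prob_space (M i)) \<Longrightarrow> product_sigma_finite M"
  by (intro product_sigma_finite.intro prob_space_imp_sigma_finite)

lemma distr_PiM_componentwise:
  assumes I: "finite I" and M: "\<And>i. prob_space (M i)"
    and f [measurable]: "\<And>i. f i \<in> measurable (M i) (N i)"
  shows "distr (PiM I M) (PiM I N) (\<lambda>x. \<lambda>i\<in>I. f i (x i)) = PiM I (\<lambda>i. distr (M i) (N i) (f i))"
proof -
  let ?T = "\<lambda>x. \<lambda>i\<in>I. f i (x i)"
  interpret M: product_sigma_finite M by (rule product_sigma_finite_prob_space[OF M])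
  interpret D: product_sigma_finite "\<lambda>i. distr (M i) (N i) (f i)"
    by (intro product_sigma_finite_prob_space prob_space.prob_space_distr M f)
  show ?thesis
  proof (rule D.PiM_eqI[OF I])
    show "sets (distr (PiM I M) (PiM I N) ?T) = sets (PiM I (\<lambda>i. distr (M i) (N i) (f i)))"
      by (simp cong: sets_PiM_cong)
    fix A assume "\<And>i. i \<in> I \<Longrightarrow> A i \<in> sets (distr (M i) (N i) (f i))"
    then have A: "\<And>i. i \<in> I \<Longrightarrow> A i \<in> sets (N i)" by simp
    have "emeasure (distr (PiM I M) (PiM I N) ?T) (Pi\<^sub>E I A)
        = emeasure (PiM I M) (?T -` Pi\<^sub>E I A \<inter> space (PiM I M))"
      using I A by (intro emeasure_distr measurable_restrict sets_PiM_I_finite) auto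
    also have "?T -` Pi\<^sub>E I A \<inter> space (PiM I M) = Pi\<^sub>E I (\<lambda>i. f i -` A i \<inter> space (M i))"
      by (auto simp: space_PiM PiE_iff)
    also have "emeasure (PiM I M) \<dots> = (\<Prod>i\<in>I. emeasure (M i) (f i -` A i \<inter> space (M i)))"
      using I A by (intro M.emeasure_PiM measurable_sets[OF f])
    also have "\<dots> = (\<Prod>i\<in>I. emeasure (distr (M i) (N i) (f i)) (A i))"
      using A by (intro prod.cong) (auto simp: emeasure_distr)
    finally show "emeasure (distr (PiM I M) (PiM I N) ?T) (Pi\<^sub>E I A) = \<dots>" .
  qed
qed

lemma density_PiM:
  assumes I: "finite I" and M: "\<And>i. prob_space (M i)"
    and [measurable]: "\<And>i. f i \<in> borel_measurable (M i)"
    and density: "\<And>i. prob_space (density (M i) (f i))"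
  shows "density (PiM I M) (\<lambda>x. \<Prod>i\<in>I. f i (x i)) = PiM I (\<lambda>i. density (M i) (f i))"
proof -
  interpret M: product_sigma_finite M by (rule product_sigma_finite_prob_space[OF M])
  interpret D: product_sigma_finite "\<lambda>i. density (M i) (f i)"
    by (rule product_sigma_finite_prob_space[OF density])
  show ?thesis
  proof (rule D.PiM_eqI[OF I])
    show "sets (density (PiM I M) (\<lambda>x. \<Prod>i\<in>I. f i (x i))) = sets (PiM I (\<lambda>i. density (M i) (f i)))"
      by (simp cong: sets_PiM_cong)
    fix A assume "\<And>i. i \<in> I \<Longrightarrow> A i \<in> sets (density (M i) (f i))"
    then have A [measurable]: "\<And>i. i \<in> I \<Longrightarrow> A i \<in> sets (M i)" by simp
    have "emeasure (density (PiM I M) (\<lambda>x. \<Prod>i\<in>I. f i (x i))) (Pi\<^sub>E I A)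
        = (\<integral>\<^sup>+x. (\<Prod>i\<in>I. f i (x i)) * indicator (Pi\<^sub>E I A) x \<partial>PiM I M)"
      using I A by (intro emeasure_density sets_PiM_I_finite) auto
    also have "\<dots> = (\<integral>\<^sup>+x. (\<Prod>i\<in>I. f i (x i) * indicator (A i) (x i)) \<partial>PiM I M)"
    proof (rule nn_integral_cong)
      fix x assume "x \<in> space (PiM I M)"
      then have "indicator (Pi\<^sub>E I A) x = (\<Prod>i\<in>I. indicator (A i) (x i) :: ennreal)"
        using I by (auto simp: space_PiM PiE_iff indicator_def prod_zero_iff)
      then show "(\<Prod>i\<in>I. f i (x i)) * indicator (Pi\<^sub>E I A) x = (\<Prod>i\<in>I. f i (x i) * indicator (A i) (x i))"
        by (simp add: prod.distrib)
    qed
    also have "\<dots> = (\<Prod>i\<in>I. \<integral>\<^sup>+t. f i t * indicator (A i) t \<partial>M i)"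
      using I A by (intro M.product_nn_integral_prod) auto
    also have "\<dots> = (\<Prod>i\<in>I. emeasure (density (M i) (f i)) (A i))"
      using A by (intro prod.cong) (auto simp: emeasure_density)
    finally show "emeasure (density (PiM I M) (\<lambda>x. \<Prod>i\<in>I. f i (x i))) (Pi\<^sub>E I A) = \<dots>" .
  qed
qed

lemma distr_PiM_pair:
  assumes I: "finite I" and M: "\<And>i. prob_space (M i)" and N: "\<And>i. prob_space (N i)"
  shows "distr (PiM I M \<Otimes>\<^sub>M PiM I N) (PiM I (\<lambda>i. M i \<Otimes>\<^sub>M N i)) (\<lambda>p. \<lambda>i\<in>I. (fst p i, snd p i))
    = PiM I (\<lambda>i. M i \<Otimes>\<^sub>M N i)"
proof -
  let ?zip = "\<lambda>p. \<lambda>i\<in>I. (fst p i, snd p i)"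
  interpret M: product_sigma_finite M by (rule product_sigma_finite_prob_space[OF M])
  interpret N: product_sigma_finite N by (rule product_sigma_finite_prob_space[OF N])
  interpret Q: product_sigma_finite "\<lambda>i. M i \<Otimes>\<^sub>M N i"
    by (intro product_sigma_finite_prob_space prob_space_pair M N)
  interpret PN: prob_space "PiM I N" by (rule prob_space_PiM[OF N])
  show ?thesis
  proof (rule Q.PiM_eqI[OF I])
    fix A assume A [measurable]: "\<And>i. i \<in> I \<Longrightarrow> A i \<in> sets (M i \<Otimes>\<^sub>M N i)"
    have zip: "?zip \<in> measurable (PiM I M \<Otimes>\<^sub>M PiM I N) (PiM I (\<lambda>i. M i \<Otimes>\<^sub>M N i))"
      by (rule measurable_restrict) measurable
    have "emeasure (distr (PiM I M \<Otimes>\<^sub>M PiM I N) (PiM I (\<lambda>i. M i \<Otimes>\<^sub>M N i)) ?zip) (Pi\<^sub>E I A)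
        = (\<integral>\<^sup>+p. indicator (Pi\<^sub>E I A) (?zip p) \<partial>(PiM I M \<Otimes>\<^sub>M PiM I N))"
      using nn_integral_distr[OF zip, of "indicator (Pi\<^sub>E I A)"] sets_PiM_I_finite[OF I A] by simp
    also have "\<dots> = (\<integral>\<^sup>+p. (\<Prod>i\<in>I. indicator (A i) (fst p i, snd p i)) \<partial>(PiM I M \<Otimes>\<^sub>M PiM I N))"
      using I by (intro nn_integral_cong) (auto simp: PiE_iff indicator_def prod_zero_iff)
    also have "\<dots> = (\<integral>\<^sup>+x. \<integral>\<^sup>+z. (\<Prod>i\<in>I. indicator (A i) (x i, z i)) \<partial>PiM I N \<partial>PiM I M)"
      by (subst PN.nn_integral_fst[symmetric]) measurable
    also have "\<dots> = (\<integral>\<^sup>+x. (\<Prod>i\<in>I. \<integral>\<^sup>+b. indicator (A i) (x i, b) \<partial>N i) \<partial>PiM I M)"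
      by (intro nn_integral_cong N.product_nn_integral_prod I) (auto simp: space_PiM PiE_iff)
    also have "\<dots> = (\<Prod>i\<in>I. \<integral>\<^sup>+a. \<integral>\<^sup>+b. indicator (A i) (a, b) \<partial>N i \<partial>M i)"
      by (intro M.product_nn_integral_prod I) measurable
    also have "\<dots> = (\<Prod>i\<in>I. emeasure (M i \<Otimes>\<^sub>M N i) (A i))"
      by (intro prod.cong refl) (auto simp: N.emeasure_pair_measure)
    finally show "emeasure (distr (PiM I M \<Otimes>\<^sub>M PiM I N) (PiM I (\<lambda>i. M i \<Otimes>\<^sub>M N i)) ?zip) (Pi\<^sub>E I A) = \<dots>" .
  qed simp
qed

section \<open>Rotation invariance of the Gaussian measure\<close>

lemma prob_space_gauss1: "prob_space gauss1"
  unfolding gauss1_def by (rule prob_space_normal_density) simp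

lemma sets_gauss1 [measurable_cong, simp]: "sets gauss1 = sets borel"
  by (simp add: gauss1_def)

lemma space_gauss1 [simp]: "space gauss1 = UNIV"
  by (simp add: gauss1_def)

lemma measurable_gauss1 [simp]:
  "measurable gauss1 M = measurable borel M" "measurable M gauss1 = measurable M borel"
  by (rule measurable_cong_sets, simp_all)+

interpretation gauss1: prob_space gauss1 by (rule prob_space_gauss1)

interpretation gauss1_PiM: product_sigma_finite "\<lambda>_::nat. gauss1"
  by unfold_locales

interpretation gauss1_pair: pair_prob_space gauss1 gauss1
  by unfold_locales

lemma prob_space_gauss: "prob_space (gauss n)"
  unfolding gauss_def by (rule prob_space_PiM) (rule prob_space_gauss1)

interpretation gauss: prob_space "gauss n" for n by (rule prob_space_gauss)

abbreviation gauss_pair :: "nat \<Rightarrow> ((nat \<Rightarrow> real) \<times> (nat \<Rightarrow> real)) measure"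
  where "gauss_pair n \<equiv> gauss n \<Otimes>\<^sub>M gauss n"

interpretation gauss_pair: pair_prob_space "gauss n" "gauss n" for n by unfold_locales

lemma sets_gauss [measurable_cong]: "sets (gauss n) = sets (PiM {..<n} (\<lambda>_. borel))"
  unfolding gauss_def by (rule sets_PiM_cong) auto

lemma space_gauss: "space (gauss n) = extensional {..<n}"
  by (auto simp: gauss_def space_PiM PiE_def)

lemma measurable_gauss_component [measurable (raw)]:
  assumes "h \<in> measurable M (gauss n)" "i < n"
  shows "(\<lambda>p. h p i) \<in> borel_measurable M"
  using measurable_compose[OF assms(1)[unfolded gauss_def] measurable_component_singleton[of i "{..<n}"]] assms(2)
  by simp

lemma nn_integral_gauss1_pair:
  assumes [measurable]: "F \<in> borel_measurable (borel \<Otimes>\<^sub>M borel)"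
  shows "(\<integral>\<^sup>+a. \<integral>\<^sup>+b. F (a, b) \<partial>gauss1 \<partial>gauss1)
     = (\<integral>\<^sup>+a. \<integral>\<^sup>+b. ennreal (exp (- (a\<^sup>2 + b\<^sup>2) / 2) / (2 * pi)) * F (a, b) \<partial>lborel \<partial>lborel)"
proof -
  have product: "std_normal_density a * std_normal_density b = exp (- (a\<^sup>2 + b\<^sup>2) / 2) / (2 * pi)" for a b
    by (simp add: std_normal_density_def field_simps exp_add [symmetric] exp_minus)
  show ?thesis
    unfolding gauss1_def product [symmetric]
    by (simp add: nn_integral_density ennreal_mult mult.assoc nn_integral_cmult)
qed

lemma nn_integral_lborel_shear_fst:
  fixes F :: "real \<times> real \<Rightarrow> ennreal"
  assumes [measurable]: "F \<in> borel_measurable (borel \<Otimes>\<^sub>M borel)"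
  shows "(\<integral>\<^sup>+a. \<integral>\<^sup>+b. F (a + t * b, b) \<partial>lborel \<partial>lborel) = (\<integral>\<^sup>+a. \<integral>\<^sup>+b. F (a, b) \<partial>lborel \<partial>(lborel :: real measure))"
proof -
  have "(\<integral>\<^sup>+a. \<integral>\<^sup>+b. F (a + t * b, b) \<partial>lborel \<partial>lborel) = (\<integral>\<^sup>+b. \<integral>\<^sup>+a. F (t * b + 1 * a, b) \<partial>lborel \<partial>lborel)"
    by (subst lborel_pair.Fubini') (auto simp: add.commute)
  also have "\<dots> = (\<integral>\<^sup>+b. \<integral>\<^sup>+a. F (a, b) \<partial>lborel \<partial>lborel)"
  proof (rule nn_integral_cong)
    fix b :: real
    show "(\<integral>\<^sup>+a. F (t * b + 1 * a, b) \<partial>lborel) = (\<integral>\<^sup>+a. F (a, b) \<partial>lborel)"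
      using nn_integral_real_affine[of "\<lambda>a. F (a, b)" 1 "t * b"] by simp
  qed
  also have "\<dots> = (\<integral>\<^sup>+a. \<integral>\<^sup>+b. F (a, b) \<partial>lborel \<partial>lborel)"
    by (subst lborel_pair.Fubini') auto
  finally show ?thesis .
qed

lemma nn_integral_lborel_shear_snd:
  fixes F :: "real \<times> real \<Rightarrow> ennreal"
  assumes [measurable]: "F \<in> borel_measurable (borel \<Otimes>\<^sub>M borel)"
  shows "(\<integral>\<^sup>+a. \<integral>\<^sup>+b. F (a, b + t * a) \<partial>lborel \<partial>lborel) = (\<integral>\<^sup>+a. \<integral>\<^sup>+b. F (a, b) \<partial>lborel \<partial>(lborel :: real measure))"
proof (rule nn_integral_cong)
  fix a :: real
  show "(\<integral>\<^sup>+b. F (a, b + t * a) \<partial>lborel) = (\<integral>\<^sup>+b. F (a, b) \<partial>lborel)"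
    using nn_integral_real_affine[of "\<lambda>b. F (a, b)" 1 "t * a"] by (simp add: add.commute)
qed

lemma nn_integral_lborel_reflect:
  fixes F :: "real \<times> real \<Rightarrow> ennreal"
  assumes [measurable]: "F \<in> borel_measurable (borel \<Otimes>\<^sub>M borel)"
  shows "(\<integral>\<^sup>+a. \<integral>\<^sup>+b. F (- a, - b) \<partial>lborel \<partial>lborel) = (\<integral>\<^sup>+a. \<integral>\<^sup>+b. F (a, b) \<partial>lborel \<partial>(lborel :: real measure))"
proof -
  have reflect: "(\<integral>\<^sup>+a. g (- a) \<partial>lborel) = (\<integral>\<^sup>+a. g a \<partial>lborel)"
    if [measurable]: "g \<in> borel_measurable borel" for g :: "real \<Rightarrow> ennreal"
    using nn_integral_real_affine[of g "-1" 0] by simp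
  show ?thesis
    by (subst reflect[of "\<lambda>b. F (_, b)"], measurable)
       (rule reflect[of "\<lambda>a. \<integral>\<^sup>+b. F (a, b) \<partial>lborel"], measurable)
qed

text \<open>A planar rotation is a composition of three shears, unless its sine vanishes.\<close>

lemma nn_integral_lborel_rotation:
  fixes F :: "real \<times> real \<Rightarrow> ennreal" and c s :: real
  assumes [measurable]: "F \<in> borel_measurable (borel \<Otimes>\<^sub>M borel)" and cs: "c\<^sup>2 + s\<^sup>2 = 1"
  shows "(\<integral>\<^sup>+a. \<integral>\<^sup>+b. F (c * a + s * b, - s * a + c * b) \<partial>lborel \<partial>lborel)
    = (\<integral>\<^sup>+a. \<integral>\<^sup>+b. F (a, b) \<partial>lborel \<partial>(lborel :: real measure))"
proof (cases "s = 0")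
  case True
  then have "c = 1 \<or> c = - 1" using cs by (simp add: power2_eq_1_iff)
  then show ?thesis using True nn_integral_lborel_reflect[of F] by auto
next
  case False
  define t where "t = (1 - c) / s"
  have cos_eq: "1 - t * s = c" using False by (simp add: t_def)
  have "s * (t * (1 + c)) = (1 - c) * (1 + c)" using False by (simp add: t_def)
  also have "\<dots> = s * s" using cs by (simp add: power2_eq_square algebra_simps)
  finally have "t * (1 + c) = s" using False by simp
  then have sin_eq: "t + c * t = s" by (simp add: algebra_simps)
  define G where "G = (\<lambda>p. F (fst p + t * snd p, snd p))"
  define H where "H = (\<lambda>p. G (fst p, snd p + (- s) * fst p))"
  have [measurable]: "G \<in> borel_measurable (borel \<Otimes>\<^sub>M borel)" "H \<in> borel_measurable (borel \<Otimes>\<^sub>M borel)"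
    unfolding G_def H_def by measurable
  have H: "H (a + t * b, b) = F (c * a + s * b, - s * a + c * b)" for a b
  proof -
    have snd: "b + - s * (a + t * b) = - s * a + (1 - t * s) * b" by (simp add: algebra_simps)
    have fst: "a + t * b + t * (- s * a + c * b) = (1 - t * s) * a + (t + c * t) * b"
      by (simp add: algebra_simps)
    show ?thesis unfolding H_def G_def fst_conv snd_conv snd cos_eq fst sin_eq ..
  qed
  have "(\<integral>\<^sup>+a. \<integral>\<^sup>+b. F (c * a + s * b, - s * a + c * b) \<partial>lborel \<partial>lborel)
      = (\<integral>\<^sup>+a. \<integral>\<^sup>+b. H (a + t * b, b) \<partial>lborel \<partial>lborel)"
    by (simp add: H)
  also have "\<dots> = (\<integral>\<^sup>+a. \<integral>\<^sup>+b. G (a, b + (- s) * a) \<partial>lborel \<partial>lborel)"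
    by (subst nn_integral_lborel_shear_fst) (auto simp: H_def)
  also have "\<dots> = (\<integral>\<^sup>+a. \<integral>\<^sup>+b. F (a + t * b, b) \<partial>lborel \<partial>lborel)"
    by (subst nn_integral_lborel_shear_snd) (auto simp: G_def)
  also have "\<dots> = (\<integral>\<^sup>+a. \<integral>\<^sup>+b. F (a, b) \<partial>lborel \<partial>lborel)"
    by (rule nn_integral_lborel_shear_fst) auto
  finally show ?thesis .
qed

lemma nn_integral_gauss1_rotation:
  fixes F :: "real \<times> real \<Rightarrow> ennreal" and c s :: real
  assumes [measurable]: "F \<in> borel_measurable (borel \<Otimes>\<^sub>M borel)" and cs: "c\<^sup>2 + s\<^sup>2 = 1"
  shows "(\<integral>\<^sup>+a. \<integral>\<^sup>+b. F (c * a + s * b, - s * a + c * b) \<partial>gauss1 \<partial>gauss1)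
    = (\<integral>\<^sup>+a. \<integral>\<^sup>+b. F (a, b) \<partial>gauss1 \<partial>gauss1)"
proof -
  let ?F = "\<lambda>p. ennreal (exp (- ((fst p)\<^sup>2 + (snd p)\<^sup>2) / 2) / (2 * pi)) * F p"
  have "(c * a + s * b)\<^sup>2 + (- s * a + c * b)\<^sup>2 = a\<^sup>2 + b\<^sup>2" for a b
  proof -
    have "(c * a + s * b)\<^sup>2 + (- s * a + c * b)\<^sup>2 = (c\<^sup>2 + s\<^sup>2) * (a\<^sup>2 + b\<^sup>2)"
      by (simp add: power2_eq_square algebra_simps)
    then show ?thesis using cs by simp
  qed
  then show ?thesis
    using nn_integral_lborel_rotation[of ?F c s, OF _ cs]
      nn_integral_gauss1_pair[of F] nn_integral_gauss1_pair[of "\<lambda>p. F (c * fst p + s * snd p, - s * fst p + c * snd p)"]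
    by simp
qed

lemma distr_gauss1_pair_rotation:
  fixes c s :: real
  assumes "c\<^sup>2 + s\<^sup>2 = 1"
  shows "distr (gauss1 \<Otimes>\<^sub>M gauss1) (gauss1 \<Otimes>\<^sub>M gauss1) (\<lambda>p. (c * fst p + s * snd p, - s * fst p + c * snd p))
    = gauss1 \<Otimes>\<^sub>M gauss1"
proof (rule distr_eqI_nn_integral)
  fix F :: "real \<times> real \<Rightarrow> ennreal" assume [measurable]: "F \<in> borel_measurable (gauss1 \<Otimes>\<^sub>M gauss1)"
  then have "F \<in> borel_measurable (borel \<Otimes>\<^sub>M borel)" by simp
  from nn_integral_gauss1_rotation[OF this assms]
  show "(\<integral>\<^sup>+p. F (c * fst p + s * snd p, - s * fst p + c * snd p) \<partial>(gauss1 \<Otimes>\<^sub>M gauss1)) = (\<integral>\<^sup>+p. F p \<partial>(gauss1 \<Otimes>\<^sub>M gauss1))"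
    by (simp add: gauss1.nn_integral_fst[symmetric])
qed simp

definition mix :: "nat \<Rightarrow> (nat \<Rightarrow> real) \<Rightarrow> (nat \<Rightarrow> real) \<Rightarrow> (nat \<Rightarrow> real) \<Rightarrow> (nat \<Rightarrow> real) \<Rightarrow> nat \<Rightarrow> real"
  where "mix n \<alpha> \<beta> x z = (\<lambda>i\<in>{..<n}. \<alpha> i * x i + \<beta> i * z i)"

abbreviation lincomb :: "nat \<Rightarrow> real \<Rightarrow> real \<Rightarrow> (nat \<Rightarrow> real) \<Rightarrow> (nat \<Rightarrow> real) \<Rightarrow> nat \<Rightarrow> real"
  where "lincomb n a b \<equiv> mix n (\<lambda>_. a) (\<lambda>_. b)"

lemma mix_in_space [simp]: "mix n \<alpha> \<beta> x z \<in> space (gauss n)"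
  by (simp add: mix_def space_gauss)

lemma mix_apply [simp]: "i < n \<Longrightarrow> mix n \<alpha> \<beta> x z i = \<alpha> i * x i + \<beta> i * z i"
  by (simp add: mix_def)

lemma measurable_restrict_gauss:
  assumes "\<And>i. i < n \<Longrightarrow> (\<lambda>p. f p i) \<in> borel_measurable M"
  shows "(\<lambda>p. \<lambda>i\<in>{..<n}. f p i) \<in> measurable M (gauss n)"
  unfolding gauss_def using assms by (intro measurable_restrict) simp

lemma measurable_mix [measurable (raw)]:
  assumes [measurable]: "f \<in> measurable M (gauss n)" "g \<in> measurable M (gauss n)"
  shows "(\<lambda>p. mix n \<alpha> \<beta> (f p) (g p)) \<in> measurable M (gauss n)"
  unfolding mix_def by (rule measurable_restrict_gauss) measurable

lemma measurable_mix_right [measurable]: "mix n \<alpha> \<beta> x \<in> measurable (gauss n) (gauss n)"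
  unfolding mix_def by (rule measurable_restrict_gauss) measurable

text \<open>Zipping two Gaussian vectors into a vector of pairs reduces to the plane.\<close>

lemma distr_pair_rotation:
  assumes weights: "\<And>i. (\<alpha> i)\<^sup>2 + (\<beta> i)\<^sup>2 = 1"
  shows "distr (gauss_pair n) (gauss_pair n)
     (\<lambda>p. (mix n \<alpha> \<beta> (fst p) (snd p), mix n (\<lambda>i. - \<beta> i) \<alpha> (fst p) (snd p))) = gauss_pair n"
    (is "distr _ _ ?rot = _")
proof -
  let ?Q = "PiM {..<n} (\<lambda>_. gauss1 \<Otimes>\<^sub>M gauss1)"
  let ?zip = "\<lambda>p. \<lambda>i\<in>{..<n}. (fst p i, snd p i)"
  let ?rot2 = "\<lambda>i p. (\<alpha> i * fst p + \<beta> i * snd p, - \<beta> i * fst p + \<alpha> i * snd p)"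
  let ?rots = "\<lambda>q. \<lambda>i\<in>{..<n}. ?rot2 i (q i)"
  let ?unzip = "\<lambda>q. (\<lambda>i\<in>{..<n}. fst (q i), \<lambda>i\<in>{..<n}. snd (q i))"
  have zip: "distr (gauss_pair n) ?Q ?zip = ?Q"
    using distr_PiM_pair[of "{..<n}" "\<lambda>_. gauss1" "\<lambda>_. gauss1"] gauss1.prob_space_axioms
    by (simp add: gauss_def)
  have "distr ?Q ?Q ?rots = PiM {..<n} (\<lambda>i. distr (gauss1 \<Otimes>\<^sub>M gauss1) (gauss1 \<Otimes>\<^sub>M gauss1) (?rot2 i))"
    by (rule distr_PiM_componentwise) (use gauss1_pair.prob_space_axioms in auto)
  then have rots: "distr ?Q ?Q ?rots = ?Q" by (simp only: distr_gauss1_pair_rotation[OF weights])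
  have zip_meas [measurable]: "?zip \<in> measurable (gauss_pair n) ?Q"
    by (rule measurable_restrict) measurable
  have rots_meas [measurable]: "?rots \<in> measurable ?Q ?Q"
    by (rule measurable_restrict) measurable
  have unzip_meas [measurable]: "?unzip \<in> measurable ?Q (gauss_pair n)"
    by (intro measurable_Pair measurable_restrict_gauss) measurable
  have "gauss_pair n = distr (gauss_pair n) (gauss_pair n) (\<lambda>p. ?unzip (?zip p))"
    by (subst distr_id2[symmetric], simp, intro distr_cong)
       (auto simp: space_pair_measure space_gauss prod_eq_iff extensional_restrict cong: restrict_cong)
  also have "\<dots> = distr (distr (gauss_pair n) ?Q ?zip) (gauss_pair n) ?unzip"
    by (subst distr_distr) (auto simp: comp_def)
  also have "\<dots> = distr ?Q (gauss_pair n) ?unzip" by (simp only: zip)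
  finally have unzip_eq: "distr ?Q (gauss_pair n) ?unzip = gauss_pair n" ..
  have "distr (gauss_pair n) (gauss_pair n) ?rot = distr (gauss_pair n) (gauss_pair n) (?unzip \<circ> (?rots \<circ> ?zip))"
    by (intro distr_cong) (auto simp: mix_def cong: restrict_cong)
  also have "\<dots> = distr (distr (distr (gauss_pair n) ?Q ?zip) ?Q ?rots) (gauss_pair n) ?unzip"
    unfolding distr_distr[OF rots_meas zip_meas] distr_distr[OF unzip_meas measurable_comp[OF zip_meas rots_meas]] ..
  also have "\<dots> = gauss_pair n" by (simp only: zip rots unzip_eq)
  finally show ?thesis .
qed

lemma distr_mix:
  assumes "\<And>i. (\<alpha> i)\<^sup>2 + (\<beta> i)\<^sup>2 = 1"
  shows "distr (gauss_pair n) (gauss n) (\<lambda>p. mix n \<alpha> \<beta> (fst p) (snd p)) = gauss n"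
proof -
  let ?R = "\<lambda>p. (mix n \<alpha> \<beta> (fst p) (snd p), mix n (\<lambda>i. - \<beta> i) \<alpha> (fst p) (snd p))"
  have "distr (gauss_pair n) (gauss n) (\<lambda>p. mix n \<alpha> \<beta> (fst p) (snd p))
      = distr (distr (gauss_pair n) (gauss_pair n) ?R) (gauss n) fst"
    by (subst distr_distr) (auto simp: comp_def)
  also have "\<dots> = gauss n"
    by (simp add: distr_pair_rotation[OF assms] gauss.distr_pair_fst)
  finally show ?thesis .
qed

definition givens :: "nat \<Rightarrow> nat \<Rightarrow> real \<Rightarrow> real \<Rightarrow> (nat \<Rightarrow> real) \<Rightarrow> nat \<Rightarrow> real"
  where "givens i j c s x = x(i := c * x i + s * x j, j := - s * x i + c * x j)"

lemma measurable_fun_upd_gauss: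
  assumes "f \<in> measurable M (gauss n)" "g \<in> borel_measurable M" "i < n"
  shows "(\<lambda>p. (f p)(i := g p)) \<in> measurable M (gauss n)"
  unfolding gauss_def
proof (rule measurable_PiM_single')
  fix j assume "j \<in> {..<n}"
  then show "(\<lambda>p. ((f p)(i := g p)) j) \<in> measurable M gauss1"
    using measurable_gauss_component[OF assms(1), of j] assms(2) by (cases "i = j") auto
qed (use measurable_space[OF assms(1)] assms(3) in \<open>auto simp: space_gauss PiE_iff extensional_def\<close>)

lemma measurable_givens [measurable]:
  assumes "i < n" "j < n"
  shows "givens i j c s \<in> measurable (gauss n) (gauss n)"
  unfolding givens_def
  by (intro measurable_fun_upd_gauss borel_measurable_const borel_measurable_add borel_measurable_times measurable_gauss_component)
     (use assms in auto)

lemma nn_integral_gauss_split2: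
  assumes ij: "i < n" "j < n" "i \<noteq> j" and "H \<in> borel_measurable (gauss n)"
  shows "(\<integral>\<^sup>+x. H x \<partial>gauss n)
    = (\<integral>\<^sup>+x. \<integral>\<^sup>+b. \<integral>\<^sup>+a. H (x(j := b, i := a)) \<partial>gauss1 \<partial>gauss1 \<partial>PiM ({..<n} - {i, j}) (\<lambda>_. gauss1))"
proof -
  let ?J = "{..<n} - {i, j}"
  have split_indices: "{..<n} = insert i (insert j ?J)" using ij by auto
  have H [measurable]: "H \<in> borel_measurable (PiM (insert i (insert j ?J)) (\<lambda>_. gauss1))"
    using assms(4) unfolding gauss_def split_indices[symmetric] .
  have "(\<integral>\<^sup>+x. H x \<partial>gauss n) = (\<integral>\<^sup>+x. \<integral>\<^sup>+a. H (x(i := a)) \<partial>gauss1 \<partial>(PiM (insert j ?J) (\<lambda>_. gauss1)))"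
    unfolding gauss_def by (subst split_indices, rule gauss1_PiM.product_nn_integral_insert) (use ij H in auto)
  also have "\<dots> = (\<integral>\<^sup>+x. \<integral>\<^sup>+b. \<integral>\<^sup>+a. H (x(j := b, i := a)) \<partial>gauss1 \<partial>gauss1 \<partial>PiM ?J (\<lambda>_. gauss1))"
    by (rule gauss1_PiM.product_nn_integral_insert) (use ij in auto)
  finally show ?thesis .
qed

lemma distr_givens:
  assumes ij: "i < n" "j < n" "i \<noteq> j" and cs: "c\<^sup>2 + s\<^sup>2 = 1"
  shows "distr (gauss n) (gauss n) (givens i j c s) = gauss n"
proof (rule distr_eqI_nn_integral)
  fix F :: "_ \<Rightarrow> ennreal" assume F: "F \<in> borel_measurable (gauss n)"
  let ?J = "{..<n} - {i, j}"
  let ?P = "PiM ?J (\<lambda>_. gauss1)"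
  have "{..<n} = insert i (insert j ?J)" using ij by auto
  then have [measurable]: "F \<in> borel_measurable (PiM (insert i (insert j ?J)) (\<lambda>_. gauss1))"
    using F by (simp add: gauss_def)
  have swap: "givens i j c s (x(j := b, i := a)) = x(j := c * b + (- s) * a, i := - (- s) * b + c * a)" for x a b
    using ij by (auto simp: givens_def)
  have "(\<integral>\<^sup>+x. F (givens i j c s x) \<partial>gauss n)
    = (\<integral>\<^sup>+x. \<integral>\<^sup>+b. \<integral>\<^sup>+a. F (x(j := c * b + (- s) * a, i := - (- s) * b + c * a)) \<partial>gauss1 \<partial>gauss1 \<partial>?P)"
    unfolding swap[symmetric]
    by (rule nn_integral_gauss_split2[OF ij], rule measurable_compose[OF measurable_givens F]) (use ij in auto)
  also have "\<dots> = (\<integral>\<^sup>+x. \<integral>\<^sup>+b. \<integral>\<^sup>+a. F (x(j := b, i := a)) \<partial>gauss1 \<partial>gauss1 \<partial>?P)"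
  proof (rule nn_integral_cong)
    fix x assume [measurable]: "x \<in> space ?P"
    show "(\<integral>\<^sup>+b. \<integral>\<^sup>+a. F (x(j := c * b + (- s) * a, i := - (- s) * b + c * a)) \<partial>gauss1 \<partial>gauss1)
       = (\<integral>\<^sup>+b. \<integral>\<^sup>+a. F (x(j := b, i := a)) \<partial>gauss1 \<partial>gauss1)"
      using nn_integral_gauss1_rotation[of "\<lambda>p. F (x(j := fst p, i := snd p))" c "- s"] cs by simp
  qed
  also have "\<dots> = (\<integral>\<^sup>+x. F x \<partial>gauss n)" using nn_integral_gauss_split2[OF ij F] by simp
  finally show "(\<integral>\<^sup>+x. F (givens i j c s x) \<partial>gauss n) = (\<integral>\<^sup>+x. F x \<partial>gauss n)" .
qed (use ij in measurable)

section \<open>Euclidean geometry of coordinate vectors\<close>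

definition norm_n :: "nat \<Rightarrow> (nat \<Rightarrow> real) \<Rightarrow> real"
  where "norm_n n x = sqrt (\<Sum>i<n. (x i)\<^sup>2)"

lemma norm_n_L2_set: "norm_n n x = L2_set x {..<n}"
  by (simp add: norm_n_def L2_set_def)

lemma norm_n_nonneg [simp]: "norm_n n x \<ge> 0"
  by (simp add: norm_n_def sum_nonneg)

lemma norm_n_sq: "(norm_n n x)\<^sup>2 = (\<Sum>i<n. (x i)\<^sup>2)"
  by (simp add: norm_n_def sum_nonneg)

lemma norm_n_eq_0_iff: "norm_n n x = 0 \<longleftrightarrow> (\<forall>i<n. x i = 0)"
  by (auto simp: norm_n_L2_set L2_set_eq_0_iff)

lemma norm_n_cmult: "norm_n n (\<lambda>i. c * x i) = \<bar>c\<bar> * norm_n n x"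
  by (simp add: norm_n_def power_mult_distrib sum_distrib_left[symmetric] real_sqrt_mult)

lemma norm_n_le_sum_abs: "norm_n n x \<le> (\<Sum>i<n. \<bar>x i\<bar>)"
  unfolding norm_n_L2_set by (rule L2_set_le_sum_abs)

lemma inner_n_self: "inner_n n x x = (norm_n n x)\<^sup>2"
  unfolding norm_n_sq inner_n_def by (simp add: power2_eq_square)

lemma inner_n_commute: "inner_n n x y = inner_n n y x"
  by (simp add: inner_n_def mult.commute)

lemma inner_n_cong:
  "(\<And>i. i < n \<Longrightarrow> x i = x' i) \<Longrightarrow> (\<And>i. i < n \<Longrightarrow> y i = y' i) \<Longrightarrow> inner_n n x y = inner_n n x' y'"
  unfolding inner_n_def by (rule sum.cong) simp_all

lemma inner_n_lincomb: "inner_n n v (lincomb n a b x y) = a * inner_n n v x + b * inner_n n v y"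
  by (simp add: inner_n_def sum_distrib_left sum.distrib[symmetric] algebra_simps)

lemma inner_n_diff_right: "inner_n n v (\<lambda>i. x i - y i) = inner_n n v x - inner_n n v y"
  by (simp add: inner_n_def right_diff_distrib sum_subtractf)

lemma inner_n_sum_right: "inner_n n x (\<lambda>i. \<Sum>b<m. d b * u b i) = (\<Sum>b<m. d b * inner_n n x (u b))"
proof -
  have "inner_n n x (\<lambda>i. \<Sum>b<m. d b * u b i) = (\<Sum>i<n. \<Sum>b<m. d b * (x i * u b i))"
    by (simp add: inner_n_def sum_distrib_left mult_ac)
  also have "\<dots> = (\<Sum>b<m. \<Sum>i<n. d b * (x i * u b i))" by (rule sum.swap)
  finally show ?thesis by (simp add: inner_n_def sum_distrib_left)
qed

definition unit_vec_n :: "nat \<Rightarrow> nat \<Rightarrow> nat \<Rightarrow> real"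
  where "unit_vec_n n i = (\<lambda>j\<in>{..<n}. if j = i then 1 else 0)"

lemma unit_vec_n_in_space [simp]: "unit_vec_n n i \<in> space (gauss n)"
  by (simp add: unit_vec_n_def space_gauss)

lemma inner_n_unit_vec: "i < n \<Longrightarrow> inner_n n (unit_vec_n n i) y = y i"
  by (simp add: inner_n_def unit_vec_n_def if_distrib if_distribR cong: if_cong)

lemma inner_n_le_norm_mult: "inner_n n x y \<le> norm_n n x * norm_n n y"
proof -
  have "inner_n n x y \<le> (\<Sum>i<n. \<bar>x i\<bar> * \<bar>y i\<bar>)"
    unfolding inner_n_def by (intro sum_mono) (metis abs_ge_self abs_mult)
  also have "\<dots> \<le> norm_n n x * norm_n n y"
    unfolding norm_n_L2_set by (rule L2_set_mult_ineq)
  finally show ?thesis .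
qed

lemma dist_n_norm: "dist_n n x y = norm_n n (\<lambda>i. x i - y i)"
  by (simp add: dist_n_def norm_n_def)

lemma dist_n_nonneg [simp]: "0 \<le> dist_n n x y"
  by (simp add: dist_n_norm)

lemma dist_n_self [simp]: "dist_n n x x = 0"
  by (simp add: dist_n_def)

lemma dist_n_commute: "dist_n n x y = dist_n n y x"
  by (simp add: dist_n_def power2_commute)

lemma dist_n_triangle: "dist_n n x z \<le> dist_n n x y + dist_n n y z"
  using L2_set_triangle_ineq[of "\<lambda>i. x i - y i" "\<lambda>i. y i - z i" "{..<n}"]
  by (simp add: dist_n_norm norm_n_L2_set)

lemma dist_n_sq: "(dist_n n x y)\<^sup>2 = inner_n n x x - 2 * inner_n n x y + inner_n n y y"
  unfolding dist_n_norm norm_n_sq inner_n_def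
  by (simp add: power2_diff sum.distrib sum_subtractf sum_distrib_left power2_eq_square algebra_simps)

definition orthonormal_n :: "nat \<Rightarrow> nat \<Rightarrow> (nat \<Rightarrow> nat \<Rightarrow> real) \<Rightarrow> bool"
  where "orthonormal_n n m u \<longleftrightarrow> (\<forall>i<m. u i \<in> space (gauss n)) \<and>
    (\<forall>i<m. \<forall>j<m. inner_n n (u i) (u j) = (if i = j then 1 else 0))"

lemma orthonormal_nD:
  assumes "orthonormal_n n m u"
  shows "i < m \<Longrightarrow> u i \<in> space (gauss n)" "i < m \<Longrightarrow> inner_n n (u i) (u i) = 1"
    "i < m \<Longrightarrow> j < m \<Longrightarrow> i \<noteq> j \<Longrightarrow> inner_n n (u i) (u j) = 0"
  using assms by (auto simp: orthonormal_n_def)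

lemma orthonormal_n_antimono: "orthonormal_n n m u \<Longrightarrow> k \<le> m \<Longrightarrow> orthonormal_n n k u"
  by (auto simp: orthonormal_n_def)

lemma orthonormal_sum_sq: "orthonormal_n n m u \<Longrightarrow> b < m \<Longrightarrow> (\<Sum>i<n. (u b i)\<^sup>2) = 1"
  using orthonormal_nD(2)[of n m u b] by (simp add: inner_n_def power2_eq_square)

lemma inner_orthonormal_combination:
  assumes "orthonormal_n n m u" "b < m"
  shows "inner_n n (u b) (\<lambda>i. \<Sum>b<m. d b * u b i) = d b"
proof -
  have "inner_n n (u b) (\<lambda>i. \<Sum>b<m. d b * u b i) = (\<Sum>b'<m. d b' * (if b = b' then 1 else 0))"
    unfolding inner_n_sum_right using assms by (intro sum.cong) (auto simp: orthonormal_n_def)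
  also have "\<dots> = d b" using assms(2) by (simp add: if_distrib cong: if_cong)
  finally show ?thesis .
qed

lemma sum_sq_orthonormal_combination:
  assumes "orthonormal_n n m u"
  shows "(\<Sum>i<n. (\<Sum>b<m. d b * u b i)\<^sup>2) = (\<Sum>b<m. (d b)\<^sup>2)"
proof -
  let ?s = "\<lambda>i. \<Sum>b<m. d b * u b i"
  have "(\<Sum>i<n. (?s i)\<^sup>2) = inner_n n ?s ?s" by (simp add: inner_n_def power2_eq_square)
  also have "\<dots> = (\<Sum>b<m. d b * inner_n n (u b) ?s)" by (simp add: inner_n_sum_right inner_n_commute[of n ?s])
  also have "\<dots> = (\<Sum>b<m. (d b)\<^sup>2)" using inner_orthonormal_combination[OF assms] by (simp add: power2_eq_square)
  finally show ?thesis .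
qed

definition proj_resid :: "nat \<Rightarrow> nat \<Rightarrow> (nat \<Rightarrow> nat \<Rightarrow> real) \<Rightarrow> (nat \<Rightarrow> real) \<Rightarrow> real"
  where "proj_resid n m u y = (\<Sum>i<n. (y i)\<^sup>2) - (\<Sum>b<m. (inner_n n (u b) y)\<^sup>2)"

lemma sum_sq_diff_orthonormal_combination:
  assumes u: "orthonormal_n n m u"
  shows "(\<Sum>i<n. (y i - (\<Sum>b<m. d b * u b i))\<^sup>2) = proj_resid n m u y + (\<Sum>b<m. (inner_n n (u b) y - d b)\<^sup>2)"
proof -
  let ?s = "\<lambda>i. \<Sum>b<m. d b * u b i"
  have "(\<Sum>i<n. (y i - ?s i)\<^sup>2) = (\<Sum>i<n. (y i)\<^sup>2) - 2 * inner_n n y ?s + (\<Sum>i<n. (?s i)\<^sup>2)"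
    unfolding inner_n_def power2_diff sum_distrib_left
    by (simp only: sum.distrib sum_subtractf mult.assoc)
  also have "\<dots> = (\<Sum>i<n. (y i)\<^sup>2) - 2 * (\<Sum>b<m. d b * inner_n n (u b) y) + (\<Sum>b<m. (d b)\<^sup>2)"
    unfolding sum_sq_orthonormal_combination[OF u] inner_n_sum_right by (simp add: inner_n_commute[of n y])
  also have "(\<Sum>b<m. (inner_n n (u b) y - d b)\<^sup>2)
    = (\<Sum>b<m. (inner_n n (u b) y)\<^sup>2) - 2 * (\<Sum>b<m. d b * inner_n n (u b) y) + (\<Sum>b<m. (d b)\<^sup>2)"
    unfolding power2_diff sum_distrib_left by (simp add: sum.distrib sum_subtractf mult_ac)
  ultimately show ?thesis by (simp add: proj_resid_def)
qed

lemma proj_resid_le: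
  assumes "orthonormal_n n m u"
  shows "proj_resid n m u y \<le> (\<Sum>i<n. (y i - (\<Sum>b<m. d b * u b i))\<^sup>2)"
  unfolding sum_sq_diff_orthonormal_combination[OF assms] by (simp add: sum_nonneg)

lemma proj_resid_eq:
  assumes "orthonormal_n n m u"
  shows "proj_resid n m u y = (\<Sum>i<n. (y i - (\<Sum>b<m. inner_n n (u b) y * u b i))\<^sup>2)"
  unfolding sum_sq_diff_orthonormal_combination[OF assms] by simp

definition in_span_n :: "nat \<Rightarrow> nat \<Rightarrow> (nat \<Rightarrow> nat \<Rightarrow> real) \<Rightarrow> (nat \<Rightarrow> real) \<Rightarrow> bool"
  where "in_span_n n m u y \<longleftrightarrow> (\<exists>d. \<forall>i<n. y i = (\<Sum>b<m. d b * u b i))"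

lemma in_span_n_Suc:
  assumes "in_span_n n m u y"
  shows "in_span_n n (Suc m) (u(m := w)) y"
proof -
  obtain d where "\<forall>i<n. y i = (\<Sum>b<m. d b * u b i)" using assms by (auto simp: in_span_n_def)
  then have "\<forall>i<n. y i = (\<Sum>b<Suc m. (d(m := 0)) b * (u(m := w)) b i)" by simp
  then show ?thesis unfolding in_span_n_def by (rule exI[where x = "d(m := 0)"])
qed

lemma orthonormal_n_extend:
  assumes "orthonormal_n n m u" "w \<in> space (gauss n)" "inner_n n w w = 1"
    and orthogonal: "\<And>b. b < m \<Longrightarrow> inner_n n (u b) w = 0"
  shows "orthonormal_n n (Suc m) (u(m := w))"
proof -
  have "inner_n n w (u b) = 0" if "b < m" for b
    using orthogonal[OF that] by (simp only: inner_n_commute[of n w])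
  then show ?thesis using assms by (auto simp: orthonormal_n_def less_Suc_eq)
qed

lemma gram_schmidt_step:
  assumes u: "orthonormal_n n m u"
  shows "\<exists>m'\<le>Suc m. \<exists>u'. orthonormal_n n m' u' \<and> in_span_n n m' u' y \<and> (\<forall>z. in_span_n n m u z \<longrightarrow> in_span_n n m' u' z)"
proof -
  let ?p = "\<lambda>i. \<Sum>b<m. inner_n n (u b) y * u b i"
  define r where "r = (\<lambda>i. y i - ?p i)"
  let ?c = "norm_n n r"
  show ?thesis
  proof (cases "?c = 0")
    case True
    then have "\<forall>i<n. y i = ?p i" by (simp add: norm_n_eq_0_iff r_def)
    then have "in_span_n n m u y" unfolding in_span_n_def by (rule exI[of _ "\<lambda>b. inner_n n (u b) y"])
    then show ?thesis using u by (intro exI[of _ m] conjI exI[of _ u]) auto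
  next
    case False
    then have c: "?c > 0" using norm_n_nonneg[of n r] by linarith
    define w where "w = (\<lambda>i\<in>{..<n}. r i / ?c)"
    have inner_w: "inner_n n x w = inner_n n x r / ?c" for x by (simp add: inner_n_def w_def sum_divide_distrib)
    have "inner_n n w w = inner_n n r r / ?c / ?c" by (simp add: inner_w inner_n_commute[of n w])
    then have w_unit: "inner_n n w w = 1" using c by (simp add: inner_n_self power2_eq_square)
    have "inner_n n (u b) w = 0" if "b < m" for b
      using inner_orthonormal_combination[OF u that, of "\<lambda>b. inner_n n (u b) y"]
      by (simp add: inner_w r_def inner_n_diff_right)
    then have "orthonormal_n n (Suc m) (u(m := w))"
      by (intro orthonormal_n_extend u w_unit) (simp_all add: w_def space_gauss)
    moreover have "\<forall>i<n. y i = (\<Sum>b<Suc m. ((\<lambda>b. inner_n n (u b) y)(m := ?c)) b * (u(m := w)) b i)"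
      using c by (simp add: w_def r_def)
    then have "in_span_n n (Suc m) (u(m := w)) y"
      unfolding in_span_n_def by (rule exI[where x = "(\<lambda>b. inner_n n (u b) y)(m := ?c)"])
    ultimately show ?thesis using in_span_n_Suc by blast
  qed
qed

lemma gram_schmidt_n:
  "\<exists>m\<le>k. \<exists>u. orthonormal_n n m u \<and> (\<forall>a<k. in_span_n n m u (y a))"
proof (induction k)
  case 0
  show ?case by (auto simp: orthonormal_n_def)
next
  case (Suc k)
  then obtain m u where "m \<le> k" "orthonormal_n n m u" "\<forall>a<k. in_span_n n m u (y a)" by blast
  then show ?case using gram_schmidt_step[of n m u "y k"]
    by (metis Suc_le_mono less_Suc_eq order_trans)
qed

section \<open>Linear isometries of Gaussian space\<close>

definition gauss_isom :: "nat \<Rightarrow> ((nat \<Rightarrow> real) \<Rightarrow> (nat \<Rightarrow> real)) \<Rightarrow> ((nat \<Rightarrow> real) \<Rightarrow> (nat \<Rightarrow> real)) \<Rightarrow> bool"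
  where "gauss_isom n T T' \<longleftrightarrow>
    T \<in> measurable (gauss n) (gauss n) \<and> T' \<in> measurable (gauss n) (gauss n) \<and>
    distr (gauss n) (gauss n) T = gauss n \<and> distr (gauss n) (gauss n) T' = gauss n \<and>
    (\<forall>x\<in>space (gauss n). T' (T x) = x \<and> T (T' x) = x) \<and>
    (\<forall>x\<in>space (gauss n). \<forall>y\<in>space (gauss n). inner_n n (T x) (T y) = inner_n n x y) \<and>
    (\<forall>x\<in>space (gauss n). \<forall>y\<in>space (gauss n). \<forall>a b. T (lincomb n a b x y) = lincomb n a b (T x) (T y))"

lemma gauss_isomD:
  assumes "gauss_isom n T T'"
  shows gauss_isom_measurable: "T \<in> measurable (gauss n) (gauss n)"
    and gauss_isom_distr: "distr (gauss n) (gauss n) T = gauss n"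
    and gauss_isom_left_inverse: "x \<in> space (gauss n) \<Longrightarrow> T' (T x) = x"
    and gauss_isom_right_inverse: "x \<in> space (gauss n) \<Longrightarrow> T (T' x) = x"
    and gauss_isom_in_space: "x \<in> space (gauss n) \<Longrightarrow> T x \<in> space (gauss n)"
    and gauss_isom_inner: "x \<in> space (gauss n) \<Longrightarrow> y \<in> space (gauss n) \<Longrightarrow> inner_n n (T x) (T y) = inner_n n x y"
    and gauss_isom_lincomb: "x \<in> space (gauss n) \<Longrightarrow> y \<in> space (gauss n) \<Longrightarrow>
      T (lincomb n a b x y) = lincomb n a b (T x) (T y)"
  using assms unfolding gauss_isom_def by (auto intro: measurable_space)

lemma gauss_isom_id: "gauss_isom n (\<lambda>x. x) (\<lambda>x. x)"
  by (auto simp: gauss_isom_def distr_id2)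

lemma gauss_isom_sym:
  assumes T: "gauss_isom n T T'" shows "gauss_isom n T' T"
proof -
  have T'_in: "T' x \<in> space (gauss n)" if "x \<in> space (gauss n)" for x
    using T that unfolding gauss_isom_def by (auto intro: measurable_space)
  have "inner_n n (T' x) (T' y) = inner_n n x y" if "x \<in> space (gauss n)" "y \<in> space (gauss n)" for x y
    using gauss_isom_inner[OF T, of "T' x" "T' y"] that gauss_isom_right_inverse[OF T] T'_in by simp
  moreover have "T' (lincomb n a b x y) = lincomb n a b (T' x) (T' y)"
    if "x \<in> space (gauss n)" "y \<in> space (gauss n)" for x y a b
    using gauss_isom_lincomb[OF T, of "T' x" "T' y" a b] that T'_in
      gauss_isom_left_inverse[OF T] gauss_isom_right_inverse[OF T] by (metis mix_in_space)
  ultimately show ?thesis using T unfolding gauss_isom_def by auto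
qed

lemma gauss_isom_comp:
  assumes S: "gauss_isom n S S'" and T: "gauss_isom n T T'"
  shows "gauss_isom n (\<lambda>x. S (T x)) (\<lambda>x. T' (S' x))"
proof -
  note S' = gauss_isom_sym[OF S] and T' = gauss_isom_sym[OF T]
  note [measurable] = gauss_isom_measurable[OF S] gauss_isom_measurable[OF S']
    gauss_isom_measurable[OF T] gauss_isom_measurable[OF T']
  have "distr (gauss n) (gauss n) (\<lambda>x. S (T x)) = gauss n"
    using distr_distr[of S "gauss n" "gauss n" T "gauss n"]
    by (simp add: comp_def gauss_isom_distr[OF S] gauss_isom_distr[OF T])
  moreover have "distr (gauss n) (gauss n) (\<lambda>x. T' (S' x)) = gauss n"
    using distr_distr[of T' "gauss n" "gauss n" S' "gauss n"]
    by (simp add: comp_def gauss_isom_distr[OF S'] gauss_isom_distr[OF T'])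
  ultimately show ?thesis
    using S T gauss_isom_in_space[OF S] gauss_isom_in_space[OF S'] gauss_isom_in_space[OF T] gauss_isom_in_space[OF T']
    unfolding gauss_isom_def by auto
qed

lemma dist_n_isom:
  assumes T: "gauss_isom n T T'" and xy: "x \<in> space (gauss n)" "y \<in> space (gauss n)"
  shows "dist_n n (T x) (T y) = dist_n n x y"
proof -
  have "(dist_n n (T x) (T y))\<^sup>2 = (dist_n n x y)\<^sup>2"
    unfolding dist_n_sq using gauss_isom_inner[OF T] xy by simp
  then show ?thesis by (simp add: power2_eq_iff_nonneg)
qed

lemma integral_isom:
  fixes F :: "_ \<Rightarrow> real"
  assumes T: "gauss_isom n T T'" and [measurable]: "F \<in> borel_measurable (gauss n)"
  shows "(\<integral>x. F (T x) \<partial>gauss n) = (\<integral>x. F x \<partial>gauss n)"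
  using integral_distr[OF gauss_isom_measurable[OF T], of F] gauss_isom_distr[OF T] by simp

lemma integral_pair_isom:
  fixes F :: "_ \<Rightarrow> real"
  assumes T: "gauss_isom n T T'" and [measurable]: "F \<in> borel_measurable (gauss_pair n)"
  shows "(\<integral>p. F (T (fst p), T (snd p)) \<partial>gauss_pair n) = (\<integral>p. F p \<partial>gauss_pair n)"
proof -
  note [measurable] = gauss_isom_measurable[OF T]
  have "distr (gauss_pair n) (gauss_pair n) (\<lambda>(x, y). (T x, T y)) = gauss_pair n"
    using pair_measure_distr[of T "gauss n" "gauss n" T "gauss n" "gauss n"] gauss_isom_distr[OF T]
    by (simp add: gauss.sigma_finite_measure_axioms)
  then show ?thesis
    using integral_distr[of "\<lambda>(x, y). (T x, T y)" "gauss_pair n" "gauss_pair n" F]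
    by (simp add: case_prod_beta)
qed

lemma inner_n_split2:
  assumes "i < n" "j < n" "i \<noteq> j"
  shows "inner_n n x y = x i * y i + x j * y j + (\<Sum>t\<in>{..<n} - {i, j}. x t * y t)"
proof -
  have "{..<n} = insert i (insert j ({..<n} - {i, j}))" using assms by auto
  then have "inner_n n x y = (\<Sum>t\<in>insert i (insert j ({..<n} - {i, j})). x t * y t)"
    by (simp add: inner_n_def)
  then show ?thesis using assms by simp
qed

lemma gauss_isom_givens:
  assumes ij: "i < n" "j < n" "i \<noteq> j" and cs: "c\<^sup>2 + s\<^sup>2 = 1"
  shows "gauss_isom n (givens i j c s) (givens i j c (- s))"
proof -
  have inverse: "givens i j c (- t) (givens i j c t x) = x" if "c\<^sup>2 + t\<^sup>2 = 1" for t x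
  proof -
    have "c * (c * a + t * b) - t * (- t * a + c * b) = (c\<^sup>2 + t\<^sup>2) * a"
      "t * (c * a + t * b) + c * (- t * a + c * b) = (c\<^sup>2 + t\<^sup>2) * b" for a b
      by (simp_all add: algebra_simps power2_eq_square)
    from this[of "x i" "x j"] show ?thesis
      using ij that by (auto simp: givens_def fun_eq_iff)
  qed
  have inner: "inner_n n (givens i j c s x) (givens i j c s y) = inner_n n x y" for x y
  proof -
    have plane: "(c * a + s * b) * (c * a' + s * b') + (- s * a + c * b) * (- s * a' + c * b')
        = (c\<^sup>2 + s\<^sup>2) * (a * a' + b * b')" for a b a' b'
      by (simp add: algebra_simps power2_eq_square)
    have "(\<Sum>t\<in>{..<n} - {i, j}. givens i j c s x t * givens i j c s y t) = (\<Sum>t\<in>{..<n} - {i, j}. x t * y t)"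
      by (rule sum.cong) (auto simp: givens_def)
    then show ?thesis
      using plane[of "x i" "x j" "y i" "y j"] ij cs unfolding inner_n_split2[OF ij] by (simp add: givens_def)
  qed
  have linear: "givens i j c s (lincomb n a b x y) = lincomb n a b (givens i j c s x) (givens i j c s y)" for a b x y
    using ij by (auto simp: givens_def mix_def fun_eq_iff algebra_simps)
  show ?thesis
    unfolding gauss_isom_def
    using ij cs inverse[of s] inverse[of "- s"] inner linear distr_givens[OF ij] by auto
qed

lemma distr_gauss1_uminus: "distr gauss1 gauss1 uminus = gauss1"
proof (rule distr_eqI_nn_integral)
  fix F :: "real \<Rightarrow> ennreal" assume "F \<in> borel_measurable gauss1"
  then have [measurable]: "F \<in> borel_measurable borel" by simp
  have "(\<integral>\<^sup>+x. F (- x) \<partial>gauss1) = (\<integral>\<^sup>+x. ennreal (std_normal_density x) * F (- x) \<partial>lborel)"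
    by (simp add: gauss1_def nn_integral_density)
  also have "\<dots> = (\<integral>\<^sup>+x. ennreal (std_normal_density x) * F x \<partial>lborel)"
    using nn_integral_real_affine[of "\<lambda>x. ennreal (std_normal_density x) * F (- x)" "-1" 0]
    by (simp add: std_normal_density_def)
  also have "\<dots> = (\<integral>\<^sup>+x. F x \<partial>gauss1)" by (simp add: gauss1_def nn_integral_density)
  finally show "(\<integral>\<^sup>+x. F (- x) \<partial>gauss1) = (\<integral>\<^sup>+x. F x \<partial>gauss1)" .
qed simp

definition flip_coord :: "nat \<Rightarrow> (nat \<Rightarrow> real) \<Rightarrow> nat \<Rightarrow> real"
  where "flip_coord j x = x(j := - x j)"

lemma gauss_isom_flip_coord:
  assumes j: "j < n"
  shows "gauss_isom n (flip_coord j) (flip_coord j)"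
proof -
  let ?f = "\<lambda>i. if i = j then uminus else (\<lambda>t. t) :: real \<Rightarrow> real"
  have meas: "flip_coord j \<in> measurable (gauss n) (gauss n)"
    unfolding flip_coord_def using j by (intro measurable_fun_upd_gauss) auto
  have "distr (gauss n) (gauss n) (flip_coord j) = distr (gauss n) (gauss n) (\<lambda>x. \<lambda>i\<in>{..<n}. ?f i (x i))"
    using j by (intro distr_cong) (auto simp: flip_coord_def space_gauss fun_eq_iff extensional_def)
  also have "\<dots> = PiM {..<n} (\<lambda>i. distr gauss1 gauss1 (?f i))"
    unfolding gauss_def by (rule distr_PiM_componentwise) (auto simp: prob_space_gauss1)
  also have "\<dots> = gauss n"
    unfolding gauss_def by (intro PiM_cong) (auto simp: distr_gauss1_uminus distr_id2)
  finally have distr: "distr (gauss n) (gauss n) (flip_coord j) = gauss n" .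
  have "inner_n n (flip_coord j x) (flip_coord j y) = inner_n n x y" for x y
    unfolding inner_n_def by (intro sum.cong) (auto simp: flip_coord_def)
  then show ?thesis
    unfolding gauss_isom_def using meas distr j by (auto simp: flip_coord_def mix_def fun_eq_iff)
qed

lemma gauss_isom_zero_above:
  assumes p: "p < n" and "q \<le> n"
  shows "\<exists>T T'. gauss_isom n T T' \<and> (\<forall>x\<in>space (gauss n). \<forall>b<p. T x b = x b) \<and> (\<forall>t. p < t \<longrightarrow> t < q \<longrightarrow> T y t = 0)"
  using \<open>q \<le> n\<close>
proof (induction q)
  case 0
  then show ?case using gauss_isom_id by fastforce
next
  case (Suc q)
  then obtain T T' where T: "gauss_isom n T T'" and fixed: "\<And>x b. x \<in> space (gauss n) \<Longrightarrow> b < p \<Longrightarrow> T x b = x b"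
    and zero: "\<And>t. p < t \<Longrightarrow> t < q \<Longrightarrow> T y t = 0" by auto
  show ?case
  proof (cases "q \<le> p \<or> T y q = 0")
    case True
    then show ?thesis using T fixed zero by (metis less_SucE not_less)
  next
    case False
    define r where "r = sqrt ((T y p)\<^sup>2 + (T y q)\<^sup>2)"
    have r: "r > 0" "r\<^sup>2 = (T y p)\<^sup>2 + (T y q)\<^sup>2" using False by (simp_all add: r_def sum_power2_gt_zero_iff)
    let ?c = "T y p / r" and ?s = "T y q / r"
    have "?c\<^sup>2 + ?s\<^sup>2 = ((T y p)\<^sup>2 + (T y q)\<^sup>2) / r\<^sup>2"
      by (simp add: power_divide add_divide_distrib)
    then have cs: "?c\<^sup>2 + ?s\<^sup>2 = 1" using r(1) r(2)[symmetric] by simp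
    have G: "gauss_isom n (givens p q ?c ?s) (givens p q ?c (- ?s))"
      by (rule gauss_isom_givens) (use False p Suc.prems cs in auto)
    have "\<forall>x\<in>space (gauss n). \<forall>b<p. givens p q ?c ?s (T x) b = x b"
      using fixed False by (auto simp: givens_def)
    moreover have "givens p q ?c ?s (T y) t = 0" if "p < t" "t < Suc q" for t
      using zero[of t] that r by (cases "t = q") (auto simp: givens_def)
    ultimately show ?thesis using gauss_isom_comp[OF G T] by blast
  qed
qed

lemma gauss_isom_unit_to_axis:
  assumes y: "y \<in> space (gauss n)" "inner_n n y y = 1" and zero: "\<And>b. b < p \<Longrightarrow> y b = 0" and p: "p < n"
  shows "\<exists>T T'. gauss_isom n T T' \<and> (\<forall>x\<in>space (gauss n). \<forall>b<p. T x b = x b) \<and> (\<forall>v. inner_n n (T y) v = v p)"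
proof -
  obtain S S' where S: "gauss_isom n S S'" and fixed: "\<And>x b. x \<in> space (gauss n) \<Longrightarrow> b < p \<Longrightarrow> S x b = x b"
    and above: "\<And>t. p < t \<Longrightarrow> t < n \<Longrightarrow> S y t = 0"
    using gauss_isom_zero_above[OF p order_refl, of y] by auto
  have inner_S: "inner_n n (S y) v = S y p * v p" for v
  proof -
    have "inner_n n (S y) v = (\<Sum>t<n. if t = p then S y p * v p else 0)"
      unfolding inner_n_def
    proof (rule sum.cong)
      fix t assume "t \<in> {..<n}"
      then show "S y t * v t = (if t = p then S y p * v p else 0)"
        using fixed[OF y(1), of t] zero[of t] above[of t] by (cases t p rule: linorder_cases) auto
    qed simp
    then show ?thesis using p by simp
  qed
  have "inner_n n (S y) (S y) = 1" using gauss_isom_inner[OF S y(1) y(1)] y(2) by simp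
  then have "(S y p)\<^sup>2 = 1" by (simp add: inner_S power2_eq_square)
  then consider (fixed_axis) "S y p = 1" | (flipped_axis) "S y p = - 1" by (auto simp: power2_eq_1_iff)
  then show ?thesis
  proof cases
    case fixed_axis
    then show ?thesis using S fixed inner_S by (metis mult_1)
  next
    case flipped_axis
    have F: "gauss_isom n (flip_coord p) (flip_coord p)" by (rule gauss_isom_flip_coord[OF p])
    have "inner_n n (flip_coord p (S y)) v = v p" for v
    proof -
      have "inner_n n (flip_coord p (S y)) v = inner_n n (S y) (flip_coord p v)"
        unfolding inner_n_def by (intro sum.cong) (auto simp: flip_coord_def)
      then show ?thesis using inner_S flipped_axis by (simp add: flip_coord_def)
    qed
    moreover have "flip_coord p (S x) b = x b" if "x \<in> space (gauss n)" "b < p" for x b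
      using fixed[OF that] that(2) by (simp add: flip_coord_def)
    ultimately show ?thesis using gauss_isom_comp[OF F S] by blast
  qed
qed

lemma gauss_isom_orthonormal:
  assumes "orthonormal_n n m u"
  shows "m \<le> n \<and> (\<exists>T T'. gauss_isom n T T' \<and> (\<forall>b<m. \<forall>x\<in>space (gauss n). inner_n n (u b) x = T x b))"
  using assms
proof (induction m)
  case 0
  then show ?case using gauss_isom_id by auto
next
  case (Suc m)
  then have "orthonormal_n n m u" by (auto intro: orthonormal_n_antimono)
  from Suc.IH[OF this] obtain T T' where T: "gauss_isom n T T'"
    and coord: "\<And>b x. b < m \<Longrightarrow> x \<in> space (gauss n) \<Longrightarrow> inner_n n (u b) x = T x b" by blast
  have new_vec: "u m \<in> space (gauss n)" "inner_n n (u m) (u m) = 1" using orthonormal_nD[OF Suc.prems] by auto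
  define y where "y = T (u m)"
  have y: "y \<in> space (gauss n)" unfolding y_def by (rule gauss_isom_in_space[OF T new_vec(1)])
  have y_unit: "inner_n n y y = 1" unfolding y_def using gauss_isom_inner[OF T new_vec(1) new_vec(1)] new_vec(2) by simp
  have zero: "y b = 0" if "b < m" for b
    unfolding y_def coord[OF that new_vec(1), symmetric] using that by (intro orthonormal_nD(3)[OF Suc.prems]) auto
  have m: "m < n"
  proof (rule ccontr)
    assume "\<not> m < n"
    then have "inner_n n y y = 0" unfolding inner_n_def using zero by (intro sum.neutral) auto
    with y_unit show False by simp
  qed
  obtain S S' where S: "gauss_isom n S S'" and fixed: "\<And>x b. x \<in> space (gauss n) \<Longrightarrow> b < m \<Longrightarrow> S x b = x b"
    and axis: "\<And>v. inner_n n (S y) v = v m"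
    using gauss_isom_unit_to_axis[OF y y_unit zero m] by blast
  have "inner_n n (u b) x = S (T x) b" if "b < Suc m" and x: "x \<in> space (gauss n)" for b x
  proof (cases "b = m")
    case True
    have "inner_n n (u m) x = inner_n n (S y) (S (T x))"
      using gauss_isom_inner[OF S y gauss_isom_in_space[OF T x]] gauss_isom_inner[OF T new_vec(1) x] by (simp add: y_def)
    then show ?thesis by (simp add: axis True)
  next
    case False
    then show ?thesis using coord[of b x] fixed[OF gauss_isom_in_space[OF T x], of b] that by simp
  qed
  then show ?case using m gauss_isom_comp[OF S T] by (metis Suc_leI)
qed

section \<open>Moments and exponential tilts\<close>

lemma (in prob_space) integrable_bounded:
  fixes f :: "'a \<Rightarrow> real"
  assumes "f \<in> borel_measurable M" "\<And>x. x \<in> space M \<Longrightarrow> \<bar>f x\<bar> \<le> B"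
  shows "integrable M f"
  by (rule integrable_const_bound[of _ B]) (use assms in auto)

lemma (in prob_space) has_bochner_integral_constant: "has_bochner_integral M (\<lambda>_. c :: real) c"
  using prob_space by (auto simp: has_bochner_integral_iff)

lemma (in prob_space) expectation_abs_le_sqrt:
  fixes X :: "'a \<Rightarrow> real"
  assumes [measurable]: "X \<in> borel_measurable M" and X_sq: "integrable M (\<lambda>x. (X x)\<^sup>2)"
  shows "integrable M X" "(\<integral>x. \<bar>X x\<bar> \<partial>M) \<le> sqrt (\<integral>x. (X x)\<^sup>2 \<partial>M)"
proof -
  have "\<bar>X x\<bar> \<le> 1 + (X x)\<^sup>2" for x
    using zero_le_power2[of "\<bar>X x\<bar> - 1"] by (simp add: power2_diff)
  then show i: "integrable M X"
    by (intro Bochner_Integration.integrable_bound[of M "\<lambda>x. 1 + (X x)\<^sup>2" X] Bochner_Integration.integrable_add X_sq) auto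
  have "0 \<le> variance (\<lambda>x. \<bar>X x\<bar>)" by (rule variance_positive)
  also have "\<dots> = expectation (\<lambda>x. \<bar>X x\<bar>\<^sup>2) - (expectation (\<lambda>x. \<bar>X x\<bar>))\<^sup>2"
    by (rule variance_eq) (use i X_sq in auto)
  finally show "(\<integral>x. \<bar>X x\<bar> \<partial>M) \<le> sqrt (\<integral>x. (X x)\<^sup>2 \<partial>M)"
    by (intro real_le_rsqrt) simp
qed

lemma integral_inner_n_mult:
  assumes "\<And>i. i < n \<Longrightarrow> integrable M (\<lambda>z. h z i * \<phi> z)"
  shows "integrable M (\<lambda>z. inner_n n v (h z) * \<phi> z)"
    "(\<integral>z. inner_n n v (h z) * \<phi> z \<partial>M) = inner_n n v (\<lambda>i. \<integral>z. h z i * \<phi> z \<partial>M)"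
proof -
  have expand: "(\<lambda>z. inner_n n v (h z) * \<phi> z) = (\<lambda>z. \<Sum>i<n. v i * (h z i * \<phi> z))"
    by (simp add: inner_n_def sum_distrib_right mult.assoc)
  show "integrable M (\<lambda>z. inner_n n v (h z) * \<phi> z)"
    unfolding expand by (intro Bochner_Integration.integrable_sum integrable_mult_right assms) auto
  have "(\<integral>z. inner_n n v (h z) * \<phi> z \<partial>M) = (\<Sum>i<n. \<integral>z. v i * (h z i * \<phi> z) \<partial>M)"
    unfolding expand by (intro Bochner_Integration.integral_sum integrable_mult_right assms) simp
  then show "(\<integral>z. inner_n n v (h z) * \<phi> z \<partial>M) = inner_n n v (\<lambda>i. \<integral>z. h z i * \<phi> z \<partial>M)"
    by (simp add: inner_n_def)
qed

lemma has_bochner_integral_gauss1_iff: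
  fixes g :: "real \<Rightarrow> real"
  assumes [measurable]: "g \<in> borel_measurable borel"
  shows "has_bochner_integral gauss1 g c \<longleftrightarrow> has_bochner_integral lborel (\<lambda>t. std_normal_density t * g t) c"
  unfolding gauss1_def has_bochner_integral_iff
  by (subst integrable_density, simp, simp, simp, subst integral_density, simp_all)

lemma gauss1_moments:
  shows gauss1_mean: "has_bochner_integral gauss1 (\<lambda>t. t) 0"
    and gauss1_second_moment: "has_bochner_integral gauss1 (\<lambda>t. t\<^sup>2) 1"
    and gauss1_fourth_moment: "has_bochner_integral gauss1 (\<lambda>t. t ^ 4) 3"
    and gauss1_abs_moment: "has_bochner_integral gauss1 (\<lambda>t. \<bar>t\<bar>) (sqrt (2 / pi))"
proof -
  show "has_bochner_integral gauss1 (\<lambda>t. t) 0"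
    using std_normal_moment_odd[of 0] by (simp add: has_bochner_integral_gauss1_iff)
  show "has_bochner_integral gauss1 (\<lambda>t. t\<^sup>2) 1"
    using std_normal_moment_even[of 1] by (simp add: has_bochner_integral_gauss1_iff)
  show "has_bochner_integral gauss1 (\<lambda>t. t ^ 4) 3"
    using std_normal_moment_even[of 2] by (simp add: has_bochner_integral_gauss1_iff fact_numeral)
  show "has_bochner_integral gauss1 (\<lambda>t. \<bar>t\<bar>) (sqrt (2 / pi))"
    using std_normal_moment_abs_odd[of 0] by (simp add: has_bochner_integral_gauss1_iff)
qed

lemma sqrt_2_pi_bounds:
  "1 / 2 \<le> sqrt (2 / pi)" "sqrt (2 / pi) \<le> 1" "pi / 2 * sqrt (2 / pi) \<le> 3 / 2"
proof -
  show "1 / 2 \<le> sqrt (2 / pi)"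
    using pi_less_4 pi_gt_zero by (intro real_le_rsqrt) (simp add: power2_eq_square field_simps)
  show "sqrt (2 / pi) \<le> 1" using pi_gt3 by simp
  have "(pi / 2 * sqrt (2 / pi))\<^sup>2 = pi / 2" unfolding power_mult_distrib by (simp add: power2_eq_square)
  also have "\<dots> \<le> (3 / 2)\<^sup>2" using pi_less_4 by (simp add: power2_eq_square)
  finally show "pi / 2 * sqrt (2 / pi) \<le> 3 / 2" by (rule power2_le_imp_le) simp
qed

lemma distr_gauss_component: "i < n \<Longrightarrow> distr (gauss n) gauss1 (\<lambda>x. x i) = gauss1"
  unfolding gauss_def using distr_PiM_component[of "{..<n}" "\<lambda>_. gauss1" i] prob_space_gauss1 by simp

lemma measurable_gauss_coord: "i < n \<Longrightarrow> (\<lambda>x. x i) \<in> borel_measurable (gauss n)"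
  by (rule measurable_gauss_component[of "\<lambda>x. x"]) auto

lemma has_bochner_integral_gauss_component_iff:
  fixes \<phi> :: "real \<Rightarrow> real"
  assumes i: "i < n" and [measurable]: "\<phi> \<in> borel_measurable borel"
  shows "has_bochner_integral (gauss n) (\<lambda>z. \<phi> (z i)) c \<longleftrightarrow> has_bochner_integral gauss1 \<phi> c"
proof -
  have [measurable]: "(\<lambda>x. x i) \<in> measurable (gauss n) gauss1" using measurable_gauss_coord[OF i] by simp
  show ?thesis
    unfolding has_bochner_integral_iff
    using integrable_distr_eq[of "\<lambda>x. x i" "gauss n" gauss1 \<phi>] integral_distr[of "\<lambda>x. x i" "gauss n" gauss1 \<phi>]
    by (simp add: distr_gauss_component i)
qed

lemma gauss_component_moments:
  assumes "i < n"
  shows gauss_component_mean: "has_bochner_integral (gauss n) (\<lambda>z. z i) 0"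
    and gauss_component_second_moment: "has_bochner_integral (gauss n) (\<lambda>z. (z i)\<^sup>2) 1"
    and gauss_component_abs_moment: "has_bochner_integral (gauss n) (\<lambda>z. \<bar>z i\<bar>) (sqrt (2 / pi))"
proof -
  have "(\<lambda>t::real. t) \<in> borel_measurable borel" "(\<lambda>t::real. t\<^sup>2) \<in> borel_measurable borel"
    "(\<lambda>t::real. \<bar>t\<bar>) \<in> borel_measurable borel" by measurable
  note iff = this[THEN has_bochner_integral_gauss_component_iff[OF assms]]
  show "has_bochner_integral (gauss n) (\<lambda>z. z i) 0" unfolding iff(1) by (rule gauss1_mean)
  show "has_bochner_integral (gauss n) (\<lambda>z. (z i)\<^sup>2) 1" unfolding iff(2) by (rule gauss1_second_moment)
  show "has_bochner_integral (gauss n) (\<lambda>z. \<bar>z i\<bar>) (sqrt (2 / pi))" unfolding iff(3) by (rule gauss1_abs_moment)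
qed

lemma integrable_gauss_component [simp]:
  "i < n \<Longrightarrow> integrable (gauss n) (\<lambda>z. z i)" "i < n \<Longrightarrow> integrable (gauss n) (\<lambda>z. (z i)\<^sup>2)"
  "i < n \<Longrightarrow> integrable (gauss n) (\<lambda>z. \<bar>z i\<bar>)"
  using gauss_component_moments[of i n] unfolding has_bochner_integral_iff by blast+

lemma measurable_inner_n [measurable (raw)]:
  "h \<in> measurable M (gauss n) \<Longrightarrow> (\<lambda>p. inner_n n v (h p)) \<in> borel_measurable M"
  unfolding inner_n_def
  by (intro borel_measurable_sum borel_measurable_times borel_measurable_const measurable_gauss_component) auto

lemma distr_inner_n_unit:
  assumes v: "v \<in> space (gauss n)" "inner_n n v v = 1"
  shows "distr (gauss n) gauss1 (inner_n n v) = gauss1"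
proof -
  have "orthonormal_n n 1 (\<lambda>_. v)" using v by (simp add: orthonormal_n_def)
  from gauss_isom_orthonormal[OF this] obtain T T' where n: "1 \<le> n" and T: "gauss_isom n T T'"
    and coord: "\<And>x. x \<in> space (gauss n) \<Longrightarrow> inner_n n v x = T x 0" by auto
  note [measurable] = gauss_isom_measurable[OF T]
  have [measurable]: "(\<lambda>x. x 0) \<in> borel_measurable (gauss n)" using n by (intro measurable_gauss_coord) simp
  have "distr (gauss n) gauss1 (inner_n n v) = distr (gauss n) gauss1 (\<lambda>x. T x 0)"
    by (intro distr_cong) (auto simp: coord)
  also have "\<dots> = distr (distr (gauss n) (gauss n) T) gauss1 (\<lambda>x. x 0)"
    by (subst distr_distr) (auto simp: comp_def)
  also have "\<dots> = gauss1" using n by (simp add: gauss_isom_distr[OF T] distr_gauss_component)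
  finally show ?thesis .
qed

lemma distr_inner_n:
  "distr (gauss n) borel (inner_n n v) = distr gauss1 borel (\<lambda>t. norm_n n v * t)"
proof (cases "norm_n n v = 0")
  case True
  then have "inner_n n v x = 0" for x by (simp add: norm_n_eq_0_iff inner_n_def)
  then have "distr (gauss n) borel (inner_n n v) = distr (gauss n) borel (\<lambda>_. 0)" by (intro distr_cong) auto
  also have "\<dots> = distr gauss1 borel (\<lambda>_. 0)" by (simp add: gauss.distr_const gauss1.distr_const)
  finally show ?thesis using True by simp
next
  case False
  let ?r = "norm_n n v"
  define u where "u = (\<lambda>i\<in>{..<n}. v i / ?r)"
  have inner_u: "inner_n n u x = inner_n n v x / ?r" for x by (simp add: u_def inner_n_def sum_divide_distrib)
  have u: "u \<in> space (gauss n)" by (simp add: u_def space_gauss)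
  have "inner_n n u u = inner_n n v v / ?r / ?r"
    by (simp add: inner_u inner_n_commute[of n v u])
  then have u_unit: "inner_n n u u = 1" using False by (simp add: inner_n_self power2_eq_square)
  have "distr (gauss n) borel (inner_n n v) = distr (gauss n) borel (\<lambda>x. ?r * inner_n n u x)"
    using False by (simp add: inner_u)
  also have "\<dots> = distr (distr (gauss n) gauss1 (inner_n n u)) borel (\<lambda>t. ?r * t)"
    by (subst distr_distr) (auto simp: comp_def)
  finally show ?thesis by (simp add: distr_inner_n_unit[OF u u_unit])
qed

lemma integral_inner_n:
  fixes \<phi> :: "real \<Rightarrow> real"
  assumes [measurable]: "\<phi> \<in> borel_measurable borel"
  shows "(\<integral>z. \<phi> (inner_n n v z) \<partial>gauss n) = (\<integral>t. \<phi> (norm_n n v * t) \<partial>gauss1)"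
    and "integrable (gauss n) (\<lambda>z. \<phi> (inner_n n v z)) \<longleftrightarrow> integrable gauss1 (\<lambda>t. \<phi> (norm_n n v * t))"
proof -
  have "(\<integral>z. \<phi> (inner_n n v z) \<partial>gauss n) = (\<integral>t. \<phi> t \<partial>(distr (gauss n) borel (inner_n n v)))"
    by (subst integral_distr) auto
  also have "\<dots> = (\<integral>t. \<phi> (norm_n n v * t) \<partial>gauss1)"
    unfolding distr_inner_n by (subst integral_distr) auto
  finally show "(\<integral>z. \<phi> (inner_n n v z) \<partial>gauss n) = (\<integral>t. \<phi> (norm_n n v * t) \<partial>gauss1)" .
  have "integrable (gauss n) (\<lambda>z. \<phi> (inner_n n v z)) \<longleftrightarrow> integrable (distr (gauss n) borel (inner_n n v)) \<phi>"
    by (subst integrable_distr_eq) auto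
  also have "\<dots> \<longleftrightarrow> integrable gauss1 (\<lambda>t. \<phi> (norm_n n v * t))"
    unfolding distr_inner_n by (subst integrable_distr_eq) auto
  finally show "integrable (gauss n) (\<lambda>z. \<phi> (inner_n n v z)) \<longleftrightarrow> integrable gauss1 (\<lambda>t. \<phi> (norm_n n v * t))" .
qed

lemma inner_n_abs_moment: "has_bochner_integral (gauss n) (\<lambda>z. \<bar>inner_n n v z\<bar>) (sqrt (2 / pi) * norm_n n v)"
  using gauss1_abs_moment[THEN has_bochner_integral_mult_right, of "norm_n n v"]
  by (auto simp: has_bochner_integral_iff integral_inner_n[of abs] abs_mult mult.commute)

lemma inner_n_second_moment: "has_bochner_integral (gauss n) (\<lambda>z. (inner_n n v z)\<^sup>2) ((norm_n n v)\<^sup>2)"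
  using gauss1_second_moment[THEN has_bochner_integral_mult_right, of "(norm_n n v)\<^sup>2"]
  by (auto simp: has_bochner_integral_iff integral_inner_n[of "\<lambda>t. t\<^sup>2"] power_mult_distrib)

lemma inner_n_fourth_moment: "has_bochner_integral (gauss n) (\<lambda>z. (inner_n n v z) ^ 4) (3 * (norm_n n v) ^ 4)"
  using gauss1_fourth_moment[THEN has_bochner_integral_mult_right, of "(norm_n n v) ^ 4"]
  by (auto simp: has_bochner_integral_iff integral_inner_n[of "\<lambda>t. t ^ 4"] power_mult_distrib mult.commute)

lemma gauss_bessel:
  fixes \<phi> :: "(nat \<Rightarrow> real) \<Rightarrow> real"
  assumes [measurable]: "\<phi> \<in> borel_measurable (gauss n)" and \<phi>2: "integrable (gauss n) (\<lambda>z. (\<phi> z)\<^sup>2)"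
  shows "(\<Sum>i<n. (\<integral>z. z i * \<phi> z \<partial>gauss n)\<^sup>2) \<le> (\<integral>z. (\<phi> z)\<^sup>2 \<partial>gauss n)"
proof -
  define p where "p i = (\<integral>z. z i * \<phi> z \<partial>gauss n)" for i
  have coeff: "integrable (gauss n) (\<lambda>z. z i * \<phi> z)" if "i < n" for i
  proof (rule Bochner_Integration.integrable_bound)
    show "integrable (gauss n) (\<lambda>z. (z i)\<^sup>2 + (\<phi> z)\<^sup>2)" using that \<phi>2 by auto
    show "(\<lambda>z. z i * \<phi> z) \<in> borel_measurable (gauss n)" using that by measurable
    have "\<bar>a * b\<bar> \<le> a\<^sup>2 + b\<^sup>2" for a b :: real
    proof -
      have "2 * (\<bar>a\<bar> * \<bar>b\<bar>) \<le> a\<^sup>2 + b\<^sup>2" using sum_squares_bound[of "\<bar>a\<bar>" "\<bar>b\<bar>"] by simp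
      moreover have "0 \<le> \<bar>a\<bar> * \<bar>b\<bar>" by simp
      ultimately show ?thesis unfolding abs_mult by linarith
    qed
    then show "AE z in gauss n. norm (z i * \<phi> z) \<le> norm ((z i)\<^sup>2 + (\<phi> z)\<^sup>2)" by simp
  qed
  have "(\<integral>z. inner_n n p z * \<phi> z \<partial>gauss n) = inner_n n p p"
    using integral_inner_n_mult(2)[of n "gauss n" "\<lambda>z. z" \<phi> p] coeff by (simp add: p_def[abs_def])
  then have cross: "(\<integral>z. inner_n n p z * \<phi> z \<partial>gauss n) = (norm_n n p)\<^sup>2" by (simp add: inner_n_self)
  note square = inner_n_second_moment[of n p, unfolded has_bochner_integral_iff]
  have "0 \<le> (\<integral>z. (\<phi> z - inner_n n p z)\<^sup>2 \<partial>gauss n)" by (rule Bochner_Integration.integral_nonneg) simp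
  also have "\<dots> = (\<integral>z. (\<phi> z)\<^sup>2 + (inner_n n p z)\<^sup>2 - 2 * (inner_n n p z * \<phi> z) \<partial>gauss n)"
    by (intro Bochner_Integration.integral_cong) (auto simp: power2_diff)
  also have "\<dots> = (\<integral>z. (\<phi> z)\<^sup>2 \<partial>gauss n) + (norm_n n p)\<^sup>2 - 2 * (norm_n n p)\<^sup>2"
    using \<phi>2 square cross integral_inner_n_mult(1)[of n "gauss n" "\<lambda>z. z" \<phi> p] coeff by simp
  finally show ?thesis by (simp add: norm_n_sq p_def)
qed

lemma distr_gauss1_shift:
  "distr gauss1 gauss1 (\<lambda>t. t + r) = density gauss1 (\<lambda>t. ennreal (exp (r * t - r\<^sup>2 / 2)))"
proof (rule measure_eqI)
  fix A assume "A \<in> sets (distr gauss1 gauss1 (\<lambda>t. t + r))"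
  then have [measurable]: "A \<in> sets borel" by simp
  have ratio: "std_normal_density t * exp (r * t - r\<^sup>2 / 2) = std_normal_density (- r + t)" for t
    by (simp add: std_normal_density_def exp_add[symmetric] power2_eq_square field_simps)
  have "emeasure (distr gauss1 gauss1 (\<lambda>t. t + r)) A = (\<integral>\<^sup>+t. indicator A (t + r) \<partial>gauss1)"
    using nn_integral_distr[of "\<lambda>t. t + r" gauss1 gauss1 "indicator A"] by simp
  also have "\<dots> = (\<integral>\<^sup>+t. ennreal (std_normal_density t) * indicator A (t + r) \<partial>lborel)"
    by (simp add: gauss1_def nn_integral_density)
  also have "\<dots> = (\<integral>\<^sup>+t. ennreal (std_normal_density (- r + t)) * indicator A t \<partial>lborel)"
    using nn_integral_real_affine[of "\<lambda>t. ennreal (std_normal_density t) * indicator A (t + r)" 1 "- r"] by simp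
  also have "\<dots> = (\<integral>\<^sup>+t. ennreal (exp (r * t - r\<^sup>2 / 2)) * indicator A t \<partial>gauss1)"
    unfolding ratio[symmetric] by (simp add: gauss1_def nn_integral_density ennreal_mult mult.assoc)
  also have "\<dots> = emeasure (density gauss1 (\<lambda>t. ennreal (exp (r * t - r\<^sup>2 / 2)))) A"
    by (simp add: emeasure_density)
  finally show "emeasure (distr gauss1 gauss1 (\<lambda>t. t + r)) A = \<dots>" .
qed simp

lemma has_bochner_integral_gauss1_tilt_iff:
  fixes g :: "real \<Rightarrow> real"
  assumes [measurable]: "g \<in> borel_measurable borel"
  shows "has_bochner_integral gauss1 (\<lambda>t. exp (r * t - r\<^sup>2 / 2) * g t) c \<longleftrightarrow> has_bochner_integral gauss1 (\<lambda>t. g (t + r)) c"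
proof -
  let ?tilted = "density gauss1 (\<lambda>t. ennreal (exp (r * t - r\<^sup>2 / 2)))"
  have "integrable gauss1 (\<lambda>t. exp (r * t - r\<^sup>2 / 2) * g t) \<longleftrightarrow> integrable ?tilted g"
    by (subst integrable_density) auto
  also have "\<dots> \<longleftrightarrow> integrable gauss1 (\<lambda>t. g (t + r))"
    unfolding distr_gauss1_shift[symmetric] by (subst integrable_distr_eq) auto
  finally have integrable: "integrable gauss1 (\<lambda>t. exp (r * t - r\<^sup>2 / 2) * g t) \<longleftrightarrow> integrable gauss1 (\<lambda>t. g (t + r))" .
  have "(\<integral>t. exp (r * t - r\<^sup>2 / 2) * g t \<partial>gauss1) = (\<integral>t. g t \<partial>?tilted)"
    by (subst integral_density) auto
  also have "\<dots> = (\<integral>t. g (t + r) \<partial>gauss1)"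
    unfolding distr_gauss1_shift[symmetric] by (subst integral_distr) auto
  finally show ?thesis using integrable by (simp add: has_bochner_integral_iff)
qed

lemma exp_tilt_mean: "has_bochner_integral gauss1 (\<lambda>t. exp (r * t - r\<^sup>2 / 2)) 1"
  using has_bochner_integral_gauss1_tilt_iff[of "\<lambda>_. 1" r 1] gauss1.has_bochner_integral_constant[of 1] by simp

lemma exp_tilt_remainder_second_moment:
  "has_bochner_integral gauss1 (\<lambda>t. (exp (r * t - r\<^sup>2 / 2) - 1 - r * t)\<^sup>2) (exp (r\<^sup>2) - 1 - r\<^sup>2)"
proof -
  let ?e = "\<lambda>t. exp (r * t - r\<^sup>2 / 2)"
  note const = gauss1.has_bochner_integral_constant
  have linear: "has_bochner_integral gauss1 (\<lambda>t. ?e t * (1 + r * t)) (1 + r\<^sup>2)"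
  proof (subst has_bochner_integral_gauss1_tilt_iff)
    have "has_bochner_integral gauss1 (\<lambda>t. (1 + r\<^sup>2) + r * t) ((1 + r\<^sup>2) + r * 0)"
      by (intro has_bochner_integral_add const has_bochner_integral_mult_right gauss1_mean)
    then show "has_bochner_integral gauss1 (\<lambda>t. 1 + r * (t + r)) (1 + r\<^sup>2)"
      by (simp add: algebra_simps power2_eq_square)
  qed simp
  have square: "has_bochner_integral gauss1 (\<lambda>t. ?e t * ?e t) (exp (r\<^sup>2))"
  proof (subst has_bochner_integral_gauss1_tilt_iff)
    have "has_bochner_integral gauss1 (\<lambda>t. exp (r\<^sup>2) * ?e t) (exp (r\<^sup>2) * 1)"
      by (intro has_bochner_integral_mult_right exp_tilt_mean)
    moreover have "exp (r\<^sup>2) * ?e t = ?e (t + r)" for t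
      by (simp add: exp_add[symmetric] algebra_simps power2_eq_square)
    ultimately show "has_bochner_integral gauss1 (\<lambda>t. ?e (t + r)) (exp (r\<^sup>2))" by simp
  qed simp
  have "has_bochner_integral gauss1 (\<lambda>t. ?e t * ?e t - 2 * (?e t * (1 + r * t)) + (1 + 2 * r * t + r\<^sup>2 * t\<^sup>2))
     (exp (r\<^sup>2) - 2 * (1 + r\<^sup>2) + (1 + 2 * r * 0 + r\<^sup>2 * 1))"
    by (intro has_bochner_integral_add has_bochner_integral_diff has_bochner_integral_mult_right
        square linear const gauss1_mean gauss1_second_moment)
  moreover have "?e t * ?e t - 2 * (?e t * (1 + r * t)) + (1 + 2 * r * t + r\<^sup>2 * t\<^sup>2) = (?e t - 1 - r * t)\<^sup>2" for t
    by (simp add: power2_eq_square algebra_simps)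
  ultimately show ?thesis by (simp add: diff_diff_eq add.commute)
qed

lemma exp_tilt_remainder_L2_bound:
  shows integrable_exp_tilt_remainder: "integrable gauss1 (\<lambda>t. exp (r * t - r\<^sup>2 / 2) - 1 - r * t)"
    and "(\<integral>t. \<bar>exp (r * t - r\<^sup>2 / 2) - 1 - r * t\<bar> \<partial>gauss1) \<le> sqrt (exp (r\<^sup>2) - 1 - r\<^sup>2)"
  using gauss1.expectation_abs_le_sqrt[of "\<lambda>t. exp (r * t - r\<^sup>2 / 2) - 1 - r * t"]
    exp_tilt_remainder_second_moment[of r] by (auto simp: has_bochner_integral_iff)

lemma exp_tilt_remainder_linear_bound:
  "(\<integral>t. \<bar>exp (r * t - r\<^sup>2 / 2) - 1 - r * t\<bar> \<partial>gauss1) \<le> 2 + \<bar>r\<bar>"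
proof -
  have "has_bochner_integral gauss1 (\<lambda>t. exp (r * t - r\<^sup>2 / 2) + 1 + \<bar>r\<bar> * \<bar>t\<bar>) (1 + 1 + \<bar>r\<bar> * sqrt (2 / pi))"
    by (intro has_bochner_integral_add gauss1.has_bochner_integral_constant has_bochner_integral_mult_right
        exp_tilt_mean gauss1_abs_moment)
  then have dominating: "integrable gauss1 (\<lambda>t. exp (r * t - r\<^sup>2 / 2) + 1 + \<bar>r\<bar> * \<bar>t\<bar>)"
    "(\<integral>t. exp (r * t - r\<^sup>2 / 2) + 1 + \<bar>r\<bar> * \<bar>t\<bar> \<partial>gauss1) = 2 + \<bar>r\<bar> * sqrt (2 / pi)"
    by (auto simp: has_bochner_integral_iff)
  have "(\<integral>t. \<bar>exp (r * t - r\<^sup>2 / 2) - 1 - r * t\<bar> \<partial>gauss1) \<le> (\<integral>t. exp (r * t - r\<^sup>2 / 2) + 1 + \<bar>r\<bar> * \<bar>t\<bar> \<partial>gauss1)"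
  proof (rule integral_mono)
    fix t :: real
    show "\<bar>exp (r * t - r\<^sup>2 / 2) - 1 - r * t\<bar> \<le> exp (r * t - r\<^sup>2 / 2) + 1 + \<bar>r\<bar> * \<bar>t\<bar>"
      unfolding abs_mult[symmetric] using exp_gt_zero[of "r * t - r\<^sup>2 / 2"] by linarith
  qed (use integrable_exp_tilt_remainder dominating(1) in auto)
  also have "\<dots> \<le> 2 + \<bar>r\<bar>" unfolding dominating(2) using sqrt_2_pi_bounds(2) by (simp add: mult_left_le)
  finally show ?thesis .
qed

lemma exp_tilt_remainder_quadratic_bound:
  "(\<integral>t. \<bar>exp (r * t - r\<^sup>2 / 2) - 1 - r * t\<bar> \<partial>gauss1) \<le> 3 * r\<^sup>2"
proof (cases "r\<^sup>2 \<le> 1")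
  case True
  have "exp (r\<^sup>2) - 1 - r\<^sup>2 \<le> (r\<^sup>2)\<^sup>2" using exp_bound[of "r\<^sup>2"] True by simp
  then have "sqrt (exp (r\<^sup>2) - 1 - r\<^sup>2) \<le> r\<^sup>2" by (simp add: real_le_lsqrt)
  then show ?thesis using exp_tilt_remainder_L2_bound(2)[of r] zero_le_power2[of r] by linarith
next
  case False
  then have "1 \<le> \<bar>r\<bar>" by (simp add: abs_square_le_1)
  then have "\<bar>r\<bar> \<le> \<bar>r\<bar>\<^sup>2" using self_le_power[of "\<bar>r\<bar>" 2] by simp
  with False show ?thesis using exp_tilt_remainder_linear_bound[of r] by simp
qed

definition shift_n :: "nat \<Rightarrow> (nat \<Rightarrow> real) \<Rightarrow> (nat \<Rightarrow> real) \<Rightarrow> nat \<Rightarrow> real"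
  where "shift_n n y z = (\<lambda>i\<in>{..<n}. z i + y i)"

lemma measurable_shift_n [measurable]: "shift_n n y \<in> measurable (gauss n) (gauss n)"
  unfolding shift_n_def by (rule measurable_restrict_gauss) measurable

lemma distr_shift_n:
  "distr (gauss n) (gauss n) (shift_n n y) = density (gauss n) (\<lambda>z. ennreal (exp (inner_n n y z - (norm_n n y)\<^sup>2 / 2)))"
proof -
  let ?e = "\<lambda>i t. ennreal (exp (y i * t - (y i)\<^sup>2 / 2))"
  have "distr (gauss n) (gauss n) (shift_n n y) = PiM {..<n} (\<lambda>i. distr gauss1 gauss1 (\<lambda>t. t + y i))"
    unfolding gauss_def shift_n_def[abs_def] by (rule distr_PiM_componentwise) (auto simp: prob_space_gauss1)
  also have "\<dots> = PiM {..<n} (\<lambda>i. density gauss1 (?e i))" by (simp only: distr_gauss1_shift)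
  also have "\<dots> = density (gauss n) (\<lambda>z. \<Prod>i<n. ?e i (z i))"
    unfolding gauss_def
  proof (rule density_PiM[symmetric])
    show "prob_space (density gauss1 (?e i))" for i
      unfolding distr_gauss1_shift[symmetric] by (rule gauss1.prob_space_distr) simp
  qed (auto simp: prob_space_gauss1)
  also have "(\<lambda>z. \<Prod>i<n. ?e i (z i)) = (\<lambda>z. ennreal (exp (inner_n n y z - (norm_n n y)\<^sup>2 / 2)))"
    by (simp add: prod_ennreal exp_sum[symmetric] inner_n_def norm_n_sq sum_subtractf sum_divide_distrib)
  finally show ?thesis .
qed

lemma cameron_martin:
  fixes F :: "(nat \<Rightarrow> real) \<Rightarrow> real"
  assumes [measurable]: "F \<in> borel_measurable (gauss n)"
  shows "(\<integral>z. F (shift_n n y z) \<partial>gauss n) = (\<integral>z. exp (inner_n n y z - (norm_n n y)\<^sup>2 / 2) * F z \<partial>gauss n)"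
    "integrable (gauss n) (\<lambda>z. F (shift_n n y z)) \<longleftrightarrow> integrable (gauss n) (\<lambda>z. exp (inner_n n y z - (norm_n n y)\<^sup>2 / 2) * F z)"
proof -
  have "(\<integral>z. F (shift_n n y z) \<partial>gauss n) = (\<integral>z. F z \<partial>(distr (gauss n) (gauss n) (shift_n n y)))"
    by (subst integral_distr) auto
  also have "\<dots> = (\<integral>z. exp (inner_n n y z - (norm_n n y)\<^sup>2 / 2) * F z \<partial>gauss n)"
    unfolding distr_shift_n by (subst integral_density) auto
  finally show "(\<integral>z. F (shift_n n y z) \<partial>gauss n) = \<dots>" .
  have "integrable (gauss n) (\<lambda>z. F (shift_n n y z)) \<longleftrightarrow> integrable (distr (gauss n) (gauss n) (shift_n n y)) F"
    by (subst integrable_distr_eq) auto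
  also have "\<dots> \<longleftrightarrow> integrable (gauss n) (\<lambda>z. exp (inner_n n y z - (norm_n n y)\<^sup>2 / 2) * F z)"
    unfolding distr_shift_n by (subst integrable_density) auto
  finally show "integrable (gauss n) (\<lambda>z. F (shift_n n y z)) \<longleftrightarrow> \<dots>" .
qed

section \<open>Gaussian smoothing\<close>

definition unit_bounded :: "nat \<Rightarrow> ((nat \<Rightarrow> real) \<Rightarrow> real) \<Rightarrow> bool"
  where "unit_bounded n f \<longleftrightarrow> f \<in> borel_measurable (gauss n) \<and> (\<forall>x\<in>space (gauss n). \<bar>f x\<bar> \<le> 1)"

lemma unit_bounded_measurable: "unit_bounded n f \<Longrightarrow> f \<in> borel_measurable (gauss n)"
  by (simp add: unit_bounded_def)

lemma unit_bounded_abs_le: "unit_bounded n f \<Longrightarrow> x \<in> space (gauss n) \<Longrightarrow> \<bar>f x\<bar> \<le> 1"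
  by (simp add: unit_bounded_def)

lemma unit_bounded_abs_diff_le:
  "unit_bounded n g \<Longrightarrow> unit_bounded n h \<Longrightarrow> x \<in> space (gauss n) \<Longrightarrow> y \<in> space (gauss n) \<Longrightarrow> \<bar>g x - h y\<bar> \<le> 2"
  using unit_bounded_abs_le[of n g x] unit_bounded_abs_le[of n h y] by linarith

lemma unit_bounded_indicator: "A \<in> sets (gauss n) \<Longrightarrow> unit_bounded n (indicator A)"
  by (auto simp: unit_bounded_def indicator_def)

lemma unit_bounded_isom:
  assumes T: "gauss_isom n T T'" and f: "unit_bounded n f"
  shows "unit_bounded n (\<lambda>x. f (T x))"
  using measurable_compose[OF gauss_isom_measurable[OF T] unit_bounded_measurable[OF f]] f gauss_isom_in_space[OF T]
  by (simp add: unit_bounded_def)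

lemma unit_bounded_mix:
  assumes "unit_bounded n f"
  shows "(\<lambda>z. f (mix n \<alpha> \<beta> x z)) \<in> borel_measurable (gauss n)" "\<bar>f (mix n \<alpha> \<beta> x z)\<bar> \<le> 1"
  using assms by (auto simp: unit_bounded_def)

lemma integrable_unit_bounded: "unit_bounded n f \<Longrightarrow> integrable (gauss n) f"
  by (rule gauss.integrable_bounded[of _ _ 1]) (auto simp: unit_bounded_def)

lemma integrable_unit_bounded_mix: "unit_bounded n f \<Longrightarrow> integrable (gauss n) (\<lambda>z. f (mix n \<alpha> \<beta> x z))"
  by (rule gauss.integrable_bounded[of _ _ 1]) (use unit_bounded_mix in auto)

lemma integrable_abs_diff_unit_bounded:
  assumes "unit_bounded n g" "unit_bounded n h"
  shows "integrable (gauss n) (\<lambda>x. \<bar>g x - h x\<bar>)"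
  using integrable_unit_bounded[OF assms(1)] integrable_unit_bounded[OF assms(2)] by simp

lemma integrable_coord_mult_mix:
  assumes "unit_bounded n f" "i < n"
  shows "integrable (gauss n) (\<lambda>z. z i * f (mix n \<alpha> \<beta> x z))"
proof (rule Bochner_Integration.integrable_bound)
  show "integrable (gauss n) (\<lambda>z. z i)" using assms(2) by simp
  show "(\<lambda>z. z i * f (mix n \<alpha> \<beta> x z)) \<in> borel_measurable (gauss n)"
    using unit_bounded_mix[OF assms(1)] measurable_gauss_coord[OF assms(2)] by auto
  show "AE z in gauss n. norm (z i * f (mix n \<alpha> \<beta> x z)) \<le> norm (z i)"
    using unit_bounded_mix(2)[OF assms(1)] by (auto simp: abs_mult intro!: mult_left_le)
qed

text \<open>A coordinate \<open>i\<close> with \<open>\<alpha> i = 0\<close> is averaged out. By Gaussian integration by parts \<open>smooth_grad\<close> is the gradient of \<open>smooth\<close>;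
  only the Taylor estimate \<open>smooth_taylor\<close> is needed, never differentiability.\<close>

definition smooth :: "nat \<Rightarrow> (nat \<Rightarrow> real) \<Rightarrow> (nat \<Rightarrow> real) \<Rightarrow> ((nat \<Rightarrow> real) \<Rightarrow> real) \<Rightarrow> (nat \<Rightarrow> real) \<Rightarrow> real"
  where "smooth n \<alpha> \<beta> f x = (\<integral>z. f (mix n \<alpha> \<beta> x z) \<partial>gauss n)"

definition noise_coeff :: "nat \<Rightarrow> (nat \<Rightarrow> real) \<Rightarrow> (nat \<Rightarrow> real) \<Rightarrow> ((nat \<Rightarrow> real) \<Rightarrow> real) \<Rightarrow> (nat \<Rightarrow> real) \<Rightarrow> nat \<Rightarrow> real"
  where "noise_coeff n \<alpha> \<beta> f x i = (\<integral>z. z i * f (mix n \<alpha> \<beta> x z) \<partial>gauss n)"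

definition smooth_grad :: "nat \<Rightarrow> (nat \<Rightarrow> real) \<Rightarrow> (nat \<Rightarrow> real) \<Rightarrow> ((nat \<Rightarrow> real) \<Rightarrow> real) \<Rightarrow> (nat \<Rightarrow> real) \<Rightarrow> nat \<Rightarrow> real"
  where "smooth_grad n \<alpha> \<beta> f x i = \<alpha> i / \<beta> i * noise_coeff n \<alpha> \<beta> f x i"

lemma measurable_smooth [measurable]:
  assumes f: "unit_bounded n f" shows "smooth n \<alpha> \<beta> f \<in> borel_measurable (gauss n)"
proof -
  note [measurable] = unit_bounded_measurable[OF f]
  show ?thesis unfolding smooth_def by measurable
qed

lemma measurable_noise_coeff [measurable]:
  assumes f: "unit_bounded n f" and i: "i < n"
  shows "(\<lambda>x. noise_coeff n \<alpha> \<beta> f x i) \<in> borel_measurable (gauss n)"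
proof -
  note [measurable] = unit_bounded_measurable[OF f]
  show ?thesis unfolding noise_coeff_def using i by measurable
qed

lemma measurable_smooth_grad:
  assumes "unit_bounded n f" "i < n"
  shows "(\<lambda>x. smooth_grad n \<alpha> \<beta> f x i) \<in> borel_measurable (gauss n)"
  unfolding smooth_grad_def using measurable_noise_coeff[OF assms] by (intro borel_measurable_times) auto

lemma unit_bounded_smooth:
  assumes f: "unit_bounded n f" shows "unit_bounded n (smooth n \<alpha> \<beta> f)"
proof -
  have "\<bar>smooth n \<alpha> \<beta> f x\<bar> \<le> 1" for x
  proof -
    have "\<bar>smooth n \<alpha> \<beta> f x\<bar> \<le> (\<integral>z. \<bar>f (mix n \<alpha> \<beta> x z)\<bar> \<partial>gauss n)" unfolding smooth_def by (rule integral_abs_bound)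
    also have "\<dots> \<le> (\<integral>z. 1 \<partial>gauss n)"
      by (rule integral_mono) (use integrable_unit_bounded_mix[OF f] unit_bounded_mix(2)[OF f] in auto)
    finally show ?thesis by (simp add: gauss.prob_space)
  qed
  then show ?thesis using measurable_smooth[OF f] by (simp add: unit_bounded_def)
qed

lemma sum_sq_noise_coeff_le:
  assumes f: "unit_bounded n f"
  shows "(\<Sum>i<n. (noise_coeff n \<alpha> \<beta> f x i)\<^sup>2) \<le> 1"
proof -
  have integrable: "integrable (gauss n) (\<lambda>z. (f (mix n \<alpha> \<beta> x z))\<^sup>2)"
    by (rule gauss.integrable_bounded[of _ _ 1]) (use unit_bounded_mix[OF f] in \<open>auto simp: abs_square_le_1\<close>)
  have "(\<Sum>i<n. (noise_coeff n \<alpha> \<beta> f x i)\<^sup>2) \<le> (\<integral>z. (f (mix n \<alpha> \<beta> x z))\<^sup>2 \<partial>gauss n)"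
    unfolding noise_coeff_def by (rule gauss_bessel) (use integrable unit_bounded_mix[OF f] in auto)
  also have "\<dots> \<le> (\<integral>z. 1 \<partial>gauss n)"
    by (rule integral_mono) (use integrable unit_bounded_mix(2)[OF f] in \<open>auto simp: abs_square_le_1\<close>)
  finally show ?thesis by (simp add: gauss.prob_space)
qed

definition noise_shift :: "(nat \<Rightarrow> real) \<Rightarrow> (nat \<Rightarrow> real) \<Rightarrow> (nat \<Rightarrow> real) \<Rightarrow> (nat \<Rightarrow> real) \<Rightarrow> nat \<Rightarrow> real"
  where "noise_shift \<alpha> \<beta> x x' i = \<alpha> i / \<beta> i * (x' i - x i)"

lemma mix_noise_shift:
  "(\<And>i. i < n \<Longrightarrow> \<beta> i \<noteq> 0) \<Longrightarrow> mix n \<alpha> \<beta> x (shift_n n (noise_shift \<alpha> \<beta> x x') z) = mix n \<alpha> \<beta> x' z"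
  by (auto simp: mix_def shift_n_def noise_shift_def fun_eq_iff field_simps)

lemma smooth_tilt:
  assumes f: "unit_bounded n f" and \<beta>: "\<And>i. i < n \<Longrightarrow> \<beta> i \<noteq> 0" and y: "y = noise_shift \<alpha> \<beta> x x'"
  shows "smooth n \<alpha> \<beta> f x' = (\<integral>z. exp (inner_n n y z - (norm_n n y)\<^sup>2 / 2) * f (mix n \<alpha> \<beta> x z) \<partial>gauss n)"
    "integrable (gauss n) (\<lambda>z. exp (inner_n n y z - (norm_n n y)\<^sup>2 / 2) * f (mix n \<alpha> \<beta> x z))"
proof -
  have "mix n \<alpha> \<beta> x (shift_n n y z) = mix n \<alpha> \<beta> x' z" for z unfolding y by (rule mix_noise_shift[OF \<beta>])
  note cm = cameron_martin[OF unit_bounded_mix(1)[OF f, of \<alpha> \<beta> x], of y, unfolded this]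
  show "smooth n \<alpha> \<beta> f x' = (\<integral>z. exp (inner_n n y z - (norm_n n y)\<^sup>2 / 2) * f (mix n \<alpha> \<beta> x z) \<partial>gauss n)"
    unfolding smooth_def by (rule cm(1))
  show "integrable (gauss n) (\<lambda>z. exp (inner_n n y z - (norm_n n y)\<^sup>2 / 2) * f (mix n \<alpha> \<beta> x z))"
    using cm(2) integrable_unit_bounded_mix[OF f] by blast
qed

lemma smooth_grad_linear:
  assumes f: "unit_bounded n f" and y: "y = noise_shift \<alpha> \<beta> x x'"
  shows "(\<Sum>i<n. smooth_grad n \<alpha> \<beta> f x i * (x' i - x i)) = (\<integral>z. inner_n n y z * f (mix n \<alpha> \<beta> x z) \<partial>gauss n)"
    "integrable (gauss n) (\<lambda>z. inner_n n y z * f (mix n \<alpha> \<beta> x z))"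
proof -
  note linear = integral_inner_n_mult[of n "gauss n" "\<lambda>z. z" "\<lambda>z. f (mix n \<alpha> \<beta> x z)" y, OF integrable_coord_mult_mix[OF f]]
  show "integrable (gauss n) (\<lambda>z. inner_n n y z * f (mix n \<alpha> \<beta> x z))" by (rule linear(1))
  have "(\<Sum>i<n. smooth_grad n \<alpha> \<beta> f x i * (x' i - x i)) = inner_n n y (noise_coeff n \<alpha> \<beta> f x)"
    by (simp add: inner_n_def y noise_shift_def smooth_grad_def mult_ac)
  then show "(\<Sum>i<n. smooth_grad n \<alpha> \<beta> f x i * (x' i - x i)) = (\<integral>z. inner_n n y z * f (mix n \<alpha> \<beta> x z) \<partial>gauss n)"
    by (simp only: noise_coeff_def[abs_def] linear(2))
qed

lemma smooth_taylor:
  assumes f: "unit_bounded n f" and \<beta>: "\<And>i. i < n \<Longrightarrow> \<beta> i \<noteq> 0"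
  shows "\<bar>smooth n \<alpha> \<beta> f x' - smooth n \<alpha> \<beta> f x - (\<Sum>i<n. smooth_grad n \<alpha> \<beta> f x i * (x' i - x i))\<bar>
     \<le> 3 * (\<Sum>i<n. (\<alpha> i / \<beta> i)\<^sup>2 * (x' i - x i)\<^sup>2)"
proof -
  define y where "y = noise_shift \<alpha> \<beta> x x'"
  define F where "F z = f (mix n \<alpha> \<beta> x z)" for z
  let ?e = "\<lambda>z. exp (inner_n n y z - (norm_n n y)\<^sup>2 / 2)" and ?q = "\<lambda>t. exp (t - (norm_n n y)\<^sup>2 / 2) - 1 - t"
  have q [measurable]: "(\<lambda>t. ?q t) \<in> borel_measurable borel" "(\<lambda>t. \<bar>?q t\<bar>) \<in> borel_measurable borel" by measurable
  note tilt = smooth_tilt[OF f \<beta> y_def, folded F_def]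
  note grad = smooth_grad_linear[OF f y_def, folded F_def]
  have F: "integrable (gauss n) F" "\<And>z. \<bar>F z\<bar> \<le> 1"
    unfolding F_def using integrable_unit_bounded_mix[OF f] unit_bounded_mix(2)[OF f] by auto
  have "smooth n \<alpha> \<beta> f x' - smooth n \<alpha> \<beta> f x - (\<Sum>i<n. smooth_grad n \<alpha> \<beta> f x i * (x' i - x i))
     = (\<integral>z. ?e z * F z \<partial>gauss n) - (\<integral>z. F z \<partial>gauss n) - (\<integral>z. inner_n n y z * F z \<partial>gauss n)"
    using tilt(1) grad(1) by (simp add: smooth_def F_def)
  also have "\<dots> = (\<integral>z. ?e z * F z - F z - inner_n n y z * F z \<partial>gauss n)"
    using tilt(2) grad(2) F(1) by simp
  finally have "\<bar>smooth n \<alpha> \<beta> f x' - smooth n \<alpha> \<beta> f x - (\<Sum>i<n. smooth_grad n \<alpha> \<beta> f x i * (x' i - x i))\<bar>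
     = \<bar>\<integral>z. ?e z * F z - F z - inner_n n y z * F z \<partial>gauss n\<bar>" by simp
  also have "\<dots> \<le> (\<integral>z. \<bar>?e z * F z - F z - inner_n n y z * F z\<bar> \<partial>gauss n)"
    by (rule integral_abs_bound)
  also have "\<dots> \<le> (\<integral>z. \<bar>?q (inner_n n y z)\<bar> \<partial>gauss n)"
  proof (rule integral_mono)
    show "integrable (gauss n) (\<lambda>z. \<bar>?q (inner_n n y z)\<bar>)"
      using integral_inner_n(2)[OF q(1), of n y] integrable_exp_tilt_remainder by (intro integrable_abs) simp
    fix z
    have "?e z * F z - F z - inner_n n y z * F z = ?q (inner_n n y z) * F z"
      by (simp add: algebra_simps)
    then show "\<bar>?e z * F z - F z - inner_n n y z * F z\<bar> \<le> \<bar>?q (inner_n n y z)\<bar>"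
      using F(2)[of z] by (simp only: abs_mult) (rule mult_left_le, simp_all)
  qed (use tilt(2) grad(2) F(1) in auto)
  also have "\<dots> = (\<integral>t. \<bar>?q (norm_n n y * t)\<bar> \<partial>gauss1)" by (rule integral_inner_n(1)[OF q(2)])
  also have "\<dots> \<le> 3 * (norm_n n y)\<^sup>2" by (rule exp_tilt_remainder_quadratic_bound)
  also have "\<dots> = 3 * (\<Sum>i<n. (\<alpha> i / \<beta> i)\<^sup>2 * (x' i - x i)\<^sup>2)"
    unfolding norm_n_sq y_def noise_shift_def power_mult_distrib ..
  finally show ?thesis .
qed

section \<open>Expected change along rotations\<close>

lemma (in pair_prob_space)
  fixes F :: "'a \<Rightarrow> real"
  assumes [measurable]: "F \<in> borel_measurable M1"
  shows integral_fst_marginal: "(\<integral>p. F (fst p) \<partial>(M1 \<Otimes>\<^sub>M M2)) = (\<integral>x. F x \<partial>M1)"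
    and integrable_fst_marginal: "integrable (M1 \<Otimes>\<^sub>M M2) (\<lambda>p. F (fst p)) \<longleftrightarrow> integrable M1 F"
  using integral_distr[of fst "M1 \<Otimes>\<^sub>M M2" M1 F] integrable_distr_eq[of fst "M1 \<Otimes>\<^sub>M M2" M1 F]
  by (simp_all add: M2.distr_pair_fst)

lemma (in pair_prob_space) distr_pair_snd: "distr (M1 \<Otimes>\<^sub>M M2) M2 snd = M2"
  by (rule distr_eqI_nn_integral) (auto simp: M2.nn_integral_fst[symmetric] M1.emeasure_space_1)

lemma (in pair_prob_space)
  fixes F :: "'b \<Rightarrow> real"
  assumes [measurable]: "F \<in> borel_measurable M2"
  shows integral_snd_marginal: "(\<integral>p. F (snd p) \<partial>(M1 \<Otimes>\<^sub>M M2)) = (\<integral>x. F x \<partial>M2)"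
    and integrable_snd_marginal: "integrable (M1 \<Otimes>\<^sub>M M2) (\<lambda>p. F (snd p)) \<longleftrightarrow> integrable M2 F"
  using integral_distr[of snd "M1 \<Otimes>\<^sub>M M2" M2 F] integrable_distr_eq[of snd "M1 \<Otimes>\<^sub>M M2" M2 F]
  by (simp_all add: distr_pair_snd)

lemma integral_pair_rotation:
  fixes F :: "_ \<Rightarrow> real"
  assumes weights: "\<And>i. (\<alpha> i)\<^sup>2 + (\<beta> i)\<^sup>2 = 1" and [measurable]: "F \<in> borel_measurable (gauss_pair n)"
  shows "(\<integral>p. F (mix n \<alpha> \<beta> (fst p) (snd p), mix n (\<lambda>i. - \<beta> i) \<alpha> (fst p) (snd p)) \<partial>gauss_pair n) = (\<integral>p. F p \<partial>gauss_pair n)"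
  using integral_distr[of "\<lambda>p. (mix n \<alpha> \<beta> (fst p) (snd p), mix n (\<lambda>i. - \<beta> i) \<alpha> (fst p) (snd p))" "gauss_pair n" "gauss_pair n" F]
  by (simp add: distr_pair_rotation[OF weights])

lemma integral_mix:
  fixes F :: "_ \<Rightarrow> real"
  assumes weights: "\<And>i. (\<alpha> i)\<^sup>2 + (\<beta> i)\<^sup>2 = 1" and [measurable]: "F \<in> borel_measurable (gauss n)"
  shows "(\<integral>p. F (mix n \<alpha> \<beta> (fst p) (snd p)) \<partial>gauss_pair n) = (\<integral>x. F x \<partial>gauss n)"
  using integral_distr[of "\<lambda>p. mix n \<alpha> \<beta> (fst p) (snd p)" "gauss_pair n" "gauss n" F]
  by (simp add: distr_mix[OF weights])

definition rot :: "nat \<Rightarrow> nat set \<Rightarrow> real \<Rightarrow> (nat \<Rightarrow> real) \<Rightarrow> (nat \<Rightarrow> real) \<Rightarrow> nat \<Rightarrow> real"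
  where "rot n S \<phi> = mix n (\<lambda>i. if i \<in> S then cos \<phi> else 1) (\<lambda>i. if i \<in> S then sin \<phi> else 0)"

definition rot_change :: "nat \<Rightarrow> nat set \<Rightarrow> ((nat \<Rightarrow> real) \<Rightarrow> real) \<Rightarrow> real \<Rightarrow> real"
  where "rot_change n S h \<phi> = (\<integral>p. \<bar>h (rot n S \<phi> (fst p) (snd p)) - h (fst p)\<bar> \<partial>gauss_pair n)"

abbreviation mehler :: "nat \<Rightarrow> real \<Rightarrow> ((nat \<Rightarrow> real) \<Rightarrow> real) \<Rightarrow> (nat \<Rightarrow> real) \<Rightarrow> real"
  where "mehler n \<theta> \<equiv> smooth n (\<lambda>_. cos \<theta>) (\<lambda>_. sin \<theta>)"

lemma measurable_rot [measurable (raw)]: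
  assumes "f \<in> measurable M (gauss n)" "g \<in> measurable M (gauss n)"
  shows "(\<lambda>p. rot n S \<phi> (f p) (g p)) \<in> measurable M (gauss n)"
  unfolding rot_def using assms by (rule measurable_mix)

lemma rot_in_space [simp]: "rot n S \<phi> x z \<in> space (gauss n)"
  by (simp add: rot_def)

lemma rot_full: "rot n {..<n} \<theta> = lincomb n (cos \<theta>) (sin \<theta>)"
  by (auto simp: rot_def mix_def fun_eq_iff)

lemma rot_0: "x \<in> space (gauss n) \<Longrightarrow> rot n S 0 x z = x"
  by (auto simp: rot_def mix_def space_gauss fun_eq_iff extensional_def)

lemma rot_half_pi: "z \<in> space (gauss n) \<Longrightarrow> rot n {..<n} (pi / 2) x z = z"
  by (auto simp: rot_full mix_def space_gauss fun_eq_iff extensional_def)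

lemma integral_rot:
  fixes F :: "_ \<Rightarrow> real"
  assumes "F \<in> borel_measurable (gauss n)"
  shows "(\<integral>p. F (rot n S \<phi> (fst p) (snd p)) \<partial>gauss_pair n) = (\<integral>x. F x \<partial>gauss n)"
  unfolding rot_def by (rule integral_mix) (use assms in auto)

lemma integrable_rot_diff:
  assumes h: "unit_bounded n h"
  shows "integrable (gauss_pair n) (\<lambda>p. h (rot n S \<phi> (fst p) (snd p)) - h (fst p))"
proof -
  note [measurable] = unit_bounded_measurable[OF h]
  show ?thesis
    by (rule gauss_pair.integrable_bounded[of _ _ 2])
       (use unit_bounded_abs_diff_le[OF h h] in \<open>auto simp: space_pair_measure\<close>)
qed

lemma rot_change_add_le:
  assumes h: "unit_bounded n h"
  shows "rot_change n S h (\<phi> + \<psi>) \<le> rot_change n S h \<phi> + rot_change n S h \<psi>"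
proof -
  note [measurable] = unit_bounded_measurable[OF h]
  let ?a = "\<lambda>i. if i \<in> S then cos \<phi> else 1" and ?b = "\<lambda>i. if i \<in> S then sin \<phi> else 0"
  let ?R = "\<lambda>p. rot n S \<phi> (fst p) (snd p)" and ?R' = "\<lambda>p. mix n (\<lambda>i. - ?b i) ?a (fst p) (snd p)"
  let ?second = "\<lambda>p. \<bar>h (rot n S \<psi> (?R p) (?R' p)) - h (?R p)\<bar>" and ?first = "\<lambda>p. \<bar>h (?R p) - h (fst p)\<bar>"
  have compose: "rot n S (\<phi> + \<psi>) (fst p) (snd p) = rot n S \<psi> (?R p) (?R' p)" for p
    by (auto simp: rot_def mix_def fun_eq_iff cos_add sin_add algebra_simps)
  have second: "integrable (gauss_pair n) ?second"
    by (rule gauss_pair.integrable_bounded[of _ _ 2]) (use unit_bounded_abs_diff_le[OF h h] in auto)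
  have "rot_change n S h (\<phi> + \<psi>) \<le> (\<integral>p. ?second p + ?first p \<partial>gauss_pair n)"
    unfolding rot_change_def
  proof (rule integral_mono)
    show "\<bar>h (rot n S (\<phi> + \<psi>) (fst p) (snd p)) - h (fst p)\<bar> \<le> ?second p + ?first p" for p
      unfolding compose by linarith
  qed (use second integrable_rot_diff[OF h] in auto)
  also have "\<dots> = (\<integral>p. ?second p \<partial>gauss_pair n) + rot_change n S h \<phi>"
    unfolding rot_change_def using second integrable_rot_diff[OF h] by simp
  also have "(\<integral>p. ?second p \<partial>gauss_pair n) = rot_change n S h \<psi>"
    using integral_pair_rotation[of ?a ?b "\<lambda>p. \<bar>h (rot n S \<psi> (fst p) (snd p)) - h (fst p)\<bar>" n]
    by (simp add: rot_change_def rot_def[of n S \<phi>])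
  finally show ?thesis by simp
qed

lemma rot_change_mult_le:
  assumes h: "unit_bounded n h"
  shows "rot_change n S h (real N * \<phi>) \<le> real N * rot_change n S h \<phi>"
proof (induction N)
  case 0
  have "rot_change n S h 0 = (\<integral>p. 0 \<partial>gauss_pair n)"
    unfolding rot_change_def
    by (intro Bochner_Integration.integral_cong) (auto simp: space_pair_measure rot_0)
  then show ?case by simp
next
  case (Suc N)
  have "rot_change n S h (real (Suc N) * \<phi>) \<le> rot_change n S h (real N * \<phi>) + rot_change n S h \<phi>"
    using rot_change_add_le[OF h, of S "real N * \<phi>" \<phi>] by (simp add: algebra_simps)
  with Suc show ?case by (simp add: algebra_simps)
qed

lemma rot_change_perturb:
  assumes g: "unit_bounded n g" and h: "unit_bounded n h"
  shows "rot_change n S g \<theta> \<le> rot_change n S h \<theta> + 2 * (\<integral>x. \<bar>g x - h x\<bar> \<partial>gauss n)"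
proof -
  note [measurable] = unit_bounded_measurable[OF g] unit_bounded_measurable[OF h]
  let ?R = "\<lambda>p. rot n S \<theta> (fst p) (snd p)" and ?d = "\<lambda>x. \<bar>g x - h x\<bar>"
  have rotated: "integrable (gauss_pair n) (\<lambda>p. ?d (?R p))"
    by (rule gauss_pair.integrable_bounded[of _ _ 2]) (use unit_bounded_abs_diff_le[OF g h] in auto)
  have fixed: "integrable (gauss_pair n) (\<lambda>p. ?d (fst p))"
    by (subst gauss_pair.integrable_fst_marginal) (use integrable_abs_diff_unit_bounded[OF g h] in auto)
  have "rot_change n S g \<theta> \<le> (\<integral>p. ?d (?R p) + (\<bar>h (?R p) - h (fst p)\<bar> + ?d (fst p)) \<partial>gauss_pair n)"
    unfolding rot_change_def
  proof (rule integral_mono)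
    show "integrable (gauss_pair n) (\<lambda>p. ?d (?R p) + (\<bar>h (?R p) - h (fst p)\<bar> + ?d (fst p)))"
      by (intro Bochner_Integration.integrable_add rotated fixed integrable_abs integrable_rot_diff[OF h])
  qed (use integrable_rot_diff[OF g] in auto)
  also have "\<dots> = (\<integral>p. ?d (?R p) \<partial>gauss_pair n) + (rot_change n S h \<theta> + (\<integral>p. ?d (fst p) \<partial>gauss_pair n))"
    unfolding rot_change_def using rotated fixed integrable_rot_diff[OF h, of S \<theta>] by simp
  also have "(\<integral>p. ?d (?R p) \<partial>gauss_pair n) = (\<integral>x. ?d x \<partial>gauss n)" by (rule integral_rot) simp
  also have "(\<integral>p. ?d (fst p) \<partial>gauss_pair n) = (\<integral>x. ?d x \<partial>gauss n)" by (rule gauss_pair.integral_fst_marginal) simp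
  finally show ?thesis by simp
qed

lemma integral_abs_diff_rot_average_le:
  assumes h: "unit_bounded n h" and k: "unit_bounded n k"
    and average: "\<And>x. k x = (\<integral>z. h (rot n S \<phi> x z) \<partial>gauss n)"
  shows "(\<integral>x. \<bar>h x - k x\<bar> \<partial>gauss n) \<le> rot_change n S h \<phi>"
proof -
  have integrable: "integrable (gauss_pair n) (\<lambda>p. \<bar>h (rot n S \<phi> (fst p) (snd p)) - h (fst p)\<bar>)"
    using integrable_rot_diff[OF h] by (intro integrable_abs)
  have "(\<integral>x. \<bar>h x - k x\<bar> \<partial>gauss n) \<le> (\<integral>x. (\<integral>z. \<bar>h (rot n S \<phi> x z) - h x\<bar> \<partial>gauss n) \<partial>gauss n)"
  proof (rule integral_mono)
    show "integrable (gauss n) (\<lambda>x. \<bar>h x - k x\<bar>)" by (rule integrable_abs_diff_unit_bounded[OF h k])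
    show "integrable (gauss n) (\<lambda>x. \<integral>z. \<bar>h (rot n S \<phi> x z) - h x\<bar> \<partial>gauss n)"
      using gauss_pair.integrable_fst'[OF integrable] by simp
    fix x
    have "k x - h x = (\<integral>z. h (rot n S \<phi> x z) - h x \<partial>gauss n)"
      unfolding average rot_def using integrable_unit_bounded_mix[OF h] by (simp add: gauss.prob_space)
    then show "\<bar>h x - k x\<bar> \<le> (\<integral>z. \<bar>h (rot n S \<phi> x z) - h x\<bar> \<partial>gauss n)"
      by (subst abs_minus_commute) (simp only: integral_abs_bound)
  qed
  also have "\<dots> = rot_change n S h \<phi>"
    unfolding rot_change_def using gauss_pair.integral_fst'[OF integrable] by simp
  finally show ?thesis .
qed

lemma integral_abs_diff_mehler_le:
  assumes "unit_bounded n f"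
  shows "(\<integral>x. \<bar>f x - mehler n \<theta> f x\<bar> \<partial>gauss n) \<le> rot_change n {..<n} f \<theta>"
  by (rule integral_abs_diff_rot_average_le[OF assms unit_bounded_smooth[OF assms]]) (simp add: smooth_def rot_full)

lemma one_minus_cos_le: "1 - cos \<phi> \<le> \<phi>\<^sup>2 / 2" for \<phi> :: real
proof -
  have "\<bar>sin (\<phi> / 2)\<bar> \<le> \<bar>\<phi> / 2\<bar>" by (rule abs_sin_x_le_abs_x)
  then have "(sin (\<phi> / 2))\<^sup>2 \<le> (\<phi> / 2)\<^sup>2" by (rule abs_le_square_iff[THEN iffD1])
  moreover have "cos \<phi> = 1 - 2 * (sin (\<phi> / 2))\<^sup>2" using cos_double_sin[of "\<phi> / 2"] by simp
  ultimately show ?thesis by (simp add: power_divide)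
qed

lemma gauss_sum_sq_moment:
  assumes S: "S \<subseteq> {..<n}"
  shows "has_bochner_integral (gauss n) (\<lambda>x. \<Sum>i\<in>S. (x i)\<^sup>2) (card S)"
proof -
  have "has_bochner_integral (gauss n) (\<lambda>x. \<Sum>i\<in>S. (x i)\<^sup>2) (\<Sum>i\<in>S. 1)"
    using S by (intro has_bochner_integral_sum gauss_component_second_moment) auto
  then show ?thesis by simp
qed

lemma measurable_norm_n:
  assumes "\<And>i. i < n \<Longrightarrow> (\<lambda>x. w x i) \<in> borel_measurable M"
  shows "(\<lambda>x. norm_n n (w x)) \<in> borel_measurable M"
proof -
  have [measurable]: "(\<lambda>x. \<Sum>i<n. (w x i)\<^sup>2) \<in> borel_measurable M"
    by (intro borel_measurable_sum borel_measurable_power assms) auto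
  show ?thesis unfolding norm_n_def by measurable
qed



locale coord_taylor =
  fixes n :: nat and S :: "nat set" and h :: "(nat \<Rightarrow> real) \<Rightarrow> real"
    and v :: "(nat \<Rightarrow> real) \<Rightarrow> nat \<Rightarrow> real" and V L :: real
  assumes unit_bounded: "unit_bounded n h" and coords: "S \<subseteq> {..<n}"
    and measurable_grad: "\<And>i. i < n \<Longrightarrow> (\<lambda>x. v x i) \<in> borel_measurable (gauss n)"
    and grad_support: "\<And>x i. i < n \<Longrightarrow> i \<notin> S \<Longrightarrow> v x i = 0"
    and grad_bound: "\<And>x. norm_n n (v x) \<le> V"
    and nonneg: "0 \<le> L"
    and taylor: "\<And>x x'. (\<And>i. i < n \<Longrightarrow> i \<notin> S \<Longrightarrow> x' i = x i) \<Longrightarrow>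
       \<bar>h x' - h x - inner_n n (v x) (\<lambda>i. x' i - x i)\<bar> \<le> L * (dist_n n x' x)\<^sup>2"
begin

lemma measurable_norm_grad [measurable]: "(\<lambda>x. norm_n n (v x)) \<in> borel_measurable (gauss n)"
  by (rule measurable_norm_n) (rule measurable_grad)

lemma integrable_norm_grad: "integrable (gauss n) (\<lambda>x. norm_n n (v x))"
  by (rule gauss.integrable_bounded[of _ _ V]) (use grad_bound in auto)

lemma inner_grad: "inner_n n (v x) z = (\<Sum>i\<in>S. v x i * z i)"
  unfolding inner_n_def by (rule sum.mono_neutral_right) (use coords grad_support in auto)

lemma abs_inner_grad_le: "\<bar>inner_n n (v x) z\<bar> \<le> (V\<^sup>2 + (\<Sum>i\<in>S. (z i)\<^sup>2)) / 2"
proof -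
  have "\<bar>inner_n n (v x) z\<bar> \<le> (\<Sum>i\<in>S. \<bar>v x i * z i\<bar>)" unfolding inner_grad by (rule sum_abs)
  also have "\<dots> \<le> (\<Sum>i\<in>S. ((v x i)\<^sup>2 + (z i)\<^sup>2) / 2)"
  proof (rule sum_mono)
    fix i show "\<bar>v x i * z i\<bar> \<le> ((v x i)\<^sup>2 + (z i)\<^sup>2) / 2"
      using sum_squares_bound[of "\<bar>v x i\<bar>" "\<bar>z i\<bar>"] by (simp add: abs_mult)
  qed
  also have "\<dots> = ((\<Sum>i\<in>S. (v x i)\<^sup>2) + (\<Sum>i\<in>S. (z i)\<^sup>2)) / 2"
    by (simp add: sum_divide_distrib[symmetric] sum.distrib)
  also have "(\<Sum>i\<in>S. (v x i)\<^sup>2) \<le> (norm_n n (v x))\<^sup>2"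
    unfolding norm_n_sq by (rule sum_mono2) (use coords in auto)
  also have "\<dots> \<le> V\<^sup>2" using grad_bound by (intro power_mono) auto
  finally show ?thesis by simp
qed

lemma measurable_inner_grad [measurable]: "(\<lambda>p. inner_n n (v (fst p)) (snd p)) \<in> borel_measurable (gauss_pair n)"
  unfolding inner_n_def
  by (intro borel_measurable_sum borel_measurable_times)
     (auto intro!: measurable_compose[OF measurable_fst measurable_grad] measurable_gauss_component)

lemma sum_sq_pair_moments:
  "has_bochner_integral (gauss_pair n) (\<lambda>p. \<Sum>i\<in>S. (fst p i)\<^sup>2) (card S)"
  "has_bochner_integral (gauss_pair n) (\<lambda>p. \<Sum>i\<in>S. (snd p i)\<^sup>2) (card S)"
proof -
  have m: "(\<lambda>x. \<Sum>i\<in>S. (x i)\<^sup>2) \<in> borel_measurable (gauss n)"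
    using coords by (intro borel_measurable_sum borel_measurable_power measurable_gauss_coord) auto
  note moment = gauss_sum_sq_moment[OF coords]
  show "has_bochner_integral (gauss_pair n) (\<lambda>p. \<Sum>i\<in>S. (fst p i)\<^sup>2) (card S)"
    using moment gauss_pair.integral_fst_marginal[OF m] gauss_pair.integrable_fst_marginal[OF m]
    by (simp add: has_bochner_integral_iff)
  show "has_bochner_integral (gauss_pair n) (\<lambda>p. \<Sum>i\<in>S. (snd p i)\<^sup>2) (card S)"
    using moment gauss_pair.integral_snd_marginal[OF m] gauss_pair.integrable_snd_marginal[OF m]
    by (simp add: has_bochner_integral_iff)
qed

lemma inner_grad_abs_moment:
  "has_bochner_integral (gauss_pair n) (\<lambda>p. \<bar>inner_n n (v (fst p)) (snd p)\<bar>) (sqrt (2 / pi) * (\<integral>x. norm_n n (v x) \<partial>gauss n))"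
proof -
  have integrable: "integrable (gauss_pair n) (\<lambda>p. \<bar>inner_n n (v (fst p)) (snd p)\<bar>)"
  proof (rule Bochner_Integration.integrable_bound)
    show "integrable (gauss_pair n) (\<lambda>p. (V\<^sup>2 + (\<Sum>i\<in>S. (snd p i)\<^sup>2)) / 2)"
      using sum_sq_pair_moments(2) by (simp add: has_bochner_integral_iff)
    show "AE p in gauss_pair n. norm \<bar>inner_n n (v (fst p)) (snd p)\<bar> \<le> norm ((V\<^sup>2 + (\<Sum>i\<in>S. (snd p i)\<^sup>2)) / 2)"
      using order_trans[OF abs_inner_grad_le abs_ge_self] by (intro AE_I2) simp
  qed simp
  have "(\<integral>p. \<bar>inner_n n (v (fst p)) (snd p)\<bar> \<partial>gauss_pair n) = (\<integral>x. (\<integral>z. \<bar>inner_n n (v x) z\<bar> \<partial>gauss n) \<partial>gauss n)"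
    using gauss_pair.integral_fst'[OF integrable] by simp
  also have "\<dots> = (\<integral>x. sqrt (2 / pi) * norm_n n (v x) \<partial>gauss n)"
    using inner_n_abs_moment by (simp add: has_bochner_integral_iff)
  finally show ?thesis using integrable by (simp add: has_bochner_integral_iff)
qed

lemma rot_displacement_sq_le:
  "(dist_n n (rot n S \<phi> x z) x)\<^sup>2 \<le> 2 * ((1 - cos \<phi>)\<^sup>2 * (\<Sum>i\<in>S. (x i)\<^sup>2) + (sin \<phi>)\<^sup>2 * (\<Sum>i\<in>S. (z i)\<^sup>2))"
proof -
  have "(dist_n n (rot n S \<phi> x z) x)\<^sup>2 = (\<Sum>i\<in>S. (rot n S \<phi> x z i - x i)\<^sup>2)"
    unfolding dist_n_norm norm_n_sq
    by (rule sum.mono_neutral_right) (use coords in \<open>auto simp: rot_def\<close>)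
  also have "\<dots> \<le> (\<Sum>i\<in>S. 2 * ((1 - cos \<phi>)\<^sup>2 * (x i)\<^sup>2 + (sin \<phi>)\<^sup>2 * (z i)\<^sup>2))"
  proof (rule sum_mono)
    fix i assume "i \<in> S"
    then have "rot n S \<phi> x z i - x i = - (1 - cos \<phi>) * x i + sin \<phi> * z i"
      using coords by (auto simp: rot_def algebra_simps)
    moreover have "(a + b)\<^sup>2 \<le> 2 * (a\<^sup>2 + b\<^sup>2)" for a b :: real
      using sum_squares_bound[of a b] by (simp add: power2_sum)
    ultimately show "(rot n S \<phi> x z i - x i)\<^sup>2 \<le> 2 * ((1 - cos \<phi>)\<^sup>2 * (x i)\<^sup>2 + (sin \<phi>)\<^sup>2 * (z i)\<^sup>2)"
      by (metis power2_minus power_mult_distrib)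
  qed
  also have "\<dots> = 2 * ((1 - cos \<phi>)\<^sup>2 * (\<Sum>i\<in>S. (x i)\<^sup>2) + (sin \<phi>)\<^sup>2 * (\<Sum>i\<in>S. (z i)\<^sup>2))"
    by (simp add: sum_distrib_left sum.distrib)
  finally show ?thesis .
qed

lemma rot_increment_approx:
  "\<bar>\<bar>h (rot n S \<phi> x z) - h x\<bar> - \<bar>sin \<phi> * inner_n n (v x) z\<bar>\<bar>
    \<le> (1 - cos \<phi>) * ((V\<^sup>2 + (\<Sum>i\<in>S. (x i)\<^sup>2)) / 2)
      + L * (2 * ((1 - cos \<phi>)\<^sup>2 * (\<Sum>i\<in>S. (x i)\<^sup>2) + (sin \<phi>)\<^sup>2 * (\<Sum>i\<in>S. (z i)\<^sup>2)))"
proof -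
  let ?c = "1 - cos \<phi>" and ?x' = "rot n S \<phi> x z"
  have "inner_n n (v x) (\<lambda>i. ?x' i - x i) = sin \<phi> * inner_n n (v x) z - ?c * inner_n n (v x) x"
    unfolding inner_grad sum_distrib_left sum_subtractf[symmetric]
    by (rule sum.cong) (use coords in \<open>auto simp: rot_def algebra_simps\<close>)
  then have "\<bar>h ?x' - h x - (sin \<phi> * inner_n n (v x) z - ?c * inner_n n (v x) x)\<bar> \<le> L * (dist_n n ?x' x)\<^sup>2"
    using taylor[of ?x' x] by (simp add: rot_def)
  also have "\<dots> \<le> L * (2 * (?c\<^sup>2 * (\<Sum>i\<in>S. (x i)\<^sup>2) + (sin \<phi>)\<^sup>2 * (\<Sum>i\<in>S. (z i)\<^sup>2)))"
    by (rule mult_left_mono[OF rot_displacement_sq_le nonneg])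
  finally have increment: "\<bar>h ?x' - h x - (sin \<phi> * inner_n n (v x) z - ?c * inner_n n (v x) x)\<bar> \<le> \<dots>" .
  have "\<bar>?c * inner_n n (v x) x\<bar> \<le> ?c * ((V\<^sup>2 + (\<Sum>i\<in>S. (x i)\<^sup>2)) / 2)"
    using mult_left_mono[OF abs_inner_grad_le[of x x], of ?c] by (simp add: abs_mult)
  moreover have "\<bar>\<bar>a\<bar> - \<bar>l\<bar>\<bar> \<le> t + e" if "\<bar>a - (l - q)\<bar> \<le> e" "\<bar>q\<bar> \<le> t" for a l q e t :: real
    using that by linarith
  ultimately show ?thesis using increment by blast
qed

lemma rot_change_first_order:
  "\<bar>rot_change n S h \<phi> - \<bar>sin \<phi>\<bar> * sqrt (2 / pi) * (\<integral>x. norm_n n (v x) \<partial>gauss n)\<bar>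
     \<le> \<phi>\<^sup>2 * ((V\<^sup>2 + card S) / 4 + 2 * L * card S)"
proof -
  let ?D = "\<lambda>p. h (rot n S \<phi> (fst p) (snd p)) - h (fst p)" and ?Lin = "\<lambda>p. inner_n n (v (fst p)) (snd p)"
  let ?c = "1 - cos \<phi>"
  let ?E = "\<lambda>p. ?c * ((V\<^sup>2 + (\<Sum>i\<in>S. (fst p i)\<^sup>2)) / 2)
    + L * (2 * (?c\<^sup>2 * (\<Sum>i\<in>S. (fst p i)\<^sup>2) + (sin \<phi>)\<^sup>2 * (\<Sum>i\<in>S. (snd p i)\<^sup>2)))"
  note D = integrable_rot_diff[OF unit_bounded, of S \<phi>]
  note Lin = inner_grad_abs_moment[unfolded has_bochner_integral_iff]
  have "has_bochner_integral (gauss_pair n) ?E (?c * ((V\<^sup>2 + card S) / 2) + L * (2 * (?c\<^sup>2 * card S + (sin \<phi>)\<^sup>2 * card S)))"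
    by (intro has_bochner_integral_add has_bochner_integral_mult_right has_bochner_integral_divide
        sum_sq_pair_moments gauss_pair.has_bochner_integral_constant)
  then have E: "integrable (gauss_pair n) ?E"
    "(\<integral>p. ?E p \<partial>gauss_pair n) = ?c * ((V\<^sup>2 + card S) / 2) + L * (2 * (?c\<^sup>2 * card S + (sin \<phi>)\<^sup>2 * card S))"
    by (simp_all only: has_bochner_integral_iff)
  have "\<bar>rot_change n S h \<phi> - \<bar>sin \<phi>\<bar> * sqrt (2 / pi) * (\<integral>x. norm_n n (v x) \<partial>gauss n)\<bar>
      = \<bar>(\<integral>p. \<bar>?D p\<bar> - \<bar>sin \<phi> * ?Lin p\<bar> \<partial>gauss_pair n)\<bar>"
    unfolding rot_change_def abs_mult using D Lin by simp
  also have "\<dots> \<le> (\<integral>p. \<bar>\<bar>?D p\<bar> - \<bar>sin \<phi> * ?Lin p\<bar>\<bar> \<partial>gauss_pair n)" by (rule integral_abs_bound)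
  also have "\<dots> \<le> (\<integral>p. ?E p \<partial>gauss_pair n)"
    by (rule integral_mono[OF _ E(1) rot_increment_approx]) (use D Lin in \<open>auto simp: abs_mult\<close>)
  also have "\<dots> = ?c * ((V\<^sup>2 + card S) / 2 + 4 * L * card S)"
  proof -
    have "?c\<^sup>2 + (sin \<phi>)\<^sup>2 = 2 * ?c" by (simp add: power2_diff sin_squared_eq)
    then have cards: "?c\<^sup>2 * card S + (sin \<phi>)\<^sup>2 * card S = 2 * ?c * card S" by (metis distrib_right)
    show ?thesis unfolding E(2) cards by (simp add: algebra_simps)
  qed
  also have "\<dots> \<le> \<phi>\<^sup>2 / 2 * ((V\<^sup>2 + card S) / 2 + 4 * L * card S)"
    using one_minus_cos_le nonneg by (intro mult_right_mono) auto
  also have "\<dots> = \<phi>\<^sup>2 * ((V\<^sup>2 + card S) / 4 + 2 * L * card S)" by (simp add: algebra_simps)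
  finally show ?thesis .
qed

text \<open>The quadratic error is removed by splitting the rotation into ever smaller ones.\<close>

lemma rot_change_le_mean_grad:
  assumes \<theta>: "\<theta> \<ge> 0"
  shows "rot_change n S h \<theta> \<le> \<theta> * sqrt (2 / pi) * (\<integral>x. norm_n n (v x) \<partial>gauss n)"
proof -
  let ?I = "\<integral>x. norm_n n (v x) \<partial>gauss n" and ?C = "(V\<^sup>2 + card S) / 4 + 2 * L * card S"
  have mean_nonneg: "?I \<ge> 0" by (rule Bochner_Integration.integral_nonneg) simp
  have split: "rot_change n S h \<theta> \<le> \<theta> * sqrt (2 / pi) * ?I + \<theta>\<^sup>2 * ?C * (1 / real (Suc N))" for N
  proof -
    let ?m = "real (Suc N)"
    let ?\<phi> = "\<theta> / ?m"
    have "rot_change n S h \<theta> = rot_change n S h (?m * ?\<phi>)" by simp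
    also have "\<dots> \<le> ?m * rot_change n S h ?\<phi>" by (rule rot_change_mult_le[OF unit_bounded])
    also have "\<dots> \<le> ?m * (?\<phi> * sqrt (2 / pi) * ?I + ?\<phi>\<^sup>2 * ?C)"
    proof (rule mult_left_mono)
      have "\<bar>sin ?\<phi>\<bar> * (sqrt (2 / pi) * ?I) \<le> ?\<phi> * (sqrt (2 / pi) * ?I)"
        using mean_nonneg \<theta> abs_sin_x_le_abs_x[of ?\<phi>] by (intro mult_right_mono) auto
      then show "rot_change n S h ?\<phi> \<le> ?\<phi> * sqrt (2 / pi) * ?I + ?\<phi>\<^sup>2 * ?C"
        using rot_change_first_order[of ?\<phi>] by (simp only: mult.assoc abs_le_iff) linarith
    qed simp
    also have "\<dots> = \<theta> * sqrt (2 / pi) * ?I + \<theta>\<^sup>2 * ?C * (1 / ?m)"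
      by (simp only: power_divide distrib_left power2_eq_square) (simp add: field_simps del: of_nat_Suc)
    finally show ?thesis .
  qed
  have "(\<lambda>N. \<theta> * sqrt (2 / pi) * ?I + \<theta>\<^sup>2 * ?C * (1 / real (Suc N))) \<longlonglongrightarrow> \<theta> * sqrt (2 / pi) * ?I + \<theta>\<^sup>2 * ?C * 0"
    by (intro tendsto_intros LIMSEQ_inverse_real_of_nat[unfolded inverse_eq_divide])
  from LIMSEQ_le_const[OF this] show ?thesis using split by auto
qed

end

definition coord_proj :: "nat set \<Rightarrow> (nat \<Rightarrow> real) \<Rightarrow> nat \<Rightarrow> real"
  where "coord_proj S v i = (if i \<in> S then v i else 0)"

lemma norm_coord_proj_sq: "S \<subseteq> {..<n} \<Longrightarrow> (norm_n n (coord_proj S v))\<^sup>2 = (\<Sum>i\<in>S. (v i)\<^sup>2)"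
  unfolding norm_n_sq by (rule sum.mono_neutral_cong_right) (auto simp: coord_proj_def)

lemma norm_coord_proj_le: "norm_n n (coord_proj S v) \<le> norm_n n v"
  unfolding norm_n_def by (intro real_sqrt_le_mono sum_mono) (auto simp: coord_proj_def)

lemma coord_taylor_coord_proj:
  assumes "coord_taylor n S h v V L" and S': "S' \<subseteq> S"
  shows "coord_taylor n S' h (\<lambda>x. coord_proj S' (v x)) V L"
proof -
  interpret coord_taylor n S h v V L by fact
  have inner: "inner_n n (coord_proj S' (v x)) (\<lambda>i. x' i - x i) = inner_n n (v x) (\<lambda>i. x' i - x i)"
    if "\<And>i. i < n \<Longrightarrow> i \<notin> S' \<Longrightarrow> x' i = x i" for x x'
    unfolding inner_n_def using that by (intro sum.cong) (auto simp: coord_proj_def)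
  show ?thesis
  proof
    show "\<bar>h x' - h x - inner_n n (coord_proj S' (v x)) (\<lambda>i. x' i - x i)\<bar> \<le> L * (dist_n n x' x)\<^sup>2"
      if "\<And>i. i < n \<Longrightarrow> i \<notin> S' \<Longrightarrow> x' i = x i" for x x'
    proof -
      have "inner_n n (coord_proj S' (v x)) (\<lambda>i. x' i - x i) = inner_n n (v x) (\<lambda>i. x' i - x i)"
        by (rule inner) (rule that)
      then show ?thesis using taylor[of x' x] that S' by auto
    qed
    show "norm_n n (coord_proj S' (v x)) \<le> V" for x
      by (rule order_trans[OF norm_coord_proj_le grad_bound])
    show "(\<lambda>x. coord_proj S' (v x) i) \<in> borel_measurable (gauss n)" if "i < n" for i
      unfolding coord_proj_def using measurable_grad[OF that] by auto
  qed (use unit_bounded coords S' nonneg in \<open>auto simp: coord_proj_def\<close>)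
qed

lemma norm_smooth_grad_le:
  assumes f: "unit_bounded n f" and ratio: "\<And>i. i < n \<Longrightarrow> \<bar>\<alpha> i / \<beta> i\<bar> \<le> c" and c: "0 \<le> c"
  shows "norm_n n (smooth_grad n \<alpha> \<beta> f x) \<le> c"
proof (rule power2_le_imp_le[OF _ c])
  have "(\<alpha> i / \<beta> i)\<^sup>2 \<le> c\<^sup>2" if "i < n" for i
    using power_mono[OF ratio[OF that] abs_ge_zero, of 2] by (simp only: power2_abs)
  then have "(norm_n n (smooth_grad n \<alpha> \<beta> f x))\<^sup>2 \<le> (\<Sum>i<n. c\<^sup>2 * (noise_coeff n \<alpha> \<beta> f x i)\<^sup>2)"
    unfolding norm_n_sq smooth_grad_def power_mult_distrib by (intro sum_mono mult_right_mono) auto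
  also have "\<dots> \<le> c\<^sup>2 * 1"
    unfolding sum_distrib_left[symmetric] by (intro mult_left_mono sum_sq_noise_coeff_le[OF f]) simp
  finally show "(norm_n n (smooth_grad n \<alpha> \<beta> f x))\<^sup>2 \<le> c\<^sup>2" by simp
qed

lemma smooth_taylor_dist:
  assumes f: "unit_bounded n f" and \<beta>: "\<And>i. i < n \<Longrightarrow> \<beta> i \<noteq> 0" and ratio: "\<And>i. i < n \<Longrightarrow> \<bar>\<alpha> i / \<beta> i\<bar> \<le> c"
  shows "\<bar>smooth n \<alpha> \<beta> f x' - smooth n \<alpha> \<beta> f x - inner_n n (smooth_grad n \<alpha> \<beta> f x) (\<lambda>i. x' i - x i)\<bar>
    \<le> 3 * c\<^sup>2 * (dist_n n x' x)\<^sup>2"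
proof -
  have "(\<alpha> i / \<beta> i)\<^sup>2 \<le> c\<^sup>2" if "i < n" for i
    using power_mono[OF ratio[OF that] abs_ge_zero, of 2] by (simp only: power2_abs)
  then have "(\<Sum>i<n. (\<alpha> i / \<beta> i)\<^sup>2 * (x' i - x i)\<^sup>2) \<le> c\<^sup>2 * (dist_n n x' x)\<^sup>2"
    unfolding dist_n_norm norm_n_sq sum_distrib_left by (intro sum_mono mult_right_mono) auto
  moreover have "\<bar>smooth n \<alpha> \<beta> f x' - smooth n \<alpha> \<beta> f x - inner_n n (smooth_grad n \<alpha> \<beta> f x) (\<lambda>i. x' i - x i)\<bar>
      \<le> 3 * (\<Sum>i<n. (\<alpha> i / \<beta> i)\<^sup>2 * (x' i - x i)\<^sup>2)"
    unfolding inner_n_def by (rule smooth_taylor[OF f]) (rule \<beta>)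
  ultimately show ?thesis by linarith
qed

lemma coord_taylor_smooth:
  assumes f: "unit_bounded n f" and S: "S \<subseteq> {..<n}"
    and \<beta>: "\<And>i. i < n \<Longrightarrow> \<beta> i \<noteq> 0" and \<alpha>: "\<And>i. i < n \<Longrightarrow> i \<notin> S \<Longrightarrow> \<alpha> i = 0"
    and ratio: "\<And>i. i < n \<Longrightarrow> \<bar>\<alpha> i / \<beta> i\<bar> \<le> c" and c: "0 \<le> c"
  shows "coord_taylor n S (smooth n \<alpha> \<beta> f) (smooth_grad n \<alpha> \<beta> f) c (3 * c\<^sup>2)"
proof
  show "norm_n n (smooth_grad n \<alpha> \<beta> f x) \<le> c" for x by (rule norm_smooth_grad_le[OF f ratio c])
  show "\<bar>smooth n \<alpha> \<beta> f x' - smooth n \<alpha> \<beta> f x - inner_n n (smooth_grad n \<alpha> \<beta> f x) (\<lambda>i. x' i - x i)\<bar>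
      \<le> 3 * c\<^sup>2 * (dist_n n x' x)\<^sup>2" for x x'
    by (rule smooth_taylor_dist[OF f \<beta> ratio])
qed (use f S \<alpha> c unit_bounded_smooth[OF f] measurable_smooth_grad[OF f] in \<open>auto simp: smooth_grad_def\<close>)

lemma coord_taylor_mehler:
  assumes f: "unit_bounded n f" and \<theta>: "0 < \<theta>" "\<theta> < 1"
  shows "coord_taylor n {..<n} (mehler n \<theta> f) (smooth_grad n (\<lambda>_. cos \<theta>) (\<lambda>_. sin \<theta>) f) (cos \<theta> / sin \<theta>) (3 * (cos \<theta> / sin \<theta>)\<^sup>2)"
proof -
  have "0 < sin \<theta>" "0 < cos \<theta>" using \<theta> pi_gt3 by (auto simp: sin_gt_zero_02 cos_gt_zero)
  then show ?thesis by (intro coord_taylor_smooth[OF f]) auto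
qed

section \<open>Surface area bounds the expected change\<close>

lemma borel_measurable_lipschitz_n:
  fixes g :: "(nat \<Rightarrow> real) \<Rightarrow> real"
  assumes lipschitz: "\<And>x y. \<bar>g x - g y\<bar> \<le> L * dist_n n x y"
  shows "g \<in> borel_measurable (gauss n)"
proof -
  have id_measurable: "(\<lambda>x. x) \<in> borel_measurable (gauss n)"
  proof (rule measurable_coordinatewise_then_product)
    fix i
    show "(\<lambda>x. x i) \<in> borel_measurable (gauss n)"
    proof (cases "i < n")
      case True then show ?thesis by (rule measurable_gauss_coord)
    next
      case False
      then have "(\<lambda>x. x i) \<in> borel_measurable (gauss n) \<longleftrightarrow> (\<lambda>x. undefined :: real) \<in> borel_measurable (gauss n)"
        by (intro measurable_cong) (auto simp: space_gauss extensional_def)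
      then show ?thesis by simp
    qed
  qed
  have "continuous_on UNIV g"
  proof (rule continuous_at_imp_continuous_on, intro ballI)
    fix x :: "nat \<Rightarrow> real"
    have "continuous_on UNIV (\<lambda>y. L * dist_n n y x)"
      unfolding dist_n_def by (intro continuous_intros continuous_on_product_coordinates)
    then have "isCont (\<lambda>y. L * dist_n n y x) x" by (simp add: continuous_on_eq_continuous_at)
    then have "((\<lambda>y. L * dist_n n y x) \<longlongrightarrow> 0) (at x)" by (simp add: isCont_def)
    then have "((\<lambda>y. g y - g x) \<longlongrightarrow> 0) (at x)"
      by (rule Lim_null_comparison[rotated]) (use lipschitz in auto)
    then show "isCont g x" unfolding isCont_def by (rule LIM_zero_cancel)
  qed
  then have "g \<in> borel_measurable borel" by (rule borel_measurable_continuous_onI)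
  from measurable_compose[OF id_measurable this] show ?thesis .
qed

lemma gauss_pair_component_abs_moments:
  assumes i: "i < n"
  shows "has_bochner_integral (gauss_pair n) (\<lambda>p. \<bar>fst p i\<bar>) (sqrt (2 / pi))"
    "has_bochner_integral (gauss_pair n) (\<lambda>p. \<bar>snd p i\<bar>) (sqrt (2 / pi))"
proof -
  have m: "(\<lambda>x. \<bar>x i\<bar>) \<in> borel_measurable (gauss n)" using measurable_gauss_coord[OF i] by measurable
  note moment = gauss_component_abs_moment[OF i]
  show "has_bochner_integral (gauss_pair n) (\<lambda>p. \<bar>fst p i\<bar>) (sqrt (2 / pi))"
    using moment gauss_pair.integral_fst_marginal[OF m] gauss_pair.integrable_fst_marginal[OF m]
    by (simp add: has_bochner_integral_iff)
  show "has_bochner_integral (gauss_pair n) (\<lambda>p. \<bar>snd p i\<bar>) (sqrt (2 / pi))"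
    using moment gauss_pair.integral_snd_marginal[OF m] gauss_pair.integrable_snd_marginal[OF m]
    by (simp add: has_bochner_integral_iff)
qed

lemma rot_change_lipschitz_le:
  assumes g: "unit_bounded n g" and lipschitz: "\<And>x y. \<bar>g x - g y\<bar> \<le> \<Lambda> * dist_n n x y"
    and \<Lambda>: "0 \<le> \<Lambda>" and \<tau>: "0 < \<tau>" "\<tau> < 1"
  shows "rot_change n {..<n} g \<tau> \<le> \<Lambda> * (2 * real n * \<tau>)"
proof -
  let ?a = "cos \<tau>" and ?b = "sin \<tau>" and ?w = "sqrt (2 / pi)"
  have b_nonneg: "0 \<le> ?b" using \<tau> sin_gt_zero_02[of \<tau>] by simp
  let ?W = "\<lambda>p. \<Lambda> * (\<Sum>i<n. (1 - ?a) * \<bar>fst p i\<bar> + ?b * \<bar>snd p i\<bar>)"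
  have "has_bochner_integral (gauss_pair n) ?W (\<Lambda> * (\<Sum>i<n. (1 - ?a) * ?w + ?b * ?w))"
    by (intro has_bochner_integral_mult_right has_bochner_integral_sum has_bochner_integral_add
        gauss_pair_component_abs_moments) auto
  then have W: "integrable (gauss_pair n) ?W" "(\<integral>p. ?W p \<partial>gauss_pair n) = \<Lambda> * (\<Sum>i<n. (1 - ?a) * ?w + ?b * ?w)"
    by (simp_all only: has_bochner_integral_iff)
  have "rot_change n {..<n} g \<tau> \<le> (\<integral>p. ?W p \<partial>gauss_pair n)"
    unfolding rot_change_def
  proof (rule integral_mono[OF _ W(1)])
    fix p :: "(nat \<Rightarrow> real) \<times> (nat \<Rightarrow> real)"
    let ?x' = "rot n {..<n} \<tau> (fst p) (snd p)"
    have "dist_n n ?x' (fst p) \<le> (\<Sum>i<n. \<bar>?x' i - fst p i\<bar>)"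
      unfolding dist_n_norm by (rule norm_n_le_sum_abs)
    also have "\<dots> \<le> (\<Sum>i<n. (1 - ?a) * \<bar>fst p i\<bar> + ?b * \<bar>snd p i\<bar>)"
    proof (rule sum_mono)
      fix i assume "i \<in> {..<n}"
      then have "?x' i - fst p i = ?b * snd p i - (1 - ?a) * fst p i"
        by (simp add: rot_full algebra_simps)
      then show "\<bar>?x' i - fst p i\<bar> \<le> (1 - ?a) * \<bar>fst p i\<bar> + ?b * \<bar>snd p i\<bar>"
        using b_nonneg abs_triangle_ineq4[of "?b * snd p i" "(1 - ?a) * fst p i"] by (simp add: abs_mult)
    qed
    finally show "\<bar>g ?x' - g (fst p)\<bar> \<le> ?W p"
      using lipschitz[of ?x' "fst p"] \<Lambda> by (meson mult_left_mono order_trans)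
  qed (use integrable_rot_diff[OF g] in auto)
  also have "\<dots> \<le> \<Lambda> * (\<Sum>i<n. 2 * \<tau>)"
    unfolding W(2)
  proof (intro mult_left_mono[OF _ \<Lambda>] sum_mono)
    have "1 - ?a \<le> \<tau>\<^sup>2 / 2" by (rule one_minus_cos_le)
    also have "\<dots> \<le> \<tau>" using \<tau> by (simp add: power2_eq_square)
    finally have "1 - ?a + ?b \<le> 2 * \<tau>" using sin_x_le_x[of \<tau>] \<tau> by linarith
    then have "?w * (1 - ?a + ?b) \<le> 1 * (2 * \<tau>)" using sqrt_2_pi_bounds(2) \<tau> b_nonneg by (intro mult_mono) auto
    then show "(1 - ?a) * ?w + ?b * ?w \<le> 2 * \<tau>" by (simp add: algebra_simps)
  qed
  finally show ?thesis by (simp add: mult_ac)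
qed

text \<open>The smoothings of \<open>g\<close> at a scale much below \<open>r\<close> have gradients concentrated on \<open>E\<close>.\<close>

locale shell_lipschitz =
  fixes n :: nat and g :: "(nat \<Rightarrow> real) \<Rightarrow> real" and E :: "(nat \<Rightarrow> real) set" and \<Lambda> r :: real
  assumes unit_bounded: "unit_bounded n g" and shell [measurable]: "E \<in> sets (gauss n)"
    and \<Lambda>: "0 \<le> \<Lambda>" and r: "0 < r"
    and lipschitz: "\<And>x y. \<bar>g x - g y\<bar> \<le> \<Lambda> * dist_n n x y"
    and local_const: "\<And>x y. x \<in> space (gauss n) \<Longrightarrow> x \<notin> E \<Longrightarrow> dist_n n y x \<le> r \<Longrightarrow> g y = g x"
begin

lemma mehler_increment_le:
  assumes \<tau>: "0 < \<tau>" "\<tau> < 1" and near: "cos \<tau> * norm_n n d \<le> r"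
  shows "mehler n \<tau> g (\<lambda>i. x i + d i) - mehler n \<tau> g x
    \<le> cos \<tau> * norm_n n d * (\<Lambda> * (\<integral>z. indicator E (lincomb n (cos \<tau>) (sin \<tau>) x z) \<partial>gauss n))"
proof -
  let ?m = "lincomb n (cos \<tau>) (sin \<tau>)" and ?x' = "\<lambda>i. x i + d i"
  have cos_pos: "0 < cos \<tau>" using \<tau> pi_gt3 by (simp add: cos_gt_zero)
  have dist: "dist_n n (?m ?x' z) (?m x z) = cos \<tau> * norm_n n d" for z
  proof -
    have "dist_n n (?m ?x' z) (?m x z) = norm_n n (\<lambda>i. cos \<tau> * d i)"
      unfolding dist_n_norm norm_n_def by (intro arg_cong[of _ _ sqrt] sum.cong) (auto simp: algebra_simps)
    then show ?thesis using cos_pos by (simp add: norm_n_cmult)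
  qed
  have "mehler n \<tau> g ?x' - mehler n \<tau> g x = (\<integral>z. g (?m ?x' z) - g (?m x z) \<partial>gauss n)"
    unfolding smooth_def using integrable_unit_bounded_mix[OF unit_bounded] by simp
  also have "\<dots> \<le> (\<integral>z. cos \<tau> * norm_n n d * \<Lambda> * indicator E (?m x z) \<partial>gauss n)"
  proof (rule integral_mono)
    show "integrable (gauss n) (\<lambda>z. cos \<tau> * norm_n n d * \<Lambda> * indicator E (?m x z))"
      by (intro integrable_mult_right integrable_unit_bounded_mix unit_bounded_indicator shell)
    show "g (?m ?x' z) - g (?m x z) \<le> cos \<tau> * norm_n n d * \<Lambda> * indicator E (?m x z)" for z
    proof (cases "?m x z \<in> E")
      case True
      then show ?thesis using lipschitz[of "?m ?x' z" "?m x z"] by (simp add: dist abs_le_iff mult_ac)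
    next
      case False
      then show ?thesis using local_const[of "?m x z" "?m ?x' z"] near by (simp add: dist)
    qed
  qed (use integrable_unit_bounded_mix[OF unit_bounded] in auto)
  finally show ?thesis by (simp add: mult.assoc)
qed

lemma norm_mehler_grad_le:
  assumes \<tau>: "0 < \<tau>" "\<tau> < 1"
  shows "norm_n n (smooth_grad n (\<lambda>_. cos \<tau>) (\<lambda>_. sin \<tau>) g x)
    \<le> \<Lambda> * (\<integral>z. indicator E (lincomb n (cos \<tau>) (sin \<tau>) x z) \<partial>gauss n)"
proof -
  let ?grad = "smooth_grad n (\<lambda>_. cos \<tau>) (\<lambda>_. sin \<tau>) g x" and ?C = "3 * (cos \<tau> / sin \<tau>)\<^sup>2"
  let ?v = "norm_n n ?grad" and ?P = "\<integral>z. (indicator E (lincomb n (cos \<tau>) (sin \<tau>) x z) :: real) \<partial>gauss n"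
  interpret coord_taylor n "{..<n}" "mehler n \<tau> g" "smooth_grad n (\<lambda>_. cos \<tau>) (\<lambda>_. sin \<tau>) g" "cos \<tau> / sin \<tau>" ?C
    by (rule coord_taylor_mehler[OF unit_bounded \<tau>])
  have P: "0 \<le> ?P" by (rule Bochner_Integration.integral_nonneg) simp
  have cos_bounds: "0 < cos \<tau>" "cos \<tau> \<le> 1" using \<tau> pi_gt3 by (auto simp: cos_gt_zero)
  show ?thesis
  proof (cases "?v = 0")
    case True
    then show ?thesis using \<Lambda> P by simp
  next
    case False
    then have v: "0 < ?v" using norm_n_nonneg[of n ?grad] by linarith
    have step: "?v \<le> cos \<tau> * (\<Lambda> * ?P) + ?C * ?v * \<rho>" if \<rho>: "0 < \<rho>" "\<rho> < r / (cos \<tau> * ?v)" for \<rho>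
    proof -
      let ?x' = "\<lambda>i. x i + \<rho> * ?grad i"
      have norm: "norm_n n (\<lambda>i. \<rho> * ?grad i) = \<rho> * ?v" using \<rho> by (simp add: norm_n_cmult)
      have "cos \<tau> * (\<rho> * ?v) \<le> r" using \<rho>(2) cos_bounds v by (simp add: pos_less_divide_eq mult_ac)
      then have "mehler n \<tau> g ?x' - mehler n \<tau> g x \<le> cos \<tau> * (\<rho> * ?v) * (\<Lambda> * ?P)"
        using mehler_increment_le[OF \<tau>, of "\<lambda>i. \<rho> * ?grad i" x] by (simp add: norm)
      moreover have "inner_n n ?grad (\<lambda>i. ?x' i - x i) = \<rho> * ?v\<^sup>2"
        by (simp add: inner_n_self[symmetric] inner_n_def sum_distrib_left mult_ac)
      moreover have "dist_n n ?x' x = \<rho> * ?v" by (simp add: dist_n_norm norm)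
      ultimately have "\<rho> * ?v\<^sup>2 \<le> cos \<tau> * (\<rho> * ?v) * (\<Lambda> * ?P) + ?C * (\<rho> * ?v)\<^sup>2"
        using taylor[of ?x' x] by (simp add: abs_le_iff)
      then have "(\<rho> * ?v) * ?v \<le> (\<rho> * ?v) * (cos \<tau> * (\<Lambda> * ?P) + ?C * ?v * \<rho>)"
        by (simp add: power2_eq_square algebra_simps)
      then show ?thesis using \<rho>(1) v by (simp only: mult_le_cancel_left_pos mult_pos_pos)
    qed
    have "((\<lambda>\<rho>. cos \<tau> * (\<Lambda> * ?P) + ?C * ?v * \<rho>) \<longlongrightarrow> cos \<tau> * (\<Lambda> * ?P) + ?C * ?v * 0) (at_right 0)"
      by (intro tendsto_intros)
    moreover have "\<forall>\<^sub>F \<rho> in at_right 0. ?v \<le> cos \<tau> * (\<Lambda> * ?P) + ?C * ?v * \<rho>"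
      using step cos_bounds v r by (intro eventually_at_rightI[of 0 "r / (cos \<tau> * ?v)"]) auto
    ultimately have "?v \<le> cos \<tau> * (\<Lambda> * ?P) + ?C * ?v * 0" by (rule tendsto_lowerbound) simp
    moreover have "cos \<tau> * (\<Lambda> * ?P) \<le> \<Lambda> * ?P" using cos_bounds \<Lambda> P by (simp add: mult_left_le_one_le)
    ultimately show ?thesis by linarith
  qed
qed

lemma rot_change_mehler_le:
  assumes \<tau>: "0 < \<tau>" "\<tau> < 1" and \<theta>: "0 \<le> \<theta>"
  shows "rot_change n {..<n} (mehler n \<tau> g) \<theta> \<le> \<theta> * sqrt (2 / pi) * (\<Lambda> * measure (gauss n) E)"
proof -
  let ?grad = "smooth_grad n (\<lambda>_. cos \<tau>) (\<lambda>_. sin \<tau>) g" and ?m = "lincomb n (cos \<tau>) (sin \<tau>)"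
  interpret coord_taylor n "{..<n}" "mehler n \<tau> g" ?grad "cos \<tau> / sin \<tau>" "3 * (cos \<tau> / sin \<tau>)\<^sup>2"
    by (rule coord_taylor_mehler[OF _ \<tau>]) (rule unit_bounded)
  have E: "unit_bounded n (indicator E)" by (rule unit_bounded_indicator[OF shell])
  have "integrable (gauss n) (mehler n \<tau> (indicator E))" by (rule integrable_unit_bounded[OF unit_bounded_smooth[OF E]])
  then have inner: "integrable (gauss n) (\<lambda>x. \<integral>z. (indicator E (?m x z) :: real) \<partial>gauss n)" by (simp add: smooth_def[abs_def])
  have pair: "integrable (gauss_pair n) (\<lambda>p. indicator E (?m (fst p) (snd p)) :: real)"
    by (rule gauss_pair.integrable_bounded[of _ _ 1]) (auto simp: indicator_def)
  have "(\<integral>x. norm_n n (?grad x) \<partial>gauss n) \<le> (\<integral>x. \<Lambda> * (\<integral>z. indicator E (?m x z) \<partial>gauss n) \<partial>gauss n)"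
    by (rule integral_mono[OF integrable_norm_grad integrable_mult_right[OF inner]]) (rule norm_mehler_grad_le[OF \<tau>])
  also have "\<dots> = \<Lambda> * (\<integral>p. indicator E (?m (fst p) (snd p)) \<partial>gauss_pair n)"
    using gauss_pair.integral_fst'[OF pair] by simp
  also have "\<dots> = \<Lambda> * measure (gauss n) E" by (subst integral_mix) auto
  finally have "\<theta> * sqrt (2 / pi) * (\<integral>x. norm_n n (?grad x) \<partial>gauss n) \<le> \<theta> * sqrt (2 / pi) * (\<Lambda> * measure (gauss n) E)"
    using \<theta> by (intro mult_left_mono) auto
  with rot_change_le_mean_grad[OF \<theta>] show ?thesis by (rule order_trans)
qed

lemma rot_change_le:
  assumes \<theta>: "0 \<le> \<theta>"
  shows "rot_change n {..<n} g \<theta> \<le> \<theta> * sqrt (2 / pi) * (\<Lambda> * measure (gauss n) E)"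
proof -
  let ?B = "\<theta> * sqrt (2 / pi) * (\<Lambda> * measure (gauss n) E)"
  have smoothed: "rot_change n {..<n} g \<theta> \<le> ?B + 2 * (\<Lambda> * (2 * real n * \<tau>))" if \<tau>: "0 < \<tau>" "\<tau> < 1" for \<tau>
  proof -
    have "(\<integral>x. \<bar>g x - mehler n \<tau> g x\<bar> \<partial>gauss n) \<le> \<Lambda> * (2 * real n * \<tau>)"
      by (rule order_trans[OF integral_abs_diff_mehler_le[OF unit_bounded] rot_change_lipschitz_le[OF unit_bounded lipschitz \<Lambda> \<tau>]])
    then show ?thesis
      using rot_change_perturb[OF unit_bounded unit_bounded_smooth[OF unit_bounded], of "{..<n}" \<theta> "\<lambda>_. cos \<tau>" "\<lambda>_. sin \<tau>"]
        rot_change_mehler_le[OF \<tau> \<theta>] by linarith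
  qed
  have "((\<lambda>\<tau>. ?B + 2 * (\<Lambda> * (2 * real n * \<tau>))) \<longlongrightarrow> ?B + 2 * (\<Lambda> * (2 * real n * 0))) (at_right 0)"
    by (intro tendsto_intros)
  moreover have "\<forall>\<^sub>F \<tau> in at_right 0. rot_change n {..<n} g \<theta> \<le> ?B + 2 * (\<Lambda> * (2 * real n * \<tau>))"
    using smoothed by (intro eventually_at_rightI[of 0 1]) auto
  ultimately have "rot_change n {..<n} g \<theta> \<le> ?B + 2 * (\<Lambda> * (2 * real n * 0))" by (rule tendsto_lowerbound) simp
  then show ?thesis by simp
qed

end

definition infdist_n :: "nat \<Rightarrow> (nat \<Rightarrow> real) \<Rightarrow> (nat \<Rightarrow> real) set \<Rightarrow> real"
  where "infdist_n n x A = Inf (dist_n n x ` A)"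

definition cutoff :: "nat \<Rightarrow> (nat \<Rightarrow> real) set \<Rightarrow> real \<Rightarrow> (nat \<Rightarrow> real) \<Rightarrow> real"
  where "cutoff n A \<delta> x = max 0 (min 1 ((\<delta> - \<delta>\<^sup>2 - infdist_n n x A) / (\<delta> - 2 * \<delta>\<^sup>2)))"

context
  fixes n :: nat and A :: "(nat \<Rightarrow> real) set"
  assumes nonempty: "A \<noteq> {}"
begin

lemma infdist_n_le: "a \<in> A \<Longrightarrow> infdist_n n x A \<le> dist_n n x a"
  unfolding infdist_n_def by (rule cInf_lower) (auto intro!: bdd_belowI[of _ 0])

lemma infdist_n_nonneg: "0 \<le> infdist_n n x A"
  unfolding infdist_n_def by (rule cInf_greatest) (use nonempty in auto)

lemma infdist_n_zero: "x \<in> A \<Longrightarrow> infdist_n n x A = 0"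
  using infdist_n_le[of x x] infdist_n_nonneg[of x] by simp

lemma infdist_n_lipschitz: "\<bar>infdist_n n x A - infdist_n n y A\<bar> \<le> dist_n n x y"
proof -
  have "infdist_n n x A \<le> dist_n n x y + infdist_n n y A" for x y
  proof -
    have "infdist_n n x A - dist_n n x y \<le> infdist_n n y A"
      unfolding infdist_n_def[of n y A]
    proof (rule cInf_greatest)
      fix d assume "d \<in> dist_n n y ` A"
      then obtain a where a: "a \<in> A" "d = dist_n n y a" by auto
      show "infdist_n n x A - dist_n n x y \<le> d"
        using infdist_n_le[OF a(1), of x] dist_n_triangle[of n x a y] a(2) by simp
    qed (use nonempty in auto)
    then show ?thesis by simp
  qed
  from this[of x y] this[of y x] show ?thesis by (auto simp: dist_n_commute abs_le_iff)
qed

lemma measurable_infdist_n [measurable]: "(\<lambda>x. infdist_n n x A) \<in> borel_measurable (gauss n)"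
  by (rule borel_measurable_lipschitz_n[of _ 1]) (use infdist_n_lipschitz in simp)

lemma enlarge_eq_infdist: "enlarge n A \<delta> = {x \<in> space (gauss n). infdist_n n x A \<le> \<delta>}"
proof -
  have "bdd_below (dist_n n x ` A)" for x by (auto intro!: bdd_belowI[of _ 0])
  from ereal_Inf'[OF this] have "setdist_n n x A = ereal (infdist_n n x A)" for x
    unfolding setdist_n_def infdist_n_def using nonempty by (simp add: image_comp)
  then show ?thesis by (simp add: enlarge_def)
qed

lemma measurable_cutoff [measurable]: "cutoff n A \<delta> \<in> borel_measurable (gauss n)"
  unfolding cutoff_def by measurable

lemma unit_bounded_cutoff: "unit_bounded n (cutoff n A \<delta>)"
  unfolding unit_bounded_def using measurable_cutoff by (auto simp: cutoff_def)

lemma cutoff_width_pos: "0 < \<delta> \<Longrightarrow> \<delta> < 1 / 2 \<Longrightarrow> 0 < \<delta> - 2 * \<delta>\<^sup>2" for \<delta> :: real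
  by (simp add: power2_eq_square)

lemma cutoff_eq_1: "0 < \<delta> \<Longrightarrow> \<delta> < 1 / 2 \<Longrightarrow> infdist_n n x A \<le> \<delta>\<^sup>2 \<Longrightarrow> cutoff n A \<delta> x = 1"
  using cutoff_width_pos[of \<delta>] by (simp add: cutoff_def pos_le_divide_eq min_def max_def)

lemma cutoff_eq_0:
  assumes "0 < \<delta>" "\<delta> < 1 / 2" "\<delta> - \<delta>\<^sup>2 \<le> infdist_n n x A"
  shows "cutoff n A \<delta> x = 0"
proof -
  have "(\<delta> - \<delta>\<^sup>2 - infdist_n n x A) / (\<delta> - 2 * \<delta>\<^sup>2) \<le> 0"
    using assms cutoff_width_pos by (simp add: divide_nonpos_pos)
  then show ?thesis by (simp add: cutoff_def)
qed

lemma cutoff_lipschitz: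
  assumes \<delta>: "0 < \<delta>" "\<delta> < 1 / 2"
  shows "\<bar>cutoff n A \<delta> x - cutoff n A \<delta> y\<bar> \<le> 1 / (\<delta> - 2 * \<delta>\<^sup>2) * dist_n n x y"
proof -
  let ?K = "\<delta> - 2 * \<delta>\<^sup>2"
  have clip: "\<bar>max 0 (min 1 a) - max 0 (min 1 b)\<bar> \<le> \<bar>a - b\<bar>" for a b :: real by linarith
  have "\<bar>cutoff n A \<delta> x - cutoff n A \<delta> y\<bar> \<le> \<bar>(\<delta> - \<delta>\<^sup>2 - infdist_n n x A) / ?K - (\<delta> - \<delta>\<^sup>2 - infdist_n n y A) / ?K\<bar>"
    unfolding cutoff_def by (rule clip)
  also have "\<dots> = \<bar>infdist_n n x A - infdist_n n y A\<bar> / ?K"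
    using cutoff_width_pos[OF \<delta>] by (simp add: diff_divide_distrib[symmetric] abs_minus_commute)
  also have "\<dots> \<le> dist_n n x y / ?K"
    using infdist_n_lipschitz cutoff_width_pos[OF \<delta>] by (intro divide_right_mono) auto
  finally show ?thesis by simp
qed

lemma shell_lipschitz_cutoff:
  assumes A: "A \<in> sets (gauss n)" and \<delta>: "0 < \<delta>" "\<delta> < 1 / 2"
  shows "shell_lipschitz n (cutoff n A \<delta>) (enlarge n A \<delta> - A) (1 / (\<delta> - 2 * \<delta>\<^sup>2)) (\<delta>\<^sup>2)"
proof
  show "enlarge n A \<delta> - A \<in> sets (gauss n)" unfolding enlarge_eq_infdist using A by measurable
  fix x y assume x: "x \<in> space (gauss n)" "x \<notin> enlarge n A \<delta> - A" and "dist_n n y x \<le> \<delta>\<^sup>2"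
  then have near: "\<bar>infdist_n n y A - infdist_n n x A\<bar> \<le> \<delta>\<^sup>2" using infdist_n_lipschitz order_trans by blast
  from x consider (inside) "x \<in> A" | (outside) "infdist_n n x A > \<delta>" by (auto simp: enlarge_eq_infdist)
  then show "cutoff n A \<delta> y = cutoff n A \<delta> x"
  proof cases
    case inside
    then have "infdist_n n x A = 0" by (rule infdist_n_zero)
    then show ?thesis using near cutoff_eq_1[OF \<delta>, of x] cutoff_eq_1[OF \<delta>, of y] by auto
  next
    case outside
    then have "\<delta> - \<delta>\<^sup>2 \<le> infdist_n n x A" "\<delta> - \<delta>\<^sup>2 \<le> infdist_n n y A" using near zero_le_power2[of \<delta>] by linarith+
    then show ?thesis using cutoff_eq_0[OF \<delta>] by simp
  qed
qed (use \<delta> unit_bounded_cutoff cutoff_lipschitz cutoff_width_pos[OF \<delta>] in auto)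

lemma abs_indicator_minus_cutoff_le:
  assumes \<delta>: "0 < \<delta>" "\<delta> < 1 / 2" and x: "x \<in> space (gauss n)"
  shows "\<bar>indicator A x - cutoff n A \<delta> x\<bar> \<le> indicator (enlarge n A \<delta> - A) x"
proof -
  consider (inside) "x \<in> A" | (shell) "x \<in> enlarge n A \<delta> - A" | (outside) "x \<notin> A" "\<delta> < infdist_n n x A"
    using x by (force simp: enlarge_eq_infdist)
  then show ?thesis
  proof cases
    case inside
    then show ?thesis using infdist_n_zero cutoff_eq_1[OF \<delta>] by simp
  next
    case shell
    then show ?thesis by (auto simp: cutoff_def)
  next
    case outside
    then have "\<delta> - \<delta>\<^sup>2 \<le> infdist_n n x A" using zero_le_power2[of \<delta>] by linarith
    then show ?thesis using outside cutoff_eq_0[OF \<delta>] by simp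
  qed
qed

lemma rot_change_indicator_le_shell:
  assumes A: "A \<in> sets (gauss n)" and \<delta>: "0 < \<delta>" "\<delta> < 1 / 2" and \<theta>: "0 \<le> \<theta>"
  shows "rot_change n {..<n} (indicator A) \<theta>
    \<le> measure (gauss n) (enlarge n A \<delta> - A) * (\<theta> * sqrt (2 / pi) / (\<delta> - 2 * \<delta>\<^sup>2) + 2)"
proof -
  let ?E = "enlarge n A \<delta> - A"
  interpret shell_lipschitz n "cutoff n A \<delta>" ?E "1 / (\<delta> - 2 * \<delta>\<^sup>2)" "\<delta>\<^sup>2"
    by (rule shell_lipschitz_cutoff[OF A \<delta>])
  have \<chi>: "unit_bounded n (indicator A)" "unit_bounded n (indicator ?E)"
    using A shell by (auto intro: unit_bounded_indicator)
  have "(\<integral>x. \<bar>indicator A x - cutoff n A \<delta> x\<bar> \<partial>gauss n) \<le> (\<integral>x. indicator ?E x \<partial>gauss n)"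
    by (intro integral_mono integrable_abs_diff_unit_bounded \<chi> unit_bounded integrable_unit_bounded
        abs_indicator_minus_cutoff_le \<delta>)
  also have "\<dots> = measure (gauss n) ?E" using shell by simp
  finally show ?thesis
    using rot_change_perturb[OF \<chi>(1) unit_bounded, of "{..<n}" \<theta>] rot_change_le[OF \<theta>]
    by (simp add: algebra_simps)
qed

end

lemma gsa_le_imp_shell:
  assumes "gsa n A \<le> ereal s" "0 < e" "0 < d"
  shows "\<exists>\<delta>. 0 < \<delta> \<and> \<delta> < d \<and> measure (gauss n) (enlarge n A \<delta> - A) < (s + e) * \<delta>"
proof (rule ccontr)
  assume "\<not> ?thesis"
  then have "s + e \<le> measure (gauss n) (enlarge n A \<delta> - A) / \<delta>" if "0 < \<delta>" "\<delta> < d" for \<delta>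
    using that by (metis not_less pos_le_divide_eq)
  then have "\<forall>\<^sub>F \<delta> in at_right 0. ereal (s + e) \<le> ereal (measure (gauss n) (enlarge n A \<delta> - A) / \<delta>)"
    using assms(3) by (intro eventually_at_rightI[of 0 d]) auto
  then have "ereal (s + e) \<le> gsa n A" unfolding gsa_def by (rule Liminf_bounded)
  with assms show False by (metis ereal_less_eq(3) less_add_same_cancel1 not_less order_trans)
qed

lemma rot_change_indicator_le:
  assumes A: "A \<in> sets (gauss n)" and s: "gsa n A \<le> ereal s" "0 \<le> s" and \<theta>: "0 \<le> \<theta>"
  shows "rot_change n {..<n} (indicator A) \<theta> \<le> \<theta> * sqrt (2 / pi) * s"
proof (cases "A = {}")
  case True
  then show ?thesis using s(2) \<theta> by (simp add: rot_change_def)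
next
  case nonempty: False
  let ?c = "\<theta> * sqrt (2 / pi)"
  have bound: "rot_change n {..<n} (indicator A) \<theta> \<le> (s + e) * (?c / (1 - 2 * e) + 2 * e)" if e: "0 < e" "e < 1 / 2" for e
  proof -
    obtain \<delta> where \<delta>: "0 < \<delta>" "\<delta> < e" and m: "measure (gauss n) (enlarge n A \<delta> - A) < (s + e) * \<delta>"
      using gsa_le_imp_shell[OF s(1) e(1) e(1)] by blast
    have width: "\<delta> - 2 * \<delta>\<^sup>2 = \<delta> * (1 - 2 * \<delta>)" by (simp add: power2_eq_square algebra_simps)
    have "rot_change n {..<n} (indicator A) \<theta> \<le> measure (gauss n) (enlarge n A \<delta> - A) * (?c / (\<delta> - 2 * \<delta>\<^sup>2) + 2)"
      by (rule rot_change_indicator_le_shell[OF nonempty A \<delta>(1) _ \<theta>]) (use \<delta> e in linarith)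
    also have "\<dots> \<le> ((s + e) * \<delta>) * (?c / (\<delta> - 2 * \<delta>\<^sup>2) + 2)"
      using m \<theta> \<delta> e by (intro mult_right_mono) (auto simp: width)
    also have "\<dots> = (s + e) * (?c / (1 - 2 * \<delta>) + 2 * \<delta>)"
    proof -
      have "(u * t) * (c / (t * k) + 2) = u * (c / k + 2 * t)" if "t \<noteq> 0" for c u t k :: real
        using that by (simp add: distrib_left mult.commute mult.left_commute)
      then show ?thesis using \<delta>(1) unfolding width by simp
    qed
    also have "\<dots> \<le> (s + e) * (?c / (1 - 2 * e) + 2 * e)"
      using \<delta> e \<theta> s(2) by (intro mult_left_mono add_mono divide_left_mono mult_pos_pos) auto
    finally show ?thesis .
  qed
  have "((\<lambda>e. (s + e) * (?c / (1 - 2 * e) + 2 * e)) \<longlongrightarrow> (s + 0) * (?c / (1 - 2 * 0) + 2 * 0)) (at_right 0)"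
    by (intro tendsto_intros) simp
  moreover have "\<forall>\<^sub>F e in at_right 0. rot_change n {..<n} (indicator A) \<theta> \<le> (s + e) * (?c / (1 - 2 * e) + 2 * e)"
    using bound by (intro eventually_at_rightI[of 0 "1 / 2"]) auto
  ultimately have "rot_change n {..<n} (indicator A) \<theta> \<le> (s + 0) * (?c / (1 - 2 * 0) + 2 * 0)"
    by (rule tendsto_lowerbound) simp
  then show ?thesis by (simp add: mult.commute)
qed

definition sign_function :: "nat \<Rightarrow> ((nat \<Rightarrow> real) \<Rightarrow> real) \<Rightarrow> bool"
  where "sign_function n f \<longleftrightarrow> f \<in> borel_measurable (gauss n) \<and> is_pm1 n f"

lemma sign_function_measurable: "sign_function n f \<Longrightarrow> f \<in> borel_measurable (gauss n)"
  by (simp add: sign_function_def)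

lemma sign_function_cases: "sign_function n f \<Longrightarrow> x \<in> space (gauss n) \<Longrightarrow> f x = 1 \<or> f x = - 1"
  by (auto simp: sign_function_def is_pm1_def)

lemma unit_bounded_sign_function: "sign_function n f \<Longrightarrow> unit_bounded n f"
  by (auto simp: unit_bounded_def sign_function_def is_pm1_def)

lemma rot_change_sign_function_le:
  assumes f: "sign_function n f" and s: "surf n f \<le> ereal s" "0 \<le> s" and \<theta>: "0 \<le> \<theta>"
  shows "rot_change n {..<n} f \<theta> \<le> 2 * (\<theta> * sqrt (2 / pi) * s)"
proof -
  note [measurable] = sign_function_measurable[OF f]
  define A where "A = {x \<in> space (gauss n). f x = 1}"
  have A: "A \<in> sets (gauss n)" unfolding A_def by measurable
  have "f x = 2 * indicator A x - 1" if "x \<in> space (gauss n)" for x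
    using sign_function_cases[OF f that] that by (auto simp: A_def)
  then have "\<bar>f x - f y\<bar> = 2 * \<bar>indicator A x - indicator A y\<bar>" if "x \<in> space (gauss n)" "y \<in> space (gauss n)" for x y
    using that by (simp add: abs_if)
  then have "rot_change n {..<n} f \<theta>
      = (\<integral>p. 2 * \<bar>indicator A (rot n {..<n} \<theta> (fst p) (snd p)) - indicator A (fst p)\<bar> \<partial>gauss_pair n)"
    unfolding rot_change_def by (intro Bochner_Integration.integral_cong) (auto simp: space_pair_measure)
  then have "rot_change n {..<n} f \<theta> = 2 * rot_change n {..<n} (indicator A) \<theta>" by (simp add: rot_change_def)
  then show ?thesis
    using rot_change_indicator_le[OF A _ s(2) \<theta>] s(1) by (simp add: surf_def A_def)
qed

section \<open>Level sets and the coarea inequality\<close>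



locale upper_gradient =
  fixes n :: nat and H w :: "(nat \<Rightarrow> real) \<Rightarrow> real" and L :: real
  assumes measurable_H [measurable]: "H \<in> borel_measurable (gauss n)"
    and integrable_w: "integrable (gauss n) w"
    and w_nonneg: "\<And>x. 0 \<le> w x" and L_nonneg: "0 \<le> L"
    and upper_taylor: "\<And>x y. x \<in> space (gauss n) \<Longrightarrow> y \<in> space (gauss n) \<Longrightarrow>
      H y \<le> H x + w x * dist_n n x y + L * (dist_n n x y)\<^sup>2"
begin

lemma measurable_w [measurable]: "w \<in> borel_measurable (gauss n)"
  using integrable_w by (rule borel_measurable_integrable)

definition superlevel :: "real \<Rightarrow> (nat \<Rightarrow> real) set"
  where "superlevel \<tau> = {x \<in> space (gauss n). \<tau> \<le> H x}"

definition band :: "real \<Rightarrow> real \<Rightarrow> (nat \<Rightarrow> real) set"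
  where "band d \<tau> = {x \<in> space (gauss n). H x < \<tau> \<and> \<tau> \<le> H x + (w x * d + L * d\<^sup>2)}"

lemma measurable_band [measurable]: "band d \<tau> \<in> sets (gauss n)"
  unfolding band_def by measurable

lemma enlarge_superlevel_subset_band: "enlarge n (superlevel \<tau>) d - superlevel \<tau> \<subseteq> band d \<tau>"
proof
  fix x assume x: "x \<in> enlarge n (superlevel \<tau>) d - superlevel \<tau>"
  then have space: "x \<in> space (gauss n)" and below: "H x < \<tau>" and dist: "setdist_n n x (superlevel \<tau>) \<le> ereal d"
    by (auto simp: enlarge_def superlevel_def)
  have beyond: "\<tau> \<le> H x + (w x * t + L * t\<^sup>2)" if "d < t" for t
  proof -
    have "setdist_n n x (superlevel \<tau>) < ereal t"
      using dist that by (meson ereal_less_eq(3) less_ereal.simps(1) order.strict_trans1)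
    then obtain a where a: "a \<in> superlevel \<tau>" "dist_n n x a < t" unfolding setdist_n_def by (auto simp: INF_less_iff)
    then have "\<tau> \<le> H a" "a \<in> space (gauss n)" by (auto simp: superlevel_def)
    then have "\<tau> \<le> H x + w x * dist_n n x a + L * (dist_n n x a)\<^sup>2"
      using upper_taylor[OF space] order_trans by blast
    also have "\<dots> \<le> H x + w x * t + L * t\<^sup>2"
      using a(2) w_nonneg[of x] L_nonneg by (intro add_mono mult_left_mono power_mono) auto
    finally show ?thesis by simp
  qed
  have "((\<lambda>t. H x + (w x * t + L * t\<^sup>2)) \<longlongrightarrow> H x + (w x * d + L * d\<^sup>2)) (at_right d)"
    by (intro tendsto_intros)
  moreover have "\<forall>\<^sub>F t in at_right d. \<tau> \<le> H x + (w x * t + L * t\<^sup>2)"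
    by (rule eventually_mono[OF eventually_at_right_less]) (rule beyond)
  ultimately have "\<tau> \<le> H x + (w x * d + L * d\<^sup>2)"
    by (rule tendsto_lowerbound) simp
  then show "x \<in> band d \<tau>" using space below by (simp add: band_def)
qed

lemma emeasure_band:
  "emeasure (gauss n) (band d \<tau>) = (\<integral>\<^sup>+x. indicator {H x<..H x + (w x * d + L * d\<^sup>2)} \<tau> \<partial>gauss n)"
proof -
  have "emeasure (gauss n) (band d \<tau>) = (\<integral>\<^sup>+x. indicator (band d \<tau>) x \<partial>gauss n)" by simp
  also have "\<dots> = (\<integral>\<^sup>+x. indicator {H x<..H x + (w x * d + L * d\<^sup>2)} \<tau> \<partial>gauss n)"
    by (rule nn_integral_cong) (auto simp: band_def indicator_def)
  finally show ?thesis .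
qed

lemma measurable_indicator_band [measurable]:
  "(\<lambda>p. indicator {H (snd p)<..H (snd p) + (w (snd p) * d + L * d\<^sup>2)} (fst p) :: ennreal)
    \<in> borel_measurable (lborel \<Otimes>\<^sub>M gauss n)"
proof -
  have "(\<lambda>p. indicator {p. H (snd p) < fst p \<and> fst p \<le> H (snd p) + (w (snd p) * d + L * d\<^sup>2)} p :: ennreal)
    \<in> borel_measurable (lborel \<Otimes>\<^sub>M gauss n)" by measurable
  then show ?thesis by (simp add: indicator_def)
qed

lemma measurable_emeasure_band [measurable]: "(\<lambda>\<tau>. emeasure (gauss n) (band d \<tau>)) \<in> borel_measurable lborel"
  unfolding emeasure_band using measurable_indicator_band[of d] by measurable

lemma nn_integral_emeasure_band:
  assumes d: "0 \<le> d"
  shows "(\<integral>\<^sup>+\<tau>. emeasure (gauss n) (band d \<tau>) \<partial>lborel) = ennreal (d * ((\<integral>x. w x \<partial>gauss n) + L * d))"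
proof -
  interpret lborel_gauss: pair_sigma_finite lborel "gauss n" by unfold_locales
  have "(\<integral>\<^sup>+\<tau>. emeasure (gauss n) (band d \<tau>) \<partial>lborel)
      = (\<integral>\<^sup>+x. \<integral>\<^sup>+\<tau>. indicator {H x<..H x + (w x * d + L * d\<^sup>2)} \<tau> \<partial>lborel \<partial>gauss n)"
    unfolding emeasure_band using measurable_indicator_band[of d] by (intro lborel_gauss.Fubini'[symmetric]) simp
  also have "\<dots> = (\<integral>\<^sup>+x. ennreal (w x * d + L * d\<^sup>2) \<partial>gauss n)"
    using w_nonneg L_nonneg d by (intro nn_integral_cong) simp
  also have "\<dots> = ennreal (\<integral>x. w x * d + L * d\<^sup>2 \<partial>gauss n)"
    by (rule nn_integral_eq_integral) (use integrable_w w_nonneg L_nonneg d in auto)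
  also have "(\<integral>x. w x * d + L * d\<^sup>2 \<partial>gauss n) = d * ((\<integral>x. w x \<partial>gauss n) + L * d)"
    using integrable_w by (simp add: gauss.prob_space power2_eq_square algebra_simps)
  finally show ?thesis .
qed

lemma liminf_band_ge:
  assumes c: "ereal c < gsa n (superlevel \<tau>)" and d: "\<And>j. 0 < d j" "d \<longlonglongrightarrow> 0"
  shows "ennreal c \<le> liminf (\<lambda>j. ennreal (1 / d j) * emeasure (gauss n) (band (d j) \<tau>))"
proof -
  let ?E = "\<lambda>\<delta>. enlarge n (superlevel \<tau>) \<delta> - superlevel \<tau>"
  have "filterlim d (at_right 0) sequentially"
    unfolding filterlim_at by (intro conjI d(2) always_eventually) (auto simp: d(1) less_imp_neq[OF d(1), symmetric])
  moreover have "\<forall>\<^sub>F \<delta> in at_right 0. ereal c < ereal (measure (gauss n) (?E \<delta>) / \<delta>)"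
    using c unfolding gsa_def by (rule less_LiminfD)
  ultimately have "\<forall>\<^sub>F j in sequentially. ereal c < ereal (measure (gauss n) (?E (d j)) / d j)"
    unfolding filterlim_iff by blast
  then have "\<forall>\<^sub>F j in sequentially. ennreal c \<le> ennreal (1 / d j) * emeasure (gauss n) (band (d j) \<tau>)"
  proof (rule eventually_mono)
    fix j assume j: "ereal c < ereal (measure (gauss n) (?E (d j)) / d j)"
    have "measure (gauss n) (?E (d j)) \<le> measure (gauss n) (band (d j) \<tau>)"
      by (rule gauss.finite_measure_mono[OF enlarge_superlevel_subset_band]) simp
    then have "c \<le> 1 / d j * measure (gauss n) (band (d j) \<tau>)"
      using j d(1)[of j] by (simp add: field_simps)
    then show "ennreal c \<le> ennreal (1 / d j) * emeasure (gauss n) (band (d j) \<tau>)"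
      using d(1)[of j] by (simp add: gauss.emeasure_eq_measure ennreal_mult'[symmetric] ennreal_leI)
  qed
  then show ?thesis by (rule Liminf_bounded)
qed

lemma coarea_inequality:
  assumes lu: "l \<le> u" and c: "\<And>\<tau>. l < \<tau> \<Longrightarrow> \<tau> < u \<Longrightarrow> ereal c < gsa n (superlevel \<tau>)"
  shows "c * (u - l) \<le> (\<integral>x. w x \<partial>gauss n)"
proof (cases "0 \<le> c")
  case False
  then have "c * (u - l) \<le> 0" using lu by (simp add: mult_nonpos_nonneg)
  also have "0 \<le> (\<integral>x. w x \<partial>gauss n)" by (rule Bochner_Integration.integral_nonneg) (rule w_nonneg)
  finally show ?thesis .
next
  case True
  define d where "d j = 1 / real (Suc j)" for j
  have d: "0 < d j" for j by (simp add: d_def)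
  have d_lim: "d \<longlonglongrightarrow> 0" unfolding d_def using LIMSEQ_inverse_real_of_nat by (simp add: inverse_eq_divide)
  let ?W = "\<integral>x. w x \<partial>gauss n"
  have W: "0 \<le> ?W" by (rule Bochner_Integration.integral_nonneg) (rule w_nonneg)
  have integral_rate: "(\<integral>\<^sup>+\<tau>. ennreal (1 / d j) * emeasure (gauss n) (band (d j) \<tau>) \<partial>lborel) = ennreal (?W + L * d j)" for j
  proof -
    have "ennreal (1 / d j) * ennreal (d j * (?W + L * d j)) = ennreal (?W + L * d j)"
      using d[of j] W L_nonneg by (subst ennreal_mult[symmetric]) auto
    then show ?thesis
      by (simp add: nn_integral_cmult nn_integral_emeasure_band less_imp_le[OF d])
  qed
  have "ennreal (c * (u - l)) = (\<integral>\<^sup>+\<tau>. ennreal c * indicator {l<..<u} \<tau> \<partial>lborel)"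
    using True lu by (simp add: nn_integral_cmult ennreal_mult)
  also have "\<dots> \<le> (\<integral>\<^sup>+\<tau>. liminf (\<lambda>j. ennreal (1 / d j) * emeasure (gauss n) (band (d j) \<tau>)) \<partial>lborel)"
    using liminf_band_ge[OF c d d_lim] by (intro nn_integral_mono) (auto simp: indicator_def)
  also have "\<dots> \<le> liminf (\<lambda>j. \<integral>\<^sup>+\<tau>. ennreal (1 / d j) * emeasure (gauss n) (band (d j) \<tau>) \<partial>lborel)"
    by (rule nn_integral_liminf) simp
  also have "\<dots> = ennreal (?W + L * 0)"
    unfolding integral_rate by (rule lim_imp_Liminf, simp, intro tendsto_ennrealI tendsto_intros d_lim)
  finally show ?thesis using W by (simp add: ennreal_le_iff)
qed

lemma ex_superlevel_gsa_le:
  assumes "l \<le> u" "(\<integral>x. w x \<partial>gauss n) < c * (u - l)"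
  shows "\<exists>\<tau>. l < \<tau> \<and> \<tau> < u \<and> gsa n (superlevel \<tau>) \<le> ereal c"
  using coarea_inequality[of l u c] assms by (metis not_le)

end

section \<open>From noise stability to a nearby junta\<close>

definition junta_class :: "nat \<Rightarrow> nat \<Rightarrow> real \<Rightarrow> ((nat \<Rightarrow> real) \<Rightarrow> real) set"
  where "junta_class n k s = {g. sign_function n g \<and> linear_junta n k g \<and> surf n g \<le> ereal s}"

lemma linear_juntaI:
  assumes "m \<le> k" "orthonormal_n n m u"
    and "\<And>x. x \<in> space (gauss n) \<Longrightarrow> f x = g (\<lambda>j. if j < m then inner_n n (u j) x else 0)"
  shows "linear_junta n k f"
  unfolding linear_junta_def
proof (rule exI[where x = m], rule exI[where x = u], rule exI[where x = g], intro conjI)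
  show "\<forall>i<m. u i \<in> space (gauss n)" "\<forall>i<m. \<forall>j<m. inner_n n (u i) (u j) = (if i = j then 1 else 0)"
    using assms(2) by (auto simp: orthonormal_n_def)
  show "\<forall>x\<in>space (gauss n). f x = g (\<lambda>j. if j < m then inner_n n (u j) x else 0)"
    by (rule ballI) (rule assms(3))
qed (rule assms(1))

lemma linear_juntaE:
  assumes "linear_junta n k f"
  obtains m u g where "m \<le> k" "orthonormal_n n m u"
    "\<And>x. x \<in> space (gauss n) \<Longrightarrow> f x = g (\<lambda>j. if j < m then inner_n n (u j) x else 0)"
proof -
  obtain m u g where m: "m \<le> k" and u: "\<forall>i<m. u i \<in> space (gauss n)"
      "\<forall>i<m. \<forall>j<m. inner_n n (u i) (u j) = (if i = j then 1 else 0)"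
    and g: "\<forall>x\<in>space (gauss n). f x = g (\<lambda>j. if j < m then inner_n n (u j) x else 0)"
    using assms unfolding linear_junta_def by (elim exE conjE)
  have "orthonormal_n n m u" using u by (simp add: orthonormal_n_def)
  with m show thesis by (rule that) (rule g[rule_format])
qed

lemma linear_junta_mono: "linear_junta n m g \<Longrightarrow> m \<le> k \<Longrightarrow> linear_junta n k g"
  unfolding linear_junta_def by (elim exE conjE, intro exI conjI, erule (1) order_trans, assumption+)

lemma junta_class_mono: "m \<le> k \<Longrightarrow> junta_class n m s \<subseteq> junta_class n k s"
  by (auto simp: junta_class_def intro: linear_junta_mono)

lemma rot_change_isom:
  assumes T: "gauss_isom n T T'" and f: "unit_bounded n f"
  shows "rot_change n {..<n} (\<lambda>x. f (T x)) \<theta> = rot_change n {..<n} f \<theta>"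
proof -
  note [measurable] = unit_bounded_measurable[OF f]
  have "rot_change n {..<n} (\<lambda>x. f (T x)) \<theta>
    = (\<integral>p. \<bar>f (rot n {..<n} \<theta> (T (fst p)) (T (snd p))) - f (T (fst p))\<bar> \<partial>gauss_pair n)"
    unfolding rot_change_def rot_full
    by (intro Bochner_Integration.integral_cong) (auto simp: space_pair_measure gauss_isom_lincomb[OF T])
  also have "\<dots> = rot_change n {..<n} f \<theta>"
    using integral_pair_isom[OF T, of "\<lambda>p. \<bar>f (rot n {..<n} \<theta> (fst p) (snd p)) - f (fst p)\<bar>"]
    by (simp add: rot_change_def)
  finally show ?thesis .
qed

lemma nn_integral_mix:
  fixes F :: "_ \<Rightarrow> ennreal"
  assumes weights: "\<And>i. (\<alpha> i)\<^sup>2 + (\<beta> i)\<^sup>2 = 1" and [measurable]: "F \<in> borel_measurable (gauss n)"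
  shows "(\<integral>\<^sup>+x. \<integral>\<^sup>+y. F (mix n \<alpha> \<beta> x y) \<partial>gauss n \<partial>gauss n) = (\<integral>\<^sup>+x. F x \<partial>gauss n)"
proof -
  have "(\<integral>\<^sup>+x. \<integral>\<^sup>+y. F (mix n \<alpha> \<beta> x y) \<partial>gauss n \<partial>gauss n) = (\<integral>\<^sup>+p. F (mix n \<alpha> \<beta> (fst p) (snd p)) \<partial>gauss_pair n)"
    by (subst gauss.nn_integral_fst[symmetric]) auto
  also have "\<dots> = (\<integral>\<^sup>+x. F x \<partial>(distr (gauss_pair n) (gauss n) (\<lambda>p. mix n \<alpha> \<beta> (fst p) (snd p))))"
    by (subst nn_integral_distr) auto
  finally show ?thesis by (simp add: distr_mix[OF weights])
qed

lemma distr_mix_pairs: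
  assumes weights: "\<And>i. (\<alpha> i)\<^sup>2 + (\<beta> i)\<^sup>2 = 1"
  shows "distr (gauss_pair n \<Otimes>\<^sub>M gauss_pair n) (gauss_pair n)
     (\<lambda>q. (mix n \<alpha> \<beta> (fst (fst q)) (fst (snd q)), mix n \<alpha> \<beta> (snd (fst q)) (snd (snd q)))) = gauss_pair n"
proof (rule distr_eqI_nn_integral)
  fix F :: "_ \<Rightarrow> ennreal" assume [measurable]: "F \<in> borel_measurable (gauss_pair n)"
  note mix = nn_integral_mix[of \<alpha> \<beta>, OF weights]
  have "(\<integral>\<^sup>+q. F (mix n \<alpha> \<beta> (fst (fst q)) (fst (snd q)), mix n \<alpha> \<beta> (snd (fst q)) (snd (snd q))) \<partial>(gauss_pair n \<Otimes>\<^sub>M gauss_pair n))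
    = (\<integral>\<^sup>+x. \<integral>\<^sup>+x'. \<integral>\<^sup>+y. \<integral>\<^sup>+y'. F (mix n \<alpha> \<beta> x y, mix n \<alpha> \<beta> x' y') \<partial>gauss n \<partial>gauss n \<partial>gauss n \<partial>gauss n)"
    by (simp add: gauss_pair.nn_integral_fst[symmetric] gauss.nn_integral_fst[symmetric])
  also have "\<dots> = (\<integral>\<^sup>+x. \<integral>\<^sup>+y. \<integral>\<^sup>+x'. \<integral>\<^sup>+y'. F (mix n \<alpha> \<beta> x y, mix n \<alpha> \<beta> x' y') \<partial>gauss n \<partial>gauss n \<partial>gauss n \<partial>gauss n)"
    by (rule nn_integral_cong, rule gauss_pair.Fubini') measurable
  also have "\<dots> = (\<integral>\<^sup>+x. \<integral>\<^sup>+y. \<integral>\<^sup>+x'. F (mix n \<alpha> \<beta> x y, x') \<partial>gauss n \<partial>gauss n \<partial>gauss n)"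
    by (intro nn_integral_cong mix) measurable
  also have "\<dots> = (\<integral>\<^sup>+x. \<integral>\<^sup>+x'. F (x, x') \<partial>gauss n \<partial>gauss n)"
    by (rule mix) measurable
  also have "\<dots> = (\<integral>\<^sup>+p. F p \<partial>gauss_pair n)" by (subst gauss.nn_integral_fst) auto
  finally show "(\<integral>\<^sup>+q. F (mix n \<alpha> \<beta> (fst (fst q)) (fst (snd q)), mix n \<alpha> \<beta> (snd (fst q)) (snd (snd q)))
      \<partial>(gauss_pair n \<Otimes>\<^sub>M gauss_pair n)) = (\<integral>\<^sup>+p. F p \<partial>gauss_pair n)" .
qed measurable

interpretation gauss_pair_pair: pair_prob_space "gauss_pair n" "gauss_pair n" for n by unfold_locales

text \<open>The noise \<open>N\<close> of the smoothing is rotated together with its argument, which does not change its distribution.\<close>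

lemma rot_change_smooth_le:
  assumes f: "unit_bounded n f" and weights: "\<And>i. (\<alpha> i)\<^sup>2 + (\<beta> i)\<^sup>2 = 1"
  shows "rot_change n S (smooth n \<alpha> \<beta> f) \<theta> \<le> rot_change n S f \<theta>"
proof -
  note [measurable] = unit_bounded_measurable[OF f]
  let ?h = "smooth n \<alpha> \<beta> f" and ?R = "rot n S \<theta>" and ?mix = "mix n \<alpha> \<beta>"
  let ?F = "\<lambda>X N. \<bar>f (?R (?mix (fst X) (fst N)) (?mix (snd X) (snd N))) - f (?mix (fst X) (fst N))\<bar>"
  have F: "integrable (gauss_pair n \<Otimes>\<^sub>M gauss_pair n) (\<lambda>q. ?F (fst q) (snd q))"
    by (rule gauss_pair_pair.integrable_bounded[of _ _ 2]) (use unit_bounded_abs_diff_le[OF f f] in auto)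
  have commute: "?R (?mix x y) (?mix x' y') = ?mix (?R x x') (?R y y')" for x y x' y'
    by (auto simp: rot_def mix_def fun_eq_iff algebra_simps)
  have plain: "?h x = (\<integral>N. f (?mix x (fst N)) \<partial>gauss_pair n)" for x
    unfolding smooth_def using unit_bounded_mix(1)[OF f] by (subst gauss_pair.integral_fst_marginal) auto
  have rotated: "?h x = (\<integral>N. f (?mix x (?R (fst N) (snd N))) \<partial>gauss_pair n)" for x
    unfolding smooth_def using unit_bounded_mix(1)[OF f] by (subst integral_rot) auto
  have "rot_change n S ?h \<theta> \<le> (\<integral>X. (\<integral>N. ?F X N \<partial>gauss_pair n) \<partial>gauss_pair n)"
    unfolding rot_change_def
  proof (rule integral_mono)
    show "integrable (gauss_pair n) (\<lambda>p. \<bar>?h (?R (fst p) (snd p)) - ?h (fst p)\<bar>)"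
      using integrable_rot_diff[OF unit_bounded_smooth[OF f]] by (intro integrable_abs)
    show "integrable (gauss_pair n) (\<lambda>X. \<integral>N. ?F X N \<partial>gauss_pair n)"
      using gauss_pair_pair.integrable_fst'[OF F] by simp
    fix X
    have "integrable (gauss_pair n) (\<lambda>N. f (?mix (?R (fst X) (snd X)) (?R (fst N) (snd N))))"
      "integrable (gauss_pair n) (\<lambda>N. f (?mix (fst X) (fst N)))"
      using unit_bounded_mix(2)[OF f] by (auto intro!: gauss_pair.integrable_bounded[of _ _ 1])
    then have "?h (?R (fst X) (snd X)) - ?h (fst X)
       = (\<integral>N. f (?mix (?R (fst X) (snd X)) (?R (fst N) (snd N))) - f (?mix (fst X) (fst N)) \<partial>gauss_pair n)"
      unfolding plain[of "fst X"] rotated[of "?R (fst X) (snd X)"] by simp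
    then show "\<bar>?h (?R (fst X) (snd X)) - ?h (fst X)\<bar> \<le> (\<integral>N. ?F X N \<partial>gauss_pair n)"
      unfolding commute by (simp only: integral_abs_bound)
  qed
  also have "\<dots> = (\<integral>q. ?F (fst q) (snd q) \<partial>(gauss_pair n \<Otimes>\<^sub>M gauss_pair n))"
    using gauss_pair_pair.integral_fst'[OF F] by simp
  also have "\<dots> = (\<integral>p. \<bar>f (?R (fst p) (snd p)) - f (fst p)\<bar> \<partial>(distr (gauss_pair n \<Otimes>\<^sub>M gauss_pair n) (gauss_pair n)
      (\<lambda>q. (?mix (fst (fst q)) (fst (snd q)), ?mix (snd (fst q)) (snd (snd q))))))"
    by (subst integral_distr) auto
  also have "\<dots> = rot_change n S f \<theta>" unfolding distr_mix_pairs[OF weights] rot_change_def ..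
  finally show ?thesis .
qed



definition head_smooth :: "nat \<Rightarrow> nat \<Rightarrow> real \<Rightarrow> ((nat \<Rightarrow> real) \<Rightarrow> real) \<Rightarrow> (nat \<Rightarrow> real) \<Rightarrow> real"
  where "head_smooth n m \<Theta> = smooth n (\<lambda>i. if i < m then cos \<Theta> else 0) (\<lambda>i. if i < m then sin \<Theta> else 1)"

definition head_grad :: "nat \<Rightarrow> nat \<Rightarrow> real \<Rightarrow> ((nat \<Rightarrow> real) \<Rightarrow> real) \<Rightarrow> (nat \<Rightarrow> real) \<Rightarrow> nat \<Rightarrow> real"
  where "head_grad n m \<Theta> = smooth_grad n (\<lambda>i. if i < m then cos \<Theta> else 0) (\<lambda>i. if i < m then sin \<Theta> else 1)"

abbreviation mehler_coeff :: "nat \<Rightarrow> real \<Rightarrow> ((nat \<Rightarrow> real) \<Rightarrow> real) \<Rightarrow> (nat \<Rightarrow> real) \<Rightarrow> nat \<Rightarrow> real"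
  where "mehler_coeff n \<Theta> \<equiv> noise_coeff n (\<lambda>_. cos \<Theta>) (\<lambda>_. sin \<Theta>)"

lemma unit_bounded_head_smooth: "unit_bounded n f \<Longrightarrow> unit_bounded n (head_smooth n m \<Theta> f)"
  unfolding head_smooth_def by (rule unit_bounded_smooth)

lemma head_smooth_cong: "(\<And>i. i < m \<Longrightarrow> x i = y i) \<Longrightarrow> head_smooth n m \<Theta> f x = head_smooth n m \<Theta> f y"
  unfolding head_smooth_def smooth_def mix_def
  by (intro Bochner_Integration.integral_cong refl arg_cong[of _ _ f]) (auto simp: fun_eq_iff)

lemma head_smooth_average:
  assumes f: "unit_bounded n f"
  shows "(\<integral>z. mehler n \<Theta> f (rot n {m..<n} (pi / 2) x z) \<partial>gauss n) = head_smooth n m \<Theta> f x"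
proof -
  note [measurable] = unit_bounded_measurable[OF f]
  let ?\<alpha> = "\<lambda>i. if i < m then cos \<Theta> else 0" and ?\<beta> = "\<lambda>i. if i < m then sin \<Theta> else 1"
  let ?N = "\<lambda>p. mix n (\<lambda>i. if i < m then 0 else cos \<Theta>) (\<lambda>i. if i < m then 1 else sin \<Theta>) (fst p) (snd p)"
  have combine: "lincomb n (cos \<Theta>) (sin \<Theta>) (rot n {m..<n} (pi / 2) x (fst p)) (snd p) = mix n ?\<alpha> ?\<beta> x (?N p)" for p
    by (auto simp: mix_def rot_def fun_eq_iff)
  have integrable: "integrable (gauss_pair n) (\<lambda>p. f (lincomb n (cos \<Theta>) (sin \<Theta>) (rot n {m..<n} (pi / 2) x (fst p)) (snd p)))"
    unfolding combine by (rule gauss_pair.integrable_bounded[of _ _ 1]) (auto simp: unit_bounded_mix[OF f])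
  have "(\<integral>z. mehler n \<Theta> f (rot n {m..<n} (pi / 2) x z) \<partial>gauss n)
     = (\<integral>p. f (lincomb n (cos \<Theta>) (sin \<Theta>) (rot n {m..<n} (pi / 2) x (fst p)) (snd p)) \<partial>gauss_pair n)"
    unfolding smooth_def using gauss_pair.integral_fst'[OF integrable] by simp
  also have "\<dots> = (\<integral>N. f (mix n ?\<alpha> ?\<beta> x N) \<partial>gauss n)"
    unfolding combine by (rule integral_mix) (auto simp: unit_bounded_mix[OF f])
  finally show ?thesis by (simp add: head_smooth_def smooth_def)
qed

lemma integral_norm_tail_coeff_le:
  assumes f: "unit_bounded n f" and \<kappa>: "(\<integral>x. (\<Sum>i\<in>{m..<n}. (mehler_coeff n \<Theta> f x i)\<^sup>2) \<partial>gauss n) \<le> \<kappa>"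
  shows "(\<integral>x. norm_n n (coord_proj {m..<n} (mehler_coeff n \<Theta> f x)) \<partial>gauss n) \<le> sqrt \<kappa>"
proof -
  let ?t = "\<lambda>x. norm_n n (coord_proj {m..<n} (mehler_coeff n \<Theta> f x))"
  have tail_sq: "(?t x)\<^sup>2 = (\<Sum>i\<in>{m..<n}. (mehler_coeff n \<Theta> f x i)\<^sup>2)" for x by (rule norm_coord_proj_sq) auto
  have t [measurable]: "?t \<in> borel_measurable (gauss n)"
    by (rule measurable_norm_n) (use measurable_noise_coeff[OF f] in \<open>auto simp: coord_proj_def\<close>)
  have "(?t x)\<^sup>2 \<le> 1" for x
  proof -
    have "(\<Sum>i\<in>{m..<n}. (mehler_coeff n \<Theta> f x i)\<^sup>2) \<le> (\<Sum>i<n. (mehler_coeff n \<Theta> f x i)\<^sup>2)"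
      by (rule sum_mono2) auto
    then show ?thesis using sum_sq_noise_coeff_le[OF f] order_trans unfolding tail_sq by blast
  qed
  then have "integrable (gauss n) (\<lambda>x. (?t x)\<^sup>2)" by (intro gauss.integrable_bounded[of _ _ 1]) auto
  from gauss.expectation_abs_le_sqrt(2)[OF t this]
  have "(\<integral>x. ?t x \<partial>gauss n) \<le> sqrt (\<integral>x. (?t x)\<^sup>2 \<partial>gauss n)" by simp
  also have "\<dots> \<le> sqrt \<kappa>" using \<kappa> by (simp add: tail_sq)
  finally show ?thesis .
qed

lemma integral_abs_diff_mehler_head_smooth_le:
  assumes f: "unit_bounded n f" and \<Theta>: "0 < \<Theta>" "\<Theta> < 1"
    and \<kappa>: "(\<integral>x. (\<Sum>i\<in>{m..<n}. (mehler_coeff n \<Theta> f x i)\<^sup>2) \<partial>gauss n) \<le> \<kappa>"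
  shows "(\<integral>x. \<bar>mehler n \<Theta> f x - head_smooth n m \<Theta> f x\<bar> \<partial>gauss n) \<le> pi / 2 * sqrt (2 / pi) / sin \<Theta> * sqrt \<kappa>"
proof -
  let ?S = "{m..<n}"
  let ?grad = "smooth_grad n (\<lambda>_. cos \<Theta>) (\<lambda>_. sin \<Theta>) f" and ?t = "\<lambda>x. norm_n n (coord_proj ?S (mehler_coeff n \<Theta> f x))"
  have pos: "0 < cos \<Theta>" "cos \<Theta> \<le> 1" "0 < sin \<Theta>" using \<Theta> pi_gt3 by (auto simp: cos_gt_zero sin_gt_zero_02)
  interpret coord_taylor n ?S "mehler n \<Theta> f" "\<lambda>x. coord_proj ?S (?grad x)" "cos \<Theta> / sin \<Theta>" "3 * (cos \<Theta> / sin \<Theta>)\<^sup>2"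
    by (rule coord_taylor_coord_proj[OF coord_taylor_mehler[OF f \<Theta>]]) auto
  have "(\<integral>x. \<bar>mehler n \<Theta> f x - head_smooth n m \<Theta> f x\<bar> \<partial>gauss n) \<le> rot_change n ?S (mehler n \<Theta> f) (pi / 2)"
    by (rule integral_abs_diff_rot_average_le[OF unit_bounded unit_bounded_head_smooth[OF f] head_smooth_average[OF f, symmetric]])
  also have "\<dots> \<le> pi / 2 * sqrt (2 / pi) * (\<integral>x. norm_n n (coord_proj ?S (?grad x)) \<partial>gauss n)"
    by (rule rot_change_le_mean_grad) simp
  also have "(\<integral>x. norm_n n (coord_proj ?S (?grad x)) \<partial>gauss n) = cos \<Theta> / sin \<Theta> * (\<integral>x. ?t x \<partial>gauss n)"
  proof -
    have scaled: "coord_proj ?S (?grad x) = (\<lambda>i. cos \<Theta> / sin \<Theta> * coord_proj ?S (mehler_coeff n \<Theta> f x) i)" for x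
      by (auto simp: coord_proj_def smooth_grad_def fun_eq_iff)
    show ?thesis unfolding scaled norm_n_cmult using pos by simp
  qed
  also have "pi / 2 * sqrt (2 / pi) * (cos \<Theta> / sin \<Theta> * (\<integral>x. ?t x \<partial>gauss n)) \<le> pi / 2 * sqrt (2 / pi) * (1 / sin \<Theta> * sqrt \<kappa>)"
    using pos integral_norm_tail_coeff_le[OF f \<kappa>]
    by (intro mult_left_mono mult_mono divide_right_mono) (auto intro: Bochner_Integration.integral_nonneg)
  finally show ?thesis by simp
qed

lemma integral_abs_diff_head_smooth_le:
  assumes f: "unit_bounded n f" and \<Theta>: "0 < \<Theta>" "\<Theta> < 1" "\<Theta> = real M * \<theta>"
    and \<nu>: "rot_change n {..<n} f \<theta> \<le> \<nu>"
    and \<kappa>: "(\<integral>x. (\<Sum>i\<in>{m..<n}. (mehler_coeff n \<Theta> f x i)\<^sup>2) \<partial>gauss n) \<le> \<kappa>"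
  shows "(\<integral>x. \<bar>f x - head_smooth n m \<Theta> f x\<bar> \<partial>gauss n) \<le> real M * \<nu> + pi / 2 * sqrt (2 / pi) / sin \<Theta> * sqrt \<kappa>"
proof -
  let ?h = "mehler n \<Theta> f" and ?k = "head_smooth n m \<Theta> f"
  have h: "unit_bounded n ?h" and k: "unit_bounded n ?k"
    by (rule unit_bounded_smooth[OF f]) (rule unit_bounded_head_smooth[OF f])
  note integrable = integrable_abs_diff_unit_bounded[OF f k] integrable_abs_diff_unit_bounded[OF f h]
    integrable_abs_diff_unit_bounded[OF h k]
  have "(\<integral>x. \<bar>f x - ?h x\<bar> \<partial>gauss n) \<le> rot_change n {..<n} f \<Theta>" by (rule integral_abs_diff_mehler_le[OF f])
  also have "\<dots> \<le> real M * rot_change n {..<n} f \<theta>" unfolding \<Theta>(3) by (rule rot_change_mult_le[OF f])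
  also have "\<dots> \<le> real M * \<nu>" using \<nu> by (rule mult_left_mono) simp
  finally have mehler_close: "(\<integral>x. \<bar>f x - ?h x\<bar> \<partial>gauss n) \<le> real M * \<nu>" .
  have "(\<integral>x. \<bar>f x - ?k x\<bar> \<partial>gauss n) \<le> (\<integral>x. \<bar>f x - ?h x\<bar> + \<bar>?h x - ?k x\<bar> \<partial>gauss n)"
    by (intro integral_mono Bochner_Integration.integrable_add integrable) linarith
  also have "\<dots> = (\<integral>x. \<bar>f x - ?h x\<bar> \<partial>gauss n) + (\<integral>x. \<bar>?h x - ?k x\<bar> \<partial>gauss n)" using integrable by simp
  finally show ?thesis using mehler_close integral_abs_diff_mehler_head_smooth_le[OF f \<Theta>(1,2) \<kappa>] by linarith
qed

definition head_taylor_error :: "nat \<Rightarrow> real \<Rightarrow> real"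
  where "head_taylor_error m \<Theta> = ((1 / sin \<Theta>)\<^sup>2 + real m) / 4 + 2 * (3 * (1 / sin \<Theta>)\<^sup>2) * real m"

context
  fixes n m :: nat and \<Theta> :: real and f :: "(nat \<Rightarrow> real) \<Rightarrow> real"
  assumes f: "unit_bounded n f" and \<Theta>: "0 < \<Theta>" "\<Theta> < 1" and m: "m \<le> n"
begin

lemma head_ratio_le: "\<bar>(if i < m then cos \<Theta> else 0) / (if i < m then sin \<Theta> else 1)\<bar> \<le> 1 / sin \<Theta>"
  using sin_gt_zero_02[of \<Theta>] \<Theta> by (auto simp: abs_divide divide_right_mono)

lemma head_scale_nonzero: "(if i < m then sin \<Theta> else 1) \<noteq> 0"
  using sin_gt_zero_02[of \<Theta>] \<Theta> by simp

lemma coord_taylor_head_smooth: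
  "coord_taylor n {..<m} (head_smooth n m \<Theta> f) (head_grad n m \<Theta> f) (1 / sin \<Theta>) (3 * (1 / sin \<Theta>)\<^sup>2)"
  unfolding head_smooth_def head_grad_def
proof (rule coord_taylor_smooth[OF f])
  show "\<bar>(if i < m then cos \<Theta> else 0) / (if i < m then sin \<Theta> else 1)\<bar> \<le> 1 / sin \<Theta>" for i
    by (rule head_ratio_le)
qed (use m sin_gt_zero_02[of \<Theta>] \<Theta> in auto)

lemma mean_head_grad_le:
  assumes \<theta>: "0 < \<theta>" "\<theta> < 1"
  shows "sin \<theta> * sqrt (2 / pi) * (\<integral>x. norm_n n (head_grad n m \<Theta> f x) \<partial>gauss n)
    \<le> rot_change n {..<n} f \<theta> + \<theta>\<^sup>2 * head_taylor_error m \<Theta>"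
proof -
  interpret coord_taylor n "{..<m}" "head_smooth n m \<Theta> f" "head_grad n m \<Theta> f" "1 / sin \<Theta>" "3 * (1 / sin \<Theta>)\<^sup>2"
    by (rule coord_taylor_head_smooth)
  have "head_smooth n m \<Theta> f (rot n {..<m} \<theta> x z) = head_smooth n m \<Theta> f (rot n {..<n} \<theta> x z)" for x z
    using m by (intro head_smooth_cong) (simp add: rot_def)
  then have "rot_change n {..<m} (head_smooth n m \<Theta> f) \<theta> = rot_change n {..<n} (head_smooth n m \<Theta> f) \<theta>"
    unfolding rot_change_def by simp
  also have "\<dots> \<le> rot_change n {..<n} f \<theta>"
    unfolding head_smooth_def by (rule rot_change_smooth_le[OF f]) simp
  finally have stable: "rot_change n {..<m} (head_smooth n m \<Theta> f) \<theta> \<le> rot_change n {..<n} f \<theta>" .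
  have "\<bar>sin \<theta>\<bar> = sin \<theta>" using \<theta> sin_gt_zero_02[of \<theta>] by simp
  then show ?thesis using rot_change_first_order[of \<theta>] stable unfolding head_taylor_error_def card_lessThan by linarith
qed

lemma upper_gradient_head_smooth:
  assumes T: "gauss_isom n T T'"
  shows "upper_gradient n (\<lambda>x. head_smooth n m \<Theta> f (T x)) (\<lambda>x. norm_n n (head_grad n m \<Theta> f (T x))) (3 * (1 / sin \<Theta>)\<^sup>2)"
proof
  interpret coord_taylor n "{..<m}" "head_smooth n m \<Theta> f" "head_grad n m \<Theta> f" "1 / sin \<Theta>" "3 * (1 / sin \<Theta>)\<^sup>2"
    by (rule coord_taylor_head_smooth)
  note [measurable] = gauss_isom_measurable[OF T]
  show "(\<lambda>x. head_smooth n m \<Theta> f (T x)) \<in> borel_measurable (gauss n)"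
    by (rule unit_bounded_measurable[OF unit_bounded_isom[OF T unit_bounded]])
  show "integrable (gauss n) (\<lambda>x. norm_n n (head_grad n m \<Theta> f (T x)))"
    by (rule gauss.integrable_bounded[of _ _ "1 / sin \<Theta>"]) (use grad_bound in auto)
  fix x y assume xy: "x \<in> space (gauss n)" "y \<in> space (gauss n)"
  have dist: "dist_n n (T y) (T x) = dist_n n x y"
    unfolding dist_n_commute[of n "T y"] by (rule dist_n_isom[OF T xy])
  have "\<bar>head_smooth n m \<Theta> f (T y) - head_smooth n m \<Theta> f (T x) - inner_n n (head_grad n m \<Theta> f (T x)) (\<lambda>i. T y i - T x i)\<bar>
      \<le> 3 * (1 / sin \<Theta>)\<^sup>2 * (dist_n n (T y) (T x))\<^sup>2"
    unfolding head_smooth_def head_grad_def by (rule smooth_taylor_dist[OF f]) (rule head_scale_nonzero, rule head_ratio_le)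
  moreover have "inner_n n (head_grad n m \<Theta> f (T x)) (\<lambda>i. T y i - T x i) \<le> norm_n n (head_grad n m \<Theta> f (T x)) * dist_n n (T y) (T x)"
    unfolding dist_n_norm by (rule inner_n_le_norm_mult)
  ultimately show "head_smooth n m \<Theta> f (T y)
      \<le> head_smooth n m \<Theta> f (T x) + norm_n n (head_grad n m \<Theta> f (T x)) * dist_n n x y + 3 * (1 / sin \<Theta>)\<^sup>2 * (dist_n n x y)\<^sup>2"
    unfolding dist by linarith
qed simp_all

lemma ex_head_level_small_surface:
  assumes T: "gauss_isom n T T'" and lu: "l \<le> u" and \<theta>: "0 < \<theta>" "\<theta> < 1"
    and surface: "rot_change n {..<n} f \<theta> + \<theta>\<^sup>2 * head_taylor_error m \<Theta> < sin \<theta> * sqrt (2 / pi) * (c * (u - l))"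
  shows "\<exists>\<tau>. l < \<tau> \<and> \<tau> < u \<and> surf n (\<lambda>x. if \<tau> \<le> head_smooth n m \<Theta> f (T x) then 1 else - 1) \<le> ereal c"
proof -
  interpret taylor: coord_taylor n "{..<m}" "head_smooth n m \<Theta> f" "head_grad n m \<Theta> f" "1 / sin \<Theta>" "3 * (1 / sin \<Theta>)\<^sup>2"
    by (rule coord_taylor_head_smooth)
  interpret upper_gradient n "\<lambda>x. head_smooth n m \<Theta> f (T x)" "\<lambda>x. norm_n n (head_grad n m \<Theta> f (T x))" "3 * (1 / sin \<Theta>)\<^sup>2"
    by (rule upper_gradient_head_smooth[OF T])
  have "sin \<theta> * sqrt (2 / pi) * (\<integral>x. norm_n n (head_grad n m \<Theta> f x) \<partial>gauss n) < sin \<theta> * sqrt (2 / pi) * (c * (u - l))"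
    by (rule le_less_trans[OF mean_head_grad_le[OF \<theta>] surface])
  then have "(\<integral>x. norm_n n (head_grad n m \<Theta> f x) \<partial>gauss n) < c * (u - l)"
    using \<theta> sin_gt_zero_02[of \<theta>] by (simp add: mult_less_cancel_left_pos)
  then have "(\<integral>x. norm_n n (head_grad n m \<Theta> f (T x)) \<partial>gauss n) < c * (u - l)"
    by (simp add: integral_isom[OF T taylor.measurable_norm_grad])
  from ex_superlevel_gsa_le[OF lu this] obtain \<tau> where \<tau>: "l < \<tau>" "\<tau> < u" "gsa n (superlevel \<tau>) \<le> ereal c" by blast
  have "{x \<in> space (gauss n). (if \<tau> \<le> head_smooth n m \<Theta> f (T x) then 1 else - 1 :: real) = 1} = superlevel \<tau>"
    by (auto simp: superlevel_def)
  then have "surf n (\<lambda>x. if \<tau> \<le> head_smooth n m \<Theta> f (T x) then 1 else - 1) \<le> ereal c"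
    using \<tau>(3) by (simp only: surf_def)
  with \<tau>(1,2) show ?thesis by (intro exI[of _ \<tau>] conjI)
qed

end

lemma inner_noise_coeff:
  assumes "unit_bounded n f"
  shows "inner_n n v (noise_coeff n \<alpha> \<beta> f x) = (\<integral>z. inner_n n v z * f (mix n \<alpha> \<beta> x z) \<partial>gauss n)"
  unfolding noise_coeff_def[abs_def]
  using integral_inner_n_mult(2)[of n "gauss n" "\<lambda>z. z" "\<lambda>z. f (mix n \<alpha> \<beta> x z)" v, OF integrable_coord_mult_mix[OF assms]]
  by simp

lemma noise_coeff_isom:
  assumes T: "gauss_isom n T T'" and f: "unit_bounded n f" and x: "x \<in> space (gauss n)" and i: "i < n"
  shows "noise_coeff n (\<lambda>_. a) (\<lambda>_. b) (\<lambda>y. f (T' y)) (T x) i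
    = T (restrict (noise_coeff n (\<lambda>_. a) (\<lambda>_. b) f x) {..<n}) i"
proof -
  note T' = gauss_isom_sym[OF T]
  note [measurable] = unit_bounded_measurable[OF f] gauss_isom_measurable[OF T'] measurable_gauss_coord[OF i]
  let ?p = "noise_coeff n (\<lambda>_. a) (\<lambda>_. b) f x" and ?e = "unit_vec_n n i"
  have p: "restrict ?p {..<n} \<in> space (gauss n)" by (simp add: space_gauss)
  have coord: "T z i = inner_n n (T' ?e) z" if "z \<in> space (gauss n)" for z
    using gauss_isom_inner[OF T gauss_isom_in_space[OF T' unit_vec_n_in_space[of n i]] that]
    by (simp add: gauss_isom_right_inverse[OF T unit_vec_n_in_space] inner_n_unit_vec[OF i])
  have "noise_coeff n (\<lambda>_. a) (\<lambda>_. b) (\<lambda>y. f (T' y)) (T x) i = (\<integral>z. T z i * f (T' (lincomb n a b (T x) (T z))) \<partial>gauss n)"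
    unfolding noise_coeff_def using integral_isom[OF T, of "\<lambda>z. z i * f (T' (lincomb n a b (T x) z))"] by simp
  also have "\<dots> = (\<integral>z. inner_n n (T' ?e) z * f (lincomb n a b x z) \<partial>gauss n)"
    using x by (intro Bochner_Integration.integral_cong)
      (auto simp: coord gauss_isom_lincomb[OF T, symmetric] gauss_isom_left_inverse[OF T])
  also have "\<dots> = inner_n n (T' ?e) ?p" by (rule inner_noise_coeff[OF f, symmetric])
  also have "\<dots> = inner_n n (T' ?e) (restrict ?p {..<n})" by (rule inner_n_cong) auto
  finally show ?thesis using coord[OF p] by simp
qed

lemma proj_resid_isom:
  assumes T: "gauss_isom n T T'" and y: "y \<in> space (gauss n)" and m: "m \<le> n"
    and coord: "\<And>b x. b < m \<Longrightarrow> x \<in> space (gauss n) \<Longrightarrow> inner_n n (u b) x = T x b"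
  shows "proj_resid n m u y = (\<Sum>i\<in>{m..<n}. (T y i)\<^sup>2)"
proof -
  have "(\<Sum>i<n. (y i)\<^sup>2) = (\<Sum>i<n. (T y i)\<^sup>2)"
    using gauss_isom_inner[OF T y y] by (simp add: inner_n_def power2_eq_square)
  also have "\<dots> = (\<Sum>i<m. (T y i)\<^sup>2) + (\<Sum>i\<in>{m..<n}. (T y i)\<^sup>2)"
    using sum.atLeastLessThan_concat[of 0 m n "\<lambda>i. (T y i)\<^sup>2"] m by (simp add: lessThan_atLeast0)
  finally show ?thesis unfolding proj_resid_def using coord y by simp
qed

lemma proj_resid_restrict: "proj_resid n m u (restrict y {..<n}) = proj_resid n m u y"
proof -
  have "inner_n n v (restrict y {..<n}) = inner_n n v y" for v by (rule inner_n_cong) auto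
  then show ?thesis by (simp add: proj_resid_def)
qed

lemma proj_resid_noise_coeff_isom:
  assumes T: "gauss_isom n T T'" and f: "unit_bounded n f" and x: "x \<in> space (gauss n)" and m: "m \<le> n"
    and coord: "\<And>b x. b < m \<Longrightarrow> x \<in> space (gauss n) \<Longrightarrow> inner_n n (u b) x = T x b"
  shows "proj_resid n m u (noise_coeff n (\<lambda>_. a) (\<lambda>_. b) f x)
    = (\<Sum>i\<in>{m..<n}. (noise_coeff n (\<lambda>_. a) (\<lambda>_. b) (\<lambda>y. f (T' y)) (T x) i)\<^sup>2)"
  by (subst proj_resid_restrict[symmetric], subst proj_resid_isom[OF T _ m coord])
     (auto simp: space_gauss noise_coeff_isom[OF T f x])

lemma integral_abs_diff_head_smooth_isom_le:
  assumes f: "unit_bounded n f" and T: "gauss_isom n T T'" and m: "m \<le> n"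
    and coord: "\<And>b x. b < m \<Longrightarrow> x \<in> space (gauss n) \<Longrightarrow> inner_n n (u b) x = T x b"
    and \<Theta>: "\<Theta> = real M * \<theta>" "0 < \<Theta>" "\<Theta> < 1" and \<nu>: "rot_change n {..<n} f \<theta> \<le> \<nu>"
    and \<kappa>: "(\<integral>x. proj_resid n m u (mehler_coeff n \<Theta> f x) \<partial>gauss n) \<le> \<kappa>"
  shows "(\<integral>x. \<bar>f x - head_smooth n m \<Theta> (\<lambda>y. f (T' y)) (T x)\<bar> \<partial>gauss n)
    \<le> real M * \<nu> + pi / 2 * sqrt (2 / pi) / sin \<Theta> * sqrt \<kappa>"
proof -
  note T' = gauss_isom_sym[OF T]
  define F where "F = (\<lambda>x. f (T' x))"
  have F: "unit_bounded n F" unfolding F_def by (rule unit_bounded_isom[OF T' f])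
  have F_change: "rot_change n {..<n} F \<theta> \<le> \<nu>" unfolding F_def using \<nu> by (simp add: rot_change_isom[OF T' f])
  note [measurable] = unit_bounded_measurable[OF F] unit_bounded_measurable[OF unit_bounded_head_smooth[OF F]]
    measurable_noise_coeff[OF F]
  have "(\<lambda>x. \<Sum>i\<in>{m..<n}. (mehler_coeff n \<Theta> F x i)\<^sup>2) \<in> borel_measurable (gauss n)" by measurable
  from integral_isom[OF T this]
  have "(\<integral>x. (\<Sum>i\<in>{m..<n}. (mehler_coeff n \<Theta> F x i)\<^sup>2) \<partial>gauss n) = (\<integral>x. proj_resid n m u (mehler_coeff n \<Theta> f x) \<partial>gauss n)"
    by (simp add: F_def proj_resid_noise_coeff_isom[OF T f _ m coord] cong: Bochner_Integration.integral_cong)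
  with \<kappa> have tail: "(\<integral>x. (\<Sum>i\<in>{m..<n}. (mehler_coeff n \<Theta> F x i)\<^sup>2) \<partial>gauss n) \<le> \<kappa>" by simp
  have "(\<integral>x. \<bar>f x - head_smooth n m \<Theta> F (T x)\<bar> \<partial>gauss n) = (\<integral>x. \<bar>F (T x) - head_smooth n m \<Theta> F (T x)\<bar> \<partial>gauss n)"
    by (intro Bochner_Integration.integral_cong) (auto simp: F_def gauss_isom_left_inverse[OF T])
  also have "\<dots> = (\<integral>x. \<bar>F x - head_smooth n m \<Theta> F x\<bar> \<partial>gauss n)"
    by (rule integral_isom[OF T]) measurable
  also have "\<dots> \<le> real M * \<nu> + pi / 2 * sqrt (2 / pi) / sin \<Theta> * sqrt \<kappa>"
    by (rule integral_abs_diff_head_smooth_le[OF F \<Theta>(2,3,1) F_change tail])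
  finally show ?thesis by (simp only: F_def)
qed

lemma gdist_level_le:
  assumes f: "sign_function n f" and [measurable]: "H \<in> borel_measurable (gauss n)"
    and integrable: "integrable (gauss n) (\<lambda>x. \<bar>f x - H x\<bar>)"
    and \<eta>: "0 < \<eta>" and \<tau>: "- 1 + \<eta> < \<tau>" "\<tau> < 1 - \<eta>"
  shows "gdist n f (\<lambda>x. if \<tau> \<le> H x then 1 else - 1) \<le> (\<integral>x. \<bar>f x - H x\<bar> \<partial>gauss n) / \<eta>"
proof -
  note [measurable] = sign_function_measurable[OF f]
  let ?B = "{x \<in> space (gauss n). f x \<noteq> (if \<tau> \<le> H x then 1 else - 1)}"
  have B: "?B \<in> sets (gauss n)" by measurable
  then have "gdist n f (\<lambda>x. if \<tau> \<le> H x then 1 else - 1) = (\<integral>x. indicator ?B x \<partial>gauss n)" by (simp add: gdist_def)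
  also have "\<dots> \<le> (\<integral>x. \<bar>f x - H x\<bar> / \<eta> \<partial>gauss n)"
  proof (rule integral_mono)
    show "integrable (gauss n) (indicator ?B :: _ \<Rightarrow> real)"
      by (rule integrable_unit_bounded[OF unit_bounded_indicator[OF B]])
    show "integrable (gauss n) (\<lambda>x. \<bar>f x - H x\<bar> / \<eta>)" using integrable by simp
    fix x assume x: "x \<in> space (gauss n)"
    show "indicator ?B x \<le> \<bar>f x - H x\<bar> / \<eta>"
    proof (cases "x \<in> ?B")
      case True
      then have "\<eta> \<le> \<bar>f x - H x\<bar>" using sign_function_cases[OF f x] \<tau> by (auto split: if_splits)
      then show ?thesis using \<eta> True by simp
    qed (use \<eta> in simp)
  qed
  finally show ?thesis by simp
qed

lemma linear_junta_head_level:
  assumes u: "orthonormal_n n m u"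
    and coord: "\<And>b x. b < m \<Longrightarrow> x \<in> space (gauss n) \<Longrightarrow> inner_n n (u b) x = T x b"
  shows "linear_junta n m (\<lambda>x. if \<tau> \<le> head_smooth n m \<Theta> f (T x) then 1 else - 1)"
proof (rule linear_juntaI[OF order_refl u, where g = "\<lambda>y. if \<tau> \<le> head_smooth n m \<Theta> f y then 1 else - 1"])
  fix x assume "x \<in> space (gauss n)"
  then have "head_smooth n m \<Theta> f (T x) = head_smooth n m \<Theta> f (\<lambda>j. if j < m then inner_n n (u j) x else 0)"
    by (intro head_smooth_cong) (simp add: coord)
  then show "(if \<tau> \<le> head_smooth n m \<Theta> f (T x) then 1 else - 1 :: real)
      = (if \<tau> \<le> head_smooth n m \<Theta> f (\<lambda>j. if j < m then inner_n n (u j) x else 0) then 1 else - 1)"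
    by simp
qed

lemma ex_junta_near_stable:
  assumes f: "sign_function n f" and u: "orthonormal_n n m u"
    and \<Theta>: "\<Theta> = real M * \<theta>" "0 < \<Theta>" "\<Theta> < 1" and \<theta>: "0 < \<theta>" "\<theta> < 1"
    and \<nu>: "rot_change n {..<n} f \<theta> \<le> \<nu>"
    and \<kappa>: "(\<integral>x. proj_resid n m u (mehler_coeff n \<Theta> f x) \<partial>gauss n) \<le> \<kappa>"
    and \<eta>: "0 < \<eta>" "\<eta> < 1"
    and surface: "\<nu> + \<theta>\<^sup>2 * head_taylor_error m \<Theta> < sin \<theta> * sqrt (2 / pi) * (c * (2 - 2 * \<eta>))"
  shows "\<exists>g\<in>junta_class n m c. gdist n f g \<le> (real M * \<nu> + pi / 2 * sqrt (2 / pi) / sin \<Theta> * sqrt \<kappa>) / \<eta>"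
proof -
  obtain T T' where m: "m \<le> n" and T: "gauss_isom n T T'"
    and coord: "\<And>b x. b < m \<Longrightarrow> x \<in> space (gauss n) \<Longrightarrow> inner_n n (u b) x = T x b"
    using gauss_isom_orthonormal[OF u] by blast
  note T' = gauss_isom_sym[OF T] and fb = unit_bounded_sign_function[OF f]
  define F where "F = (\<lambda>x. f (T' x))"
  have F: "unit_bounded n F" unfolding F_def by (rule unit_bounded_isom[OF T' fb])
  have F_change: "rot_change n {..<n} F \<theta> \<le> \<nu>" unfolding F_def using \<nu> by (simp add: rot_change_isom[OF T' fb])
  define H where "H = (\<lambda>x. head_smooth n m \<Theta> F (T x))"
  have H: "unit_bounded n H" unfolding H_def by (rule unit_bounded_isom[OF T unit_bounded_head_smooth[OF F]])
  note [measurable] = unit_bounded_measurable[OF H]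
  have "\<exists>\<tau>. - 1 + \<eta> < \<tau> \<and> \<tau> < 1 - \<eta> \<and> surf n (\<lambda>x. if \<tau> \<le> H x then 1 else - 1) \<le> ereal c"
    unfolding H_def using \<eta> F_change surface
    by (intro ex_head_level_small_surface[OF F \<Theta>(2,3) m T _ \<theta>]) auto
  then obtain \<tau> where \<tau>: "- 1 + \<eta> < \<tau>" "\<tau> < 1 - \<eta>" and surf: "surf n (\<lambda>x. if \<tau> \<le> H x then 1 else - 1) \<le> ereal c" by blast
  let ?g = "\<lambda>x. if \<tau> \<le> H x then 1 else - 1"
  have "sign_function n ?g" by (auto simp: sign_function_def is_pm1_def)
  moreover have "linear_junta n m ?g" unfolding H_def by (rule linear_junta_head_level[OF u coord])
  ultimately have g: "?g \<in> junta_class n m c" using surf by (simp only: junta_class_def mem_Collect_eq)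
  have "gdist n f ?g \<le> (\<integral>x. \<bar>f x - H x\<bar> \<partial>gauss n) / \<eta>"
    by (rule gdist_level_le[OF f _ integrable_abs_diff_unit_bounded[OF fb H] \<eta>(1) \<tau>]) measurable
  also have "\<dots> \<le> (real M * \<nu> + pi / 2 * sqrt (2 / pi) / sin \<Theta> * sqrt \<kappa>) / \<eta>"
    unfolding H_def F_def using \<eta>(1)
    by (intro divide_right_mono integral_abs_diff_head_smooth_isom_le[OF fb T m coord \<Theta> \<nu> \<kappa>]) auto
  finally show ?thesis using g by (rule bexI)
qed

section \<open>The rank test\<close>

text \<open>The noise of the smoothing is split into a visible part \<open>g\<close> of weight \<open>sin \<phi>\<close> and an averaged part \<open>z\<close> of weight
  \<open>cos \<phi>\<close>. The correlation of the symmetrized increment with \<open>g\<close> is therefore exactly \<open>2 sin \<phi>\<close> times the gradient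
  coefficients, and Bessel's inequality turns an upper bound on covariances into one on gradients.\<close>

definition noisy_point :: "nat \<Rightarrow> real \<Rightarrow> real \<Rightarrow> (nat \<Rightarrow> real) \<Rightarrow> (nat \<Rightarrow> real) \<Rightarrow> (nat \<Rightarrow> real) \<Rightarrow> nat \<Rightarrow> real"
  where "noisy_point n \<Theta> \<phi> x g z = lincomb n (cos \<Theta>) (sin \<Theta>) x (lincomb n (sin \<phi>) (cos \<phi>) g z)"

definition partial_smooth :: "nat \<Rightarrow> real \<Rightarrow> real \<Rightarrow> ((nat \<Rightarrow> real) \<Rightarrow> real) \<Rightarrow> (nat \<Rightarrow> real) \<Rightarrow> (nat \<Rightarrow> real) \<Rightarrow> real"
  where "partial_smooth n \<Theta> \<phi> f x g = (\<integral>z. f (noisy_point n \<Theta> \<phi> x g z) \<partial>gauss n)"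

definition sym_increment :: "nat \<Rightarrow> real \<Rightarrow> real \<Rightarrow> ((nat \<Rightarrow> real) \<Rightarrow> real) \<Rightarrow> (nat \<Rightarrow> real) \<Rightarrow> (nat \<Rightarrow> real) \<Rightarrow> real"
  where "sym_increment n \<Theta> \<phi> f x g = partial_smooth n \<Theta> \<phi> f x g - partial_smooth n \<Theta> (- \<phi>) f x g"

definition increment_cov :: "nat \<Rightarrow> real \<Rightarrow> real \<Rightarrow> ((nat \<Rightarrow> real) \<Rightarrow> real) \<Rightarrow> (nat \<Rightarrow> real) \<Rightarrow> (nat \<Rightarrow> real) \<Rightarrow> real"
  where "increment_cov n \<Theta> \<phi> f x y = (\<integral>g. sym_increment n \<Theta> \<phi> f x g * sym_increment n \<Theta> \<phi> f y g \<partial>gauss n)"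

lemma noisy_point_in_space [simp]: "noisy_point n \<Theta> \<phi> x g z \<in> space (gauss n)"
  by (simp add: noisy_point_def)

lemma measurable_noisy_point [measurable (raw)]:
  assumes [measurable]: "u \<in> measurable M (gauss n)" "g \<in> measurable M (gauss n)" "z \<in> measurable M (gauss n)"
  shows "(\<lambda>p. noisy_point n \<Theta> \<phi> (u p) (g p) (z p)) \<in> measurable M (gauss n)"
  unfolding noisy_point_def by measurable

lemma measurable_noisy_point_right [measurable (raw)]:
  assumes [measurable]: "g \<in> measurable M (gauss n)" "z \<in> measurable M (gauss n)"
  shows "(\<lambda>p. noisy_point n \<Theta> \<phi> x (g p) (z p)) \<in> measurable M (gauss n)"
  unfolding noisy_point_def by measurable

lemma noisy_point_eq:
  "noisy_point n \<Theta> \<phi> x g z = lincomb n 1 (sin \<Theta> * cos \<phi>) (lincomb n (cos \<Theta>) (sin \<Theta> * sin \<phi>) x g) z"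
  by (auto simp: noisy_point_def mix_def fun_eq_iff algebra_simps)

lemma partial_smooth_eq:
  "partial_smooth n \<Theta> \<phi> f x g
    = smooth n (\<lambda>_. 1) (\<lambda>_. sin \<Theta> * cos \<phi>) f (\<lambda>t. cos \<Theta> * x t + sin \<Theta> * sin \<phi> * g t)"
  by (simp add: partial_smooth_def smooth_def noisy_point_eq mix_def cong: restrict_cong)

lemma unit_bounded_partial_smooth:
  assumes f: "unit_bounded n f"
  shows "unit_bounded n (partial_smooth n \<Theta> \<phi> f x)"
proof -
  note [measurable] = unit_bounded_measurable[OF f]
  have "partial_smooth n \<Theta> \<phi> f x \<in> borel_measurable (gauss n)"
    unfolding partial_smooth_def by measurable
  moreover have "partial_smooth n \<Theta> \<phi> f x g
      = smooth n (\<lambda>_. 1) (\<lambda>_. sin \<Theta> * cos \<phi>) f (lincomb n (cos \<Theta>) (sin \<Theta> * sin \<phi>) x g)" for g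
    by (simp add: partial_smooth_def smooth_def noisy_point_eq)
  ultimately show ?thesis
    using unit_bounded_abs_le[OF unit_bounded_smooth[OF f]] by (simp add: unit_bounded_def)
qed

lemma measurable_sym_increment [measurable]:
  "unit_bounded n f \<Longrightarrow> sym_increment n \<Theta> \<phi> f x \<in> borel_measurable (gauss n)"
  unfolding sym_increment_def by (intro borel_measurable_diff unit_bounded_measurable unit_bounded_partial_smooth)

lemma integrable_sym_increment_mult:
  assumes f: "unit_bounded n f"
  shows "integrable (gauss n) (\<lambda>g. sym_increment n \<Theta> \<phi> f x g * sym_increment n \<Theta> \<phi> f y g)"
proof (rule gauss.integrable_bounded[of _ _ "2 * 2"])
  note [measurable] = measurable_sym_increment[OF f]
  show "(\<lambda>g. sym_increment n \<Theta> \<phi> f x g * sym_increment n \<Theta> \<phi> f y g) \<in> borel_measurable (gauss n)" by measurable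
  fix g assume g: "g \<in> space (gauss n)"
  have "\<bar>sym_increment n \<Theta> \<phi> f x' g\<bar> \<le> 2" for x'
    unfolding sym_increment_def
    by (rule unit_bounded_abs_diff_le[OF unit_bounded_partial_smooth[OF f] unit_bounded_partial_smooth[OF f] g g])
  then show "\<bar>sym_increment n \<Theta> \<phi> f x g * sym_increment n \<Theta> \<phi> f y g\<bar> \<le> 2 * 2"
    unfolding abs_mult by (intro mult_mono) auto
qed

lemma
  assumes h: "unit_bounded n h" and t: "t < n"
  shows integrable_fst_coord_mult: "\<phi> \<in> measurable (gauss_pair n) (gauss n) \<Longrightarrow> integrable (gauss_pair n) (\<lambda>p. fst p t * h (\<phi> p))"
    and integrable_snd_coord_mult: "\<phi> \<in> measurable (gauss_pair n) (gauss n) \<Longrightarrow> integrable (gauss_pair n) (\<lambda>p. snd p t * h (\<phi> p))"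
    and integral_snd_coord_mult: "(\<integral>p. snd p t * h (fst p) \<partial>gauss_pair n) = 0"
proof -
  note [measurable] = unit_bounded_measurable[OF h] measurable_gauss_coord[OF t]
  have coord: "integrable (gauss_pair n) (\<lambda>p. fst p t)" "integrable (gauss_pair n) (\<lambda>p. snd p t)"
    using gauss_pair.integrable_fst_marginal[of "\<lambda>x. x t" n] gauss_pair.integrable_snd_marginal[of "\<lambda>x. x t" n] t by simp_all
  have bound: "norm (v * h x) \<le> norm v" if "x \<in> space (gauss n)" for v x
    using unit_bounded_abs_le[OF h that] by (simp add: abs_mult mult_left_le)
  have mult: "integrable (gauss_pair n) (\<lambda>p. v p * h (\<phi> p))"
    if v: "integrable (gauss_pair n) v" and [measurable]: "\<phi> \<in> measurable (gauss_pair n) (gauss n)" for v \<phi>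
  proof (rule Bochner_Integration.integrable_bound[OF v])
    have [measurable]: "v \<in> borel_measurable (gauss_pair n)" using v by simp
    show "(\<lambda>p. v p * h (\<phi> p)) \<in> borel_measurable (gauss_pair n)" by measurable
  qed (intro AE_I2 bound measurable_space[OF that(2)])
  show "\<phi> \<in> measurable (gauss_pair n) (gauss n) \<Longrightarrow> integrable (gauss_pair n) (\<lambda>p. fst p t * h (\<phi> p))"
    by (rule mult[OF coord(1)])
  show "\<phi> \<in> measurable (gauss_pair n) (gauss n) \<Longrightarrow> integrable (gauss_pair n) (\<lambda>p. snd p t * h (\<phi> p))"
    by (rule mult[OF coord(2)])
  show "(\<integral>p. snd p t * h (fst p) \<partial>gauss_pair n) = 0"
    using gauss_pair.integral_fst'[OF mult[OF coord(2) measurable_fst]] gauss_component_mean[OF t]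
    by (simp add: has_bochner_integral_iff)
qed

lemma integral_coord_mix:
  assumes weights: "\<And>i. (\<alpha> i)\<^sup>2 + (\<beta> i)\<^sup>2 = 1" and h: "unit_bounded n h" and t: "t < n"
  shows "integrable (gauss_pair n) (\<lambda>p. fst p t * h (mix n \<alpha> \<beta> (fst p) (snd p)))" (is "integrable _ ?L")
    "(\<integral>p. fst p t * h (mix n \<alpha> \<beta> (fst p) (snd p)) \<partial>gauss_pair n) = \<alpha> t * (\<integral>x. x t * h x \<partial>gauss n)"
proof -
  note [measurable] = unit_bounded_measurable[OF h] measurable_gauss_coord[OF t]
  show "integrable (gauss_pair n) ?L" by (rule integrable_fst_coord_mult[OF h t]) measurable
  let ?R = "\<lambda>p. (mix n \<alpha> \<beta> (fst p) (snd p), mix n (\<lambda>i. - \<beta> i) \<alpha> (fst p) (snd p))"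
  let ?own = "\<lambda>p. fst p t * h (fst p)" and ?other = "\<lambda>p. snd p t * h (fst p)"
  have own: "integrable (gauss_pair n) ?own" by (rule integrable_fst_coord_mult[OF h t]) measurable
  have other: "integrable (gauss_pair n) ?other" by (rule integrable_snd_coord_mult[OF h t]) measurable
  define F where "F = (\<lambda>p. \<alpha> t * ?own p - \<beta> t * ?other p)"
  have "integrable (gauss_pair n) F" unfolding F_def using own other by simp
  then have F_measurable: "F \<in> borel_measurable (gauss_pair n)" by (rule borel_measurable_integrable)
  have rotate: "?L p = F (?R p)" for p
  proof -
    have "fst p t = \<alpha> t * fst (?R p) t - \<beta> t * snd (?R p) t"
    proof -
      have "\<alpha> t * fst (?R p) t - \<beta> t * snd (?R p) t = ((\<alpha> t)\<^sup>2 + (\<beta> t)\<^sup>2) * fst p t"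
        using t by (simp add: power2_eq_square algebra_simps)
      then show ?thesis by (simp add: weights)
    qed
    moreover have "F (?R p) = (\<alpha> t * fst (?R p) t - \<beta> t * snd (?R p) t) * h (fst (?R p))"
      by (simp only: F_def left_diff_distrib mult.assoc)
    ultimately show ?thesis by simp
  qed
  have "(\<integral>p. ?L p \<partial>gauss_pair n) = (\<integral>p. F p \<partial>gauss_pair n)"
    unfolding rotate by (rule integral_pair_rotation[OF weights F_measurable])
  also have "\<dots> = \<alpha> t * (\<integral>p. ?own p \<partial>gauss_pair n) - \<beta> t * (\<integral>p. ?other p \<partial>gauss_pair n)"
    unfolding F_def using own other by simp
  also have "(\<integral>p. ?own p \<partial>gauss_pair n) = (\<integral>x. x t * h x \<partial>gauss n)"
    by (rule gauss_pair.integral_fst_marginal) measurable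
  also have "(\<integral>p. ?other p \<partial>gauss_pair n) = 0" by (rule integral_snd_coord_mult[OF h t])
  finally show "(\<integral>p. ?L p \<partial>gauss_pair n) = \<alpha> t * (\<integral>x. x t * h x \<partial>gauss n)" by simp
qed

lemma integral_coord_partial_smooth:
  assumes f: "unit_bounded n f" and t: "t < n"
  shows "integrable (gauss n) (\<lambda>g. g t * partial_smooth n \<Theta> \<phi> f x g)"
    "(\<integral>g. g t * partial_smooth n \<Theta> \<phi> f x g \<partial>gauss n) = sin \<phi> * mehler_coeff n \<Theta> f x t"
proof -
  have "unit_bounded n (\<lambda>N. f (lincomb n (cos \<Theta>) (sin \<Theta>) x N))"
    using unit_bounded_mix[OF f] by (simp add: unit_bounded_def)
  note mix = integral_coord_mix[of "\<lambda>_. sin \<phi>" "\<lambda>_. cos \<phi>", OF _ this t, folded noisy_point_def, simplified]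
  show "integrable (gauss n) (\<lambda>g. g t * partial_smooth n \<Theta> \<phi> f x g)"
    using gauss_pair.integrable_fst'[OF mix(1)] by (simp add: partial_smooth_def)
  show "(\<integral>g. g t * partial_smooth n \<Theta> \<phi> f x g \<partial>gauss n) = sin \<phi> * mehler_coeff n \<Theta> f x t"
    using gauss_pair.integral_fst'[OF mix(1)] mix(2) by (simp add: partial_smooth_def noise_coeff_def)
qed

lemma integral_coord_sym_increment:
  assumes f: "unit_bounded n f" and t: "t < n"
  shows "integrable (gauss n) (\<lambda>g. g t * sym_increment n \<Theta> \<phi> f x g)"
    "(\<integral>g. g t * sym_increment n \<Theta> \<phi> f x g \<partial>gauss n) = 2 * sin \<phi> * mehler_coeff n \<Theta> f x t"
  unfolding sym_increment_def right_diff_distrib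
  using integral_coord_partial_smooth[OF f t] by simp_all

definition resid_form :: "nat \<Rightarrow> nat \<Rightarrow> (nat \<Rightarrow> nat \<Rightarrow> real) \<Rightarrow> (nat \<Rightarrow> nat \<Rightarrow> real) \<Rightarrow> real"
  where "resid_form m k c K = (\<Sum>i<m. K i i) - (\<Sum>a<k. \<Sum>i<m. \<Sum>j<m. c a i * c a j * K i j)"

lemma proj_resid_eq_resid_form: "proj_resid m k c y = resid_form m k c (\<lambda>i j. y i * y j)"
proof -
  have "(inner_n m (c a) y)\<^sup>2 = (\<Sum>i<m. \<Sum>j<m. c a i * c a j * (y i * y j))" for a
    by (simp add: inner_n_def power2_eq_square sum_product mult_ac)
  then show ?thesis by (simp add: proj_resid_def resid_form_def power2_eq_square)
qed

lemma resid_form_diff: "resid_form m k c K - resid_form m k c K' = resid_form m k c (\<lambda>i j. K i j - K' i j)"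
  by (simp add: resid_form_def sum_subtractf right_diff_distrib)

lemma has_bochner_integral_resid_form:
  assumes "\<And>i j. i < m \<Longrightarrow> j < m \<Longrightarrow> has_bochner_integral M (F i j) (K i j)"
  shows "has_bochner_integral M (\<lambda>x. resid_form m k c (\<lambda>i j. F i j x)) (resid_form m k c K)"
  unfolding resid_form_def
  by (intro has_bochner_integral_diff has_bochner_integral_sum has_bochner_integral_mult_right assms) auto

lemma has_bochner_integral_proj_resid_sym_increment:
  assumes f: "unit_bounded n f"
  shows "has_bochner_integral (gauss n) (\<lambda>g. proj_resid m k c (\<lambda>i. sym_increment n \<Theta> \<phi> f (xs i) g))
    (resid_form m k c (\<lambda>i j. increment_cov n \<Theta> \<phi> f (xs i) (xs j)))"
  unfolding proj_resid_eq_resid_form increment_cov_def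
  by (intro has_bochner_integral_resid_form) (simp add: has_bochner_integral_iff integrable_sym_increment_mult[OF f])

subsection \<open>Soundness\<close>

lemma in_span_n_sum:
  assumes "\<And>e. e < k \<Longrightarrow> in_span_n n m u (y e)"
  shows "in_span_n n m u (\<lambda>t. \<Sum>e<k. a e * y e t)"
proof -
  have "\<exists>d. \<forall>t<n. y e t = (\<Sum>b<m. d b * u b t)" if "e < k" for e
    using assms[OF that] by (simp add: in_span_n_def)
  then obtain d where d: "\<And>e t. e < k \<Longrightarrow> t < n \<Longrightarrow> y e t = (\<Sum>b<m. d e b * u b t)" by metis
  have "(\<Sum>e<k. a e * y e t) = (\<Sum>b<m. (\<Sum>e<k. a e * d e b) * u b t)" if "t < n" for t
  proof -
    have "(\<Sum>e<k. a e * y e t) = (\<Sum>e<k. \<Sum>b<m. a e * d e b * u b t)"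
      using that by (simp add: d sum_distrib_left mult_ac)
    also have "\<dots> = (\<Sum>b<m. \<Sum>e<k. a e * d e b * u b t)" by (rule sum.swap)
    finally show ?thesis by (simp add: sum_distrib_right)
  qed
  then show ?thesis unfolding in_span_n_def by (intro exI[of _ "\<lambda>b. \<Sum>e<k. a e * d e b"]) simp
qed

lemma proj_resid_le_in_span:
  assumes u: "orthonormal_n n m u" and "in_span_n n m u s"
  shows "proj_resid n m u y \<le> (\<Sum>i<n. (y i - s i)\<^sup>2)"
proof -
  obtain d where "\<forall>i<n. s i = (\<Sum>b<m. d b * u b i)" using assms(2) by (auto simp: in_span_n_def)
  then show ?thesis using proj_resid_le[OF u, of y d] by simp
qed

lemma has_bochner_integral_coord_orthogonal_part:
  fixes M :: "(nat \<Rightarrow> real) measure" and c :: "nat \<Rightarrow> nat \<Rightarrow> real"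
  assumes "\<And>j. has_bochner_integral M (\<lambda>g. g t * D j g) (p j)"
  shows "has_bochner_integral M (\<lambda>g. g t * (D i g - (\<Sum>e<k. inner_n m (c e) (\<lambda>j. D j g) * c e i)))
    (p i - (\<Sum>e<k. c e i * inner_n m (c e) p))"
proof -
  have "has_bochner_integral M (\<lambda>g. g t * D i g - (\<Sum>e<k. \<Sum>j<m. c e i * (c e j * (g t * D j g))))
      (p i - (\<Sum>e<k. \<Sum>j<m. c e i * (c e j * p j)))"
    by (intro has_bochner_integral_diff has_bochner_integral_sum has_bochner_integral_mult_right assms)
  then show ?thesis
    by (simp add: inner_n_def right_diff_distrib sum_distrib_left sum_distrib_right mult_ac)
qed

text \<open>By Bessel's inequality, applied to the part of each function that is orthogonal to the system \<open>c\<close>.\<close>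

lemma ex_orthonormal_coeff_resid_le:
  assumes c: "orthonormal_n m k c"
    and [measurable]: "\<And>i. D i \<in> borel_measurable (gauss n)"
    and D_mult: "\<And>i j. integrable (gauss n) (\<lambda>g. D i g * D j g)"
    and coeff: "\<And>i t. t < n \<Longrightarrow> has_bochner_integral (gauss n) (\<lambda>g. g t * D i g) (p i t)"
  shows "\<exists>k'\<le>k. \<exists>u. orthonormal_n n k' u \<and>
    (\<Sum>i<m. proj_resid n k' u (p i)) \<le> (\<integral>g. proj_resid m k c (\<lambda>i. D i g) \<partial>gauss n)"
proof -
  define y where "y = (\<lambda>e t. inner_n m (c e) (\<lambda>j. p j t))"
  obtain k' u where k': "k' \<le> k" and u: "orthonormal_n n k' u" and span: "\<And>e. e < k \<Longrightarrow> in_span_n n k' u (y e)"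
    using gram_schmidt_n[of k n y] by blast
  define l where "l = (\<lambda>i g. D i g - (\<Sum>e<k. inner_n m (c e) (\<lambda>j. D j g) * c e i))"
  have [measurable]: "l i \<in> borel_measurable (gauss n)" for i
    unfolding l_def inner_n_def by measurable
  have resid_l: "proj_resid m k c (\<lambda>i. D i g) = (\<Sum>i<m. (l i g)\<^sup>2)" for g
    unfolding proj_resid_eq[OF c] l_def ..
  have resid_integrable: "integrable (gauss n) (\<lambda>g. proj_resid m k c (\<lambda>i. D i g))"
    using has_bochner_integral_resid_form[of m "gauss n" "\<lambda>i j g. D i g * D j g" "\<lambda>i j. \<integral>g. D i g * D j g \<partial>gauss n" k c]
    by (simp add: proj_resid_eq_resid_form has_bochner_integral_iff D_mult)
  have l_sq: "integrable (gauss n) (\<lambda>g. (l i g)\<^sup>2)" if "i < m" for i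
  proof (rule Bochner_Integration.integrable_bound[OF resid_integrable])
    have "(l i g)\<^sup>2 \<le> (\<Sum>i<m. (l i g)\<^sup>2)" for g using that by (intro member_le_sum) auto
    then show "AE g in gauss n. norm ((l i g)\<^sup>2) \<le> norm (proj_resid m k c (\<lambda>i. D i g))"
      unfolding resid_l by (simp add: sum_nonneg)
  qed measurable
  have l_coeff: "(\<integral>g. g t * l i g \<partial>gauss n) = p i t - (\<Sum>e<k. c e i * y e t)" if "t < n" for i t
    unfolding l_def y_def
    by (intro has_bochner_integral_integral_eq has_bochner_integral_coord_orthogonal_part coeff[OF that])
  have "proj_resid n k' u (p i) \<le> (\<integral>g. (l i g)\<^sup>2 \<partial>gauss n)" if "i < m" for i
  proof -
    have "proj_resid n k' u (p i) \<le> (\<Sum>t<n. (p i t - (\<Sum>e<k. c e i * y e t))\<^sup>2)"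
      by (rule proj_resid_le_in_span[OF u in_span_n_sum[OF span]])
    also have "\<dots> = (\<Sum>t<n. (\<integral>g. g t * l i g \<partial>gauss n)\<^sup>2)" by (simp add: l_coeff)
    also have "\<dots> \<le> (\<integral>g. (l i g)\<^sup>2 \<partial>gauss n)" by (rule gauss_bessel[OF _ l_sq[OF that]]) measurable
    finally show ?thesis .
  qed
  then have "(\<Sum>i<m. proj_resid n k' u (p i)) \<le> (\<Sum>i<m. \<integral>g. (l i g)\<^sup>2 \<partial>gauss n)" by (intro sum_mono) simp
  also have "\<dots> = (\<integral>g. proj_resid m k c (\<lambda>i. D i g) \<partial>gauss n)"
    unfolding resid_l using l_sq by (simp add: Bochner_Integration.integral_sum)
  finally show ?thesis using k' u by blast
qed

lemma proj_resid_cmult: "proj_resid n m u (\<lambda>t. a * y t) = a\<^sup>2 * proj_resid n m u y"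
proof -
  have "inner_n n v (\<lambda>t. a * y t) = a * inner_n n v y" for v by (simp add: inner_n_def sum_distrib_left mult_ac)
  then show ?thesis by (simp add: proj_resid_def power_mult_distrib sum_distrib_left right_diff_distrib)
qed

lemma ex_orthonormal_mehler_coeff_resid_le:
  assumes f: "unit_bounded n f" and c: "orthonormal_n m k c"
  shows "\<exists>k'\<le>k. \<exists>u. orthonormal_n n k' u \<and>
    4 * (sin \<phi>)\<^sup>2 * (\<Sum>i<m. proj_resid n k' u (mehler_coeff n \<Theta> f (xs i)))
      \<le> resid_form m k c (\<lambda>i j. increment_cov n \<Theta> \<phi> f (xs i) (xs j))"
proof -
  have "has_bochner_integral (gauss n) (\<lambda>g. g t * sym_increment n \<Theta> \<phi> f (xs i) g) (2 * sin \<phi> * mehler_coeff n \<Theta> f (xs i) t)"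
    if "t < n" for i t
    using integral_coord_sym_increment[OF f that] by (simp add: has_bochner_integral_iff)
  from ex_orthonormal_coeff_resid_le[where D = "\<lambda>i. sym_increment n \<Theta> \<phi> f (xs i)",
      OF c measurable_sym_increment[OF f] integrable_sym_increment_mult[OF f] this]
  show ?thesis
    using has_bochner_integral_proj_resid_sym_increment[OF f, of m k c \<Theta> \<phi> xs]
    by (simp add: proj_resid_cmult has_bochner_integral_iff power_mult_distrib sum_distrib_left[symmetric])
qed

subsection \<open>Completeness\<close>

lemma smooth_taylor_junta:
  assumes f: "unit_bounded n f" and u: "orthonormal_n n m u"
    and junta: "\<And>x. x \<in> space (gauss n) \<Longrightarrow> f x = G (\<lambda>j. if j < m then inner_n n (u j) x else 0)"
    and \<beta>: "\<beta> \<noteq> 0"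
  defines "h \<equiv> smooth n (\<lambda>_. 1) (\<lambda>_. \<beta>) f"
  shows "\<bar>h (\<lambda>t. x t + w t) - h x - (\<Sum>j<m. inner_n n (u j) w * inner_n n (u j) (smooth_grad n (\<lambda>_. 1) (\<lambda>_. \<beta>) f x))\<bar>
    \<le> 3 / \<beta>\<^sup>2 * (\<Sum>j<m. (inner_n n (u j) w)\<^sup>2)"
proof -
  let ?w = "\<lambda>t. \<Sum>j<m. inner_n n (u j) w * u j t" and ?grad = "smooth_grad n (\<lambda>_. 1) (\<lambda>_. \<beta>) f x"
  have "f (lincomb n 1 \<beta> (\<lambda>t. x t + w t) z) = f (lincomb n 1 \<beta> (\<lambda>t. x t + ?w t) z)" for z
  proof -
    have "inner_n n (u j) (lincomb n 1 \<beta> (\<lambda>t. x t + w t) z) = inner_n n (u j) (lincomb n 1 \<beta> (\<lambda>t. x t + ?w t) z)" if "j < m" for j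
      using inner_orthonormal_combination[OF u that, of "\<lambda>j. inner_n n (u j) w"]
      unfolding inner_n_lincomb by (simp add: inner_n_def distrib_left sum.distrib)
    then show ?thesis by (simp add: junta cong: if_cong)
  qed
  then have "h (\<lambda>t. x t + w t) = h (\<lambda>t. x t + ?w t)" by (simp add: h_def smooth_def)
  moreover have "(\<Sum>t<n. ?grad t * (x t + ?w t - x t)) = (\<Sum>j<m. inner_n n (u j) w * inner_n n (u j) ?grad)"
    using inner_n_sum_right[of n ?grad "\<lambda>j. inner_n n (u j) w" u m] by (simp add: inner_n_def mult.commute)
  moreover have "(\<Sum>t<n. (1 / \<beta>)\<^sup>2 * (x t + ?w t - x t)\<^sup>2) = (\<Sum>j<m. (inner_n n (u j) w)\<^sup>2) / \<beta>\<^sup>2"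
    using sum_sq_orthonormal_combination[OF u, of "\<lambda>j. inner_n n (u j) w"]
    by (simp add: sum_distrib_left[symmetric] power_divide sum_divide_distrib[symmetric])
  ultimately show ?thesis
    using smooth_taylor[OF f, of "\<lambda>_. \<beta>" "\<lambda>_. 1" "\<lambda>t. x t + ?w t" x] \<beta> by (simp add: h_def)
qed

lemma sym_increment_junta:
  fixes x :: "nat \<Rightarrow> real"
  assumes f: "unit_bounded n f" and u: "orthonormal_n n m u"
    and junta: "\<And>x. x \<in> space (gauss n) \<Longrightarrow> f x = G (\<lambda>j. if j < m then inner_n n (u j) x else 0)"
    and angles: "sin \<Theta> \<noteq> 0" "cos \<phi> \<noteq> 0"
  defines "Y \<equiv> \<lambda>j. 2 * sin \<Theta> * sin \<phi> *
      inner_n n (u j) (smooth_grad n (\<lambda>_. 1) (\<lambda>_. sin \<Theta> * cos \<phi>) f (\<lambda>t. cos \<Theta> * x t))"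
  shows "\<bar>sym_increment n \<Theta> \<phi> f x g - (\<Sum>j<m. inner_n n (u j) g * Y j)\<bar> \<le> 6 * (tan \<phi>)\<^sup>2 * (\<Sum>j<m. (inner_n n (u j) g)\<^sup>2)"
proof -
  let ?h = "smooth n (\<lambda>_. 1) (\<lambda>_. sin \<Theta> * cos \<phi>) f (\<lambda>t. cos \<Theta> * x t)"
  let ?q = "\<Sum>j<m. (inner_n n (u j) g)\<^sup>2" and ?lin = "\<Sum>j<m. inner_n n (u j) g * Y j"
  have step: "\<bar>partial_smooth n \<Theta> \<psi> f x g - ?h - sin \<psi> / sin \<phi> * (?lin / 2)\<bar> \<le> 3 * (tan \<phi>)\<^sup>2 * ?q"
    if \<psi>: "cos \<psi> = cos \<phi>" "(sin \<psi>)\<^sup>2 = (sin \<phi>)\<^sup>2" "sin \<phi> \<noteq> 0" for \<psi>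
  proof -
    let ?w = "\<lambda>t. sin \<Theta> * sin \<psi> * g t"
    have inner: "inner_n n v ?w = sin \<Theta> * sin \<psi> * inner_n n v g" for v
      by (simp add: inner_n_def sum_distrib_left mult_ac)
    have "(\<Sum>j<m. inner_n n (u j) ?w * inner_n n (u j) (smooth_grad n (\<lambda>_. 1) (\<lambda>_. sin \<Theta> * cos \<phi>) f (\<lambda>t. cos \<Theta> * x t)))
        = sin \<psi> / sin \<phi> * (?lin / 2)"
      unfolding inner Y_def using \<psi> by (simp add: sum_distrib_left sum_divide_distrib mult_ac)
    moreover have "3 / (sin \<Theta> * cos \<phi>)\<^sup>2 * (\<Sum>j<m. (inner_n n (u j) ?w)\<^sup>2) = 3 * (tan \<phi>)\<^sup>2 * ?q"
      unfolding inner using angles \<psi> by (simp add: power_mult_distrib sum_distrib_left[symmetric] tan_def power_divide)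
    ultimately show ?thesis
      using smooth_taylor_junta[OF f u junta, of "sin \<Theta> * cos \<phi>" "\<lambda>t. cos \<Theta> * x t" ?w] angles \<psi>
      by (simp add: partial_smooth_eq)
  qed
  show ?thesis
  proof (cases "sin \<phi> = 0")
    case True
    then show ?thesis by (simp add: sym_increment_def partial_smooth_eq Y_def sum_nonneg)
  next
    case False
    have "\<bar>partial_smooth n \<Theta> \<phi> f x g - ?h - ?lin / 2\<bar> \<le> 3 * (tan \<phi>)\<^sup>2 * ?q"
      "\<bar>partial_smooth n \<Theta> (- \<phi>) f x g - ?h + ?lin / 2\<bar> \<le> 3 * (tan \<phi>)\<^sup>2 * ?q"
      using step[of \<phi>] step[of "- \<phi>"] False by simp_all
    then show ?thesis unfolding sym_increment_def by linarith
  qed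
qed

lemma integral_sum_inner_sq_sq_le:
  assumes u: "orthonormal_n n m u"
  shows "integrable (gauss n) (\<lambda>g. (\<Sum>j<m. (inner_n n (u j) g)\<^sup>2)\<^sup>2)"
    "(\<integral>g. (\<Sum>j<m. (inner_n n (u j) g)\<^sup>2)\<^sup>2 \<partial>gauss n) \<le> 3 * (real m)\<^sup>2"
proof -
  let ?q = "\<lambda>g. (\<Sum>j<m. (inner_n n (u j) g)\<^sup>2)\<^sup>2"
  have "has_bochner_integral (gauss n) (\<lambda>g. (inner_n n (u j) g) ^ 4) 3" if "j < m" for j
  proof -
    have "(norm_n n (u j))\<^sup>2 = 1" using orthonormal_nD(2)[OF u that] by (simp add: inner_n_self)
    then have "norm_n n (u j) = 1" by (metis norm_n_nonneg one_power2 power2_eq_imp_eq zero_le_one)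
    then show ?thesis using inner_n_fourth_moment[of n "u j"] by simp
  qed
  then have "has_bochner_integral (gauss n) (\<lambda>g. real m * (\<Sum>j<m. (inner_n n (u j) g) ^ 4)) (real m * (\<Sum>j<m. 3))"
    by (intro has_bochner_integral_mult_right has_bochner_integral_sum) auto
  then have moment: "has_bochner_integral (gauss n) (\<lambda>g. real m * (\<Sum>j<m. (inner_n n (u j) g) ^ 4)) (3 * (real m)\<^sup>2)"
    by (simp add: power2_eq_square mult_ac)
  have sq_le: "?q g \<le> real m * (\<Sum>j<m. (inner_n n (u j) g) ^ 4)" for g
    using sum_squared_le_sum_of_squares[of "\<lambda>j. (inner_n n (u j) g)\<^sup>2" "{..<m}"] by (simp add: mult.commute)
  show "integrable (gauss n) ?q"
    by (rule Bochner_Integration.integrable_bound[OF integrable.intros[OF moment]])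
       (use sq_le in \<open>auto simp: sum_nonneg\<close>)
  then show "(\<integral>g. ?q g \<partial>gauss n) \<le> 3 * (real m)\<^sup>2"
    using integral_mono[OF _ integrable.intros[OF moment] sq_le] moment
    by (simp add: has_bochner_integral_iff)
qed

lemma ex_orthonormal_increment_cov_resid_le:
  assumes f: "sign_function n f" and J: "linear_junta n k f" and angles: "sin \<Theta> \<noteq> 0" "cos \<phi> \<noteq> 0"
  shows "\<exists>k'\<le>k. \<exists>c. orthonormal_n m k' c \<and>
    resid_form m k' c (\<lambda>i j. increment_cov n \<Theta> \<phi> f (xs i) (xs j)) \<le> real m * (108 * (real k)\<^sup>2 * (tan \<phi>) ^ 4)"
proof -
  note fb = unit_bounded_sign_function[OF f]
  obtain l u G where l: "l \<le> k" and u: "orthonormal_n n l u"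
    and junta: "\<And>x. x \<in> space (gauss n) \<Longrightarrow> f x = G (\<lambda>j. if j < l then inner_n n (u j) x else 0)"
    using linear_juntaE[OF J] by blast
  define Y where "Y = (\<lambda>j i. 2 * sin \<Theta> * sin \<phi> *
      inner_n n (u j) (smooth_grad n (\<lambda>_. 1) (\<lambda>_. sin \<Theta> * cos \<phi>) f (\<lambda>t. cos \<Theta> * xs i t)))"
  define q where "q g = (\<Sum>j<l. (inner_n n (u j) g)\<^sup>2)" for g
  obtain k' c where k': "k' \<le> l" and c: "orthonormal_n m k' c" and span: "\<And>j. j < l \<Longrightarrow> in_span_n m k' c (Y j)"
    using gram_schmidt_n[of l m Y] by blast
  have resid: "proj_resid m k' c (\<lambda>i. sym_increment n \<Theta> \<phi> f (xs i) g) \<le> real m * (36 * (tan \<phi>) ^ 4) * (q g)\<^sup>2" for g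
  proof -
    have "proj_resid m k' c (\<lambda>i. sym_increment n \<Theta> \<phi> f (xs i) g)
        \<le> (\<Sum>i<m. (sym_increment n \<Theta> \<phi> f (xs i) g - (\<Sum>j<l. inner_n n (u j) g * Y j i))\<^sup>2)"
      by (rule proj_resid_le_in_span[OF c in_span_n_sum[OF span]])
    also have "\<dots> \<le> (\<Sum>i<m. (6 * (tan \<phi>)\<^sup>2 * q g)\<^sup>2)"
      unfolding Y_def q_def
      by (intro sum_mono power2_le_iff_abs_le[THEN iffD2] sym_increment_junta[OF fb u junta angles])
         (simp add: sum_nonneg)
    also have "\<dots> = real m * (36 * (tan \<phi>) ^ 4) * (q g)\<^sup>2"
      by (simp add: power_mult_distrib)
    finally show ?thesis .
  qed
  note moment = integral_sum_inner_sq_sq_le[OF u, folded q_def]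
  note cov = has_bochner_integral_proj_resid_sym_increment[OF fb, of m k' c \<Theta> \<phi> xs]
  have "resid_form m k' c (\<lambda>i j. increment_cov n \<Theta> \<phi> f (xs i) (xs j))
      = (\<integral>g. proj_resid m k' c (\<lambda>i. sym_increment n \<Theta> \<phi> f (xs i) g) \<partial>gauss n)"
    using cov by (simp add: has_bochner_integral_iff)
  also have "\<dots> \<le> (\<integral>g. real m * (36 * (tan \<phi>) ^ 4) * (q g)\<^sup>2 \<partial>gauss n)"
    using cov moment(1) resid by (intro integral_mono) (auto simp: has_bochner_integral_iff)
  also have "\<dots> \<le> real m * (36 * (tan \<phi>) ^ 4) * (3 * (real l)\<^sup>2)"
    unfolding integral_mult_right_zero by (intro mult_left_mono moment(2)) simp
  also have "\<dots> \<le> real m * (36 * (tan \<phi>) ^ 4) * (3 * (real k)\<^sup>2)"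
    using l by (intro mult_left_mono power_mono) auto
  finally have "resid_form m k' c (\<lambda>i j. increment_cov n \<Theta> \<phi> f (xs i) (xs j)) \<le> real m * (108 * (real k)\<^sup>2 * (tan \<phi>) ^ 4)"
    by (simp add: mult_ac)
  then show ?thesis using k' l c by (intro exI[of _ k'] conjI exI[of _ c]) simp_all
qed

section \<open>Sampling\<close>

lemma (in prob_space) has_bochner_integral_PiM_centered_mult:
  fixes D :: "'a \<Rightarrow> real"
  assumes I: "finite I" "i \<in> I" "j \<in> I" and D: "integrable M D" "integrable M (\<lambda>x. (D x)\<^sup>2)" "expectation D = 0"
  shows "has_bochner_integral (PiM I (\<lambda>_. M)) (\<lambda>w. D (w i) * D (w j)) (if i = j then expectation (\<lambda>x. (D x)\<^sup>2) else 0)"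
proof -
  interpret product_sigma_finite "\<lambda>_. M" by unfold_locales
  define F where "F l x = (if l = i then D x else 1) * (if l = j then D x else 1)" for l x
  have F: "integrable M (F l)" for l
    using D unfolding F_def by (cases "l = i"; cases "l = j") (auto simp: power2_eq_square)
  have F_prod: "(\<Prod>l\<in>I. F l (w l)) = D (w i) * D (w j)" for w
    using I unfolding F_def prod.distrib by simp
  have "(\<Prod>l\<in>I. expectation (F l)) = (if i = j then expectation (\<lambda>x. (D x)\<^sup>2) else 0)"
  proof (cases "i = j")
    case True
    have "(\<Prod>l\<in>I. expectation (F l)) = (\<Prod>l\<in>I. if l = i then expectation (\<lambda>x. (D x)\<^sup>2) else 1)"
      using True by (intro prod.cong refl) (auto simp: F_def[abs_def] power2_eq_square prob_space)
    then show ?thesis using True I by simp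
  next
    case False
    then have "F i = D" by (auto simp: F_def)
    then show ?thesis using False I D(3) by (auto intro!: prod_zero)
  qed
  then show ?thesis
    using product_integrable_prod[OF I(1), of F] product_integral_prod[OF I(1), of F] F
    by (simp add: F_prod has_bochner_integral_iff)
qed

lemma (in prob_space) sample_mean_variance:
  fixes Y :: "'a \<Rightarrow> real"
  assumes Y [measurable]: "Y \<in> borel_measurable M" and Y_sq: "integrable M (\<lambda>x. (Y x)\<^sup>2)" and r: "0 < r"
  shows "has_bochner_integral (PiM {..<r} (\<lambda>_. M)) (\<lambda>w. ((\<Sum>l<r. Y (w l)) / real r - expectation Y)\<^sup>2) (variance Y / real r)"
proof -
  let ?P = "PiM {..<r} (\<lambda>_. M)"
  have Y_int: "integrable M Y" by (rule expectation_abs_le_sqrt(1)[OF Y Y_sq])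
  define D where "D x = Y x - expectation Y" for x
  have D: "integrable M D" "expectation D = 0" unfolding D_def using Y_int by (simp_all add: prob_space)
  have D_sq: "integrable M (\<lambda>x. (D x)\<^sup>2)"
    unfolding D_def power2_diff using Y_int Y_sq by simp
  have "has_bochner_integral ?P (\<lambda>w. (\<Sum>l<r. \<Sum>l'<r. D (w l) * D (w l')) / (real r)\<^sup>2)
      ((\<Sum>l<r. \<Sum>l'<r. if l = l' then variance Y else 0) / (real r)\<^sup>2)"
    unfolding D_def[symmetric]
    by (intro has_bochner_integral_divide has_bochner_integral_sum has_bochner_integral_PiM_centered_mult D D_sq) auto
  moreover have "((\<Sum>l<r. Y (w l)) / real r - expectation Y)\<^sup>2 = (\<Sum>l<r. \<Sum>l'<r. D (w l) * D (w l')) / (real r)\<^sup>2" for w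
  proof -
    have "(\<Sum>l<r. Y (w l)) / real r - expectation Y = (\<Sum>l<r. D (w l)) / real r"
      using r by (simp add: D_def sum_subtractf diff_divide_distrib)
    then show ?thesis by (simp add: power_divide power2_eq_square sum_product)
  qed
  ultimately show ?thesis using r by (simp add: power2_eq_square)
qed

lemma (in prob_space) variance_le_second_moment:
  fixes Y :: "'a \<Rightarrow> real"
  assumes "Y \<in> borel_measurable M" "integrable M (\<lambda>x. (Y x)\<^sup>2)"
  shows "variance Y \<le> expectation (\<lambda>x. (Y x)\<^sup>2)"
  using variance_eq[OF expectation_abs_le_sqrt(1)[OF assms] assms(2)] by simp

lemma (in prob_space) integral_le_const_real:
  fixes X :: "'a \<Rightarrow> real"
  assumes "integrable M X" "\<And>x. x \<in> space M \<Longrightarrow> X x \<le> c"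
  shows "expectation X \<le> c"
  using integral_mono[OF assms(1), of "\<lambda>_. c"] assms(2) by (simp add: prob_space)

lemma (in prob_space) sample_mean_chebyshev:
  fixes Y :: "'a \<Rightarrow> real"
  assumes Y [measurable]: "Y \<in> borel_measurable M" and bound: "\<And>x. x \<in> space M \<Longrightarrow> \<bar>Y x\<bar> \<le> B"
    and r: "0 < r" and t: "0 < t"
  shows "measure (PiM {..<r} (\<lambda>_. M)) {w \<in> space (PiM {..<r} (\<lambda>_. M)). t < \<bar>(\<Sum>l<r. Y (w l)) / real r - expectation Y\<bar>}
    \<le> B\<^sup>2 / (real r * t\<^sup>2)"
proof -
  let ?P = "PiM {..<r} (\<lambda>_. M)" and ?X = "\<lambda>w. (\<Sum>l<r. Y (w l)) / real r - expectation Y"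
  interpret sample: prob_space ?P by (rule prob_space_PiM) unfold_locales
  have sq_le: "(Y x)\<^sup>2 \<le> B\<^sup>2" if "x \<in> space M" for x
    using power_mono[OF bound[OF that] abs_ge_zero, of 2] by simp
  have Y_sq: "integrable M (\<lambda>x. (Y x)\<^sup>2)" by (rule integrable_bounded[of _ "B\<^sup>2"]) (use sq_le in auto)
  note second_moment = sample_mean_variance[OF Y Y_sq r]
  have "measure ?P {w \<in> space ?P. t < \<bar>?X w\<bar>} \<le> measure ?P {w \<in> space ?P. t\<^sup>2 \<le> (?X w)\<^sup>2}"
    by (rule sample.finite_measure_mono) (use t in \<open>auto simp: abs_le_square_iff[symmetric]\<close>)
  also have "\<dots> \<le> (\<integral>w. (?X w)\<^sup>2 \<partial>?P) / t\<^sup>2"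
    by (rule integral_Markov_inequality_measure[of _ _ "{}"]) (use t integrable.intros[OF second_moment] in auto)
  also have "(\<integral>w. (?X w)\<^sup>2 \<partial>?P) = variance Y / real r" using second_moment by (simp add: has_bochner_integral_iff)
  also have "variance Y / real r / t\<^sup>2 \<le> B\<^sup>2 / real r / t\<^sup>2"
    using variance_le_second_moment[OF Y Y_sq] integral_le_const_real[OF Y_sq sq_le]
    by (intro divide_right_mono) auto
  finally show ?thesis by simp
qed

lemma resid_form_sum_divide:
  fixes r :: nat
  shows "(\<Sum>l<r. resid_form m k c (F l)) / a = resid_form m k c (\<lambda>i j. (\<Sum>l<r. F l i j) / a)"
proof (induction r)
  case 0
  show ?case by (simp add: resid_form_def)
next
  case (Suc r)
  have "resid_form m k c (\<lambda>i j. (\<Sum>l<Suc r. F l i j) / a)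
      = resid_form m k c (\<lambda>i j. (\<Sum>l<r. F l i j) / a) + resid_form m k c (F r) / a"
    by (simp add: resid_form_def sum.distrib sum_divide_distrib diff_divide_distrib add_divide_distrib distrib_left)
  then show ?case using Suc.IH by (simp add: add_divide_distrib)
qed

lemma resid_form_abs_le:
  assumes c: "orthonormal_n m k c"
  shows "\<bar>resid_form m k c K\<bar> \<le> \<bar>\<Sum>i<m. K i i\<bar> + real k * sqrt (\<Sum>i<m. \<Sum>j<m. (K i j)\<^sup>2)"
proof -
  let ?I = "{..<m} \<times> {..<m}" and ?frobenius = "sqrt (\<Sum>i<m. \<Sum>j<m. (K i j)\<^sup>2)"
  have quadratic: "\<bar>\<Sum>i<m. \<Sum>j<m. c a i * c a j * K i j\<bar> \<le> ?frobenius" if "a < k" for a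
  proof -
    let ?C = "\<lambda>(i, j). c a i * c a j" and ?K = "\<lambda>(i, j). K i j"
    have "(\<Sum>p\<in>?I. (?C p)\<^sup>2) = (\<Sum>i<m. (c a i)\<^sup>2) * (\<Sum>j<m. (c a j)\<^sup>2)"
      by (simp add: sum_product sum.cartesian_product case_prod_beta power_mult_distrib)
    then have unit: "L2_set ?C ?I = 1" by (simp add: L2_set_def orthonormal_sum_sq[OF c that])
    have "\<bar>\<Sum>i<m. \<Sum>j<m. c a i * c a j * K i j\<bar> = \<bar>\<Sum>p\<in>?I. ?C p * ?K p\<bar>"
      by (simp add: sum.cartesian_product case_prod_beta)
    also have "\<dots> \<le> (\<Sum>p\<in>?I. \<bar>?C p\<bar> * \<bar>?K p\<bar>)" unfolding abs_mult[symmetric] by (rule sum_abs)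
    also have "\<dots> \<le> L2_set ?C ?I * L2_set ?K ?I" by (rule L2_set_mult_ineq)
    also have "\<dots> = ?frobenius" unfolding unit by (simp add: L2_set_def sum.cartesian_product case_prod_beta)
    finally show ?thesis .
  qed
  have "\<bar>resid_form m k c K\<bar> \<le> \<bar>\<Sum>i<m. K i i\<bar> + \<bar>\<Sum>a<k. \<Sum>i<m. \<Sum>j<m. c a i * c a j * K i j\<bar>"
    unfolding resid_form_def by (rule abs_triangle_ineq4)
  also have "\<bar>\<Sum>a<k. \<Sum>i<m. \<Sum>j<m. c a i * c a j * K i j\<bar> \<le> (\<Sum>a<k. ?frobenius)"
    by (rule order_trans[OF sum_abs sum_mono]) (simp add: quadratic)
  finally show ?thesis by simp
qed

lemma resid_form_deviation:
  assumes c: "orthonormal_n m k c" and K: "\<And>i j. i < m \<Longrightarrow> j < m \<Longrightarrow> \<bar>K i j - K' i j\<bar> \<le> \<kappa>" and \<kappa>: "0 \<le> \<kappa>"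
  shows "\<bar>resid_form m k c K - resid_form m k c K'\<bar> \<le> \<kappa> * real m * (real k + 1)"
proof -
  have "\<bar>resid_form m k c K - resid_form m k c K'\<bar>
      \<le> \<bar>\<Sum>i<m. K i i - K' i i\<bar> + real k * sqrt (\<Sum>i<m. \<Sum>j<m. (K i j - K' i j)\<^sup>2)"
    unfolding resid_form_diff by (rule resid_form_abs_le[OF c])
  also have "\<bar>\<Sum>i<m. K i i - K' i i\<bar> \<le> (\<Sum>i<m. \<kappa>)"
    by (rule order_trans[OF sum_abs sum_mono]) (simp add: K)
  also have "(\<Sum>i<m. \<Sum>j<m. (K i j - K' i j)\<^sup>2) \<le> (\<Sum>i<m. \<Sum>j<m. \<kappa>\<^sup>2)"
    using K \<kappa> by (intro sum_mono) (simp add: abs_le_square_iff[symmetric])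
  also have "sqrt (\<Sum>i<m. \<Sum>j<m. \<kappa>\<^sup>2) = \<kappa> * real m"
    using \<kappa> by (intro real_sqrt_unique) (auto simp: power2_eq_square)
  finally show ?thesis by (simp add: algebra_simps mult_left_mono)
qed

lemma sum_sq_le_one_imp_abs_mult_le_one:
  fixes y :: "nat \<Rightarrow> real"
  assumes "(\<Sum>i<n. (y i)\<^sup>2) \<le> 1" "i < n" "j < n"
  shows "\<bar>y i * y j\<bar> \<le> 1"
proof -
  have "\<bar>y l\<bar> \<le> 1" if "l < n" for l
  proof -
    have "(y l)\<^sup>2 \<le> (\<Sum>i<n. (y i)\<^sup>2)" using that by (intro member_le_sum) auto
    with assms(1) have "(y l)\<^sup>2 \<le> 1" by linarith
    then show ?thesis by (simp only: abs_square_le_1)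
  qed
  then show ?thesis using assms(2,3) by (simp add: abs_mult mult_le_one)
qed

definition (in prob_space) moment_deviation :: "nat \<Rightarrow> ('a \<Rightarrow> nat \<Rightarrow> real) \<Rightarrow> (nat \<Rightarrow> 'a) \<Rightarrow> nat \<Rightarrow> nat \<Rightarrow> real"
  where "moment_deviation m p w i j = (\<Sum>l<m. p (w l) i * p (w l) j) / real m - expectation (\<lambda>x. p x i * p x j)"

text \<open>Controlling the Frobenius norm of the deviation bounds all orthonormal systems at once, and for vectors in the
  unit ball its expectation does not depend on the dimension.\<close>

lemma (in prob_space) sum_moment_deviation_diag:
  assumes "\<And>i. i < n \<Longrightarrow> integrable M (\<lambda>x. (p x i)\<^sup>2)"
  shows "(\<Sum>i<n. moment_deviation m p w i i)
    = (\<Sum>l<m. \<Sum>i<n. (p (w l) i)\<^sup>2) / real m - expectation (\<lambda>x. \<Sum>i<n. (p x i)\<^sup>2)"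
proof -
  have "(\<Sum>i<n. moment_deviation m p w i i) = (\<Sum>i<n. \<Sum>l<m. (p (w l) i)\<^sup>2) / real m - (\<Sum>i<n. expectation (\<lambda>x. (p x i)\<^sup>2))"
    by (simp add: moment_deviation_def sum_subtractf sum_divide_distrib power2_eq_square)
  also have "(\<Sum>i<n. \<Sum>l<m. (p (w l) i)\<^sup>2) = (\<Sum>l<m. \<Sum>i<n. (p (w l) i)\<^sup>2)" by (rule sum.swap)
  also have "(\<Sum>i<n. expectation (\<lambda>x. (p x i)\<^sup>2)) = expectation (\<lambda>x. \<Sum>i<n. (p x i)\<^sup>2)"
    using assms by (subst Bochner_Integration.integral_sum) auto
  finally show ?thesis .
qed

lemma (in prob_space) sum_second_moment_products:
  fixes p :: "'a \<Rightarrow> nat \<Rightarrow> real"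
  assumes "\<And>i j. i < n \<Longrightarrow> j < n \<Longrightarrow> integrable M (\<lambda>x. (p x i * p x j)\<^sup>2)"
  shows "(\<Sum>i<n. \<Sum>j<n. expectation (\<lambda>x. (p x i * p x j)\<^sup>2)) = expectation (\<lambda>x. (\<Sum>i<n. (p x i)\<^sup>2)\<^sup>2)"
proof -
  have "(\<Sum>i<n. (p x i)\<^sup>2)\<^sup>2 = (\<Sum>i<n. \<Sum>j<n. (p x i * p x j)\<^sup>2)" for x
    by (simp add: power_mult_distrib power2_eq_square[of "sum _ _"] sum_product)
  moreover have "has_bochner_integral M (\<lambda>x. \<Sum>i<n. \<Sum>j<n. (p x i * p x j)\<^sup>2)
      (\<Sum>i<n. \<Sum>j<n. expectation (\<lambda>x. (p x i * p x j)\<^sup>2))"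
    by (intro has_bochner_integral_sum has_bochner_integral_integrable assms) auto
  ultimately show ?thesis by (simp add: has_bochner_integral_iff)
qed

lemma (in prob_space) moment_deviation_frobenius:
  fixes p :: "'a \<Rightarrow> nat \<Rightarrow> real"
  assumes p [measurable]: "\<And>i. i < n \<Longrightarrow> (\<lambda>x. p x i) \<in> borel_measurable M"
    and ball: "\<And>x. x \<in> space M \<Longrightarrow> (\<Sum>i<n. (p x i)\<^sup>2) \<le> 1" and m: "0 < m"
  defines "X \<equiv> \<lambda>w. (\<Sum>i<n. \<Sum>j<n. (moment_deviation m p w i j)\<^sup>2) + (\<Sum>i<n. moment_deviation m p w i i)\<^sup>2"
  shows "integrable (PiM {..<m} (\<lambda>_. M)) X" "(\<integral>w. X w \<partial>PiM {..<m} (\<lambda>_. M)) \<le> 2 / real m"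
proof -
  define s where "s x = (\<Sum>i<n. (p x i)\<^sup>2)" for x
  have [measurable]: "s \<in> borel_measurable M" unfolding s_def by measurable
  have s_bound: "\<bar>s x\<bar> \<le> 1" if "x \<in> space M" for x using ball[OF that] by (simp add: s_def sum_nonneg)
  note prod_bound = sum_sq_le_one_imp_abs_mult_le_one[OF ball]
  have prod_int: "integrable M (\<lambda>x. p x i * p x j)" and prod_sq: "integrable M (\<lambda>x. (p x i * p x j)\<^sup>2)"
    if "i < n" "j < n" for i j
    using that prod_bound by (auto intro!: integrable_bounded[of _ 1] simp: abs_square_le_1)
  have s_sq: "integrable M (\<lambda>x. (s x)\<^sup>2)"
    by (rule integrable_bounded[of _ 1]) (use s_bound in \<open>auto simp: abs_square_le_1\<close>)
  have trace: "(\<Sum>i<n. moment_deviation m p w i i) = (\<Sum>l<m. s (w l)) / real m - expectation s" for w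
    unfolding s_def using prod_int by (intro sum_moment_deviation_diag) (simp add: power2_eq_square)
  have "has_bochner_integral (PiM {..<m} (\<lambda>_. M)) X
      ((\<Sum>i<n. \<Sum>j<n. variance (\<lambda>x. p x i * p x j) / real m) + variance s / real m)"
    unfolding X_def trace unfolding moment_deviation_def
    by (intro has_bochner_integral_add has_bochner_integral_sum sample_mean_variance m prod_sq s_sq) auto
  moreover have "(\<Sum>i<n. \<Sum>j<n. variance (\<lambda>x. p x i * p x j) / real m) + variance s / real m \<le> 1 / real m + 1 / real m"
  proof (rule add_mono)
    have s_moment: "expectation (\<lambda>x. (s x)\<^sup>2) \<le> 1"
      by (rule integral_le_const_real[OF s_sq]) (use s_bound in \<open>simp add: abs_square_le_1\<close>)
    then show "variance s / real m \<le> 1 / real m"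
      using variance_le_second_moment[OF _ s_sq] by (intro divide_right_mono) auto
    have "(\<Sum>i<n. \<Sum>j<n. variance (\<lambda>x. p x i * p x j)) \<le> (\<Sum>i<n. \<Sum>j<n. expectation (\<lambda>x. (p x i * p x j)\<^sup>2))"
      using prod_sq by (intro sum_mono variance_le_second_moment) auto
    also have "\<dots> = expectation (\<lambda>x. (s x)\<^sup>2)" unfolding s_def by (rule sum_second_moment_products[OF prod_sq])
    finally have "(\<Sum>i<n. \<Sum>j<n. variance (\<lambda>x. p x i * p x j)) \<le> 1" using s_moment by simp
    then show "(\<Sum>i<n. \<Sum>j<n. variance (\<lambda>x. p x i * p x j) / real m) \<le> 1 / real m"
      by (simp add: sum_divide_distrib[symmetric] divide_right_mono)
  qed
  ultimately show "integrable (PiM {..<m} (\<lambda>_. M)) X" "(\<integral>w. X w \<partial>PiM {..<m} (\<lambda>_. M)) \<le> 2 / real m"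
    by (simp_all add: has_bochner_integral_iff)
qed

lemma (in prob_space) proj_resid_deviation_le:
  fixes p :: "'a \<Rightarrow> nat \<Rightarrow> real"
  assumes p: "\<And>i j. i < n \<Longrightarrow> j < n \<Longrightarrow> integrable M (\<lambda>x. p x i * p x j)" and u: "orthonormal_n n k u"
  shows "expectation (\<lambda>x. proj_resid n k u (p x)) \<le> (\<Sum>l<m. proj_resid n k u (p (w l))) / real m
    + \<bar>\<Sum>i<n. moment_deviation m p w i i\<bar> + real k * sqrt (\<Sum>i<n. \<Sum>j<n. (moment_deviation m p w i j)\<^sup>2)"
proof -
  have "expectation (\<lambda>x. proj_resid n k u (p x)) = resid_form n k u (\<lambda>i j. expectation (\<lambda>x. p x i * p x j))"
    unfolding proj_resid_eq_resid_form
    by (intro has_bochner_integral_integral_eq has_bochner_integral_resid_form has_bochner_integral_integrable p)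
  moreover have "(\<Sum>l<m. proj_resid n k u (p (w l))) / real m = resid_form n k u (\<lambda>i j. (\<Sum>l<m. p (w l) i * p (w l) j) / real m)"
    unfolding proj_resid_eq_resid_form by (rule resid_form_sum_divide)
  ultimately have "(\<Sum>l<m. proj_resid n k u (p (w l))) / real m - expectation (\<lambda>x. proj_resid n k u (p x))
      = resid_form n k u (moment_deviation m p w)"
    unfolding moment_deviation_def[abs_def] by (simp add: resid_form_diff)
  then show ?thesis using resid_form_abs_le[OF u, of "moment_deviation m p w"] by linarith
qed

lemma (in prob_space) proj_resid_uniform_deviation:
  fixes p :: "'a \<Rightarrow> nat \<Rightarrow> real"
  assumes p: "\<And>i. i < n \<Longrightarrow> (\<lambda>x. p x i) \<in> borel_measurable M"
    and ball: "\<And>x. x \<in> space M \<Longrightarrow> (\<Sum>i<n. (p x i)\<^sup>2) \<le> 1" and m: "0 < m" and t: "0 < t"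
  shows "\<exists>E\<in>sets (PiM {..<m} (\<lambda>_. M)). measure (PiM {..<m} (\<lambda>_. M)) E \<le> 2 / (real m * t\<^sup>2) \<and>
    (\<forall>w\<in>space (PiM {..<m} (\<lambda>_. M)) - E. \<forall>k u. orthonormal_n n k u \<longrightarrow>
       expectation (\<lambda>x. proj_resid n k u (p x)) \<le> (\<Sum>l<m. proj_resid n k u (p (w l))) / real m + (real k + 1) * t)"
proof -
  let ?P = "PiM {..<m} (\<lambda>_. M)"
  let ?frobenius = "\<lambda>w. \<Sum>i<n. \<Sum>j<n. (moment_deviation m p w i j)\<^sup>2" and ?trace = "\<lambda>w. \<Sum>i<n. moment_deviation m p w i i"
  let ?E = "{w \<in> space ?P. t\<^sup>2 \<le> ?frobenius w + (?trace w)\<^sup>2}"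
  note X = moment_deviation_frobenius[OF p ball m]
  have nonneg: "0 \<le> ?frobenius w" for w by (simp add: sum_nonneg)
  have [measurable]: "(\<lambda>w. ?frobenius w + (?trace w)\<^sup>2) \<in> borel_measurable ?P" by (rule borel_measurable_integrable[OF X(1)])
  have "?E \<in> sets ?P" by measurable
  moreover have "measure ?P ?E \<le> 2 / (real m * t\<^sup>2)"
  proof -
    have "measure ?P ?E \<le> (\<integral>w. ?frobenius w + (?trace w)\<^sup>2 \<partial>?P) / t\<^sup>2"
      by (rule integral_Markov_inequality_measure[OF X(1), of "{}"]) (use t nonneg in auto)
    also have "\<dots> \<le> 2 / real m / t\<^sup>2" by (intro divide_right_mono X(2) zero_le_power2)
    finally show ?thesis by simp
  qed
  moreover have "expectation (\<lambda>x. proj_resid n k u (p x)) \<le> (\<Sum>l<m. proj_resid n k u (p (w l))) / real m + (real k + 1) * t"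
    if w: "w \<in> space ?P - ?E" and u: "orthonormal_n n k u" for w k u
  proof -
    have "?frobenius w + (?trace w)\<^sup>2 < t\<^sup>2" using w by auto
    then have "?frobenius w \<le> t\<^sup>2" "(?trace w)\<^sup>2 \<le> t\<^sup>2"
      using nonneg[of w] zero_le_power2[of "?trace w"] by linarith+
    then have "sqrt (?frobenius w) \<le> t" "\<bar>?trace w\<bar> \<le> t"
      using t abs_le_square_iff[of "?trace w" t] by (simp_all add: real_le_lsqrt)
    moreover have "real k * sqrt (?frobenius w) \<le> real k * t" by (intro mult_left_mono calculation(1)) simp
    moreover have "integrable M (\<lambda>x. p x i * p x j)" if "i < n" "j < n" for i j
      by (rule integrable_bounded[of _ 1]) (use that p sum_sq_le_one_imp_abs_mult_le_one[OF ball] in auto)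
    ultimately show ?thesis using proj_resid_deviation_le[OF _ u, of p w m] by (simp add: algebra_simps)
  qed
  ultimately show ?thesis by blast
qed

section \<open>Nonadaptive testers with arbitrary seeds\<close>

lemma nat_set_sequences_lepoll: "(UNIV :: (nat \<Rightarrow> nat set) set) \<lesssim> (UNIV :: nat set set)"
proof -
  have "inj (\<lambda>F :: nat \<Rightarrow> nat set. prod_encode ` Sigma UNIV F)"
  proof (rule injI)
    fix F G :: "nat \<Rightarrow> nat set"
    assume "prod_encode ` Sigma UNIV F = prod_encode ` Sigma UNIV G"
    then have "Sigma UNIV F = Sigma UNIV G" by (simp add: inj_image_eq_iff inj_prod_encode)
    then show "F = G" by (auto simp: set_eq_iff fun_eq_iff)
  qed
  then show ?thesis unfolding lepoll_def by blast
qed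

lemma sequences_lepoll_reals:
  assumes "(UNIV :: 'a set) \<lesssim> (UNIV :: real set)"
  shows "(UNIV :: (nat \<Rightarrow> 'a) set) \<lesssim> (UNIV :: real set)"
proof -
  note nat_sets = eqpoll_imp_lepoll[OF nat_sets_eqpoll_reals] eqpoll_imp_lepoll[OF eqpoll_sym[OF nat_sets_eqpoll_reals]]
  have "(UNIV :: 'a set) \<lesssim> (UNIV :: nat set set)" by (rule lepoll_trans[OF assms nat_sets(2)])
  from lepoll_funcset_right[OF this, of UNIV]
  have "(UNIV :: (nat \<Rightarrow> 'a) set) \<lesssim> (UNIV :: (nat \<Rightarrow> nat set) set)" by (simp add: PiE_UNIV_domain)
  from lepoll_trans[OF lepoll_trans[OF this nat_set_sequences_lepoll] nat_sets(1)] show ?thesis .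
qed

lemma pairs_lepoll_reals:
  assumes "(UNIV :: 'a set) \<lesssim> (UNIV :: real set)" "(UNIV :: 'b set) \<lesssim> (UNIV :: real set)"
  shows "(UNIV :: ('a \<times> 'b) set) \<lesssim> (UNIV :: real set)"
proof -
  have "inj (\<lambda>p i. if i = (0 :: nat) then fst p else snd p :: real)"
  proof (rule injI)
    fix p q :: "real \<times> real"
    assume "(\<lambda>i. if i = (0 :: nat) then fst p else snd p) = (\<lambda>i. if i = 0 then fst q else snd q)"
    from fun_cong[OF this, of 0] fun_cong[OF this, of 1] show "p = q" by (simp add: prod_eq_iff)
  qed
  then have "(UNIV :: (real \<times> real) set) \<lesssim> (UNIV :: (nat \<Rightarrow> real) set)" unfolding lepoll_def by blast
  also have "(UNIV :: (nat \<Rightarrow> real) set) \<lesssim> (UNIV :: real set)" by (rule sequences_lepoll_reals) simp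
  finally have "(UNIV :: (real \<times> real) set) \<lesssim> (UNIV :: real set)" .
  moreover have "(UNIV :: ('a \<times> 'b) set) \<lesssim> (UNIV :: (real \<times> real) set)"
    using times_lepoll_mono[OF assms] by simp
  ultimately show ?thesis by (rule lepoll_trans[rotated])
qed

lemma answers_nonadaptive:
  assumes "\<And>as. length as < q \<Longrightarrow> Q \<omega> as = pt (length as)" "j \<le> q"
  shows "answers f Q \<omega> j = map (\<lambda>i. f (pt i)) [0..<j]"
  using assms(2) by (induction j) (auto simp: Let_def assms(1))

definition tester :: "nat \<Rightarrow> nat \<Rightarrow> real \<Rightarrow> real \<Rightarrow> real \<Rightarrow> nat \<Rightarrow> bool"
  where "tester n k s \<epsilon> C q \<longleftrightarrow> (\<exists>(M :: real measure) Q D. prob_space M \<and> (\<forall>\<omega>\<in>space M. \<forall>as. Q \<omega> as \<in> space (gauss n)) \<and>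
     (\<forall>f. sign_function n f \<longrightarrow>
        {\<omega> \<in> space M. accepts f q Q D \<omega>} \<in> sets M \<and>
        (f \<in> junta_class n k s \<longrightarrow> measure M {\<omega> \<in> space M. accepts f q Q D \<omega>} \<ge> 0.9) \<and>
        ((\<forall>g\<in>junta_class n k ((1 + \<epsilon>) * s). gdist n f g > C * \<epsilon>) \<longrightarrow>
          measure M {\<omega> \<in> space M. \<not> accepts f q Q D \<omega>} \<ge> 0.9)))"



locale nonadaptive_algorithm = prob_space P
  for P :: "'w measure" +
  fixes n :: nat and J :: "'l set" and pt :: "'w \<Rightarrow> 'l \<Rightarrow> nat \<Rightarrow> real" and test :: "('l \<Rightarrow> real) \<Rightarrow> bool"
  assumes finite_labels: "finite J"
    and measurable_pt: "\<And>l. l \<in> J \<Longrightarrow> (\<lambda>w. pt w l) \<in> measurable P (gauss n)"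
    and test_cong: "\<And>v v'. (\<And>l. l \<in> J \<Longrightarrow> v l = v' l) \<Longrightarrow> test v = test v'"
begin

lemma pt_in_space: "w \<in> space P \<Longrightarrow> l \<in> J \<Longrightarrow> pt w l \<in> space (gauss n)"
  using measurable_space[OF measurable_pt] .

definition accept_event :: "((nat \<Rightarrow> real) \<Rightarrow> real) \<Rightarrow> 'w set"
  where "accept_event f = {w \<in> space P. test (\<lambda>l. f (pt w l))}"

lemma accept_event_measurable:
  assumes f: "sign_function n f"
  shows "accept_event f \<in> events"
proof -
  note [measurable] = sign_function_measurable[OF f]
  let ?V = "{v \<in> J \<rightarrow>\<^sub>E {- 1, 1 :: real}. test v}" and ?A = "\<lambda>v. {w \<in> space P. \<forall>l\<in>J. f (pt w l) = v l}"
  have "accept_event f = (\<Union>v\<in>?V. ?A v)"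
  proof (intro set_eqI iffI)
    fix w assume w: "w \<in> accept_event f"
    have "(\<lambda>l\<in>J. f (pt w l)) \<in> J \<rightarrow>\<^sub>E {- 1, 1}"
      using sign_function_cases[OF f pt_in_space] w by (auto simp: accept_event_def)
    moreover have "test (\<lambda>l\<in>J. f (pt w l)) = test (\<lambda>l. f (pt w l))" by (rule test_cong) simp
    ultimately show "w \<in> (\<Union>v\<in>?V. ?A v)"
      using w by (intro UN_I[of "\<lambda>l\<in>J. f (pt w l)"]) (auto simp: accept_event_def)
  next
    fix w assume "w \<in> (\<Union>v\<in>?V. ?A v)"
    then obtain v where v: "test v" "w \<in> space P" "\<forall>l\<in>J. f (pt w l) = v l" by blast
    then have "test (\<lambda>l. f (pt w l)) = test v" by (intro test_cong) auto
    with v show "w \<in> accept_event f" by (simp add: accept_event_def)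
  qed
  moreover have "finite ?V"
    using finite_labels by (auto intro!: finite_subset[OF _ finite_PiE[of J "\<lambda>_. {- 1, 1 :: real}"]])
  moreover have "?A v \<in> events" for v
  proof (cases "J = {}")
    case False
    show ?thesis
    proof (rule sets.sets_Collect_finite_All'[OF _ finite_labels False])
      fix l assume "l \<in> J"
      note [measurable] = measurable_pt[OF this]
      show "{w \<in> space P. f (pt w l) = v l} \<in> events" by measurable
    qed
  qed simp
  ultimately show ?thesis by (simp add: sets.finite_UN)
qed

lemma ex_query_algorithm_accepts:
  fixes \<iota> :: "'w \<Rightarrow> real"
  assumes \<iota>: "inj \<iota>"
  shows "\<exists>Q D. (\<forall>w\<in>space P. \<forall>as. Q (\<iota> w) as \<in> space (gauss n)) \<and>
    (\<forall>f w. accepts f (card J) Q D (\<iota> w) \<longleftrightarrow> test (\<lambda>l. f (pt w l)))"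
proof -
  obtain e where e: "bij_betw e {0..<card J} J" using ex_bij_betw_nat_finite[OF finite_labels] by blast
  define Q where "Q \<omega> as = (if length as < card J then pt (inv \<iota> \<omega>) (e (length as)) else (\<lambda>i\<in>{..<n}. 0))"
    for \<omega> and as :: "real list"
  define D where "D \<omega> as = test (\<lambda>l. as ! the_inv_into {0..<card J} e l)" for \<omega> :: real and as
  have "accepts f (card J) Q D (\<iota> w) = test (\<lambda>l. f (pt w l))" for f w
  proof -
    have answers: "answers f Q (\<iota> w) (card J) = map (\<lambda>i. f (pt w (e i))) [0..<card J]"
      by (rule answers_nonadaptive[where q = "card J"]) (auto simp: Q_def inv_f_f[OF \<iota>])
    show ?thesis
      unfolding accepts_def D_def answers
    proof (rule test_cong)
      fix l assume l: "l \<in> J"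
      let ?i = "the_inv_into {0..<card J} e l"
      have "?i \<in> {0..<card J}" using e l the_inv_into_into[of e "{0..<card J}" l "{0..<card J}"] by (auto simp: bij_betw_def)
      moreover have "e ?i = l" using e l by (auto simp: bij_betw_def f_the_inv_into_f)
      ultimately show "map (\<lambda>i. f (pt w (e i))) [0..<card J] ! ?i = f (pt w l)" by simp
    qed
  qed
  moreover have "Q (\<iota> w) as \<in> space (gauss n)" if "w \<in> space P" for w as
    using pt_in_space[OF that] bij_betwE[OF e] by (auto simp: Q_def inv_f_f[OF \<iota>] space_gauss)
  ultimately show ?thesis by blast
qed



lemma ex_query_algorithm:
  assumes seeds: "(UNIV :: 'w set) \<lesssim> (UNIV :: real set)"
  shows "\<exists>(M :: real measure) Q D. prob_space M \<and> (\<forall>\<omega>\<in>space M. \<forall>as. Q \<omega> as \<in> space (gauss n)) \<and>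
     (\<forall>f. sign_function n f \<longrightarrow>
        {\<omega> \<in> space M. accepts f (card J) Q D \<omega>} \<in> sets M \<and>
        measure M {\<omega> \<in> space M. accepts f (card J) Q D \<omega>} = prob (accept_event f))"
proof -
  obtain \<iota> :: "'w \<Rightarrow> real" where \<iota>: "inj \<iota>" using seeds by (auto simp: lepoll_def)
  obtain Q D where Q: "\<forall>w\<in>space P. \<forall>as. Q (\<iota> w) as \<in> space (gauss n)"
    and accepts: "\<And>f w. accepts f (card J) Q D (\<iota> w) \<longleftrightarrow> test (\<lambda>l. f (pt w l))"
    using ex_query_algorithm_accepts[OF \<iota>] by blast
  define M where "M = embed_measure P \<iota>"
  have \<iota>_on: "inj_on \<iota> (space P)" using \<iota> inj_on_subset by blast
  have space_M: "space M = \<iota> ` space P" by (simp add: M_def space_embed_measure)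
  have image: "\<iota> ` A \<in> sets M" "emeasure M (\<iota> ` A) = emeasure P A" if "A \<in> events" for A
    unfolding M_def using in_sets_embed_measure[OF that] emeasure_embed_measure_image'[OF \<iota>_on that] by auto
  have "prob_space M"
    by (rule prob_spaceI) (simp add: space_M image emeasure_space_1)
  moreover have "\<forall>\<omega>\<in>space M. \<forall>as. Q \<omega> as \<in> space (gauss n)" using Q by (simp add: space_M)
  moreover have "{\<omega> \<in> space M. accepts f (card J) Q D \<omega>} \<in> sets M \<and>
      measure M {\<omega> \<in> space M. accepts f (card J) Q D \<omega>} = prob (accept_event f)" if f: "sign_function n f" for f
  proof -
    have "{\<omega> \<in> space M. accepts f (card J) Q D \<omega>} = \<iota> ` accept_event f"
      by (auto simp: space_M accepts accept_event_def)
    then show ?thesis using image[OF accept_event_measurable[OF f]] by (simp add: measure_def)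
  qed
  ultimately show ?thesis by (intro exI[of _ M] exI[of _ Q] exI[of _ D]) blast
qed

lemma testerI:
  assumes seeds: "(UNIV :: 'w set) \<lesssim> (UNIV :: real set)"
    and good: "\<And>f. sign_function n f \<Longrightarrow> \<exists>E\<in>events. prob E \<le> 0.1 \<and> (\<forall>w\<in>space P - E.
        (f \<in> junta_class n k s \<longrightarrow> w \<in> accept_event f) \<and>
        (w \<in> accept_event f \<longrightarrow> (\<exists>g\<in>junta_class n k ((1 + \<epsilon>) * s). gdist n f g \<le> C * \<epsilon>)))"
  shows "tester n k s \<epsilon> C (card J)"
proof -
  obtain M :: "real measure" and Q D where M: "prob_space M" and Q: "\<forall>\<omega>\<in>space M. \<forall>as. Q \<omega> as \<in> space (gauss n)"
    and accepts: "\<forall>f. sign_function n f \<longrightarrow> {\<omega> \<in> space M. accepts f (card J) Q D \<omega>} \<in> sets M \<and>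
        measure M {\<omega> \<in> space M. accepts f (card J) Q D \<omega>} = prob (accept_event f)"
    using ex_query_algorithm[OF seeds] by blast
  interpret M: prob_space M by (rule M)
  have "{\<omega> \<in> space M. accepts f (card J) Q D \<omega>} \<in> sets M \<and>
      (f \<in> junta_class n k s \<longrightarrow> measure M {\<omega> \<in> space M. accepts f (card J) Q D \<omega>} \<ge> 0.9) \<and>
      ((\<forall>g\<in>junta_class n k ((1 + \<epsilon>) * s). gdist n f g > C * \<epsilon>) \<longrightarrow> measure M {\<omega> \<in> space M. \<not> accepts f (card J) Q D \<omega>} \<ge> 0.9)"
    if f: "sign_function n f" for f
  proof (intro conjI impI)
    let ?A = "{\<omega> \<in> space M. accepts f (card J) Q D \<omega>}"
    show A: "?A \<in> sets M" using accepts f by blast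
    have prob_A: "measure M ?A = prob (accept_event f)" using accepts f by blast
    obtain E where E: "E \<in> events" "prob E \<le> 0.1"
      and complete: "f \<in> junta_class n k s \<Longrightarrow> space P - E \<subseteq> accept_event f"
      and sound: "\<forall>w\<in>space P - E. w \<in> accept_event f \<longrightarrow> (\<exists>g\<in>junta_class n k ((1 + \<epsilon>) * s). gdist n f g \<le> C * \<epsilon>)"
      using good[OF f] by blast
    show "measure M ?A \<ge> 0.9" if "f \<in> junta_class n k s"
      using finite_measure_mono[OF complete[OF that] accept_event_measurable[OF f]] prob_compl[OF E(1)] E(2) prob_A by simp
    assume "\<forall>g\<in>junta_class n k ((1 + \<epsilon>) * s). gdist n f g > C * \<epsilon>"
    then have "accept_event f \<subseteq> E" using sound by (force simp: accept_event_def not_less)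
    then have "prob (accept_event f) \<le> 0.1" using finite_measure_mono[OF _ E(1)] E(2) order_trans by blast
    moreover have "{\<omega> \<in> space M. \<not> accepts f (card J) Q D \<omega>} = space M - ?A" by auto
    ultimately show "measure M {\<omega> \<in> space M. \<not> accepts f (card J) Q D \<omega>} \<ge> 0.9" using M.prob_compl[OF A] prob_A by simp
  qed
  with M Q show ?thesis unfolding tester_def by blast
qed

end

section \<open>The tester\<close>

lemma (in pair_prob_space) measure_le_section:
  assumes X: "X \<in> sets (M1 \<Otimes>\<^sub>M M2)" and section_le: "\<And>x. x \<in> space M1 \<Longrightarrow> measure M2 (Pair x -` X) \<le> c"
  shows "measure (M1 \<Otimes>\<^sub>M M2) X \<le> c"
proof -
  obtain x where "x \<in> space M1" using M1.not_empty by blast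
  then have c: "0 \<le> c" using section_le[of x] measure_nonneg order_trans by blast
  have "emeasure (M1 \<Otimes>\<^sub>M M2) X = (\<integral>\<^sup>+x. emeasure M2 (Pair x -` X) \<partial>M1)" by (rule M2.emeasure_pair_measure_alt[OF X])
  also have "\<dots> \<le> (\<integral>\<^sup>+x. ennreal c \<partial>M1)"
    by (rule nn_integral_mono) (use section_le in \<open>auto simp: M2.emeasure_eq_measure intro: ennreal_leI\<close>)
  also have "\<dots> = ennreal c" by (simp add: M1.emeasure_space_1)
  finally show ?thesis using c by (simp add: P.emeasure_eq_measure)
qed

lemma (in pair_prob_space) measure_times_space:
  assumes "E \<in> sets M1" shows "measure (M1 \<Otimes>\<^sub>M M2) (E \<times> space M2) = measure M1 E"
  using assms by (simp add: measure_def M2.emeasure_pair_measure_Times M2.emeasure_space_1)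

lemma (in pair_prob_space) conditional_sample_mean_chebyshev:
  fixes Y :: "'a \<Rightarrow> 'b \<Rightarrow> real"
  assumes Y: "(\<lambda>p. Y (fst p) (snd p)) \<in> borel_measurable (M1 \<Otimes>\<^sub>M M2)"
    and bound: "\<And>x q. x \<in> space M1 \<Longrightarrow> q \<in> space M2 \<Longrightarrow> \<bar>Y x q\<bar> \<le> B" and r: "0 < r" and t: "0 < t"
  defines "P \<equiv> M1 \<Otimes>\<^sub>M PiM {..<r} (\<lambda>_. M2)"
  defines "E \<equiv> {w \<in> space P. t < \<bar>(\<Sum>l<r. Y (fst w) (snd w l)) / real r - (\<integral>q. Y (fst w) q \<partial>M2)\<bar>}"
  shows "E \<in> sets P" "measure P E \<le> B\<^sup>2 / (real r * t\<^sup>2)"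
proof -
  let ?S = "PiM {..<r} (\<lambda>_. M2)"
  interpret sample: prob_space ?S by (rule prob_space_PiM) unfold_locales
  interpret sample_pair: pair_prob_space M1 ?S by unfold_locales
  have [measurable]: "fst \<in> measurable P M1" unfolding P_def by measurable
  have "(\<lambda>w. Y (fst w) (snd w l)) \<in> borel_measurable P" if "l < r" for l
  proof -
    have [measurable]: "(\<lambda>w. snd w l) \<in> measurable P M2"
      unfolding P_def by (rule measurable_compose[OF measurable_snd measurable_component_singleton]) (use that in auto)
    have "(\<lambda>w. (fst w, snd w l)) \<in> measurable P (M1 \<Otimes>\<^sub>M M2)" by measurable
    from measurable_compose[OF this Y] show ?thesis by simp
  qed
  then have [measurable]: "(\<lambda>w. \<Sum>l<r. Y (fst w) (snd w l)) \<in> borel_measurable P" by (intro borel_measurable_sum) auto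
  have [measurable]: "(\<lambda>x. \<integral>q. Y x q \<partial>M2) \<in> borel_measurable M1"
    by (rule M2.borel_measurable_lebesgue_integral) (use Y in \<open>simp add: case_prod_beta'\<close>)
  show E: "E \<in> sets P" unfolding E_def by measurable
  show "measure P E \<le> B\<^sup>2 / (real r * t\<^sup>2)"
    unfolding P_def
  proof (rule sample_pair.measure_le_section[OF E[unfolded P_def]])
    fix x assume x: "x \<in> space M1"
    have "Y x \<in> borel_measurable M2" using measurable_compose[OF measurable_Pair1'[OF x] Y] by simp
    moreover have "Pair x -` E = {w \<in> space ?S. t < \<bar>(\<Sum>l<r. Y x (w l)) / real r - (\<integral>q. Y x q \<partial>M2)\<bar>}"
      using x by (auto simp: E_def P_def space_pair_measure)
    ultimately show "measure ?S (Pair x -` E) \<le> B\<^sup>2 / (real r * t\<^sup>2)"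
      using M2.sample_mean_chebyshev[of "Y x", OF _ bound[OF x] r t] by simp
  qed
qed

definition increment_sample :: "nat \<Rightarrow> real \<Rightarrow> real \<Rightarrow> ((nat \<Rightarrow> real) \<Rightarrow> real) \<Rightarrow> (nat \<Rightarrow> real) \<Rightarrow> (nat \<Rightarrow> real) \<Rightarrow> (nat \<Rightarrow> real) \<Rightarrow> real"
  where "increment_sample n \<Theta> \<phi> f x g z = f (noisy_point n \<Theta> \<phi> x g z) - f (noisy_point n \<Theta> (- \<phi>) x g z)"

abbreviation gauss_triple :: "nat \<Rightarrow> ((nat \<Rightarrow> real) \<times> (nat \<Rightarrow> real) \<times> (nat \<Rightarrow> real)) measure"
  where "gauss_triple n \<equiv> gauss n \<Otimes>\<^sub>M gauss_pair n"

interpretation gauss_triple: pair_prob_space "gauss n" "gauss_pair n" for n by unfold_locales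

lemma increment_sample_mult_bound:
  assumes f: "unit_bounded n f"
  shows "\<bar>increment_sample n \<Theta> \<phi> f x g z * increment_sample n \<Theta> \<phi> f x' g' z'\<bar> \<le> 4"
proof -
  have "\<bar>increment_sample n \<Theta> \<phi> f x g z\<bar> \<le> 2" for x g z
    unfolding increment_sample_def by (rule unit_bounded_abs_diff_le[OF f f]) simp_all
  then have "\<bar>increment_sample n \<Theta> \<phi> f x g z\<bar> * \<bar>increment_sample n \<Theta> \<phi> f x' g' z'\<bar> \<le> 2 * 2" by (intro mult_mono) auto
  then show ?thesis by (simp add: abs_mult)
qed

lemma integral_increment_sample:
  assumes f: "unit_bounded n f" and [measurable]: "g \<in> space (gauss n)"
  shows "(\<integral>z. increment_sample n \<Theta> \<phi> f x g z \<partial>gauss n) = sym_increment n \<Theta> \<phi> f x g"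
proof -
  note [measurable] = unit_bounded_measurable[OF f]
  have "integrable (gauss n) (\<lambda>z. f (noisy_point n \<Theta> \<psi> x g z))" for \<psi>
    by (rule gauss.integrable_bounded[of _ _ 1]) (use unit_bounded_abs_le[OF f] in auto)
  then show ?thesis by (simp add: increment_sample_def sym_increment_def partial_smooth_def)
qed

lemma integral_increment_sample_mult:
  assumes f: "unit_bounded n f"
  shows "(\<integral>w. increment_sample n \<Theta> \<phi> f x (fst w) (fst (snd w)) * increment_sample n \<Theta> \<phi> f y (fst w) (snd (snd w)) \<partial>gauss_triple n)
     = increment_cov n \<Theta> \<phi> f x y"
proof -
  let ?e = "increment_sample n \<Theta> \<phi> f"
  note [measurable] = unit_bounded_measurable[OF f]
  have triple: "integrable (gauss_triple n) (\<lambda>w. ?e x (fst w) (fst (snd w)) * ?e y (fst w) (snd (snd w)))"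
    by (rule gauss_triple.integrable_bounded[of _ _ 4])
       (use increment_sample_mult_bound[OF f] in \<open>simp_all add: increment_sample_def\<close>)
  have copies: "(\<integral>q. ?e x g (fst q) * ?e y g (snd q) \<partial>gauss_pair n) = sym_increment n \<Theta> \<phi> f x g * sym_increment n \<Theta> \<phi> f y g"
    if [measurable]: "g \<in> space (gauss n)" for g
  proof -
    have "integrable (gauss_pair n) (\<lambda>q. ?e x g (fst q) * ?e y g (snd q))"
      by (rule gauss_pair.integrable_bounded[of _ _ 4])
         (use increment_sample_mult_bound[OF f] in \<open>simp_all add: increment_sample_def\<close>)
    from gauss_pair.integral_fst'[OF this] show ?thesis
      by (simp add: integral_increment_sample[OF f that, abs_def, symmetric])
  qed
  show ?thesis
    using gauss_triple.integral_fst'[OF triple] copies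
    by (simp add: increment_cov_def cong: Bochner_Integration.integral_cong)
qed

lemma integral_rot_change_triple:
  assumes f: "unit_bounded n f"
  shows "(\<integral>w. \<bar>f (rot n {..<n} \<theta> (fst w) (fst (snd w))) - f (fst w)\<bar> \<partial>gauss_triple n) = rot_change n {..<n} f \<theta>"
proof -
  note [measurable] = unit_bounded_measurable[OF f]
  let ?F = "\<lambda>g z. \<bar>f (rot n {..<n} \<theta> g z) - f g\<bar>"
  have triple: "integrable (gauss_triple n) (\<lambda>w. ?F (fst w) (fst (snd w)))"
    by (rule gauss_triple.integrable_bounded[of _ _ 2]) (use unit_bounded_abs_diff_le[OF f f] in \<open>auto simp: space_pair_measure\<close>)
  have "(\<integral>w. ?F (fst w) (fst (snd w)) \<partial>gauss_triple n) = (\<integral>g. (\<integral>q. ?F g (fst q) \<partial>gauss_pair n) \<partial>gauss n)"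
    using gauss_triple.integral_fst'[OF triple] by simp
  also have "\<dots> = (\<integral>g. (\<integral>z. ?F g z \<partial>gauss n) \<partial>gauss n)"
  proof (intro Bochner_Integration.integral_cong refl)
    fix g assume [measurable]: "g \<in> space (gauss n)"
    show "(\<integral>q. ?F g (fst q) \<partial>gauss_pair n) = (\<integral>z. ?F g z \<partial>gauss n)"
      by (rule gauss_pair.integral_fst_marginal[of "?F g"]) measurable
  qed
  also have "\<dots> = rot_change n {..<n} f \<theta>"
    unfolding rot_change_def using gauss_pair.integral_fst'[OF integrable_abs[OF integrable_rot_diff[OF f]]] by simp
  finally show ?thesis .
qed

text \<open>\<open>Increment l i s c\<close> queries the \<open>i\<close>-th point in round \<open>l\<close>: \<open>s\<close> is the sign of the visible noise and \<open>c\<close> selects one of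
  two independent copies of the averaged noise, which makes the product in \<open>cov_estimate\<close> unbiased even for \<open>i = j\<close>.\<close>

datatype query_label = Increment nat nat bool bool | Change nat bool

type_synonym seed = "(nat \<Rightarrow> nat \<Rightarrow> real) \<times> (nat \<Rightarrow> (nat \<Rightarrow> real) \<times> (nat \<Rightarrow> real) \<times> (nat \<Rightarrow> real))"

primrec query_point :: "nat \<Rightarrow> real \<Rightarrow> real \<Rightarrow> real \<Rightarrow> seed \<Rightarrow> query_label \<Rightarrow> nat \<Rightarrow> real" where
  "query_point n \<Theta> \<phi> \<theta> w (Increment l i s c) = noisy_point n \<Theta> (if s then \<phi> else - \<phi>) (fst w i) (fst (snd w l))
     (if c then snd (snd (snd w l)) else fst (snd (snd w l)))"
| "query_point n \<Theta> \<phi> \<theta> w (Change l b) = (if b then rot n {..<n} \<theta> (fst (snd w l)) (fst (snd (snd w l))) else fst (snd w l))"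

definition query_labels :: "nat \<Rightarrow> nat \<Rightarrow> query_label set"
  where "query_labels m r = (\<lambda>(l, i, s, c). Increment l i s c) ` ({..<r} \<times> {..<m} \<times> UNIV \<times> UNIV)
    \<union> (\<lambda>(l, b). Change l b) ` ({..<r} \<times> UNIV)"

definition cov_estimate :: "nat \<Rightarrow> (query_label \<Rightarrow> real) \<Rightarrow> nat \<Rightarrow> nat \<Rightarrow> real"
  where "cov_estimate r v i j = (\<Sum>l<r. (v (Increment l i True False) - v (Increment l i False False))
     * (v (Increment l j True True) - v (Increment l j False True))) / real r"

definition change_estimate :: "nat \<Rightarrow> (query_label \<Rightarrow> real) \<Rightarrow> real"
  where "change_estimate r v = (\<Sum>l<r. \<bar>v (Change l True) - v (Change l False)\<bar>) / real r"

definition junta_test :: "nat \<Rightarrow> nat \<Rightarrow> nat \<Rightarrow> real \<Rightarrow> real \<Rightarrow> (query_label \<Rightarrow> real) \<Rightarrow> bool"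
  where "junta_test m r k b B v \<longleftrightarrow>
    change_estimate r v \<le> b \<and> (\<exists>k'\<le>k. \<exists>c. orthonormal_n m k' c \<and> resid_form m k' c (cov_estimate r v) \<le> B)"

abbreviation seed_measure :: "nat \<Rightarrow> nat \<Rightarrow> nat \<Rightarrow> seed measure"
  where "seed_measure n m r \<equiv> PiM {..<m} (\<lambda>_. gauss n) \<Otimes>\<^sub>M PiM {..<r} (\<lambda>_. gauss_triple n)"

lemma query_labels_iff [simp]:
  "Increment l i s c \<in> query_labels m r \<longleftrightarrow> l < r \<and> i < m" "Change l b \<in> query_labels m r \<longleftrightarrow> l < r"
  by (auto simp: query_labels_def image_iff)

lemma finite_query_labels: "finite (query_labels m r)"
  by (simp add: query_labels_def)

lemma card_query_labels: "card (query_labels m r) = r * (4 * m + 2)"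
proof -
  have "card (query_labels m r) = card ((\<lambda>(l, i, s, c). Increment l i s c) ` ({..<r} \<times> {..<m} \<times> UNIV \<times> UNIV))
      + card ((\<lambda>(l, b). Change l b) ` ({..<r} \<times> UNIV))"
    unfolding query_labels_def by (rule card_Un_disjoint) auto
  also have "\<dots> = card ({..<r} \<times> {..<m} \<times> (UNIV :: bool set) \<times> (UNIV :: bool set)) + card ({..<r} \<times> (UNIV :: bool set))"
    by (intro arg_cong2[of _ _ _ _ "(+)"] card_image) (auto simp: inj_on_def)
  finally show ?thesis by (simp add: card_cartesian_product algebra_simps)
qed

lemma seeds_lepoll_reals: "(UNIV :: seed set) \<lesssim> (UNIV :: real set)"
  by (intro pairs_lepoll_reals sequences_lepoll_reals) simp_all

lemma measurable_query_point:
  assumes "l \<in> query_labels m r"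
  shows "(\<lambda>w. query_point n \<Theta> \<phi> \<theta> w l) \<in> measurable (seed_measure n m r) (gauss n)"
proof (cases l)
  case (Increment j i s c)
  have [measurable]: "(\<lambda>w. fst w i) \<in> measurable (seed_measure n m r) (gauss n)"
    "(\<lambda>w. snd w j) \<in> measurable (seed_measure n m r) (gauss_triple n)"
    by (rule measurable_compose[OF measurable_fst measurable_component_singleton]
        measurable_compose[OF measurable_snd measurable_component_singleton]; use assms Increment in simp)+
  show ?thesis unfolding Increment by (cases c) simp_all
next
  case (Change j b)
  have [measurable]: "(\<lambda>w. snd w j) \<in> measurable (seed_measure n m r) (gauss_triple n)"
    by (rule measurable_compose[OF measurable_snd measurable_component_singleton]) (use assms Change in simp)
  show ?thesis unfolding Change by (cases b) simp_all
qed

lemma junta_test_cong: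
  assumes v: "\<And>l. l \<in> query_labels m r \<Longrightarrow> v l = v' l"
  shows "junta_test m r k b B v = junta_test m r k b B v'"
proof -
  have "change_estimate r v = change_estimate r v'" by (simp add: change_estimate_def v)
  moreover have "resid_form m k' c (cov_estimate r v) = resid_form m k' c (cov_estimate r v')" for k' c
    by (simp add: resid_form_def cov_estimate_def v)
  ultimately show ?thesis by (simp add: junta_test_def)
qed

interpretation seed: pair_prob_space "PiM {..<m} (\<lambda>_. gauss n)" "PiM {..<r} (\<lambda>_. gauss_triple n)" for m n r
proof -
  interpret points: prob_space "PiM {..<m} (\<lambda>_. gauss n)" by (rule prob_space_PiM) unfold_locales
  interpret noise: prob_space "PiM {..<r} (\<lambda>_. gauss_triple n)" by (rule prob_space_PiM) unfold_locales
  show "pair_prob_space (PiM {..<m} (\<lambda>_. gauss n)) (PiM {..<r} (\<lambda>_. gauss_triple n))" by unfold_locales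
qed

interpretation point_noise: pair_prob_space "PiM {..<m} (\<lambda>_. gauss n)" "gauss_triple n" for m n
  by unfold_locales

lemma nonadaptive_algorithm_junta_test:
  "nonadaptive_algorithm (seed_measure n m r) n (query_labels m r) (query_point n \<Theta> \<phi> \<theta>) (junta_test m r k b B)"
  by unfold_locales (rule finite_query_labels measurable_query_point junta_test_cong, assumption?)+

lemma ex_proj_resid_event:
  assumes f: "unit_bounded n f" and m: "0 < m" and \<tau>: "0 < \<tau>"
  shows "\<exists>E\<in>sets (seed_measure n m r). measure (seed_measure n m r) E \<le> 2 / (real m * \<tau>\<^sup>2) \<and>
    (\<forall>w\<in>space (seed_measure n m r) - E. \<forall>k u. orthonormal_n n k u \<longrightarrow> (\<integral>x. proj_resid n k u (mehler_coeff n \<Theta> f x) \<partial>gauss n)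
      \<le> (\<Sum>l<m. proj_resid n k u (mehler_coeff n \<Theta> f (fst w l))) / real m + (real k + 1) * \<tau>)"
proof -
  obtain E where E: "E \<in> sets (PiM {..<m} (\<lambda>_. gauss n))" "measure (PiM {..<m} (\<lambda>_. gauss n)) E \<le> 2 / (real m * \<tau>\<^sup>2)"
    and deviation: "\<forall>xs\<in>space (PiM {..<m} (\<lambda>_. gauss n)) - E. \<forall>k u. orthonormal_n n k u \<longrightarrow>
      (\<integral>x. proj_resid n k u (mehler_coeff n \<Theta> f x) \<partial>gauss n)
      \<le> (\<Sum>l<m. proj_resid n k u (mehler_coeff n \<Theta> f (xs l))) / real m + (real k + 1) * \<tau>"
    using gauss.proj_resid_uniform_deviation[OF measurable_noise_coeff[OF f] sum_sq_noise_coeff_le[OF f] m \<tau>] by blast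
  show ?thesis
  proof (rule bexI[of _ "E \<times> space (PiM {..<r} (\<lambda>_. gauss_triple n))"], intro conjI ballI)
    fix w assume "w \<in> space (seed_measure n m r) - E \<times> space (PiM {..<r} (\<lambda>_. gauss_triple n))"
    then have "fst w \<in> space (PiM {..<m} (\<lambda>_. gauss n)) - E" by (auto simp: space_pair_measure)
    then show "\<forall>k u. orthonormal_n n k u \<longrightarrow> (\<integral>x. proj_resid n k u (mehler_coeff n \<Theta> f x) \<partial>gauss n)
      \<le> (\<Sum>l<m. proj_resid n k u (mehler_coeff n \<Theta> f (fst w l))) / real m + (real k + 1) * \<tau>"
      using deviation by blast
  qed (use E in \<open>simp_all add: seed.measure_times_space\<close>)
qed

lemma cov_estimate_chebyshev:
  fixes f :: "(nat \<Rightarrow> real) \<Rightarrow> real" and \<Theta> \<phi> \<theta> :: real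
  assumes f: "unit_bounded n f" and ij: "i < m" "j < m" and r: "0 < r" and \<kappa>: "0 < \<kappa>"
  defines "E \<equiv> {w \<in> space (seed_measure n m r). \<kappa> < \<bar>cov_estimate r (\<lambda>l. f (query_point n \<Theta> \<phi> \<theta> w l)) i j
      - increment_cov n \<Theta> \<phi> f (fst w i) (fst w j)\<bar>}"
  shows "E \<in> sets (seed_measure n m r)" "measure (seed_measure n m r) E \<le> 16 / (real r * \<kappa>\<^sup>2)"
proof -
  note [measurable] = unit_bounded_measurable[OF f]
  define Y where "Y xs q = increment_sample n \<Theta> \<phi> f (xs i) (fst q) (fst (snd q))
      * increment_sample n \<Theta> \<phi> f (xs j) (fst q) (snd (snd q))" for xs :: "nat \<Rightarrow> nat \<Rightarrow> real" and q
  have E: "E = {w \<in> space (seed_measure n m r). \<kappa> < \<bar>(\<Sum>l<r. Y (fst w) (snd w l)) / real r - (\<integral>q. Y (fst w) q \<partial>gauss_triple n)\<bar>}"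
    unfolding E_def Y_def integral_increment_sample_mult[OF f]
    by (simp add: cov_estimate_def increment_sample_def)
  have "(\<lambda>p. Y (fst p) (snd p)) \<in> borel_measurable (PiM {..<m} (\<lambda>_. gauss n) \<Otimes>\<^sub>M gauss_triple n)"
  proof -
    have [measurable]: "(\<lambda>p. fst p l) \<in> measurable (PiM {..<m} (\<lambda>_. gauss n) \<Otimes>\<^sub>M gauss_triple n) (gauss n)" if "l < m" for l
      by (rule measurable_compose[OF measurable_fst measurable_component_singleton]) (use that in simp)
    show ?thesis unfolding Y_def increment_sample_def using ij by measurable
  qed
  note chebyshev = point_noise.conditional_sample_mean_chebyshev[of Y, OF this _ r \<kappa>]
  have "\<bar>Y xs q\<bar> \<le> 4" for xs q unfolding Y_def by (rule increment_sample_mult_bound[OF f])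
  from chebyshev[of 4, OF this, folded E]
  show "E \<in> sets (seed_measure n m r)" "measure (seed_measure n m r) E \<le> 16 / (real r * \<kappa>\<^sup>2)" by simp_all
qed

lemma change_estimate_chebyshev:
  fixes f :: "(nat \<Rightarrow> real) \<Rightarrow> real" and \<Theta> \<phi> \<theta> :: real and m :: nat
  assumes f: "unit_bounded n f" and r: "0 < r" and t: "0 < t"
  defines "E \<equiv> {w \<in> space (seed_measure n m r). t < \<bar>change_estimate r (\<lambda>l. f (query_point n \<Theta> \<phi> \<theta> w l)) - rot_change n {..<n} f \<theta>\<bar>}"
  shows "E \<in> sets (seed_measure n m r)" "measure (seed_measure n m r) E \<le> 4 / (real r * t\<^sup>2)"
proof -
  note [measurable] = unit_bounded_measurable[OF f]
  define Z where "Z q = \<bar>f (rot n {..<n} \<theta> (fst q) (fst (snd q))) - f (fst q)\<bar>"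
    for q :: "(nat \<Rightarrow> real) \<times> (nat \<Rightarrow> real) \<times> (nat \<Rightarrow> real)"
  have E: "E = {w \<in> space (seed_measure n m r). t < \<bar>(\<Sum>l<r. Z (snd w l)) / real r - (\<integral>q. Z q \<partial>gauss_triple n)\<bar>}"
    unfolding E_def Z_def by (simp add: integral_rot_change_triple[OF f] change_estimate_def)
  have "(\<lambda>p. Z (snd p)) \<in> borel_measurable (PiM {..<m} (\<lambda>_. gauss n) \<Otimes>\<^sub>M gauss_triple n)"
    unfolding Z_def by measurable
  note chebyshev = point_noise.conditional_sample_mean_chebyshev[of "\<lambda>_. Z", OF this _ r t]
  have "\<bar>Z q\<bar> \<le> 2" if "q \<in> space (gauss_triple n)" for q
    using unit_bounded_abs_diff_le[OF f f] that by (auto simp: Z_def space_pair_measure)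
  from chebyshev[of 2, OF this, folded E]
  show "E \<in> sets (seed_measure n m r)" "measure (seed_measure n m r) E \<le> 4 / (real r * t\<^sup>2)" by simp_all
qed

locale junta_tester =
  fixes n k M m r :: nat and s \<epsilon> C \<Theta> \<phi> \<theta> \<kappa> \<tau> t \<eta> :: real
  assumes s: "0 \<le> s" and \<theta>: "0 < \<theta>" "\<theta> < 1" and \<Theta>: "\<Theta> = real M * \<theta>" "0 < \<Theta>" "\<Theta> < 1"
    and \<phi>: "0 < sin \<phi>" "cos \<phi> \<noteq> 0" and rounds: "0 < m" "0 < r"
    and tolerance: "0 < \<kappa>" "0 < \<tau>" "0 < t" and \<eta>: "0 < \<eta>" "\<eta> < 1"
    and failure: "2 / (real m * \<tau>\<^sup>2) + (real m)\<^sup>2 * (16 / (real r * \<kappa>\<^sup>2)) + 4 / (real r * t\<^sup>2) \<le> 0.1"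
    and surface: "2 * (\<theta> * sqrt (2 / pi) * s) + 2 * t + \<theta>\<^sup>2 * head_taylor_error k \<Theta>
      < sin \<theta> * sqrt (2 / pi) * ((1 + \<epsilon>) * s * (2 - 2 * \<eta>))"
    and distance: "(real M * (2 * (\<theta> * sqrt (2 / pi) * s) + 2 * t) + pi / 2 * sqrt (2 / pi) / sin \<Theta>
      * sqrt (27 * (real k)\<^sup>2 * (tan \<phi>) ^ 4 / (sin \<phi>)\<^sup>2 + \<kappa> * (real k + 1) / (2 * (sin \<phi>)\<^sup>2) + (real k + 1) * \<tau>)) / \<eta> \<le> C * \<epsilon>"
begin

abbreviation sampled :: "((nat \<Rightarrow> real) \<Rightarrow> real) \<Rightarrow> seed \<Rightarrow> query_label \<Rightarrow> real"
  where "sampled f w l \<equiv> f (query_point n \<Theta> \<phi> \<theta> w l)"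

definition accurate :: "((nat \<Rightarrow> real) \<Rightarrow> real) \<Rightarrow> seed \<Rightarrow> bool"
  where "accurate f w \<longleftrightarrow>
    (\<forall>k u. orthonormal_n n k u \<longrightarrow> (\<integral>x. proj_resid n k u (mehler_coeff n \<Theta> f x) \<partial>gauss n)
      \<le> (\<Sum>l<m. proj_resid n k u (mehler_coeff n \<Theta> f (fst w l))) / real m + (real k + 1) * \<tau>) \<and>
    (\<forall>i<m. \<forall>j<m. \<bar>cov_estimate r (sampled f w) i j - increment_cov n \<Theta> \<phi> f (fst w i) (fst w j)\<bar> \<le> \<kappa>) \<and>
    \<bar>change_estimate r (sampled f w) - rot_change n {..<n} f \<theta>\<bar> \<le> t"

definition change_threshold :: real
  where "change_threshold = 2 * (\<theta> * sqrt (2 / pi) * s) + t"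

definition resid_threshold :: real
  where "resid_threshold = real m * (108 * (real k)\<^sup>2 * (tan \<phi>) ^ 4) + \<kappa> * real m * (real k + 1)"

lemma sin_\<Theta>_pos: "0 < sin \<Theta>"
  using \<Theta> by (simp add: sin_gt_zero_02)

lemma ex_inaccurate_event:
  assumes f: "unit_bounded n f"
  shows "\<exists>E\<in>sets (seed_measure n m r). measure (seed_measure n m r) E \<le> 0.1 \<and> (\<forall>w\<in>space (seed_measure n m r) - E. accurate f w)"
proof -
  let ?P = "seed_measure n m r"
  obtain E where E: "E \<in> sets ?P" "measure ?P E \<le> 2 / (real m * \<tau>\<^sup>2)"
    and resid: "\<forall>w\<in>space ?P - E. \<forall>k u. orthonormal_n n k u \<longrightarrow> (\<integral>x. proj_resid n k u (mehler_coeff n \<Theta> f x) \<partial>gauss n)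
      \<le> (\<Sum>l<m. proj_resid n k u (mehler_coeff n \<Theta> f (fst w l))) / real m + (real k + 1) * \<tau>"
    using ex_proj_resid_event[OF f rounds(1) tolerance(2), of r \<Theta>] by blast
  define F where "F i j = {w \<in> space ?P. \<kappa> < \<bar>cov_estimate r (sampled f w) i j
      - increment_cov n \<Theta> \<phi> f (fst w i) (fst w j)\<bar>}" for i j
  define G where "G = {w \<in> space ?P. t < \<bar>change_estimate r (sampled f w) - rot_change n {..<n} f \<theta>\<bar>}"
  have F: "F i j \<in> sets ?P" "measure ?P (F i j) \<le> 16 / (real r * \<kappa>\<^sup>2)" if "i < m" "j < m" for i j
    unfolding F_def by (rule cov_estimate_chebyshev[OF f that rounds(2) tolerance(1)])+
  have G: "G \<in> sets ?P" "measure ?P G \<le> 4 / (real r * t\<^sup>2)"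
    unfolding G_def by (rule change_estimate_chebyshev[OF f rounds(2) tolerance(3)])+
  define U where "U = (\<Union>(i, j)\<in>{..<m} \<times> {..<m}. F i j)"
  have U_sets: "U \<in> sets ?P" unfolding U_def by (rule sets.finite_UN) (auto intro: F(1))
  have "measure ?P U \<le> (\<Sum>(i, j)\<in>{..<m} \<times> {..<m}. measure ?P (F i j))"
    unfolding U_def case_prod_beta by (rule seed.P.finite_measure_subadditive_finite) (auto intro: F(1))
  also have "\<dots> \<le> (\<Sum>p\<in>{..<m} \<times> {..<m}. 16 / (real r * \<kappa>\<^sup>2))" by (rule sum_mono) (auto intro: F(2))
  also have "\<dots> = (real m)\<^sup>2 * (16 / (real r * \<kappa>\<^sup>2))" by (simp add: card_cartesian_product power2_eq_square)
  finally have U: "measure ?P U \<le> (real m)\<^sup>2 * (16 / (real r * \<kappa>\<^sup>2))" .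
  have bad_sets: "E \<union> (U \<union> G) \<in> sets ?P" by (intro sets.Un E(1) U_sets G(1))
  have "measure ?P (E \<union> (U \<union> G)) \<le> measure ?P E + (measure ?P U + measure ?P G)"
    using measure_Un_le[OF E(1) sets.Un[OF U_sets G(1)]] measure_Un_le[OF U_sets G(1)] by linarith
  then have bad_le: "measure ?P (E \<union> (U \<union> G)) \<le> 0.1" using E(2) U G(2) failure by linarith
  have "accurate f w" if w: "w \<in> space ?P - (E \<union> (U \<union> G))" for w
    unfolding accurate_def
  proof (intro conjI)
    show "\<forall>i<m. \<forall>j<m. \<bar>cov_estimate r (sampled f w) i j - increment_cov n \<Theta> \<phi> f (fst w i) (fst w j)\<bar> \<le> \<kappa>"
      using w unfolding U_def F_def by fastforce
    show "\<bar>change_estimate r (sampled f w) - rot_change n {..<n} f \<theta>\<bar> \<le> t" using w unfolding G_def by force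
  qed (use w resid in blast)
  with bad_sets bad_le show ?thesis by blast
qed

lemma accurate_resid_form:
  assumes "accurate f w" "orthonormal_n m k' c" "k' \<le> k"
  shows "\<bar>resid_form m k' c (cov_estimate r (sampled f w)) - resid_form m k' c (\<lambda>i j. increment_cov n \<Theta> \<phi> f (fst w i) (fst w j))\<bar>
    \<le> \<kappa> * real m * (real k + 1)"
proof -
  have "\<bar>resid_form m k' c (cov_estimate r (sampled f w)) - resid_form m k' c (\<lambda>i j. increment_cov n \<Theta> \<phi> f (fst w i) (fst w j))\<bar>
      \<le> \<kappa> * real m * (real k' + 1)"
    by (rule resid_form_deviation) (use assms tolerance in \<open>auto simp: accurate_def\<close>)
  also have "\<dots> \<le> \<kappa> * real m * (real k + 1)" using assms(3) tolerance by (intro mult_left_mono) auto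
  finally show ?thesis .
qed

lemma junta_test_complete:
  assumes acc: "accurate f w" and f: "f \<in> junta_class n k s"
  shows "junta_test m r k change_threshold resid_threshold (sampled f w)"
proof -
  have sign: "sign_function n f" and J: "linear_junta n k f" and surf: "surf n f \<le> ereal s"
    using f by (auto simp: junta_class_def)
  have "rot_change n {..<n} f \<theta> \<le> 2 * (\<theta> * sqrt (2 / pi) * s)"
    by (rule rot_change_sign_function_le[OF sign surf s]) (use \<theta> in simp)
  then have "change_estimate r (sampled f w) \<le> change_threshold"
    using acc unfolding accurate_def change_threshold_def by linarith
  moreover obtain k' c where k': "k' \<le> k" and c: "orthonormal_n m k' c"
    and cov: "resid_form m k' c (\<lambda>i j. increment_cov n \<Theta> \<phi> f (fst w i) (fst w j)) \<le> real m * (108 * (real k)\<^sup>2 * (tan \<phi>) ^ 4)"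
    using ex_orthonormal_increment_cov_resid_le[OF sign J less_imp_neq[OF sin_\<Theta>_pos, symmetric] \<phi>(2), of m "fst w"] by blast
  moreover have "resid_form m k' c (cov_estimate r (sampled f w)) \<le> resid_threshold"
    using accurate_resid_form[OF acc c k'] cov unfolding resid_threshold_def by linarith
  ultimately show ?thesis unfolding junta_test_def by blast
qed

lemma junta_test_resid_le:
  assumes f: "unit_bounded n f" and acc: "accurate f w" and test: "junta_test m r k change_threshold resid_threshold (sampled f w)"
  shows "\<exists>l\<le>k. \<exists>u. orthonormal_n n l u \<and> (\<integral>x. proj_resid n l u (mehler_coeff n \<Theta> f x) \<partial>gauss n)
    \<le> 27 * (real k)\<^sup>2 * (tan \<phi>) ^ 4 / (sin \<phi>)\<^sup>2 + \<kappa> * (real k + 1) / (2 * (sin \<phi>)\<^sup>2) + (real k + 1) * \<tau>"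
proof -
  obtain k' c where k': "k' \<le> k" and c: "orthonormal_n m k' c"
    and estimate: "resid_form m k' c (cov_estimate r (sampled f w)) \<le> resid_threshold"
    using test unfolding junta_test_def by blast
  obtain l u where l: "l \<le> k'" and u: "orthonormal_n n l u"
    and coeff: "4 * (sin \<phi>)\<^sup>2 * (\<Sum>i<m. proj_resid n l u (mehler_coeff n \<Theta> f (fst w i)))
      \<le> resid_form m k' c (\<lambda>i j. increment_cov n \<Theta> \<phi> f (fst w i) (fst w j))"
    using ex_orthonormal_mehler_coeff_resid_le[OF f c] by blast
  let ?mean = "(\<Sum>i<m. proj_resid n l u (mehler_coeff n \<Theta> f (fst w i))) / real m"
  have "4 * (sin \<phi>)\<^sup>2 * (\<Sum>i<m. proj_resid n l u (mehler_coeff n \<Theta> f (fst w i))) \<le> resid_threshold + \<kappa> * real m * (real k + 1)"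
    using coeff accurate_resid_form[OF acc c k'] estimate by linarith
  also have "\<dots> = real m * (108 * (real k)\<^sup>2 * (tan \<phi>) ^ 4 + 2 * (\<kappa> * (real k + 1)))"
    by (simp add: resid_threshold_def algebra_simps)
  finally have "?mean \<le> (108 * (real k)\<^sup>2 * (tan \<phi>) ^ 4 + 2 * (\<kappa> * (real k + 1))) / (4 * (sin \<phi>)\<^sup>2)"
    using \<phi>(1) rounds(1) by (simp add: divide_le_eq le_divide_eq mult_ac)
  also have "\<dots> = 27 * (real k)\<^sup>2 * (tan \<phi>) ^ 4 / (sin \<phi>)\<^sup>2 + \<kappa> * (real k + 1) / (2 * (sin \<phi>)\<^sup>2)"
    by (simp add: add_divide_distrib)
  finally have "?mean \<le> 27 * (real k)\<^sup>2 * (tan \<phi>) ^ 4 / (sin \<phi>)\<^sup>2 + \<kappa> * (real k + 1) / (2 * (sin \<phi>)\<^sup>2)" .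
  moreover have "(\<integral>x. proj_resid n l u (mehler_coeff n \<Theta> f x) \<partial>gauss n) \<le> ?mean + (real l + 1) * \<tau>"
    using acc u unfolding accurate_def by blast
  moreover have "(real l + 1) * \<tau> \<le> (real k + 1) * \<tau>" using l k' tolerance by (intro mult_right_mono) auto
  moreover have "l \<le> k" using l k' by simp
  ultimately show ?thesis using u by (intro exI[of _ l] conjI exI[of _ u]) linarith+
qed

lemma head_taylor_error_mono: "l \<le> k' \<Longrightarrow> head_taylor_error l \<Theta> \<le> head_taylor_error k' \<Theta>"
  unfolding head_taylor_error_def by (intro add_mono divide_right_mono mult_left_mono) auto

lemma junta_test_sound:
  assumes f: "sign_function n f" and acc: "accurate f w" and test: "junta_test m r k change_threshold resid_threshold (sampled f w)"
  shows "\<exists>g\<in>junta_class n k ((1 + \<epsilon>) * s). gdist n f g \<le> C * \<epsilon>"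
proof -
  let ?\<nu> = "2 * (\<theta> * sqrt (2 / pi) * s) + 2 * t"
  obtain l u where l: "l \<le> k" and u: "orthonormal_n n l u"
    and resid: "(\<integral>x. proj_resid n l u (mehler_coeff n \<Theta> f x) \<partial>gauss n)
      \<le> 27 * (real k)\<^sup>2 * (tan \<phi>) ^ 4 / (sin \<phi>)\<^sup>2 + \<kappa> * (real k + 1) / (2 * (sin \<phi>)\<^sup>2) + (real k + 1) * \<tau>"
    using junta_test_resid_le[OF unit_bounded_sign_function[OF f] acc test] by blast
  have change: "rot_change n {..<n} f \<theta> \<le> ?\<nu>"
    using acc test unfolding accurate_def junta_test_def change_threshold_def by linarith
  have "\<theta>\<^sup>2 * head_taylor_error l \<Theta> \<le> \<theta>\<^sup>2 * head_taylor_error k \<Theta>" by (intro mult_left_mono head_taylor_error_mono l) simp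
  then have "?\<nu> + \<theta>\<^sup>2 * head_taylor_error l \<Theta> < sin \<theta> * sqrt (2 / pi) * ((1 + \<epsilon>) * s * (2 - 2 * \<eta>))" using surface by linarith
  from ex_junta_near_stable[OF f u \<Theta> \<theta> change resid \<eta> this] obtain g where "g \<in> junta_class n l ((1 + \<epsilon>) * s)" "gdist n f g \<le> C * \<epsilon>"
    using distance order_trans by blast
  then show ?thesis using junta_class_mono[OF l] by blast
qed

lemma tester: "tester n k s \<epsilon> C (r * (4 * m + 2))"
proof -
  interpret nonadaptive_algorithm "seed_measure n m r" n "query_labels m r" "query_point n \<Theta> \<phi> \<theta>"
      "junta_test m r k change_threshold resid_threshold"
    by (rule nonadaptive_algorithm_junta_test)
  have "tester n k s \<epsilon> C (card (query_labels m r))"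
  proof (rule testerI[OF seeds_lepoll_reals])
    fix f assume f: "sign_function n f"
    obtain E where E: "E \<in> sets (seed_measure n m r)" "measure (seed_measure n m r) E \<le> 0.1"
      and acc: "\<forall>w\<in>space (seed_measure n m r) - E. accurate f w"
      using ex_inaccurate_event[OF unit_bounded_sign_function[OF f]] by blast
    have "(f \<in> junta_class n k s \<longrightarrow> w \<in> accept_event f) \<and>
        (w \<in> accept_event f \<longrightarrow> (\<exists>g\<in>junta_class n k ((1 + \<epsilon>) * s). gdist n f g \<le> C * \<epsilon>))"
      if w: "w \<in> space (seed_measure n m r) - E" for w
    proof -
      have "accurate f w" using acc w by blast
      from junta_test_complete[OF this] junta_test_sound[OF f this] show ?thesis
        using w unfolding accept_event_def by blast
    qed
    with E show "\<exists>E\<in>sets (seed_measure n m r). measure (seed_measure n m r) E \<le> 0.1 \<and> (\<forall>w\<in>space (seed_measure n m r) - E.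
        (f \<in> junta_class n k s \<longrightarrow> w \<in> accept_event f) \<and>
        (w \<in> accept_event f \<longrightarrow> (\<exists>g\<in>junta_class n k ((1 + \<epsilon>) * s). gdist n f g \<le> C * \<epsilon>)))" by blast
  qed
  then show ?thesis by (simp add: card_query_labels)
qed

end

lemma linear_junta_const: "linear_junta n k (\<lambda>_. c)"
  unfolding linear_junta_def by (rule exI[of _ 0]) auto

lemma surf_const: "surf n (\<lambda>_. c) = 0"
proof -
  have empty: "enlarge n (space (gauss n)) \<delta> - space (gauss n) = {}" "enlarge n {} \<delta> = {}" for \<delta>
    by (auto simp: enlarge_def setdist_n_def top_ereal_def)
  show ?thesis
    by (cases "c = 1") (simp_all add: surf_def gsa_def empty Liminf_const zero_ereal_def[symmetric])
qed

lemma const_in_junta_class: "v = 1 \<or> v = - 1 \<Longrightarrow> 0 \<le> s \<Longrightarrow> (\<lambda>_. v) \<in> junta_class n k s"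
  by (auto simp: junta_class_def sign_function_def is_pm1_def surf_const linear_junta_const)

lemma surf_nonneg: "0 \<le> surf n f"
  unfolding surf_def gsa_def
  by (rule Liminf_bounded, rule eventually_mono[OF eventually_at_right_less]) simp

lemma gdist_const:
  assumes f: "sign_function n f" and v: "v = 1 \<or> v = - 1"
  shows "gdist n f (\<lambda>_. v) = (1 - v * (\<integral>x. f x \<partial>gauss n)) / 2"
proof -
  note [measurable] = sign_function_measurable[OF f]
  let ?B = "{x \<in> space (gauss n). f x \<noteq> v}"
  have "gdist n f (\<lambda>_. v) = (\<integral>x. indicator ?B x \<partial>gauss n)" by (simp add: gdist_def)
  also have "\<dots> = (\<integral>x. (1 - v * f x) / 2 \<partial>gauss n)"
    using sign_function_cases[OF f] v by (intro Bochner_Integration.integral_cong) (fastforce simp: indicator_def)+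
  also have "\<dots> = (1 - v * (\<integral>x. f x \<partial>gauss n)) / 2"
    using integrable_unit_bounded[OF unit_bounded_sign_function[OF f]] by (simp add: gauss.prob_space)
  finally show ?thesis .
qed

lemma rot_change_half_pi_sign_function:
  assumes f: "sign_function n f"
  shows "rot_change n {..<n} f (pi / 2) = 1 - (\<integral>x. f x \<partial>gauss n)\<^sup>2"
proof -
  note [measurable] = sign_function_measurable[OF f]
  have product: "integrable (gauss_pair n) (\<lambda>p. f (snd p) * f (fst p))"
    by (rule gauss_pair.integrable_bounded[of _ _ 1])
       (use unit_bounded_abs_le[OF unit_bounded_sign_function[OF f]] in \<open>auto simp: space_pair_measure abs_mult mult_le_one\<close>)
  have "\<bar>f z - f x\<bar> = 1 - f z * f x" if "x \<in> space (gauss n)" "z \<in> space (gauss n)" for x z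
    using sign_function_cases[OF f that(1)] sign_function_cases[OF f that(2)] by auto
  then have "rot_change n {..<n} f (pi / 2) = (\<integral>p. 1 - f (snd p) * f (fst p) \<partial>gauss_pair n)"
    unfolding rot_change_def by (intro Bochner_Integration.integral_cong) (auto simp: space_pair_measure rot_half_pi)
  also have "\<dots> = 1 - (\<integral>p. f (snd p) * f (fst p) \<partial>gauss_pair n)" using product by (simp add: gauss_pair.prob_space)
  also have "(\<integral>p. f (snd p) * f (fst p) \<partial>gauss_pair n) = (\<integral>x. f x \<partial>gauss n)\<^sup>2"
    using gauss_pair.integral_fst'[OF product] by (simp add: power2_eq_square)
  finally show ?thesis .
qed

lemma ex_const_junta_near:
  assumes f: "sign_function n f" and change: "rot_change n {..<n} f (pi / 2) \<le> 2 * c" and s: "0 \<le> s"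
  shows "\<exists>g\<in>junta_class n k s. gdist n f g \<le> c"
proof -
  define e where "e = (\<integral>x. f x \<partial>gauss n)"
  define v :: real where "v = (if 0 \<le> e then 1 else - 1)"
  have "0 \<le> gdist n f (\<lambda>_. 1)" "0 \<le> gdist n f (\<lambda>_. - 1)" by (simp_all add: gdist_def)
  then have "\<bar>e\<bar> \<le> 1" using gdist_const[OF f, of 1] gdist_const[OF f, of "- 1"] by (simp add: e_def)
  then have "1 - \<bar>e\<bar> \<le> (1 - \<bar>e\<bar>) * (1 + \<bar>e\<bar>)" by (simp add: mult_le_cancel_left1)
  also have "\<dots> = 1 - e\<^sup>2" by (simp add: algebra_simps power2_eq_square)
  also have "\<dots> \<le> 2 * c" using change by (simp add: rot_change_half_pi_sign_function[OF f] e_def)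
  finally have "(1 - v * e) / 2 \<le> c" by (simp add: v_def abs_if split: if_splits)
  moreover have v: "v = 1 \<or> v = - 1" by (simp add: v_def)
  ultimately have "gdist n f (\<lambda>_. v) \<le> c" unfolding gdist_const[OF f v] e_def by simp
  with const_in_junta_class[OF v s] show ?thesis by blast
qed

lemma half_pi_change_chebyshev:
  fixes f :: "(nat \<Rightarrow> real) \<Rightarrow> real"
  assumes f: "unit_bounded n f" and r: "0 < r" and t: "0 < t"
  defines "P \<equiv> PiM {..<r} (\<lambda>_. gauss_pair n)"
  defines "E \<equiv> {w \<in> space P. t < \<bar>(\<Sum>l<r. \<bar>f (snd (w l)) - f (fst (w l))\<bar>) / real r - rot_change n {..<n} f (pi / 2)\<bar>}"
  shows "E \<in> sets P" "measure P E \<le> 4 / (real r * t\<^sup>2)"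
proof -
  note [measurable] = unit_bounded_measurable[OF f]
  have [measurable]: "(\<lambda>w. w l) \<in> measurable P (gauss_pair n)" if "l < r" for l
    unfolding P_def by (rule measurable_component_singleton) (use that in simp)
  show "E \<in> sets P" unfolding E_def by measurable
  have change: "rot_change n {..<n} f (pi / 2) = (\<integral>p. \<bar>f (snd p) - f (fst p)\<bar> \<partial>gauss_pair n)"
    unfolding rot_change_def
    by (intro Bochner_Integration.integral_cong) (auto simp: space_pair_measure rot_half_pi)
  have "measure P E \<le> 2\<^sup>2 / (real r * t\<^sup>2)"
    unfolding E_def P_def change
    by (rule gauss_pair.sample_mean_chebyshev[OF _ _ r t])
       (use unit_bounded_abs_diff_le[OF f f] in \<open>auto simp: space_pair_measure\<close>)
  then show "measure P E \<le> 4 / (real r * t\<^sup>2)" by simp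
qed

lemma nonadaptive_algorithm_pairs:
  "nonadaptive_algorithm (PiM {..<r} (\<lambda>_. gauss_pair n)) n ({..<r} \<times> (UNIV :: bool set))
    (\<lambda>w (l, b). if b then snd (w l) else fst (w l)) (\<lambda>v. (\<Sum>l<r. \<bar>v (l, True) - v (l, False)\<bar>) / real r \<le> c)"
proof -
  let ?P = "PiM {..<r} (\<lambda>_. gauss_pair n)" and ?pt = "\<lambda>w (l, b). if b then snd (w l) else fst (w l)"
  interpret prob_space ?P by (rule prob_space_PiM) unfold_locales
  show ?thesis
  proof
    show "(\<lambda>w. ?pt w l) \<in> measurable ?P (gauss n)" if l: "l \<in> {..<r} \<times> UNIV" for l
    proof -
      obtain j b where j: "l = (j, b)" "j < r" using l by auto
      have [measurable]: "(\<lambda>w. w j) \<in> measurable ?P (gauss_pair n)"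
        by (rule measurable_component_singleton) (use j in simp)
      show ?thesis unfolding j(1) by (cases b) simp_all
    qed
  qed simp_all
qed

lemma rot_change_half_pi_le:
  assumes f: "f \<in> junta_class n k s" and s: "0 \<le> s"
  shows "rot_change n {..<n} f (pi / 2) \<le> 3 * s"
proof -
  have "rot_change n {..<n} f (pi / 2) \<le> 2 * (pi / 2 * sqrt (2 / pi) * s)"
    using f by (intro rot_change_sign_function_le s) (auto simp: junta_class_def)
  also have "\<dots> \<le> 2 * (3 / 2 * s)" using sqrt_2_pi_bounds(3) s by (intro mult_left_mono mult_right_mono) auto
  finally show ?thesis by simp
qed

lemma small_surface_tester:
  assumes \<epsilon>: "0 < \<epsilon>" and s: "0 \<le> s" "s \<le> \<epsilon>" and N: "1 / \<epsilon> \<le> real N"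
  shows "tester n k s \<epsilon> 3 (80 * N\<^sup>2)"
proof -
  define r where "r = 40 * N\<^sup>2"
  have N\<epsilon>: "1 \<le> real N * \<epsilon>" using N \<epsilon> by (simp add: pos_divide_le_eq)
  then have r: "0 < r" unfolding r_def using \<epsilon> by (cases "N = 0") auto
  let ?P = "PiM {..<r} (\<lambda>_. gauss_pair n)" and ?J = "{..<r} \<times> (UNIV :: bool set)"
  let ?pt = "\<lambda>w (l, b). if b then snd (w l) else fst (w l)"
  let ?mean = "\<lambda>v. (\<Sum>l<r. \<bar>v (l, True) - v (l, False)\<bar>) / real r"
  interpret nonadaptive_algorithm ?P n ?J ?pt "\<lambda>v. ?mean v \<le> 4 * \<epsilon>" by (rule nonadaptive_algorithm_pairs)
  have "tester n k s \<epsilon> 3 (card ?J)"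
  proof (rule testerI)
    show "(UNIV :: (nat \<Rightarrow> (nat \<Rightarrow> real) \<times> (nat \<Rightarrow> real)) set) \<lesssim> (UNIV :: real set)"
      by (intro sequences_lepoll_reals pairs_lepoll_reals) simp_all
    fix f assume f: "sign_function n f"
    define R where "R = rot_change n {..<n} f (pi / 2)"
    define E where "E = {w \<in> space ?P. \<epsilon> < \<bar>?mean (\<lambda>l. f (?pt w l)) - R\<bar>}"
    note chebyshev = half_pi_change_chebyshev[OF unit_bounded_sign_function[OF f] r \<epsilon>, folded R_def]
    have E_sets: "E \<in> sets ?P" and "measure ?P E \<le> 4 / (real r * \<epsilon>\<^sup>2)"
      using chebyshev by (simp_all add: E_def)
    note this(2)
    also have "\<dots> \<le> 0.1"
    proof -
      have "40 \<le> real r * \<epsilon>\<^sup>2" using N\<epsilon> one_le_power[OF N\<epsilon>, of 2] by (simp add: r_def power_mult_distrib)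
      then show ?thesis by (simp add: divide_le_eq)
    qed
    finally have E_prob: "measure ?P E \<le> 0.1" .
    have accurate: "\<bar>?mean (\<lambda>l. f (?pt w l)) - R\<bar> \<le> \<epsilon>" if "w \<in> space ?P - E" for w
      using that by (auto simp: E_def not_less)
    have "w \<in> accept_event f" if w: "w \<in> space ?P - E" and J: "f \<in> junta_class n k s" for w
    proof -
      have "?mean (\<lambda>l. f (?pt w l)) \<le> 4 * \<epsilon>"
        using accurate[OF w] rot_change_half_pi_le[OF J s(1)] s(2) unfolding R_def by linarith
      then show ?thesis using w by (simp add: accept_event_def)
    qed
    moreover have "\<exists>g\<in>junta_class n k ((1 + \<epsilon>) * s). gdist n f g \<le> 3 * \<epsilon>"
      if w: "w \<in> space ?P - E" and accept: "w \<in> accept_event f" for w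
    proof -
      have "?mean (\<lambda>l. f (?pt w l)) \<le> 4 * \<epsilon>" using accept by (simp add: accept_event_def)
      then have "R \<le> 2 * (3 * \<epsilon>)" using accurate[OF w] \<epsilon> by linarith
      then show ?thesis unfolding R_def using \<epsilon> s(1) by (intro ex_const_junta_near[OF f]) auto
    qed
    ultimately show "\<exists>E\<in>sets ?P. measure ?P E \<le> 0.1 \<and> (\<forall>w\<in>space ?P - E. (f \<in> junta_class n k s \<longrightarrow> w \<in> accept_event f) \<and>
        (w \<in> accept_event f \<longrightarrow> (\<exists>g\<in>junta_class n k ((1 + \<epsilon>) * s). gdist n f g \<le> 3 * \<epsilon>)))"
      using E_sets E_prob by blast
  qed
  then show ?thesis by (simp add: r_def card_cartesian_product)
qed

lemma accepts_no_queries: "accepts f 0 Q (\<lambda>_ _. b) \<omega> \<longleftrightarrow> b"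
  by (simp add: accepts_def)

lemma tester_trivial:
  assumes "\<And>f. sign_function n f \<Longrightarrow> (b \<longrightarrow> (\<exists>g\<in>junta_class n k ((1 + \<epsilon>) * s). gdist n f g \<le> C * \<epsilon>)) \<and> (\<not> b \<longrightarrow> f \<notin> junta_class n k s)"
  shows "tester n k s \<epsilon> C 0"
proof -
  interpret R: prob_space "return borel (0::real)" by (rule prob_space_return) simp
  show ?thesis
    unfolding tester_def
    by (intro exI[of _ "return borel 0"] exI[of _ "\<lambda>_ _. \<lambda>i\<in>{..<n}. 0"] exI[of _ "\<lambda>_ _. b"])
       (use assms R.prob_space in \<open>cases b; force simp: accepts_no_queries R.prob_space_axioms space_gauss not_less\<close>)
qed

lemma tester_negative_surface:
  assumes "s < 0" shows "tester n k s \<epsilon> C 0"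
proof (rule tester_trivial[of n False])
  have "\<not> surf n f \<le> ereal s" for f
    using order_trans[OF surf_nonneg, of n f "ereal s"] assms by auto
  then show "(False \<longrightarrow> (\<exists>g\<in>junta_class n k ((1 + \<epsilon>) * s). gdist n f g \<le> C * \<epsilon>)) \<and> (\<not> False \<longrightarrow> f \<notin> junta_class n k s)" for f
    by (simp add: junta_class_def)
qed

lemma tester_large_error:
  assumes s: "0 \<le> s" and \<epsilon>: "1 \<le> C * \<epsilon>" "0 < \<epsilon>" shows "tester n k s \<epsilon> C 0"
proof (rule tester_trivial[of n True])
  have "gdist n f (\<lambda>_. 1) \<le> C * \<epsilon>" for f unfolding gdist_def by (rule order_trans[OF gauss.prob_le_1 \<epsilon>(1)])
  moreover have "(\<lambda>_. 1) \<in> junta_class n k ((1 + \<epsilon>) * s)" using const_in_junta_class[of 1] s \<epsilon>(2) by simp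
  ultimately show "(True \<longrightarrow> (\<exists>g\<in>junta_class n k ((1 + \<epsilon>) * s). gdist n f g \<le> C * \<epsilon>)) \<and> (\<not> True \<longrightarrow> f \<notin> junta_class n k s)" for f
    by blast
qed

section \<open>Choice of parameters\<close>

lemma sin_lower_bound:
  fixes x :: real assumes "0 \<le> x" shows "x - x ^ 3 / 2 \<le> sin x"
proof -
  let ?f = "\<lambda>x::real. sin x - x + x ^ 3 / 2"
  have "?f 0 \<le> ?f x"
  proof (rule DERIV_nonneg_imp_nondecreasing[OF assms])
    fix y :: real
    have "(?f has_real_derivative cos y - 1 + 3 * y\<^sup>2 / 2) (at y)"
      by (auto intro!: derivative_eq_intros)
    moreover have "0 \<le> cos y - 1 + 3 * y\<^sup>2 / 2" using one_minus_cos_le[of y] zero_le_power2[of y] by linarith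
    ultimately show "\<exists>d. (?f has_real_derivative d) (at y) \<and> 0 \<le> d" by blast
  qed
  then show ?thesis by simp
qed

locale parameter_choice =
  fixes k N :: nat and s \<epsilon> :: real
  assumes \<epsilon>: "0 < \<epsilon>" "\<epsilon> < 1" and s: "\<epsilon> \<le> s" and N: "1 + s + 1 / \<epsilon> + real k \<le> real N"
begin

definition \<theta> :: real where "\<theta> = 1 / (2 ^ 16 * real N ^ 9)"
definition \<Theta> :: real where "\<Theta> = 1 / (2 ^ 4 * real N ^ 3)"
definition \<phi> :: real where "\<phi> = arcsin (1 / (2 ^ 13 * real N ^ 6))"
definition \<kappa> :: real where "\<kappa> = 1 / (2 ^ 45 * real N ^ 23)"
definition \<tau> :: real where "\<tau> = 1 / (2 ^ 19 * real N ^ 11)"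
definition t :: real where "t = \<theta> * sqrt (2 / pi) * s * \<epsilon> / 4"
definition M :: nat where "M = 2 ^ 12 * N ^ 6"
definition m :: nat where "m = 2 ^ 45 * N ^ 22"
definition r :: nat where "r = 2 ^ 190 * N ^ 90"

lemma N_ge: "2 \<le> real N" "s \<le> real N" "real k + 1 \<le> real N"
proof -
  have "1 < 1 / \<epsilon>" using \<epsilon> by simp
  then show "2 \<le> real N" "s \<le> real N" "real k + 1 \<le> real N"
    using N s \<epsilon> of_nat_0_le_iff[of k, where 'a = real] by linarith+
qed

lemma N_pos: "0 < real N"
  using N_ge(1) by linarith

lemma s_pos: "0 < s"
  using \<epsilon> s by simp

lemma one_le_N_power: "1 \<le> real N ^ j"
  using N_ge(1) by simp

lemma inverse_N_le: "1 / real N \<le> \<epsilon>" "1 / (real N)\<^sup>2 \<le> \<epsilon> * s" "1 / (real N)\<^sup>2 \<le> \<epsilon>\<^sup>2"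
proof -
  have "1 / \<epsilon> \<le> real N" using N s \<epsilon> of_nat_0_le_iff[of k, where 'a = real] by linarith
  then show inverse: "1 / real N \<le> \<epsilon>" using N_pos \<epsilon> by (simp add: field_simps)
  have "1 / real N * (1 / real N) \<le> \<epsilon> * s" "1 / real N * (1 / real N) \<le> \<epsilon> * \<epsilon>"
    by (rule mult_mono; use inverse s \<epsilon> in simp)+
  then show "1 / (real N)\<^sup>2 \<le> \<epsilon> * s" "1 / (real N)\<^sup>2 \<le> \<epsilon>\<^sup>2" by (simp_all add: power2_eq_square)
qed

lemma real_params: "real M = 2 ^ 12 * real N ^ 6" "real m = 2 ^ 45 * real N ^ 22" "real r = 2 ^ 190 * real N ^ 90"
  by (simp_all add: M_def m_def r_def)

lemma params_pos: "0 < \<theta>" "0 < \<Theta>" "0 < \<kappa>" "0 < \<tau>" "0 < t" "0 < m" "0 < r"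
  using N_pos s_pos \<epsilon> by (simp_all add: \<theta>_def \<Theta>_def \<kappa>_def \<tau>_def t_def m_def r_def)

lemma \<theta>_le: "\<theta> \<le> \<epsilon> / 2 ^ 16"
proof -
  have "real N * 1 \<le> real N * real N ^ 8" using N_pos one_le_N_power by (intro mult_left_mono) auto
  then have "real N \<le> real N ^ 9" by (simp add: power_Suc[symmetric] del: power_Suc)
  then have "\<theta> \<le> 1 / (2 ^ 16 * real N)"
    unfolding \<theta>_def using N_pos by (intro divide_left_mono mult_left_mono mult_pos_pos) auto
  also have "\<dots> = (1 / real N) / 2 ^ 16" by simp
  also have "\<dots> \<le> \<epsilon> / 2 ^ 16" using inverse_N_le(1) by (rule divide_right_mono) simp
  finally show ?thesis .
qed

lemma \<theta>_less_1: "\<theta> < 1"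
  using \<theta>_le \<epsilon> by simp

lemma \<Theta>_le: "\<Theta> \<le> 1 / 16"
  unfolding \<Theta>_def using one_le_N_power[of 3] N_pos by (simp add: divide_le_eq)

lemma \<Theta>_eq: "\<Theta> = real M * \<theta>"
  using N_pos unfolding real_params \<Theta>_def \<theta>_def by (simp add: field_simps power_add[symmetric])

lemma sin_\<phi>_le: "1 / (2 ^ 13 * real N ^ 6) \<le> 1 / 2"
  using one_le_N_power[of 6] by (simp add: divide_le_eq)

lemma sin_\<phi>: "sin \<phi> = 1 / (2 ^ 13 * real N ^ 6)"
proof -
  have "0 \<le> 1 / (2 ^ 13 * real N ^ 6)" by simp
  then show ?thesis unfolding \<phi>_def using sin_\<phi>_le by (intro sin_arcsin) linarith+
qed

lemma sin_\<phi>_sq: "(sin \<phi>)\<^sup>2 = 1 / (2 ^ 26 * real N ^ 12)"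
  by (simp add: sin_\<phi> power_divide power_mult_distrib power_mult[symmetric])

lemma cos_\<phi>_sq_ge: "3 / 4 \<le> (cos \<phi>)\<^sup>2"
proof -
  have "(sin \<phi>)\<^sup>2 \<le> (1 / 2)\<^sup>2" unfolding sin_\<phi> using sin_\<phi>_le by (intro power_mono) auto
  then show ?thesis using sin_cos_squared_add[of \<phi>] by (simp add: power2_eq_square)
qed

lemma tan_\<phi>_le: "(tan \<phi>) ^ 4 / (sin \<phi>)\<^sup>2 \<le> 16 / 9 * (sin \<phi>)\<^sup>2"
proof -
  have "(tan \<phi>) ^ 4 / (sin \<phi>)\<^sup>2 = (sin \<phi>)\<^sup>2 / ((cos \<phi>)\<^sup>2)\<^sup>2"
    using N_pos by (simp add: tan_def power_divide power_mult[symmetric] sin_\<phi> power2_eq_square eval_nat_numeral)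
  also have "\<dots> \<le> (sin \<phi>)\<^sup>2 / (3 / 4)\<^sup>2"
    using cos_\<phi>_sq_ge by (intro divide_left_mono power_mono mult_pos_pos) auto
  also have "\<dots> = 16 / 9 * (sin \<phi>)\<^sup>2" by (simp add: power2_eq_square)
  finally show ?thesis .
qed

lemma sin_\<Theta>_ge: "1 / (2 ^ 5 * real N ^ 3) \<le> sin \<Theta>"
proof -
  have "\<Theta> ^ 2 \<le> 1" using params_pos(2) \<Theta>_le by (intro power_le_one) auto
  then have "\<Theta> * \<Theta> ^ 2 \<le> \<Theta> * 1" using params_pos(2) by (intro mult_left_mono) auto
  then have "\<Theta> ^ 3 \<le> \<Theta>" by (simp add: power3_eq_cube power2_eq_square mult.assoc)
  then have "\<Theta> / 2 \<le> sin \<Theta>" using sin_lower_bound[of \<Theta>] params_pos(2) by simp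
  then show ?thesis by (simp add: \<Theta>_def)
qed

lemma inverse_sin_\<Theta>: "0 < 1 / sin \<Theta>" "1 / sin \<Theta> \<le> 2 ^ 5 * real N ^ 3"
proof -
  have "0 < 1 / (2 ^ 5 * real N ^ 3)" using N_pos by simp
  then have "0 < sin \<Theta>" using sin_\<Theta>_ge by linarith
  then show "0 < 1 / sin \<Theta>" "1 / sin \<Theta> \<le> 2 ^ 5 * real N ^ 3"
    using sin_\<Theta>_ge N_pos by (simp_all add: field_simps)
qed

lemma sin_\<theta>_ge: "\<theta> * (1 - \<epsilon> / 32) \<le> sin \<theta>"
proof -
  have "\<theta> * (\<theta> * \<theta>) \<le> \<theta> * (\<epsilon> / 2 ^ 16 * 1)"
    using params_pos(1) \<theta>_le \<theta>_less_1 \<epsilon> by (intro mult_left_mono mult_mono) auto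
  then have "\<theta> ^ 3 / 2 \<le> \<theta> * (\<epsilon> / 32)" using params_pos(1) \<epsilon> by (simp add: power3_eq_cube)
  then show ?thesis using sin_lower_bound[of \<theta>] params_pos(1) by (simp add: right_diff_distrib)
qed

lemma half_le_sqrt_mult: "\<theta> * (\<epsilon> * s) / 2 \<le> \<theta> * sqrt (2 / pi) * s * \<epsilon>"
proof -
  have "1 / 2 * (\<theta> * (\<epsilon> * s)) \<le> sqrt (2 / pi) * (\<theta> * (\<epsilon> * s))"
    using sqrt_2_pi_bounds(1) params_pos(1) \<epsilon> s_pos by (intro mult_right_mono) auto
  then show ?thesis by (simp add: mult_ac)
qed

lemma t_ge: "1 / (2 ^ 19 * real N ^ 11) \<le> t"
proof -
  have "1 / (2 ^ 19 * real N ^ 11) = \<theta> * (1 / (real N)\<^sup>2) / 8" unfolding \<theta>_def by (simp add: power_add[symmetric])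
  also have "\<dots> \<le> \<theta> * (\<epsilon> * s) / 8"
    using inverse_N_le(2) params_pos(1) by (intro divide_right_mono mult_left_mono) auto
  also have "\<dots> \<le> t" using half_le_sqrt_mult unfolding t_def by linarith
  finally show ?thesis .
qed

lemma failure_le: "2 / (real m * \<tau>\<^sup>2) + (real m)\<^sup>2 * (16 / (real r * \<kappa>\<^sup>2)) + 4 / (real r * t\<^sup>2) \<le> 0.1"
proof -
  have resid: "2 / (real m * \<tau>\<^sup>2) \<le> 1 / 50"
    using N_pos unfolding real_params \<tau>_def by (simp add: power_divide power_mult_distrib power_mult[symmetric])
  have "real r * \<kappa>\<^sup>2 = 2 ^ 100 * real N ^ 44"
    using N_pos unfolding real_params \<kappa>_def
    by (simp add: power_divide power_mult_distrib power_mult[symmetric] field_simps power_add[symmetric])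
  then have cov: "(real m)\<^sup>2 * (16 / (real r * \<kappa>\<^sup>2)) \<le> 1 / 50"
    using N_pos unfolding real_params(2) by (simp add: power_mult_distrib power_mult[symmetric])
  have "2 ^ 152 * 1 \<le> 2 ^ 152 * real N ^ 68" by (intro mult_left_mono one_le_N_power) simp
  also have "\<dots> = real r * (1 / (2 ^ 19 * real N ^ 11))\<^sup>2"
    using N_pos unfolding real_params
    by (simp add: power_divide power_mult_distrib power_mult[symmetric] field_simps power_add[symmetric])
  also have "\<dots> \<le> real r * t\<^sup>2" using t_ge N_pos by (intro mult_left_mono power_mono) auto
  finally have "4 / (real r * t\<^sup>2) \<le> 4 / 2 ^ 152" by (intro divide_left_mono) auto
  then have "4 / (real r * t\<^sup>2) \<le> 1 / 50" by simp
  with resid cov show ?thesis by simp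
qed

lemma resid_le:
  "27 * (real k)\<^sup>2 * (tan \<phi>) ^ 4 / (sin \<phi>)\<^sup>2 + \<kappa> * (real k + 1) / (2 * (sin \<phi>)\<^sup>2) + (real k + 1) * \<tau>
    \<le> 1 / (2 ^ 18 * real N ^ 10)"
proof -
  have "27 * (real k)\<^sup>2 * (tan \<phi>) ^ 4 / (sin \<phi>)\<^sup>2 \<le> 27 * (real N)\<^sup>2 * (16 / 9 * (sin \<phi>)\<^sup>2)"
  proof -
    have "27 * (real k)\<^sup>2 * ((tan \<phi>) ^ 4 / (sin \<phi>)\<^sup>2) \<le> 27 * (real N)\<^sup>2 * (16 / 9 * (sin \<phi>)\<^sup>2)"
      using N_ge(3) by (intro mult_mono tan_\<phi>_le power_mono) auto
    then show ?thesis by simp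
  qed
  also have "\<dots> = 48 / (2 ^ 26 * real N ^ 10)"
    unfolding sin_\<phi>_sq using N_pos by (simp add: field_simps power_add[symmetric])
  finally have tangent: "27 * (real k)\<^sup>2 * (tan \<phi>) ^ 4 / (sin \<phi>)\<^sup>2 \<le> 48 / (2 ^ 26 * real N ^ 10)" .
  have "\<kappa> * (real k + 1) / (2 * (sin \<phi>)\<^sup>2) \<le> \<kappa> * real N / (2 * (sin \<phi>)\<^sup>2)"
    using N_ge(3) params_pos(3) by (intro divide_right_mono mult_left_mono) auto
  also have "\<dots> = 1 / (2 ^ 20 * real N ^ 10)"
    unfolding \<kappa>_def sin_\<phi>_sq using N_pos by (simp add: field_simps power_add[symmetric] power_Suc[symmetric] del: power_Suc)
  finally have cov: "\<kappa> * (real k + 1) / (2 * (sin \<phi>)\<^sup>2) \<le> 1 / (2 ^ 20 * real N ^ 10)" .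
  have "(real k + 1) * \<tau> \<le> real N * \<tau>" using N_ge(3) params_pos(4) by (intro mult_right_mono) auto
  also have "\<dots> = 1 / (2 ^ 19 * real N ^ 10)"
    unfolding \<tau>_def using N_pos by (simp add: field_simps power_Suc[symmetric] del: power_Suc)
  finally have "(real k + 1) * \<tau> \<le> 1 / (2 ^ 19 * real N ^ 10)" .
  with tangent cov have "27 * (real k)\<^sup>2 * (tan \<phi>) ^ 4 / (sin \<phi>)\<^sup>2 + \<kappa> * (real k + 1) / (2 * (sin \<phi>)\<^sup>2) + (real k + 1) * \<tau>
      \<le> 48 / (2 ^ 26 * real N ^ 10) + 1 / (2 ^ 20 * real N ^ 10) + 1 / (2 ^ 19 * real N ^ 10)" by linarith
  also have "\<dots> \<le> 1 / (2 ^ 18 * real N ^ 10)" using N_pos by (simp add: field_simps)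
  finally show ?thesis .
qed

lemma head_taylor_error_le: "head_taylor_error k \<Theta> \<le> 7168 * real N ^ 7"
proof -
  have inverse_sq: "(1 / sin \<Theta>)\<^sup>2 \<le> 1024 * real N ^ 6"
    using power_mono[OF inverse_sin_\<Theta>(2), of 2] inverse_sin_\<Theta>(1) by (simp add: power_mult_distrib power_mult[symmetric])
  have "(1 / sin \<Theta>)\<^sup>2 * real k \<le> 1024 * real N ^ 6 * real N"
    using inverse_sq N_ge(3) by (intro mult_mono) auto
  then have "(1 / sin \<Theta>)\<^sup>2 * real k \<le> 1024 * real N ^ 7" using power_add[of "real N" 6 1] by (simp add: mult.assoc)
  moreover have "2 * real N ^ 6 \<le> real N ^ 7"
    using mult_right_mono[OF N_ge(1), of "real N ^ 6"] by (simp add: power_Suc[symmetric] del: power_Suc)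
  moreover have "real N \<le> real N ^ 7"
    using mult_left_mono[OF one_le_N_power[of 6], of "real N"] by (simp add: power_Suc[symmetric] del: power_Suc)
  moreover have "head_taylor_error k \<Theta> = (1 / sin \<Theta>)\<^sup>2 / 4 + real k / 4 + 6 * ((1 / sin \<Theta>)\<^sup>2 * real k)"
    by (simp add: head_taylor_error_def add_divide_distrib)
  ultimately show ?thesis using inverse_sq N_ge(3) by linarith
qed

lemma second_order_le: "\<theta>\<^sup>2 * head_taylor_error k \<Theta> \<le> 7 / 32 * \<epsilon> * (\<theta> * sqrt (2 / pi) * s)"
proof -
  have "\<theta>\<^sup>2 * head_taylor_error k \<Theta> \<le> \<theta>\<^sup>2 * (7168 * real N ^ 7)"
    using head_taylor_error_le by (rule mult_left_mono) simp
  also have "\<dots> = \<theta> * (7 / 64 * (1 / (real N)\<^sup>2))"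
  proof -
    have "\<theta> * (7168 * real N ^ 7) = 7 / 64 * (1 / (real N)\<^sup>2)"
      unfolding \<theta>_def using N_pos by (simp add: field_simps power_add[symmetric])
    then show ?thesis by (simp add: power2_eq_square mult.assoc)
  qed
  also have "\<dots> \<le> \<theta> * (7 / 64 * (\<epsilon> * s))" using inverse_N_le(2) params_pos(1) by (intro mult_left_mono) auto
  also have "\<dots> \<le> 7 / 32 * \<epsilon> * (\<theta> * sqrt (2 / pi) * s)" using half_le_sqrt_mult by (simp add: mult_ac)
  finally show ?thesis .
qed

lemma surface_slack: "2 + \<epsilon> / 2 + 7 / 32 * \<epsilon> < (1 - \<epsilon> / 32) * ((1 + \<epsilon>) * (2 - 2 * (\<epsilon> / 8)))"
proof -
  have "(1 - \<epsilon> / 32) * ((1 + \<epsilon>) * (2 - 2 * (\<epsilon> / 8))) = 2 + 27 / 16 * \<epsilon> - (39 / 128) * (\<epsilon> * \<epsilon>) + \<epsilon> * \<epsilon> * \<epsilon> / 128"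
    by (simp add: field_simps)
  moreover have "\<epsilon> * \<epsilon> \<le> \<epsilon> * 1" using \<epsilon> by (intro mult_left_mono) auto
  moreover have "0 \<le> \<epsilon> * \<epsilon> * \<epsilon>" using \<epsilon> by simp
  ultimately show ?thesis using \<epsilon> by linarith
qed

lemma surface_less:
  "2 * (\<theta> * sqrt (2 / pi) * s) + 2 * t + \<theta>\<^sup>2 * head_taylor_error k \<Theta>
    < sin \<theta> * sqrt (2 / pi) * ((1 + \<epsilon>) * s * (2 - 2 * (\<epsilon> / 8)))"
proof -
  let ?u = "\<theta> * sqrt (2 / pi) * s"
  have "2 * ?u + 2 * t + \<theta>\<^sup>2 * head_taylor_error k \<Theta> \<le> ?u * (2 + \<epsilon> / 2 + 7 / 32 * \<epsilon>)"
    using second_order_le unfolding t_def by (simp add: algebra_simps)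
  also have "\<dots> < ?u * ((1 - \<epsilon> / 32) * ((1 + \<epsilon>) * (2 - 2 * (\<epsilon> / 8))))"
    using surface_slack params_pos(1) s_pos by (intro mult_strict_left_mono) auto
  also have "\<dots> = (\<theta> * (1 - \<epsilon> / 32)) * (sqrt (2 / pi) * ((1 + \<epsilon>) * s * (2 - 2 * (\<epsilon> / 8))))" by (simp add: mult_ac)
  also have "\<dots> \<le> sin \<theta> * (sqrt (2 / pi) * ((1 + \<epsilon>) * s * (2 - 2 * (\<epsilon> / 8))))"
    using sin_\<theta>_ge \<epsilon> s_pos by (intro mult_right_mono) auto
  finally show ?thesis by (simp add: mult.assoc)
qed

lemma smoothing_distance_le: "real M * (2 * (\<theta> * sqrt (2 / pi) * s) + 2 * t) \<le> 5 / 32 * \<epsilon>\<^sup>2"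
proof -
  have "real M * (2 * (\<theta> * sqrt (2 / pi) * s) + 2 * t) = \<Theta> * (s * sqrt (2 / pi) * (2 + \<epsilon> / 2))"
    unfolding \<Theta>_eq t_def by (simp add: algebra_simps)
  also have "\<dots> \<le> \<Theta> * (real N * 1 * (5 / 2))"
    using N_ge(2) sqrt_2_pi_bounds(2) \<epsilon> s_pos params_pos(2) by (intro mult_left_mono mult_mono) auto
  also have "\<dots> = 5 / 32 * (1 / (real N)\<^sup>2)"
    unfolding \<Theta>_def using N_pos by (simp add: field_simps power_add[symmetric] power_Suc[symmetric] del: power_Suc)
  finally show ?thesis using inverse_N_le(3) by linarith
qed

lemma averaging_distance_le:
  assumes "\<rho> \<le> 1 / (2 ^ 18 * real N ^ 10)"
  shows "pi / 2 * sqrt (2 / pi) / sin \<Theta> * sqrt \<rho> \<le> 3 / 32 * \<epsilon>\<^sup>2"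
proof -
  have "sqrt \<rho> \<le> sqrt (1 / (2 ^ 18 * real N ^ 10))" using assms by simp
  also have "\<dots> = 1 / (2 ^ 9 * real N ^ 5)"
    by (rule real_sqrt_unique) (simp_all add: power_divide power_mult_distrib power_mult[symmetric])
  finally have sqrt_le: "sqrt \<rho> \<le> 1 / (2 ^ 9 * real N ^ 5)" .
  have "pi / 2 * sqrt (2 / pi) / sin \<Theta> * sqrt \<rho> = pi / 2 * sqrt (2 / pi) * (1 / sin \<Theta>) * sqrt \<rho>" by simp
  also have "\<dots> \<le> pi / 2 * sqrt (2 / pi) * (1 / sin \<Theta>) * (1 / (2 ^ 9 * real N ^ 5))"
    using sqrt_le inverse_sin_\<Theta>(1) by (intro mult_left_mono) auto
  also have "\<dots> \<le> 3 / 2 * (2 ^ 5 * real N ^ 3) * (1 / (2 ^ 9 * real N ^ 5))"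
    using sqrt_2_pi_bounds(3) inverse_sin_\<Theta> by (intro mult_right_mono mult_mono) auto
  also have "\<dots> = 3 / 32 * (1 / (real N)\<^sup>2)" using N_pos by (simp add: field_simps power_add[symmetric])
  finally show ?thesis using inverse_N_le(3) by linarith
qed

lemma junta_tester_params: "junta_tester k M m r s \<epsilon> 3 \<Theta> \<phi> \<theta> \<kappa> \<tau> t (\<epsilon> / 8)"
proof
  let ?\<rho> = "27 * (real k)\<^sup>2 * (tan \<phi>) ^ 4 / (sin \<phi>)\<^sup>2 + \<kappa> * (real k + 1) / (2 * (sin \<phi>)\<^sup>2) + (real k + 1) * \<tau>"
  have "(real M * (2 * (\<theta> * sqrt (2 / pi) * s) + 2 * t) + pi / 2 * sqrt (2 / pi) / sin \<Theta> * sqrt ?\<rho>) / (\<epsilon> / 8)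
      \<le> (\<epsilon>\<^sup>2 / 4) / (\<epsilon> / 8)"
    using smoothing_distance_le averaging_distance_le[OF resid_le] \<epsilon> by (intro divide_right_mono) auto
  also have "\<dots> \<le> 3 * \<epsilon>" using \<epsilon> by (simp add: power2_eq_square)
  finally show "(real M * (2 * (\<theta> * sqrt (2 / pi) * s) + 2 * t) + pi / 2 * sqrt (2 / pi) / sin \<Theta> * sqrt ?\<rho>) / (\<epsilon> / 8) \<le> 3 * \<epsilon>" .
  show "0 < sin \<phi>" "cos \<phi> \<noteq> 0" using N_pos cos_\<phi>_sq_ge by (auto simp: sin_\<phi>)
  show "\<Theta> < 1" using \<Theta>_le by simp
qed (use s_pos params_pos \<theta>_less_1 \<Theta>_eq failure_le surface_less \<epsilon> in auto)

lemma tester: "tester n k s \<epsilon> 3 (2 ^ 190 * N ^ 90 * (4 * (2 ^ 45 * N ^ 22) + 2))"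
  using junta_tester.tester[OF junta_tester_params] by (simp only: m_def r_def)

end

lemma ex_tester_power:
  assumes \<epsilon>: "0 < \<epsilon>" "\<epsilon> < 1" and s: "0 \<le> s" and N: "1 + s + 1 / \<epsilon> + real k \<le> real N"
  shows "\<exists>q. real q \<le> 2 ^ 238 * real N ^ 112 \<and> tester n k s \<epsilon> 3 q"
proof (cases "s \<le> \<epsilon>")
  case True
  have "0 < 1 / \<epsilon>" using \<epsilon> by simp
  then have N_pos: "1 \<le> real N" "1 / \<epsilon> \<le> real N" using N s of_nat_0_le_iff[of k, where 'a = real] by linarith+
  have "real N ^ 2 \<le> real N ^ 112" using N_pos by (intro power_increasing) auto
  then have "80 * real N ^ 2 \<le> 2 ^ 238 * real N ^ 112" by (intro mult_mono) auto
  then have "real (80 * N\<^sup>2) \<le> 2 ^ 238 * real N ^ 112" by simp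
  then show ?thesis using small_surface_tester[OF \<epsilon>(1) s True N_pos(2)] by blast
next
  case False
  interpret parameter_choice k N s \<epsilon> by unfold_locales (use \<epsilon> N False in auto)
  let ?q = "2 ^ 190 * N ^ 90 * (4 * (2 ^ 45 * N ^ 22) + 2)"
  have "real ?q = 2 ^ 190 * real N ^ 90 * (4 * (2 ^ 45 * real N ^ 22) + 2)"
    by (simp only: of_nat_mult of_nat_add of_nat_power of_nat_numeral)
  also have "\<dots> \<le> 2 ^ 190 * real N ^ 90 * (2 ^ 48 * real N ^ 22)"
    using one_le_N_power[of 22] by (intro mult_left_mono) auto
  also have "\<dots> = 2 ^ 238 * real N ^ 112" by (simp add: power_add[symmetric])
  finally show ?thesis using tester by blast
qed

lemma tester_polynomial:
  assumes \<epsilon>: "0 < \<epsilon>"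
  shows "\<exists>q. real q \<le> 2 ^ 350 * (1 + \<bar>s\<bar> + 1 / \<epsilon> + real k) ^ 112 \<and> tester n k s \<epsilon> 3 q"
proof -
  consider (negative) "s < 0" | (large) "0 \<le> s" "1 \<le> \<epsilon>" | (main) "0 \<le> s" "\<epsilon> < 1" by linarith
  then show ?thesis
  proof cases
    case negative
    then show ?thesis using \<epsilon> by (intro exI[of _ 0] conjI tester_negative_surface) auto
  next
    case large
    then show ?thesis by (intro exI[of _ 0] conjI tester_large_error) auto
  next
    case main
    define \<sigma> where "\<sigma> = 1 + \<bar>s\<bar> + 1 / \<epsilon> + real k"
    have \<sigma>: "1 \<le> \<sigma>" using \<epsilon> by (simp add: \<sigma>_def)
    define N where "N = nat \<lceil>\<sigma>\<rceil>"
    have N: "\<sigma> \<le> real N" unfolding N_def by (rule real_nat_ceiling_ge)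
    have "real N = of_int \<lceil>\<sigma>\<rceil>" using \<sigma> by (simp add: N_def)
    then have "real N \<le> 2 * \<sigma>" using ceiling_correct[of \<sigma>] \<sigma> by linarith
    then have "real N ^ 112 \<le> (2 * \<sigma>) ^ 112" by (rule power_mono) simp
    then have "2 ^ 238 * real N ^ 112 \<le> 2 ^ 238 * (2 ^ 112 * \<sigma> ^ 112)" by (simp add: power_mult_distrib)
    also have "\<dots> = 2 ^ 350 * \<sigma> ^ 112" by simp
    finally have N_power: "2 ^ 238 * real N ^ 112 \<le> 2 ^ 350 * \<sigma> ^ 112" .
    have "1 + s + 1 / \<epsilon> + real k \<le> real N" using N main by (simp add: \<sigma>_def)
    from ex_tester_power[OF \<epsilon> main(2,1) this] N_power show ?thesis unfolding \<sigma>_def by (meson order_trans)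
  qed
qed

theorem theorem3p1:
  shows "\<exists>C::real. C > 0 \<and> (\<exists>(c::real) (d::nat).
     \<forall>(n::nat) (k::nat) (s::real) (\<epsilon>::real). \<epsilon> > 0 \<longrightarrow>
       (\<exists>(q::nat) (M::real measure) Q D.
          real q \<le> c * (1 + \<bar>s\<bar> + 1 / \<epsilon> + real k) ^ d \<and>
          prob_space M \<and>
          (\<forall>\<omega>\<in>space M. \<forall>as. Q \<omega> as \<in> space (gauss n)) \<and>
          (\<forall>f. f \<in> borel_measurable (gauss n) \<and> is_pm1 n f \<longrightarrow>
             {\<omega> \<in> space M. accepts f q Q D \<omega>} \<in> sets M \<and>
             (linear_junta n k f \<and> surf n f \<le> ereal s \<longrightarrow>
                measure M {\<omega> \<in> space M. accepts f q Q D \<omega>} \<ge> 0.9) \<and>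
             ((\<forall>g. g \<in> borel_measurable (gauss n) \<and> is_pm1 n g \<and> linear_junta n k g \<and>
                    surf n g \<le> ereal ((1 + \<epsilon>) * s) \<longrightarrow> gdist n f g > C * \<epsilon>) \<longrightarrow>
                measure M {\<omega> \<in> space M. \<not> accepts f q Q D \<omega>} \<ge> 0.9))))"
proof (rule exI[of _ 3], rule conjI, simp, rule exI[of _ "2 ^ 350"], rule exI[of _ 112], intro allI impI, goal_cases tester)
  case (tester n k s \<epsilon>)
  from tester_polynomial[OF this] obtain q
    where q: "real q \<le> 2 ^ 350 * (1 + \<bar>s\<bar> + 1 / \<epsilon> + real k) ^ 112" and "tester n k s \<epsilon> 3 q" by blast
  from this(2) obtain M :: "real measure" and Q D
    where M: "prob_space M" and Q: "\<forall>\<omega>\<in>space M. \<forall>as. Q \<omega> as \<in> space (gauss n)"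
      and accepts: "\<forall>f. sign_function n f \<longrightarrow> {\<omega> \<in> space M. accepts f q Q D \<omega>} \<in> sets M \<and>
        (f \<in> junta_class n k s \<longrightarrow> measure M {\<omega> \<in> space M. accepts f q Q D \<omega>} \<ge> 0.9) \<and>
        ((\<forall>g\<in>junta_class n k ((1 + \<epsilon>) * s). gdist n f g > 3 * \<epsilon>) \<longrightarrow>
          measure M {\<omega> \<in> space M. \<not> accepts f q Q D \<omega>} \<ge> 0.9)"
    unfolding tester_def by (elim exE conjE)
  show ?case
    by (intro exI[of _ q] exI[of _ M] exI[of _ Q] exI[of _ D] conjI q M Q)
       (use accepts in \<open>simp add: sign_function_def junta_class_def\<close>)
qed

end
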